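(* Let $\mathcal{W}$ be the rank $r$ tautological quotient bundle of $\mathrm{Gr}(n,r)$ and let $\lambda\le\mu$ be elements of $\mathrm{Young}(n-r,r)$. Then $$\operatorname{Hom}(\mathbb{S}^\lambda\mathcal{W},\mathbb{S}^\mu\mathcal{W})\cong\mathbb{S}^{\mu/\lambda}V.$$
   Context: Let $\Bbbk$ be an algebraically closed field of characteristic zero, $1<r\le n$ integers, and $V=\Bbbk^n$. $\mathrm{Gr}(n,r)$ is the Grassmannian of $r$-dimensional quotients of $V$. $\mathrm{Young}(n-r,r)=\{\lambda\in\mathbb{Z}^r\mid n-r\ge\lambda_1\ge\dots\ge\lambda_r\ge0\}$; $\lambda\le\mu$ means $\lambda_i\le\mu_i$ for all $i$. $\mathbb{S}^\lambda\mathcal{W}$ is the vector bundle whose fibre over each point is the irreducible $\mathrm{GL}(r)$-module of highest weight $\lambda$. $\operatorname{Hom}$ denotes homomorphisms of $\mathcal{O}_{\mathrm{Gr}(n,r)}$-modules. Skew-Schur power: let $d=|\mu|-|\lambda|$, where $|\lambda|=\sum_i\lambda_i$, and number the boxes of the skew diagram $\mu/\lambda$ from left to right, top to bottom. $S_d$ acts on $V^{\otimes d}$ by $(v_1\otimes\cdots\otimes v_d)\cdot\sigma=v_{\sigma(1)}\otimes\cdots\otimes v_{\sigma(d)}$. Let $P_{\mathrm{row}}$ (resp. $P_{\mathrm{col}}$) be the subgroup of $S_d$ preserving each row (resp. each column) of $\mu/\lambda$, and define endomorphisms of $V^{\otimes d}$ by $a_{\mu/\lambda}(v)=\sum_{\sigma\in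 P_{\mathrm{row}}}v\cdot\sigma$, $b_{\mu/\lambda}(v)=\sum_{\sigma\in P_{\mathrm{col}}}\operatorname{sgn}(\sigma)\,v\cdot\sigma$. Then $\mathbb{S}^{\mu/\lambda}V:=\operatorname{im}(b_{\mu/\lambda}a_{\mu/\lambda})\subseteq V^{\otimes d}$. *)

theory Defs
  imports "Jordan_Normal_Form.Matrix_Kernel" "HOL-Combinatorics.Permutations"
begin

section \<open>Regular functions on Zariski open sets of matrices\<close>

inductive_set poly_funs :: "nat \<Rightarrow> nat \<Rightarrow> ('k :: field mat \<Rightarrow> 'k) set" for p q :: nat where
  const: "(\<lambda>A. c) \<in> poly_funs p q"
| coord: "i < p \<Longrightarrow> j < q \<Longrightarrow> (\<lambda>A. A $$ (i, j)) \<in> poly_funs p q"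
| add: "f \<in> poly_funs p q \<Longrightarrow> g \<in> poly_funs p q \<Longrightarrow> (\<lambda>A. f A + g A) \<in> poly_funs p q"
| mult: "f \<in> poly_funs p q \<Longrightarrow> g \<in> poly_funs p q \<Longrightarrow> (\<lambda>A. f A * g A) \<in> poly_funs p q"

definition zariski_open :: "nat \<Rightarrow> nat \<Rightarrow> 'k :: field mat set \<Rightarrow> bool" where
  "zariski_open p q U \<longleftrightarrow>
     (\<exists>S \<subseteq> poly_funs p q. U = {A \<in> carrier_mat p q. \<exists>f\<in>S. f A \<noteq> 0})"

definition regular_on :: "nat \<Rightarrow> nat \<Rightarrow> 'k :: field mat set \<Rightarrow> ('k mat \<Rightarrow> 'k) \<Rightarrow> bool" where
  "regular_on p q U f \<longleftrightarrow>
     (\<forall>A\<in>U. \<exists>W g h. zariski_open p q W \<and> A \<in> W \<and> W \<subseteq> U \<and>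
        g \<in> poly_funs p q \<and> h \<in> poly_funs p q \<and>
        (\<forall>B\<in>W. h B \<noteq> 0 \<and> f B = g B / h B))"

section \<open>Irreducible rational representations of the general linear group\<close>

definition GL :: "nat \<Rightarrow> 'k :: field mat set" where
  "GL r = {g \<in> carrier_mat r r. invertible_mat g}"

text \<open>A finite-dimensional rational \<open>GL(r)\<close>-module, written in a basis of the module.  The
  values of \<open>\<rho>\<close> outside \<open>GL r\<close> are irrelevant.\<close>

definition rational_rep :: "nat \<Rightarrow> nat \<Rightarrow> ('k :: field mat \<Rightarrow> 'k mat) \<Rightarrow> bool" where
  "rational_rep r m \<rho> \<longleftrightarrow>
     (\<forall>g\<in>GL r. \<rho> g \<in> GL m) \<and>
     (\<forall>g\<in>GL r. \<forall>h\<in>GL r. \<rho> (g * h) = \<rho> g * \<rho> h) \<and>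
     (\<forall>i<m. \<forall>j<m. regular_on r r (GL r) (\<lambda>g. \<rho> g $$ (i, j)))"

definition irreducible_rep :: "nat \<Rightarrow> nat \<Rightarrow> ('k :: field mat \<Rightarrow> 'k mat) \<Rightarrow> bool" where
  "irreducible_rep r m \<rho> \<longleftrightarrow>
     rational_rep r m \<rho> \<and> m \<noteq> 0 \<and>
     (\<forall>W. subspace class_ring W (module_vec TYPE('k) m) \<and>
          (\<forall>g\<in>GL r. \<forall>w\<in>W. \<rho> g *\<^sub>v w \<in> W) \<longrightarrow>
          W = {0\<^sub>v m} \<or> W = carrier_vec m)"

text \<open>Highest weights are taken with respect to the Borel subgroup of upper triangular matrices
  and its diagonal torus, so that the standard module has highest weight \<open>(1,0,\<dots>,0)\<close>.\<close>

definition has_highest_weight ::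
    "nat \<Rightarrow> nat \<Rightarrow> ('k :: field mat \<Rightarrow> 'k mat) \<Rightarrow> int list \<Rightarrow> bool" where
  "has_highest_weight r m \<rho> lam \<longleftrightarrow>
     (\<exists>v \<in> carrier_vec m. v \<noteq> 0\<^sub>v m \<and>
        (\<forall>b \<in> GL r. upper_triangular b \<longrightarrow>
           \<rho> b *\<^sub>v v = (\<Prod>i<r. (b $$ (i, i)) powi (lam ! i)) \<cdot>\<^sub>v v))"

definition irreducible_of_highest_weight ::
    "nat \<Rightarrow> nat \<Rightarrow> ('k :: field mat \<Rightarrow> 'k mat) \<Rightarrow> int list \<Rightarrow> bool" where
  "irreducible_of_highest_weight r m \<rho> lam \<longleftrightarrow>
     irreducible_rep r m \<rho> \<and> has_highest_weight r m \<rho> lam"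

section \<open>The Grassmannian and its tautological quotient bundle\<close>

text \<open>The quotient \<open>V \<rightarrow> V/K\<close> of \<open>V = k\<^sup>n\<close> is represented by its kernel \<open>K\<close>.\<close>

definition Gr :: "nat \<Rightarrow> nat \<Rightarrow> 'k :: field vec set set" where
  "Gr n r = {K. subspace class_ring K (module_vec TYPE('k) n) \<and>
     vectorspace.dim class_ring ((module_vec TYPE('k) n)\<lparr>carrier := K\<rparr>) + r = n}"

text \<open>The fibre at \<open>K\<close> of the tautological quotient bundle \<open>\<W>\<close> is \<open>V/K\<close>.  A frame of that fibre is
  an isomorphism from \<open>V/K\<close> to \<open>k\<^sup>r\<close>, that is, a surjective \<open>r \<times> n\<close> matrix with kernel \<open>K\<close>.  Thus
  \<open>frames n r U\<close> is the restriction to \<open>U\<close> of the frame bundle of \<open>\<W>\<close>, a principal bundle under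
  left multiplication by \<open>GL(r)\<close>.\<close>

definition frames :: "nat \<Rightarrow> nat \<Rightarrow> 'k :: field vec set set \<Rightarrow> 'k mat set" where
  "frames n r U = {A \<in> carrier_mat r n.
     (\<lambda>v. A *\<^sub>v v) ` carrier_vec n = carrier_vec r \<and> mat_kernel A \<in> U}"

text \<open>As a variety, \<open>Gr n r\<close> is the quotient by \<open>GL(r)\<close> of the open set of surjective matrices:
  it carries the quotient topology, and a function on an open set is regular iff its pullback to
  the frames is.  Functions on \<open>U\<close> and sections over \<open>U\<close> are kept extensional, so that they are
  determined by their values over \<open>U\<close>.\<close>

definition gr_open :: "nat \<Rightarrow> nat \<Rightarrow> 'k :: field vec set set \<Rightarrow> bool" where
  "gr_open n r U \<longleftrightarrow> U \<subseteq> Gr n r \<and> zariski_open r n (frames n r U)"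

definition gr_O :: "nat \<Rightarrow> nat \<Rightarrow> 'k :: field vec set set \<Rightarrow> ('k vec set \<Rightarrow> 'k) ring" where
  "gr_O n r U = \<lparr>
     carrier = {f \<in> extensional U. regular_on r n (frames n r U) (\<lambda>A. f (mat_kernel A))},
     mult = (\<lambda>f g. \<lambda>K\<in>U. f K * g K),
     one = (\<lambda>K\<in>U. 1),
     zero = (\<lambda>K\<in>U. 0),
     add = (\<lambda>f g. \<lambda>K\<in>U. f K + g K)\<rparr>"

text \<open>The sheaf of sections of the vector bundle associated with the frame bundle of \<open>\<W>\<close> and a
  representation \<open>\<rho>\<close> on \<open>k\<^sup>m\<close>; its fibres are \<open>GL(r)\<close>-modules of type \<open>\<rho>\<close>.  A section over \<open>U\<close> is
  given by its coordinates with respect to the frames over \<open>U\<close>, which change by \<open>\<rho> g\<close> when the frame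
  changes by \<open>g\<close>.  For \<open>\<rho> = (\<lambda>g. g)\<close> this is \<open>\<W>\<close> itself, the section defined by \<open>v \<in> V\<close> being
  \<open>\<lambda>A. A *\<^sub>v v\<close>.  If \<open>\<rho>\<close> is irreducible of highest weight \<open>lam\<close>, it is the bundle \<open>\<S>(lam) \<W>\<close>.\<close>

definition assoc_bundle ::
    "nat \<Rightarrow> nat \<Rightarrow> nat \<Rightarrow> ('k :: field mat \<Rightarrow> 'k mat) \<Rightarrow> 'k vec set set \<Rightarrow>
     ('k vec set \<Rightarrow> 'k, 'k mat \<Rightarrow> 'k vec) module" where
  "assoc_bundle n r m \<rho> U = \<lparr>
     carrier = {s \<in> extensional (frames n r U).
       (\<forall>A\<in>frames n r U. s A \<in> carrier_vec m) \<and>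
       (\<forall>i<m. regular_on r n (frames n r U) (\<lambda>A. s A $ i)) \<and>
       (\<forall>A\<in>frames n r U. \<forall>g\<in>GL r. s (g * A) = \<rho> g *\<^sub>v s A)},
     mult = undefined,
     one = undefined,
     zero = (\<lambda>A\<in>frames n r U. 0\<^sub>v m),
     add = (\<lambda>s t. \<lambda>A\<in>frames n r U. s A + t A),
     smult = (\<lambda>f s. \<lambda>A\<in>frames n r U. f (mat_kernel A) \<cdot>\<^sub>v s A)\<rparr>"

text \<open>Homomorphisms of \<open>\<O>\<close>-modules between two sheaves whose sections over \<open>U\<close> are functions on
  \<open>frames n r U\<close>: families of \<open>\<O>(U)\<close>-linear maps compatible with restriction.  They form a vector
  space over the ground field.\<close>

definition O_Hom ::
    "nat \<Rightarrow> nat \<Rightarrow>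
     ('k :: field vec set set \<Rightarrow> ('k vec set \<Rightarrow> 'k, 'k mat \<Rightarrow> 'k vec) module) \<Rightarrow>
     ('k vec set set \<Rightarrow> ('k vec set \<Rightarrow> 'k, 'k mat \<Rightarrow> 'k vec) module) \<Rightarrow>
     ('k, 'k vec set set \<Rightarrow> ('k mat \<Rightarrow> 'k vec) \<Rightarrow> ('k mat \<Rightarrow> 'k vec)) module" where
  "O_Hom n r E F = \<lparr>
     carrier = {\<phi> \<in> extensional {U. gr_open n r U}.
       (\<forall>U. gr_open n r U \<longrightarrow>
          \<phi> U \<in> LinearCombinations.module_hom (gr_O n r U) (E U) (F U) \<inter> extensional (carrier (E U))) \<and>
       (\<forall>U U'. gr_open n r U \<and> gr_open n r U' \<and> U' \<subseteq> U \<longrightarrow>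
          (\<forall>s\<in>carrier (E U).
             \<phi> U' (restrict s (frames n r U')) = restrict (\<phi> U s) (frames n r U')))},
     mult = undefined,
     one = undefined,
     zero = (\<lambda>U\<in>{U. gr_open n r U}. \<lambda>s\<in>carrier (E U). \<zero>\<^bsub>F U\<^esub>),
     add = (\<lambda>\<phi> \<psi>. \<lambda>U\<in>{U. gr_open n r U}. \<lambda>s\<in>carrier (E U). \<phi> U s \<oplus>\<^bsub>F U\<^esub> \<psi> U s),
     smult = (\<lambda>c \<phi>. \<lambda>U\<in>{U. gr_open n r U}. \<lambda>s\<in>carrier (E U). (\<lambda>K\<in>U. c) \<odot>\<^bsub>F U\<^esub> \<phi> U s)\<rparr>"

section \<open>Partitions and skew Schur powers\<close>

definition Young :: "nat \<Rightarrow> nat \<Rightarrow> int list set" where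
  "Young a r = {lam. length lam = r \<and> sorted_wrt (\<ge>) lam \<and> (\<forall>i<r. 0 \<le> lam ! i \<and> lam ! i \<le> int a)}"

definition skew_size :: "int list \<Rightarrow> int list \<Rightarrow> nat" where
  "skew_size lam mu = nat (sum_list mu - sum_list lam)"

text \<open>The boxes \<open>(row, column)\<close> of the skew diagram \<open>mu/lam\<close> listed from left to right and top to
  bottom; the list index, starting at 0, is the number of the box.\<close>

definition skew_boxes :: "int list \<Rightarrow> int list \<Rightarrow> (nat \<times> int) list" where
  "skew_boxes lam mu =
     concat (map (\<lambda>i. map (\<lambda>j. (i, j)) [lam ! i + 1 .. mu ! i]) [0..<length mu])"

lemma length_skew_boxes:
  assumes "list_all2 (\<le>) lam mu"
  shows "length (skew_boxes lam mu) = skew_size lam mu"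
proof -
  have len: "length lam = length mu" and le: "\<And>i. i < length mu \<Longrightarrow> lam ! i \<le> mu ! i"
    using assms by (auto simp: list_all2_conv_all_nth)
  have "int (length (skew_boxes lam mu)) = (\<Sum>i<length mu. int (nat (mu ! i - lam ! i)))"
    by (simp add: skew_boxes_def length_concat comp_def interv_sum_list_conv_sum_set_nat
        atLeast0LessThan)
  also have "\<dots> = (\<Sum>i<length mu. mu ! i - lam ! i)"
    by (rule sum.cong) (use le in auto)
  also have "\<dots> = sum_list mu - sum_list lam"
    by (simp add: sum_list_sum_nth sum_subtractf len atLeast0LessThan)
  finally show ?thesis by (simp add: skew_size_def)
qed

definition row_perms :: "int list \<Rightarrow> int list \<Rightarrow> (nat \<Rightarrow> nat) set" where
  "row_perms lam mu = {\<sigma>. \<sigma> permutes {..<skew_size lam mu} \<and>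
     (\<forall>k<skew_size lam mu. fst (skew_boxes lam mu ! \<sigma> k) = fst (skew_boxes lam mu ! k))}"

definition col_perms :: "int list \<Rightarrow> int list \<Rightarrow> (nat \<Rightarrow> nat) set" where
  "col_perms lam mu = {\<sigma>. \<sigma> permutes {..<skew_size lam mu} \<and>
     (\<forall>k<skew_size lam mu. snd (skew_boxes lam mu ! \<sigma> k) = snd (skew_boxes lam mu ! k))}"

text \<open>A tensor in the \<open>d\<close>-th tensor power of \<open>k\<^sup>n\<close> is given by its coefficients with respect to
  the basis \<open>e\<^bsub>I 0\<^esub> \<otimes> \<dots> \<otimes> e\<^bsub>I (d-1)\<^esub>\<close>, where \<open>I\<close> runs over the multi-indices.\<close>

definition multi_indices :: "nat \<Rightarrow> nat \<Rightarrow> (nat \<Rightarrow> nat) set" where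
  "multi_indices n d = {..<d} \<rightarrow>\<^sub>E {..<n}"

definition tensor_power :: "nat \<Rightarrow> nat \<Rightarrow> ('k :: field, (nat \<Rightarrow> nat) \<Rightarrow> 'k) module" where
  "tensor_power n d = \<lparr>
     carrier = {t. \<forall>I. I \<notin> multi_indices n d \<longrightarrow> t I = 0},
     mult = undefined,
     one = undefined,
     zero = (\<lambda>I. 0),
     add = (\<lambda>s t I. s I + t I),
     smult = (\<lambda>c t I. c * t I)\<rparr>"

definition pure_tensor :: "nat \<Rightarrow> nat \<Rightarrow> (nat \<Rightarrow> 'k :: field vec) \<Rightarrow> (nat \<Rightarrow> nat) \<Rightarrow> 'k" where
  "pure_tensor n d v I = (if I \<in> multi_indices n d then \<Prod>k<d. v k $ I k else 0)"

definition tensor_act :: "((nat \<Rightarrow> nat) \<Rightarrow> 'k) \<Rightarrow> (nat \<Rightarrow> nat) \<Rightarrow> (nat \<Rightarrow> nat) \<Rightarrow> 'k" where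
  "tensor_act t \<sigma> = (\<lambda>I. t (I \<circ> Hilbert_Choice.inv \<sigma>))"

lemma multi_indices_comp_iff:
  assumes "\<sigma> permutes {..<d}"
  shows "I \<circ> \<sigma> \<in> multi_indices n d \<longleftrightarrow> I \<in> multi_indices n d"
proof -
  have *: "J \<circ> \<tau> \<in> multi_indices n d" if "J \<in> multi_indices n d" "\<tau> permutes {..<d}" for J \<tau>
    using that permutes_in_image[OF that(2)] permutes_not_in[OF that(2)]
    unfolding multi_indices_def by (fastforce simp: PiE_iff extensional_def)
  have "I \<circ> \<sigma> \<circ> Hilbert_Choice.inv \<sigma> = I"
    using permutes_inv_o(1)[OF assms] by (simp add: comp_assoc)
  with *[OF _ assms, of I] *[OF _ permutes_inv[OF assms], of "I \<circ> \<sigma>"] show ?thesis by metis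
qed

text \<open>On pure tensors the action is
  \<open>(v\<^bsub>0\<^esub> \<otimes> \<dots> \<otimes> v\<^bsub>d-1\<^esub>) \<cdot> \<sigma> = v\<^bsub>\<sigma> 0\<^esub> \<otimes> \<dots> \<otimes> v\<^bsub>\<sigma> (d-1)\<^esub>\<close>.\<close>

lemma tensor_act_pure_tensor:
  assumes "\<sigma> permutes {..<d}"
  shows "tensor_act (pure_tensor n d v) \<sigma> = pure_tensor n d (v \<circ> \<sigma>)"
proof
  fix I
  have "(\<Prod>k<d. v k $ (I \<circ> Hilbert_Choice.inv \<sigma>) k) = (\<Prod>k<d. v (\<sigma> k) $ (I \<circ> Hilbert_Choice.inv \<sigma>) (\<sigma> k))"
    using prod.permute[OF assms, of "\<lambda>k. v k $ (I \<circ> Hilbert_Choice.inv \<sigma>) k"] by (simp add: comp_def)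
  also have "\<dots> = (\<Prod>k<d. v (\<sigma> k) $ I k)"
    using permutes_inverses(2)[OF assms] by simp
  finally show "tensor_act (pure_tensor n d v) \<sigma> I = pure_tensor n d (v \<circ> \<sigma>) I"
    using multi_indices_comp_iff[OF permutes_inv[OF assms], of I n]
    by (simp add: tensor_act_def pure_tensor_def)
qed

definition row_symmetrizer ::
    "int list \<Rightarrow> int list \<Rightarrow> ((nat \<Rightarrow> nat) \<Rightarrow> 'k :: field) \<Rightarrow> (nat \<Rightarrow> nat) \<Rightarrow> 'k" where
  "row_symmetrizer lam mu t = (\<lambda>I. \<Sum>\<sigma>\<in>row_perms lam mu. tensor_act t \<sigma> I)"

definition col_antisymmetrizer ::
    "int list \<Rightarrow> int list \<Rightarrow> ((nat \<Rightarrow> nat) \<Rightarrow> 'k :: field) \<Rightarrow> (nat \<Rightarrow> nat) \<Rightarrow> 'k" where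
  "col_antisymmetrizer lam mu t = (\<lambda>I. \<Sum>\<sigma>\<in>col_perms lam mu. of_int (sign \<sigma>) * tensor_act t \<sigma> I)"

definition skew_schur ::
    "nat \<Rightarrow> int list \<Rightarrow> int list \<Rightarrow> ('k :: field, (nat \<Rightarrow> nat) \<Rightarrow> 'k) module" where
  "skew_schur n lam mu = (tensor_power n (skew_size lam mu))
     \<lparr>carrier := (col_antisymmetrizer lam mu \<circ> row_symmetrizer lam mu) `
        carrier (tensor_power n (skew_size lam mu))\<rparr>"

section \<open>Isomorphism of vector spaces\<close>

definition vs_isomorphic ::
    "('k :: field, 'a) module \<Rightarrow> ('k, 'b) module \<Rightarrow> bool" where
  "vs_isomorphic V W \<longleftrightarrow>
     (\<exists>f. linear_map class_ring V W f \<and> bij_betw f (carrier V) (carrier W))"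

end

theory Submission
  imports Defs "HOL-Library.Function_Algebras"
begin

text \<open>A homomorphism between the two bundles is an equivariant regular function \<open>F\<close> of surjective matrices
  \<open>A\<close> with values in the linear maps between the two modules.  It is determined by its corner
  \<open>\<phi> A = \<omega> (F A v)\<close>, where \<open>v\<close> is the highest weight vector of the source and \<open>\<omega>\<close> the functional of the
  target that is semi-invariant under lower triangular matrices.  For \<open>r < n\<close> the corner is a
  polynomial, since the matrices that are not surjective have codimension at least two.  The torus
  prescribes its degree in each row of \<open>A\<close>, and adding \<open>s\<close> times row \<open>i\<close> to row \<open>i + 1\<close> yields degree at
  most \<open>lam\<^sub>i - lam\<^sub>i\<^sub>+\<^sub>1\<close> in \<open>s\<close>.  These two conditions force the lexicographically largest exponent to be the
  content of a column strict filling \<open>I\<close> of \<open>mu/lam\<close>, which is also the largest exponent of the polynomial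
  attached to the column antisymmetrization of \<open>e\<^sub>I\<close>; so the corner is the polynomial of an
  antisymmetrized tensor.  Conversely, embedding the two modules into tensor powers of \<open>k\<^sup>r\<close> turns every
  tensor on the boxes of \<open>mu/lam\<close> into an equivariant function with this corner.\<close>

section \<open>Linear algebra\<close>

text \<open>The modules are abstract irreducible representations with a highest weight vector;
  neither a model in tensors nor complete reducibility is at hand. The functional
  \<open>\<omega>\<close> and the embeddings are therefore prescribed on an orbit, and the
  difficulty is to show that every linear relation in the orbit is respected. For
  \<open>\<omega>\<close> this comes from a torus limit on the big cell. For the embeddings it comes
  from the fact that a tensor obtained by row symmetrizing and then column antisymmetrizing is
  determined by its polynomial. The same fact brings in the skew Schur power: a polynomial sees only
  the row symmetrization of its tensor, so antisymmetrized tensors have to be compared with the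
  image of both symmetrizers. With N the integer matrix of the composite, this compares N with its
  normal matrix, for kernels and for images. Algebraic closedness serves to cancel denominators
  along lines. If r = n, the surjective matrices are those of GL and a regular function need not be
  polynomial; but then the bound n - r leaves only the empty diagram, and the corner is constant
  because \<open>v\<close> and \<open>\<omega>\<close> are invariant.\<close>

lemma vector_space_fun: "vector_space (\<lambda>(c::'k::field) (x::'a \<Rightarrow> 'k) i. c * x i)"
  by unfold_locales (auto simp: fun_eq_iff algebra_simps)

text \<open>Over the rationals, \<open>N\<close> and \<open>N\<^sup>T N\<close> have the same kernel by positivity, so that \<open>N\<close> factors
  through \<open>N\<^sup>T N\<close>; such a factorization persists over every field of characteristic zero.\<close>

lemma int_matrix_factor:
  fixes N :: "'x \<Rightarrow> 'x \<Rightarrow> int"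
  assumes X: "finite X"
  shows "\<exists>Q :: 'x \<Rightarrow> 'x \<Rightarrow> rat. \<forall>I\<in>X. \<forall>J\<in>X.
           of_int (N I J) = (\<Sum>K\<in>X. Q I K * (\<Sum>L\<in>X. of_int (N L K) * of_int (N L J)))"
proof -
  define G where "G K J = (\<Sum>L\<in>X. of_int (N L K) * of_int (N L J) :: rat)" for K J
  define f where "f y = (\<lambda>K. if K \<in> X then \<Sum>J\<in>X. G K J * y J else 0)" for y :: "'x \<Rightarrow> rat"
  define g where "g y I = (\<Sum>J\<in>X. of_int (N I J) * y J)" for y :: "'x \<Rightarrow> rat" and I
  define sc where "sc = (\<lambda>(c::rat) (x::'x \<Rightarrow> rat) i. c * x i)"
  interpret V: vector_space sc unfolding sc_def by (rule vector_space_fun)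
  interpret vector_space_pair sc sc ..
  have lf: "Vector_Spaces.linear sc sc f"
    by unfold_locales (auto simp: f_def sc_def fun_eq_iff algebra_simps sum.distrib sum_distrib_left)
  \<comment> \<open>A generalized inverse \<open>r\<close> of the normal matrix, with f r f = f. The
    vector r (f y) - y then lies in the kernel of \<open>f\<close>, which \<open>g\<close> kills, so
    g = g r f and the factor sought is g r.\<close>
  from linear_exists_right_inverse_on[OF lf V.subspace_UNIV]
  obtain r where lr: "Vector_Spaces.linear sc sc r" and r: "\<And>y. f (r (f y)) = f y" by auto
  interpret r: Vector_Spaces.linear sc sc r by (rule lr)
  have ker: "g y I = 0" if "\<And>K. K \<in> X \<Longrightarrow> f y K = 0" "I \<in> X" for y I
  proof -
    have "(\<Sum>L\<in>X. (g y L)\<^sup>2) = (\<Sum>L\<in>X. \<Sum>K\<in>X. of_int (N L K) * y K * g y L)"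
      unfolding power2_eq_square by (subst (1) g_def) (simp add: sum_distrib_right)
    also have "\<dots> = (\<Sum>K\<in>X. \<Sum>L\<in>X. of_int (N L K) * y K * g y L)"
      by (rule sum.swap)
    also have "\<dots> = (\<Sum>K\<in>X. y K * f y K)"
    proof (rule sum.cong[OF refl])
      fix K assume "K \<in> X"
      have "(\<Sum>L\<in>X. of_int (N L K) * y K * g y L) = (\<Sum>L\<in>X. \<Sum>J\<in>X. y K * (of_int (N L K) * of_int (N L J) * y J))"
        by (simp add: g_def sum_distrib_left algebra_simps)
      also have "\<dots> = (\<Sum>J\<in>X. \<Sum>L\<in>X. y K * (of_int (N L K) * of_int (N L J) * y J))"
        by (rule sum.swap)
      also have "\<dots> = y K * f y K"
        using \<open>K \<in> X\<close> by (simp add: f_def G_def sum_distrib_left sum_distrib_right algebra_simps)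
      finally show "(\<Sum>L\<in>X. of_int (N L K) * y K * g y L) = y K * f y K" .
    qed
    also have "\<dots> = 0" using that(1) by simp
    finally show ?thesis using that(2) sum_nonneg_eq_0_iff[OF X, of "\<lambda>L. (g y L)\<^sup>2"] by auto
  qed
  define \<delta> where "\<delta> J = (\<lambda>K. if K = J then 1 else 0 :: rat)" for J :: 'x
  have gdel: "g (\<delta> J) I = of_int (N I J)" if "J \<in> X" for I J
    using that X by (simp add: g_def \<delta>_def if_distrib cong: if_cong)
  have fdel: "f (\<delta> J) K = G K J" if "J \<in> X" "K \<in> X" for K J
    using that X by (simp add: f_def \<delta>_def if_distrib cong: if_cong)
  define Q where "Q I K = g (r (\<delta> K)) I" for I K
  have "of_int (N I J) = (\<Sum>K\<in>X. Q I K * G K J)" if "I \<in> X" "J \<in> X" for I J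
  proof -
    let ?d = "\<lambda>K. r (f (\<delta> J)) K - \<delta> J K"
    have "f ?d K = 0" for K
      using r[of "\<delta> J"] by (auto simp: fun_eq_iff f_def algebra_simps sum_subtractf split: if_splits)
    then have "g ?d I = 0" using ker that by blast
    then have 1: "g (r (f (\<delta> J))) I = of_int (N I J)"
      using gdel[OF that(2), of I] by (simp add: g_def algebra_simps sum_subtractf)
    have "f (\<delta> J) = (\<Sum>K\<in>X. sc (G K J) (\<delta> K))"
    proof
      fix L
      have ap: "(\<Sum>K\<in>X. h K) L = (\<Sum>K\<in>X. h K L)" for h :: "'x \<Rightarrow> 'x \<Rightarrow> rat"
        using X by (induction X rule: finite_induct) auto
      have "(\<Sum>K\<in>X. sc (G K J) (\<delta> K)) L = (\<Sum>K\<in>X. if L = K then G K J else 0)"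
        unfolding ap by (rule sum.cong) (auto simp: sc_def \<delta>_def)
      then show "f (\<delta> J) L = (\<Sum>K\<in>X. sc (G K J) (\<delta> K)) L"
        using that X fdel[OF that(2), of L] by (auto simp: f_def)
    qed
    then have 2: "r (f (\<delta> J)) = (\<Sum>K\<in>X. sc (G K J) (r (\<delta> K)))"
      by (simp add: r.sum r.scale)
    have gs: "g (\<Sum>K\<in>Y. h K) I = (\<Sum>K\<in>Y. g (h K) I)" if "finite Y" for Y and h :: "'x \<Rightarrow> 'x \<Rightarrow> rat"
      using that by (induction Y rule: finite_induct) (auto simp: g_def algebra_simps sum.distrib)
    have gsc: "g (sc c h) I = g h I * c" for c h
      by (simp add: g_def sc_def sum_distrib_left sum_distrib_right mult_ac)
    show ?thesis using 1 unfolding 2 gs[OF X] gsc Q_def by simp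
  qed
  then show ?thesis unfolding G_def by blast
qed

lemma int_matrix_factor_field:
  fixes N :: "'x \<Rightarrow> 'x \<Rightarrow> int"
  assumes X: "finite X"
  obtains Q :: "'x \<Rightarrow> 'x \<Rightarrow> 'k::field_char_0" where "\<And>I J. I \<in> X \<Longrightarrow> J \<in> X \<Longrightarrow>
           of_int (N I J) = (\<Sum>K\<in>X. Q I K * (\<Sum>L\<in>X. of_int (N L K) * of_int (N L J)))"
proof -
  obtain Q :: "'x \<Rightarrow> 'x \<Rightarrow> rat" where Q: "\<And>I J. I \<in> X \<Longrightarrow> J \<in> X \<Longrightarrow>
           of_int (N I J) = (\<Sum>K\<in>X. Q I K * (\<Sum>L\<in>X. of_int (N L K) * of_int (N L J)))"
    using int_matrix_factor[OF X, of N] by blast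
  have "(of_int (N I J) :: 'k) = (\<Sum>K\<in>X. of_rat (Q I K) * (\<Sum>L\<in>X. of_int (N L K) * of_int (N L J)))"
    if "I \<in> X" "J \<in> X" for I J
    using arg_cong[OF Q[OF that], of "of_rat :: rat \<Rightarrow> 'k"]
    by (simp add: of_rat_sum of_rat_mult)
  then show ?thesis by (rule that)
qed

text \<open>Applying the factor \<open>Q\<close> to the hypothesis turns the normal matrix back into
  \<open>N\<close>.\<close>

lemma int_matrix_normal_kernel:
  fixes N :: "'x \<Rightarrow> 'x \<Rightarrow> int" and z :: "'x \<Rightarrow> 'k::field_char_0"
  assumes X: "finite X" and I: "I \<in> X"
    and 0: "\<And>K. K \<in> X \<Longrightarrow> (\<Sum>L\<in>X. of_int (N L K) * (\<Sum>J\<in>X. of_int (N L J) * z J)) = 0"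
  shows "(\<Sum>J\<in>X. of_int (N I J) * z J) = 0"
proof -
  obtain Q :: "'x \<Rightarrow> 'x \<Rightarrow> 'k" where Q: "\<And>I J. I \<in> X \<Longrightarrow> J \<in> X \<Longrightarrow>
           of_int (N I J) = (\<Sum>K\<in>X. Q I K * (\<Sum>L\<in>X. of_int (N L K) * of_int (N L J)))"
    using int_matrix_factor_field[OF X, of N] by blast
  have "(\<Sum>J\<in>X. of_int (N I J) * z J)
      = (\<Sum>J\<in>X. \<Sum>K\<in>X. \<Sum>L\<in>X. Q I K * (of_int (N L K) * (of_int (N L J) * z J)))"
    by (rule sum.cong[OF refl], subst Q[OF I])
       (simp_all add: sum_distrib_left sum_distrib_right mult.assoc)
  also have "\<dots> = (\<Sum>K\<in>X. \<Sum>J\<in>X. \<Sum>L\<in>X. Q I K * (of_int (N L K) * (of_int (N L J) * z J)))"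
    by (rule sum.swap)
  also have "\<dots> = (\<Sum>K\<in>X. \<Sum>L\<in>X. \<Sum>J\<in>X. Q I K * (of_int (N L K) * (of_int (N L J) * z J)))"
    by (rule sum.cong[OF refl], rule sum.swap)
  also have "\<dots> = (\<Sum>K\<in>X. Q I K * (\<Sum>L\<in>X. of_int (N L K) * (\<Sum>J\<in>X. of_int (N L J) * z J)))"
    by (simp add: sum_distrib_left)
  also have "\<dots> = 0" using 0 by simp
  finally show ?thesis .
qed

text \<open>Transposing the factorization writes the transpose of \<open>N\<close> as the normal
  matrix, which is symmetric, times the transpose of \<open>Q\<close>; so \<open>z\<close> is that
  transpose applied to \<open>x\<close>.\<close>

lemma int_matrix_normal_image:
  fixes N :: "'x \<Rightarrow> 'x \<Rightarrow> int" and x :: "'x \<Rightarrow> 'k::field_char_0"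
  assumes X: "finite X"
  obtains z :: "'x \<Rightarrow> 'k" where "\<And>K. K \<in> X \<Longrightarrow>
    (\<Sum>I\<in>X. of_int (N I K) * x I) = (\<Sum>L\<in>X. of_int (N L K) * (\<Sum>J\<in>X. of_int (N L J) * z J))"
proof -
  obtain Q :: "'x \<Rightarrow> 'x \<Rightarrow> 'k" where Q: "\<And>I J. I \<in> X \<Longrightarrow> J \<in> X \<Longrightarrow>
           of_int (N I J) = (\<Sum>K\<in>X. Q I K * (\<Sum>L\<in>X. of_int (N L K) * of_int (N L J)))"
    using int_matrix_factor_field[OF X, of N] by blast
  have "(\<Sum>I\<in>X. of_int (N I K) * x I)
      = (\<Sum>L\<in>X. of_int (N L K) * (\<Sum>J\<in>X. of_int (N L J) * (\<Sum>I\<in>X. Q I J * x I)))" if "K \<in> X" for K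
  proof -
    have "(\<Sum>I\<in>X. of_int (N I K) * x I)
      = (\<Sum>I\<in>X. \<Sum>J\<in>X. \<Sum>L\<in>X. of_int (N L K) * (of_int (N L J) * (Q I J * x I)))"
      by (rule sum.cong[OF refl], subst Q[OF _ that])
         (simp_all add: sum_distrib_left sum_distrib_right mult_ac)
    also have "\<dots> = (\<Sum>I\<in>X. \<Sum>L\<in>X. \<Sum>J\<in>X. of_int (N L K) * (of_int (N L J) * (Q I J * x I)))"
      by (rule sum.cong[OF refl], rule sum.swap)
    also have "\<dots> = (\<Sum>L\<in>X. \<Sum>I\<in>X. \<Sum>J\<in>X. of_int (N L K) * (of_int (N L J) * (Q I J * x I)))"
      by (rule sum.swap)
    also have "\<dots> = (\<Sum>L\<in>X. \<Sum>J\<in>X. \<Sum>I\<in>X. of_int (N L K) * (of_int (N L J) * (Q I J * x I)))"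
      by (rule sum.cong[OF refl], rule sum.swap)
    finally show ?thesis by (simp add: sum_distrib_left)
  qed
  then show ?thesis by (rule that)
qed

section \<open>Spans and linear maps prescribed on a spanning set\<close>

inductive_set vspan :: "nat \<Rightarrow> 'k :: field vec set \<Rightarrow> 'k vec set" for m R where
  zero: "0\<^sub>v m \<in> vspan m R"
| step: "x \<in> vspan m R \<Longrightarrow> r \<in> R \<Longrightarrow> c \<cdot>\<^sub>v r + x \<in> vspan m R"

lemma vspan_carrier:
  assumes "R \<subseteq> carrier_vec m" "x \<in> vspan m R"
  shows "x \<in> carrier_vec m"
  using assms(2,1) by (induction) auto

lemma vspan_add:
  assumes R: "R \<subseteq> carrier_vec m" and x: "x \<in> vspan m R" and y: "y \<in> vspan m R"
  shows "x + y \<in> vspan m R"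
  using x
proof induction
  case zero
  then show ?case using y vspan_carrier[OF R y] by simp
next
  case (step x r c)
  have "c \<cdot>\<^sub>v r + x + y = c \<cdot>\<^sub>v r + (x + y)"
    using R step vspan_carrier[OF R] y by (intro assoc_add_vec[of _ m]) auto
  then show ?case using vspan.step[OF step(3) step(2)] by simp
qed

lemma vspan_smult:
  assumes R: "R \<subseteq> carrier_vec m" and x: "x \<in> vspan m R"
  shows "a \<cdot>\<^sub>v x \<in> vspan m R"
  using x
proof induction
  case zero
  have "a \<cdot>\<^sub>v 0\<^sub>v m = 0\<^sub>v m" by auto
  then show ?case by (simp add: vspan.zero)
next
  case (step x r c)
  have "a \<cdot>\<^sub>v (c \<cdot>\<^sub>v r + x) = (a * c) \<cdot>\<^sub>v r + a \<cdot>\<^sub>v x"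
    using R step vspan_carrier[OF R step(1)] by (subst smult_add_distrib_vec[of _ m]) (auto simp: smult_smult_assoc)
  then show ?case using vspan.step[OF step(3) step(2)] by simp
qed

lemma vspan_base:
  assumes "R \<subseteq> carrier_vec m" and "r \<in> R"
  shows "r \<in> vspan m R"
proof -
  have "r \<in> carrier_vec m" using assms by auto
  then show ?thesis
    using vspan.step[OF vspan.zero[of m] assms(2), of 1] by simp
qed

text \<open>A vector outside the span would admit a linear functional that vanishes on the span but
  not at the vector, and the coordinates of this functional would contradict \<open>ann\<close>. The
  map \<open>em\<close> moves vectors into a function space, where functionals can be extended from
  an independent set.\<close>

lemma vspan_eq_carrier:
  fixes R :: "'k :: field vec set"
  assumes R: "R \<subseteq> carrier_vec m"
    and ann: "\<And>x. x \<in> carrier_vec m \<Longrightarrow> (\<And>r. r \<in> R \<Longrightarrow> r \<bullet> x = 0) \<Longrightarrow> x = 0\<^sub>v m"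
  shows "vspan m R = carrier_vec m"
proof (rule ccontr)
  assume "vspan m R \<noteq> carrier_vec m"
  then obtain v where v: "v \<in> carrier_vec m" "v \<notin> vspan m R" using vspan_carrier[OF R] by blast
  define sc where "sc = (\<lambda>(c::'k) (x::nat \<Rightarrow> 'k) i. c * x i)"
  interpret V: vector_space sc unfolding sc_def by (rule vector_space_fun)
  define sk where "sk = (\<lambda>(c::'k) (x::'k). c * x)"
  interpret K: vector_space sk unfolding sk_def by unfold_locales (auto simp: algebra_simps)
  interpret P: vector_space_pair sc sk ..
  define em where "em x = (\<lambda>i. if i < m then (x::'k vec) $ i else 0)" for x
  have em_inj: "x = y" if "em x = em y" "x \<in> carrier_vec m" "y \<in> carrier_vec m" for x y
    using that by (intro eq_vecI) (auto simp: em_def fun_eq_iff split: if_splits)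
  have em_add: "em (x + y) = em x + em y" if "x \<in> carrier_vec m" "y \<in> carrier_vec m" for x y
    using that by (auto simp: em_def)
  have em_sc: "em (c \<cdot>\<^sub>v x) = sc c (em x)" if "x \<in> carrier_vec m" for x c
    using that by (auto simp: em_def sc_def)
  define S where "S = em ` vspan m R"
  have S: "V.subspace S"
    unfolding V.subspace_def
  proof (intro conjI ballI allI)
    have "em (0\<^sub>v m) = 0" by (auto simp: em_def)
    then show "0 \<in> S" unfolding S_def using vspan.zero by (metis imageI)
    show "x + y \<in> S" if "x \<in> S" "y \<in> S" for x y
    proof -
      from that obtain a b where "x = em a" "y = em b" "a \<in> vspan m R" "b \<in> vspan m R"
        unfolding S_def by blast
      then show ?thesis using em_add[of a b] vspan_add[OF R] vspan_carrier[OF R] unfolding S_def by (metis imageI)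
    qed
    show "sc c x \<in> S" if "x \<in> S" for x c
    proof -
      from that obtain a where "x = em a" "a \<in> vspan m R" unfolding S_def by blast
      then show ?thesis using em_sc[of a c] vspan_smult[OF R] vspan_carrier[OF R] unfolding S_def by (metis imageI)
    qed
  qed
  have vS: "em v \<notin> S" using v em_inj vspan_carrier[OF R] unfolding S_def by blast
  obtain B where B: "B \<subseteq> S" "V.independent B" "S \<subseteq> V.span B" using V.maximal_independent_subset by blast
  have "V.span B = S" using B S by (metis V.span_minimal subset_antisym)
  then have "V.independent (insert (em v) B)" using vS B by (auto simp: V.independent_insert)
  from P.linear_independent_extend[OF this, of "\<lambda>x. if x = em v then 1 else 0"]
  obtain f where lf: "Vector_Spaces.linear sc sk f"
    and f0: "\<forall>x\<in>insert (em v) B. f x = (if x = em v then 1 else 0)" by blast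
  have f: "f (em v) = 1" "\<And>x. x \<in> B \<Longrightarrow> f x = 0"
    using f0 vS B(1) by auto
  interpret f: Vector_Spaces.linear sc sk f by (rule lf)
  have fS: "f x = 0" if "x \<in> S" for x
    using that \<open>V.span B = S\<close> f(2) f.eq_0_on_span by blast
  define \<delta> where "\<delta> i = (\<lambda>j. if j = i then 1 else 0 :: 'k)" for i :: nat
  have ex: "f (em x) = x \<bullet> vec m (\<lambda>i. f (\<delta> i))" if "x \<in> carrier_vec m" for x
  proof -
    have "em x = (\<Sum>i<m. sc (x $ i) (\<delta> i))"
    proof
      fix L
      have ap: "(\<Sum>K<m. h K) L = (\<Sum>K<m. h K L)" for h :: "nat \<Rightarrow> nat \<Rightarrow> 'k"
        by (induction m) auto
      have "(\<Sum>i<m. sc (x $ i) (\<delta> i)) L = (\<Sum>i<m. if L = i then x $ i else 0)"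
        unfolding ap by (rule sum.cong) (auto simp: sc_def \<delta>_def)
      then show "em x L = (\<Sum>i<m. sc (x $ i) (\<delta> i)) L" by (auto simp: em_def)
    qed
    then have "f (em x) = (\<Sum>i<m. x $ i * f (\<delta> i))" by (simp add: f.sum f.scale sk_def)
    then show ?thesis by (simp add: scalar_prod_def atLeast0LessThan)
  qed
  have "vec m (\<lambda>i. f (\<delta> i)) = 0\<^sub>v m"
  proof (rule ann)
    fix r assume "r \<in> R"
    then have "em r \<in> S" "r \<in> carrier_vec m" using vspan_base[OF R] R unfolding S_def by auto
    then show "r \<bullet> vec m (\<lambda>i. f (\<delta> i)) = 0" using fS ex by metis
  qed simp
  then show False using ex[OF v(1)] f(1) v(1) by simp
qed

text \<open>The relation generated by \<open>X s \<mapsto> Y s\<close>; it is the graph of a linear map as soon as \<open>0\<close> is related to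
  \<open>0\<close> only.\<close>

inductive_set lin_graph :: "nat \<Rightarrow> 's set \<Rightarrow> ('s \<Rightarrow> 'k :: field vec) \<Rightarrow> ('s \<Rightarrow> 'z \<Rightarrow> 'k) \<Rightarrow> ('k vec \<times> ('z \<Rightarrow> 'k)) set"
  for m S X Y where
  zero: "(0\<^sub>v m, \<lambda>z. 0) \<in> lin_graph m S X Y"
| step: "(x, y) \<in> lin_graph m S X Y \<Longrightarrow> s \<in> S \<Longrightarrow> (c \<cdot>\<^sub>v X s + x, \<lambda>z. c * Y s z + y z) \<in> lin_graph m S X Y"

text \<open>The relation is additive and homogeneous, and total because \<open>X\<close> spans; two
  values over the same vector differ by a value over 0, which \<open>wd\<close> kills. Values are
  functions on an arbitrary type, so that one statement yields scalar functionals (over the unit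
  type) as well as maps into tensors.\<close>

lemma linear_extension:
  fixes X :: "'s \<Rightarrow> 'k :: field vec"
  assumes X: "X ` S \<subseteq> carrier_vec m" and span: "vspan m (X ` S) = carrier_vec m"
    and wd: "\<And>y. (0\<^sub>v m, y) \<in> lin_graph m S X Y \<Longrightarrow> y = (\<lambda>z. 0)"
  shows "\<exists>f. (\<forall>s\<in>S. f (X s) = Y s) \<and>
     (\<forall>x\<in>carrier_vec m. \<forall>y\<in>carrier_vec m. f (x + y) = (\<lambda>z. f x z + f y z)) \<and>
     (\<forall>c. \<forall>x\<in>carrier_vec m. f (c \<cdot>\<^sub>v x) = (\<lambda>z. c * f x z))"
proof -
  let ?G = "lin_graph m S X Y"
  have car: "x \<in> carrier_vec m" if "(x, y) \<in> ?G" for x y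
    using that X by (induction) auto
  have add: "(x + x', \<lambda>z. y z + y' z) \<in> ?G" if "(x, y) \<in> ?G" "(x', y') \<in> ?G" for x y x' y'
    using that(1)
  proof induction
    case zero
    then show ?case using that(2) car[OF that(2)] by simp
  next
    case (step x y s c)
    have "c \<cdot>\<^sub>v X s + x + x' = c \<cdot>\<^sub>v X s + (x + x')"
      using X step car that by (intro assoc_add_vec[of _ m]) auto
    moreover have "(\<lambda>z. c * Y s z + y z + y' z) = (\<lambda>z. c * Y s z + (y z + y' z))" by (simp add: add.assoc)
    ultimately show ?case using lin_graph.step[OF step(3) step(2), of c] by (simp only:)
  qed
  have sm: "(a \<cdot>\<^sub>v x, \<lambda>z. a * y z) \<in> ?G" if "(x, y) \<in> ?G" for x y a
    using that
  proof induction
    case zero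
    have "a \<cdot>\<^sub>v 0\<^sub>v m = 0\<^sub>v m" by auto
    then show ?case using lin_graph.zero[of m S X Y] by simp
  next
    case (step x y s c)
    have "a \<cdot>\<^sub>v (c \<cdot>\<^sub>v X s + x) = (a * c) \<cdot>\<^sub>v X s + a \<cdot>\<^sub>v x"
      using X step car[OF step(1)] by (subst smult_add_distrib_vec[of _ m]) (auto simp: smult_smult_assoc)
    moreover have "(\<lambda>z. a * (c * Y s z + y z)) = (\<lambda>z. a * c * Y s z + a * y z)" by (simp add: distrib_left mult.assoc)
    ultimately show ?case using lin_graph.step[OF step(3) step(2), of "a * c"] by (simp only:)
  qed
  have tot: "\<exists>y. (x, y) \<in> ?G" if "x \<in> carrier_vec m" for x
  proof -
    have "x \<in> vspan m (X ` S)" using span that by simp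
    then show ?thesis
    proof induction
      case zero
      then show ?case using lin_graph.zero by blast
    next
      case (step x r c)
      then obtain y s where "(x, y) \<in> ?G" "s \<in> S" "r = X s" by auto
      then show ?case using lin_graph.step[of x y m S X Y s c] by metis
    qed
  qed
  have uniq: "y = y'" if "(x, y) \<in> ?G" "(x, y') \<in> ?G" for x y y'
  proof -
    have "(x + (-1) \<cdot>\<^sub>v x, \<lambda>z. y z + (-1) * y' z) \<in> ?G" by (rule add[OF that(1) sm[OF that(2)]])
    moreover have "x + (-1) \<cdot>\<^sub>v x = 0\<^sub>v m" using car[OF that(1)] by (intro eq_vecI) auto
    ultimately have "(\<lambda>z. y z + (-1) * y' z) = (\<lambda>z. 0)" by (intro wd) simp
    then have "y z + (-1) * y' z = 0" for z by (rule fun_cong)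
    then show ?thesis by (simp add: fun_eq_iff)
  qed
  define f where "f x = (THE y. (x, y) \<in> ?G)" for x
  have f: "f x = y" if "(x, y) \<in> ?G" for x y
    unfolding f_def using that uniq by (intro the_equality) auto
  have fG: "(x, f x) \<in> ?G" if "x \<in> carrier_vec m" for x using tot[OF that] f by auto
  show ?thesis
  proof (intro exI[of _ f] conjI ballI allI)
    show "f (X s) = Y s" if "s \<in> S" for s
    proof (rule f)
      have "(1 \<cdot>\<^sub>v X s + 0\<^sub>v m, \<lambda>z. 1 * Y s z + 0) \<in> ?G" by (rule lin_graph.step[OF lin_graph.zero that])
      moreover have "X s \<in> carrier_vec m" using X that by auto
      ultimately show "(X s, Y s) \<in> ?G" by simp
    qed
    show "f (x + y) = (\<lambda>z. f x z + f y z)" if "x \<in> carrier_vec m" "y \<in> carrier_vec m" for x y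
      by (rule f[OF add[OF fG[OF that(1)] fG[OF that(2)]]])
    show "f (c \<cdot>\<^sub>v x) = (\<lambda>z. c * f x z)" if "x \<in> carrier_vec m" for c x
      by (rule f[OF sm[OF fG[OF that]]])
  qed
qed

section \<open>Polynomial functions on matrices\<close>

lemma poly_funs_cong_carrier: "f \<in> poly_funs p q \<Longrightarrow> (\<And>i j. i < p \<Longrightarrow> j < q \<Longrightarrow> A $$ (i,j) = B $$ (i,j)) \<Longrightarrow> f A = f B"
  by (induction rule: poly_funs.induct) auto

lemma poly_funs_sum:
  "(\<And>i. i \<in> S \<Longrightarrow> f i \<in> poly_funs p q) \<Longrightarrow> (\<lambda>A. \<Sum>i\<in>S. f i A) \<in> poly_funs p q"
proof (induction S rule: infinite_finite_induct)
  case (infinite A)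
  then show ?case using poly_funs.const[of 0] by simp
next
  case empty
  then show ?case using poly_funs.const[of 0] by simp
next
  case (insert x F)
  then show ?case using poly_funs.add[of "f x" p q "\<lambda>A. \<Sum>i\<in>F. f i A"] by simp
qed

lemma poly_funs_prod:
  "(\<And>i. i \<in> S \<Longrightarrow> f i \<in> poly_funs p q) \<Longrightarrow> (\<lambda>A. \<Prod>i\<in>S. f i A) \<in> poly_funs p q"
proof (induction S rule: infinite_finite_induct)
  case (infinite A)
  then show ?case using poly_funs.const[of 1] by simp
next
  case empty
  then show ?case using poly_funs.const[of 1] by simp
next
  case (insert x F)
  then show ?case using poly_funs.mult[of "f x" p q "\<lambda>A. \<Prod>i\<in>F. f i A"] by simp
qed

lemma poly_funs_scale: "f \<in> poly_funs p q \<Longrightarrow> (\<lambda>A. c * f A) \<in> poly_funs p q"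
  using poly_funs.mult[OF poly_funs.const] by auto

lemma poly_funs_diff:
  assumes "f \<in> poly_funs p q" "g \<in> poly_funs p q"
  shows "(\<lambda>A. f A - g A) \<in> poly_funs p q"
  using poly_funs.add[OF assms(1) poly_funs_scale[OF assms(2), of "-1"]] by simp

lemma poly_funs_compose:
  assumes "f \<in> poly_funs p q"
    and "\<And>i j. i < p \<Longrightarrow> j < q \<Longrightarrow> (\<lambda>A. \<Phi> A $$ (i, j)) \<in> poly_funs p' q'"
  shows "(\<lambda>A. f (\<Phi> A)) \<in> poly_funs p' q'"
  using assms(1) by (induction) (auto intro: poly_funs.intros assms(2))

lemma poly_funs_det:
  assumes "\<And>A. \<Phi> A \<in> carrier_mat m m"
    and "\<And>i j. i < m \<Longrightarrow> j < m \<Longrightarrow> (\<lambda>A. \<Phi> A $$ (i, j)) \<in> poly_funs p q"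
  shows "(\<lambda>A. det (\<Phi> A)) \<in> poly_funs p q"
proof -
  have "(\<lambda>A. det (\<Phi> A)) = (\<lambda>A. \<Sum>\<pi>\<in>{\<pi>. \<pi> permutes {0..<m}}. signof \<pi> * (\<Prod>i\<in>{0..<m}. \<Phi> A $$ (i, \<pi> i)))"
    using det_def'[OF assms(1)] by auto
  moreover have "\<dots> \<in> poly_funs p q"
    by (intro poly_funs_sum poly_funs_scale poly_funs_prod assms(2)) (auto simp: permutes_in_image)
  ultimately show ?thesis by simp
qed

lemma poly_funs_curve:
  assumes "f \<in> poly_funs p q"
    and "\<And>i j. i < p \<Longrightarrow> j < q \<Longrightarrow> \<exists>P. \<forall>t. c t $$ (i, j) = poly P t"
  shows "\<exists>P. \<forall>t. f (c t) = poly P t"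
  using assms(1)
proof induction
  case (const a)
  show ?case by (rule exI[of _ "[:a:]"]) simp
next
  case (coord i j)
  then show ?case using assms(2) by auto
next
  case (add f g)
  then obtain P Q where "\<forall>t. f (c t) = poly P t" "\<forall>t. g (c t) = poly Q t" by blast
  then show ?case by (intro exI[of _ "P + Q"]) simp
next
  case (mult f g)
  then obtain P Q where "\<forall>t. f (c t) = poly P t" "\<forall>t. g (c t) = poly Q t" by blast
  then show ?case by (intro exI[of _ "P * Q"]) simp
qed

definition line :: "'k :: field mat \<Rightarrow> 'k mat \<Rightarrow> 'k \<Rightarrow> 'k mat" where
  "line A B t = mat (dim_row A) (dim_col A) (\<lambda>(i, j). A $$ (i, j) + t * (B $$ (i, j) - A $$ (i, j)))"

lemma line_carrier [simp]: "A \<in> carrier_mat p q \<Longrightarrow> line A B t \<in> carrier_mat p q"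
  by (auto simp: line_def)

lemma line_0 [simp]: "A \<in> carrier_mat p q \<Longrightarrow> B \<in> carrier_mat p q \<Longrightarrow> line A B 0 = A"
  by (auto simp: line_def)

lemma line_1 [simp]: "A \<in> carrier_mat p q \<Longrightarrow> B \<in> carrier_mat p q \<Longrightarrow> line A B 1 = B"
  by (auto simp: line_def)

lemma line_poly:
  assumes "A \<in> carrier_mat p q" "i < p" "j < q"
  shows "\<exists>P. \<forall>t. line A B t $$ (i, j) = poly P t"
  by (rule exI[of _ "[:A $$ (i, j), B $$ (i, j) - A $$ (i, j):]"]) (use assms in \<open>auto simp: line_def\<close>)

lemma poly_funs_line:
  assumes "f \<in> poly_funs p q" "A \<in> carrier_mat p q"
  shows "\<exists>P. \<forall>t. f (line A B t) = poly P t"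
  using poly_funs_curve[OF assms(1)] line_poly[OF assms(2)] by blast

lemma infinite_field: "infinite (UNIV :: 'k :: field_char_0 set)"
  by (rule infinite_UNIV_char_0)

text \<open>Irreducibility of affine space: on the line through \<open>A\<close> and
  \<open>B\<close> both functions become nonzero polynomials in one variable, and their product has
  finitely many roots in an infinite field.\<close>

lemma poly_funs_nonzero_mult:
  fixes f g :: "'k :: field_char_0 mat \<Rightarrow> 'k"
  assumes f: "f \<in> poly_funs p q" "A \<in> carrier_mat p q" "f A \<noteq> 0"
    and g: "g \<in> poly_funs p q" "B \<in> carrier_mat p q" "g B \<noteq> 0"
  obtains C where "C \<in> carrier_mat p q" "f C \<noteq> 0" "g C \<noteq> 0"
proof -
  obtain P Q where P: "\<And>t. f (line A B t) = poly P t" and Q: "\<And>t. g (line A B t) = poly Q t"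
    using poly_funs_line[OF f(1,2)] poly_funs_line[OF g(1) f(2)] by metis
  have "poly P 0 \<noteq> 0" "poly Q 1 \<noteq> 0"
    using P[of 0, symmetric] Q[of 1, symmetric] f g by simp_all
  then have "P * Q \<noteq> 0" by auto
  then have "finite {t. poly (P * Q) t = 0}" by (rule poly_roots_finite)
  then obtain t where "poly (P * Q) t \<noteq> 0" using infinite_field[where 'k = 'k] ex_new_if_finite by blast
  then have "poly P t \<noteq> 0" "poly Q t \<noteq> 0" by auto
  then show ?thesis using that[of "line A B t"] P Q f(2) by auto
qed

lemma poly_funs_dense:
  fixes f e :: "'k :: field_char_0 mat \<Rightarrow> 'k"
  assumes "f \<in> poly_funs p q" "e \<in> poly_funs p q" "B \<in> carrier_mat p q" "e B \<noteq> 0"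
    and "\<And>A. A \<in> carrier_mat p q \<Longrightarrow> e A \<noteq> 0 \<Longrightarrow> f A = 0"
    and "A \<in> carrier_mat p q"
  shows "f A = 0"
  using poly_funs_nonzero_mult[of f p q A e B] assms by metis

section \<open>Monomials\<close>

text \<open>Exponents vanish outside the matrix, so that distinct exponents give distinct
  monomials.\<close>

definition exponents :: "nat \<Rightarrow> nat \<Rightarrow> (nat \<Rightarrow> nat \<Rightarrow> nat) set" where
  "exponents r n = {T. \<forall>i j. \<not> (i < r \<and> j < n) \<longrightarrow> T i j = 0}"

definition monom_fun :: "nat \<Rightarrow> nat \<Rightarrow> (nat \<Rightarrow> nat \<Rightarrow> nat) \<Rightarrow> 'k :: field mat \<Rightarrow> 'k" where
  "monom_fun r n T A = (\<Prod>i<r. \<Prod>j<n. A $$ (i, j) ^ T i j)"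

text \<open>Artin's argument, for a multiplication \<open>op\<close> that need not satisfy any group
  axiom: comparing the relation at \<open>op a b\<close> with \<open>\<chi> j b\<close> times the
  relation at \<open>a\<close> removes the index \<open>j\<close> and leaves a shorter relation,
  nontrivial at \<open>k\<close> as soon as \<open>b\<close> separates \<open>k\<close> from
  \<open>j\<close>.\<close>

lemma independent_characters:
  fixes \<chi> :: "'i \<Rightarrow> 'a \<Rightarrow> 'k :: field"
  assumes "finite M"
    and "\<And>a b. a \<in> G \<Longrightarrow> b \<in> G \<Longrightarrow> op a b \<in> G"
    and "\<And>i a b. i \<in> M \<Longrightarrow> a \<in> G \<Longrightarrow> b \<in> G \<Longrightarrow> \<chi> i (op a b) = \<chi> i a * \<chi> i b"
    and "\<And>i j. i \<in> M \<Longrightarrow> j \<in> M \<Longrightarrow> i \<noteq> j \<Longrightarrow> \<exists>a\<in>G. \<chi> i a \<noteq> \<chi> j a"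
    and "\<And>i. i \<in> M \<Longrightarrow> \<exists>a\<in>G. \<chi> i a \<noteq> 0"
    and "\<And>a. a \<in> G \<Longrightarrow> (\<Sum>i\<in>M. c i * \<chi> i a) = 0"
    and "i \<in> M"
  shows "c i = 0"
  using assms(1,3-)
proof (induction M arbitrary: c i rule: finite_induct)
  case empty
  then show ?case by simp
next
  case (insert j M)
  note mult = insert.prems(1) and dist = insert.prems(2) and nz = insert.prems(3) and sum0 = insert.prems(4)
  have M0: "c k = 0" if k: "k \<in> M" for k
  proof -
    obtain b where b: "b \<in> G" "\<chi> k b \<noteq> \<chi> j b"
      using dist[of k j] k insert.hyps by auto
    have "(\<Sum>i\<in>M. c i * (\<chi> i b - \<chi> j b) * \<chi> i a) = 0" if a: "a \<in> G" for a
    proof -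
      have "(\<Sum>i\<in>insert j M. c i * \<chi> i (op a b)) - \<chi> j b * (\<Sum>i\<in>insert j M. c i * \<chi> i a) = 0"
        using sum0[OF assms(2)[OF a b(1)]] sum0[OF a] by simp
      moreover have "(\<Sum>i\<in>insert j M. c i * \<chi> i (op a b)) = (\<Sum>i\<in>insert j M. c i * (\<chi> i a * \<chi> i b))"
        using mult a b by (intro sum.cong) auto
      ultimately show ?thesis
        using insert.hyps by (simp add: algebra_simps sum_distrib_left sum_subtractf)
    qed
    then have "c k * (\<chi> k b - \<chi> j b) = 0"
      using k mult dist nz by (intro insert.IH[of "\<lambda>i. c i * (\<chi> i b - \<chi> j b)" k]) auto
    then show ?thesis using b by simp
  qed
  obtain a where a: "a \<in> G" "\<chi> j a \<noteq> 0" using nz[of j] by auto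
  have "c j = 0" using sum0[OF a(1)] M0 a(2) insert.hyps by simp
  then show ?case using M0 insert.prems(5) by auto
qed

lemma power_two_inject:
  assumes "(2 :: 'k :: field_char_0) ^ a = 2 ^ b"
  shows "a = b"
proof -
  have "of_nat (2 ^ a) = (of_nat (2 ^ b) :: 'k)" using assms by simp
  then have "(2::nat) ^ a = 2 ^ b" using of_nat_eq_iff by blast
  then show ?thesis by simp
qed

text \<open>Monomials are multiplicative for the entrywise product of matrices, hence characters;
  two exponents that differ at one place are separated by the matrix with entry 2 there and 1
  elsewhere.\<close>

lemma monom_fun_indep:
  fixes c :: "(nat \<Rightarrow> nat \<Rightarrow> nat) \<Rightarrow> 'k :: field_char_0"
  assumes M: "finite M" "M \<subseteq> exponents r n"
    and 0: "\<And>A. A \<in> carrier_mat r n \<Longrightarrow> (\<Sum>T\<in>M. c T * monom_fun r n T A) = 0"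
    and T: "T \<in> M"
  shows "c T = 0"
proof (rule independent_characters[where G = "carrier_mat r n" and \<chi> = "monom_fun r n"
        and op = "\<lambda>A B. mat r n (\<lambda>(i, j). A $$ (i, j) * B $$ (i, j))", OF M(1) _ _ _ _ 0 T])
  fix T T' assume TT: "T \<in> M" "T' \<in> M" "T \<noteq> T'"
  then obtain i j where ij: "T i j \<noteq> T' i j" by (auto simp: fun_eq_iff)
  moreover have "T \<in> exponents r n" "T' \<in> exponents r n" using TT M(2) by auto
  ultimately have "i < r \<and> j < n" unfolding exponents_def by (metis (mono_tags, lifting) mem_Collect_eq)
  define A :: "'k mat" where "A = mat r n (\<lambda>x. if x = (i, j) then 2 else 1)"
  have *: "monom_fun r n S A = 2 ^ S i j" for S
  proof -
    have "monom_fun r n S A = (\<Prod>i'<r. \<Prod>j'<n. if i' = i \<and> j' = j then 2 ^ S i j else 1)"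
      unfolding monom_fun_def by (intro prod.cong) (auto simp: A_def)
    also have "\<dots> = (\<Prod>i'<r. if i' = i then 2 ^ S i j else 1)"
      using \<open>i < r \<and> j < n\<close> by (intro prod.cong) auto
    finally show ?thesis using \<open>i < r \<and> j < n\<close> by simp
  qed
  show "\<exists>A\<in>carrier_mat r n. (monom_fun r n T A :: 'k) \<noteq> monom_fun r n T' A"
    by (rule bexI[of _ A]) (use * ij power_two_inject in \<open>auto simp: A_def\<close>)
next
  fix T assume "T \<in> M"
  show "\<exists>A\<in>carrier_mat r n. monom_fun r n T A \<noteq> (0 :: 'k)"
    by (rule bexI[of _ "mat r n (\<lambda>_. 1)"]) (auto simp: monom_fun_def)
qed (auto simp: monom_fun_def power_mult_distrib prod.distrib)

lemma poly_funs_monomials: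
  fixes f :: "'k :: field mat \<Rightarrow> 'k"
  assumes "f \<in> poly_funs r n"
  shows "\<exists>M c. finite M \<and> M \<subseteq> exponents r n \<and> (\<forall>A. f A = (\<Sum>T\<in>M. c T * monom_fun r n T A))"
  using assms
proof induction
  case (const a)
  show ?case
    by (rule exI[of _ "{\<lambda>i j. 0}"], rule exI[of _ "\<lambda>_. a"]) (auto simp: exponents_def monom_fun_def)
next
  case (coord i j)
  let ?T = "\<lambda>i' j'. if i' = i \<and> j' = j then 1 else 0 :: nat"
  have "monom_fun r n ?T A = A $$ (i, j)" for A :: "'k mat"
  proof -
    have "monom_fun r n ?T A = (\<Prod>i'<r. \<Prod>j'<n. if i' = i \<and> j' = j then A $$ (i, j) else 1)"
      unfolding monom_fun_def by (intro prod.cong) auto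
    also have "\<dots> = (\<Prod>i'<r. if i' = i then A $$ (i, j) else 1)"
      using coord by (intro prod.cong) auto
    finally show ?thesis using coord by simp
  qed
  then show ?case
    using coord by (intro exI[of _ "{?T}"] exI[of _ "\<lambda>_. 1"]) (auto simp: exponents_def)
next
  case (add f g)
  obtain M c where M: "finite M" "M \<subseteq> exponents r n" "\<And>A. f A = (\<Sum>T\<in>M. c T * monom_fun r n T A)"
    using add.IH(1) by auto
  obtain N d where N: "finite N" "N \<subseteq> exponents r n" "\<And>A. g A = (\<Sum>T\<in>N. d T * monom_fun r n T A)"
    using add.IH(2) by auto
  let ?e = "\<lambda>T. (if T \<in> M then c T else 0) + (if T \<in> N then d T else 0)"
  have "f A + g A = (\<Sum>T\<in>M \<union> N. ?e T * monom_fun r n T A)" for A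
  proof -
    have "(\<Sum>T\<in>M. c T * monom_fun r n T A) = (\<Sum>T\<in>M \<union> N. (if T \<in> M then c T else 0) * monom_fun r n T A)"
      by (rule sum.mono_neutral_cong_left) (use M N in auto)
    moreover have "(\<Sum>T\<in>N. d T * monom_fun r n T A) = (\<Sum>T\<in>M \<union> N. (if T \<in> N then d T else 0) * monom_fun r n T A)"
      by (rule sum.mono_neutral_cong_left) (use M N in auto)
    ultimately show ?thesis by (simp add: M N distrib_right sum.distrib)
  qed
  then show ?case using M N by (intro exI[of _ "M \<union> N"] exI[of _ ?e]) auto
next
  case (mult f g)
  obtain M c where M: "finite M" "M \<subseteq> exponents r n" "\<And>A. f A = (\<Sum>T\<in>M. c T * monom_fun r n T A)"
    using mult.IH(1) by auto
  obtain N d where N: "finite N" "N \<subseteq> exponents r n" "\<And>A. g A = (\<Sum>T\<in>N. d T * monom_fun r n T A)"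
    using mult.IH(2) by auto
  let ?s = "\<lambda>(T, S). \<lambda>i j. T i j + S i j :: nat"
  let ?e = "\<lambda>U. \<Sum>x\<in>{x \<in> M \<times> N. ?s x = U}. c (fst x) * d (snd x)"
  have "f A * g A = (\<Sum>U\<in>?s ` (M \<times> N). ?e U * monom_fun r n U A)" for A
  proof -
    have "f A * g A = (\<Sum>x\<in>M \<times> N. c (fst x) * d (snd x) * monom_fun r n (?s x) A)"
      by (simp add: M N sum_product sum.cartesian_product monom_fun_def power_add prod.distrib case_prod_beta mult_ac)
    also have "\<dots> = (\<Sum>U\<in>?s ` (M \<times> N). \<Sum>x\<in>{x \<in> M \<times> N. ?s x = U}. c (fst x) * d (snd x) * monom_fun r n (?s x) A)"
      by (rule sum.image_gen) (use M N in auto)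
    also have "\<dots> = (\<Sum>U\<in>?s ` (M \<times> N). ?e U * monom_fun r n U A)"
      unfolding sum_distrib_right by (intro sum.cong) auto
    finally show ?thesis .
  qed
  moreover have "?s ` (M \<times> N) \<subseteq> exponents r n"
  proof
    fix U assume "U \<in> ?s ` (M \<times> N)"
    then obtain T S where U: "U = (\<lambda>i j. T i j + S i j)" "T \<in> M" "S \<in> N" by auto
    then have "T \<in> exponents r n" "S \<in> exponents r n" using M N by auto
    then show "U \<in> exponents r n" by (simp add: exponents_def U(1))
  qed
  ultimately show ?case using M(1) N(1)
    by (intro exI[of _ "?s ` (M \<times> N)"] exI[of _ ?e]) simp
qed

abbreviation pinv :: "(nat \<Rightarrow> nat) \<Rightarrow> nat \<Rightarrow> nat" where "pinv \<equiv> Hilbert_Choice.inv"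

section \<open>Tensors and symmetrizers\<close>

text \<open>Multi-indices on an arbitrary set of boxes instead of an initial segment, because the
  diagrams of \<open>lam\<close>, \<open>mu/lam\<close> and \<open>mu\<close> will share one
  numbering.\<close>

definition idx :: "nat \<Rightarrow> nat set \<Rightarrow> (nat \<Rightarrow> nat) set" where
  "idx n B = B \<rightarrow>\<^sub>E {..<n}"

lemma finite_idx [simp]: "finite B \<Longrightarrow> finite (idx n B)"
  by (simp add: idx_def finite_PiE)

text \<open>The tensor power of \<open>A\<close> with one factor for each box, normalized to vanish
  off the multi-indices.\<close>

definition tmul :: "nat set \<Rightarrow> 'k :: field mat \<Rightarrow> ((nat \<Rightarrow> nat) \<Rightarrow> 'k) \<Rightarrow> (nat \<Rightarrow> nat) \<Rightarrow> 'k" where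
  "tmul B A y = (\<lambda>I. if I \<in> idx (dim_row A) B
     then \<Sum>J\<in>idx (dim_col A) B. (\<Prod>k\<in>B. A $$ (I k, J k)) * y J else 0)"

definition fib_perms :: "nat set \<Rightarrow> (nat \<Rightarrow> 'c) \<Rightarrow> (nat \<Rightarrow> nat) set" where
  "fib_perms B f = {\<sigma>. \<sigma> permutes B \<and> (\<forall>k\<in>B. f (\<sigma> k) = f k)}"

text \<open>The weight 1 with the rows as fibres gives the row symmetrizer, the sign with the
  columns gives the column antisymmetrizer. Permutations are not inverted here; for these two
  weights that only reindexes the sum.\<close>

definition fsym :: "((nat \<Rightarrow> nat) \<Rightarrow> int) \<Rightarrow> nat set \<Rightarrow> (nat \<Rightarrow> 'c) \<Rightarrow>
    ((nat \<Rightarrow> nat) \<Rightarrow> 'k :: field) \<Rightarrow> (nat \<Rightarrow> nat) \<Rightarrow> 'k" where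
  "fsym w B f y I = (\<Sum>\<sigma>\<in>fib_perms B f. of_int (w \<sigma>) * y (I \<circ> \<sigma>))"

definition perm_char :: "((nat \<Rightarrow> nat) \<Rightarrow> int) \<Rightarrow> bool" where
  "perm_char w \<longleftrightarrow> (\<forall>\<sigma> \<tau>. permutation \<sigma> \<longrightarrow> permutation \<tau> \<longrightarrow> w (\<sigma> \<circ> \<tau>) = w \<sigma> * w \<tau>) \<and>
     (\<forall>\<sigma>. permutation \<sigma> \<longrightarrow> w (pinv \<sigma>) = w \<sigma>) \<and> (\<forall>\<sigma>. w \<sigma> * w \<sigma> = 1)"

lemma perm_char_one [simp]: "perm_char (\<lambda>_. 1)"
  by (simp add: perm_char_def)

lemma perm_char_sign [simp]: "perm_char sign"
  by (simp add: perm_char_def sign_compose sign_inverse)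

lemma idx_comp_iff:
  assumes "\<sigma> permutes B"
  shows "I \<circ> \<sigma> \<in> idx n B \<longleftrightarrow> I \<in> idx n B"
proof -
  have *: "J \<circ> \<tau> \<in> idx n B" if "J \<in> idx n B" "\<tau> permutes B" for J \<tau>
    using that permutes_in_image[OF that(2)] permutes_not_in[OF that(2)]
    unfolding idx_def by (fastforce simp: PiE_iff extensional_def)
  have "I \<circ> \<sigma> \<circ> pinv \<sigma> = I"
    using permutes_inv_o(1)[OF assms] by (simp add: comp_assoc)
  with *[OF _ assms, of I] *[OF _ permutes_inv[OF assms], of "I \<circ> \<sigma>"] show ?thesis by metis
qed

lemma sum_idx_comp:
  assumes "\<sigma> permutes B"
  shows "(\<Sum>I\<in>idx n B. g (I \<circ> \<sigma>)) = (\<Sum>I\<in>idx n B. g I)"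
proof (rule sum.reindex_bij_witness[of _ "\<lambda>I. I \<circ> pinv \<sigma>" "\<lambda>I. I \<circ> \<sigma>"])
  show "I \<circ> pinv \<sigma> \<circ> \<sigma> = I" "I \<circ> \<sigma> \<circ> pinv \<sigma> = I" for I :: "nat \<Rightarrow> nat"
    using permutes_inv_o[OF assms] by (simp_all add: comp_assoc)
  show "I \<circ> pinv \<sigma> \<in> idx n B" if "I \<in> idx n B" for I
    using idx_comp_iff[OF permutes_inv[OF assms]] that by blast
qed (use idx_comp_iff[OF assms] in auto)

lemma finite_fib_perms: "finite B \<Longrightarrow> finite (fib_perms B f)"
  by (rule finite_subset[OF _ finite_permutations[of B]]) (auto simp: fib_perms_def)

lemma id_fib_perms: "id \<in> fib_perms B f"
  by (simp add: fib_perms_def permutes_id)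

lemma card_fib_perms: "finite B \<Longrightarrow> card (fib_perms B f) > 0"
  using finite_fib_perms[of B f] id_fib_perms[of B f] card_gt_0_iff by blast

lemma fib_perms_comp:
  assumes "\<sigma> \<in> fib_perms B f" "\<tau> \<in> fib_perms B f"
  shows "\<sigma> \<circ> \<tau> \<in> fib_perms B f"
proof -
  have "\<sigma> permutes B" "\<tau> permutes B" using assms by (auto simp: fib_perms_def)
  then show ?thesis using assms permutes_compose permutes_in_image[OF \<open>\<tau> permutes B\<close>]
    by (auto simp: fib_perms_def)
qed

lemma fib_perms_inv:
  assumes "\<sigma> \<in> fib_perms B f"
  shows "pinv \<sigma> \<in> fib_perms B f"
proof -
  have s: "\<sigma> permutes B" using assms by (auto simp: fib_perms_def)
  have "f (pinv \<sigma> k) = f k" if "k \<in> B" for k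
  proof -
    have "pinv \<sigma> k \<in> B" using permutes_in_image[OF permutes_inv[OF s]] that by simp
    then have "f (\<sigma> (pinv \<sigma> k)) = f (pinv \<sigma> k)" using assms by (auto simp: fib_perms_def)
    then show ?thesis using permutes_inverses(1)[OF s] by simp
  qed
  then show ?thesis using permutes_inv[OF s] by (auto simp: fib_perms_def)
qed

lemma fib_perms_permutes: "\<sigma> \<in> fib_perms B f \<Longrightarrow> \<sigma> permutes B"
  by (simp add: fib_perms_def)

lemma fib_perms_permutation: "finite B \<Longrightarrow> \<sigma> \<in> fib_perms B f \<Longrightarrow> permutation \<sigma>"
  unfolding fib_perms_def permutation_permutes by blast

lemma fsym_perm:
  fixes y :: "(nat \<Rightarrow> nat) \<Rightarrow> 'k :: field"
  assumes B: "finite B" and w: "perm_char w" and t: "\<tau> \<in> fib_perms B f"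
  shows "fsym w B f y (I \<circ> \<tau>) = of_int (w \<tau>) * fsym w B f y I"
proof -
  have p: "\<tau> permutes B" by (rule fib_perms_permutes[OF t])
  have "fsym w B f y (I \<circ> \<tau>) = (\<Sum>\<sigma>\<in>fib_perms B f. of_int (w \<tau>) * (of_int (w \<sigma>) * y (I \<circ> \<sigma>)))"
    unfolding fsym_def
  proof (rule sum.reindex_bij_witness[of _ "\<lambda>\<sigma>. pinv \<tau> \<circ> \<sigma>" "\<lambda>\<sigma>. \<tau> \<circ> \<sigma>"])
    fix \<sigma> assume s: "\<sigma> \<in> fib_perms B f"
    show "pinv \<tau> \<circ> (\<tau> \<circ> \<sigma>) = \<sigma>" using permutes_inv_o(2)[OF p] by (simp add: o_assoc)
    show "\<tau> \<circ> \<sigma> \<in> fib_perms B f" by (rule fib_perms_comp[OF t s])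
    have "w (\<tau> \<circ> \<sigma>) = w \<tau> * w \<sigma>" "w \<tau> * w \<tau> = 1"
      using w fib_perms_permutation[OF B s] fib_perms_permutation[OF B t] by (auto simp: perm_char_def)
    then have "w \<tau> * w (\<tau> \<circ> \<sigma>) = w \<sigma>" by (simp add: mult.assoc[symmetric])
    then have "of_int (w \<tau>) * of_int (w (\<tau> \<circ> \<sigma>)) = (of_int (w \<sigma>) :: 'k)"
      by (metis of_int_mult)
    then show "of_int (w \<tau>) * (of_int (w (\<tau> \<circ> \<sigma>)) * y (I \<circ> (\<tau> \<circ> \<sigma>))) = of_int (w \<sigma>) * y (I \<circ> \<tau> \<circ> \<sigma>)"
      by (simp add: o_assoc mult.assoc[symmetric])
  next
    fix \<sigma> assume s: "\<sigma> \<in> fib_perms B f"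
    show "\<tau> \<circ> (pinv \<tau> \<circ> \<sigma>) = \<sigma>" using permutes_inv_o(1)[OF p] by (simp add: o_assoc)
    show "pinv \<tau> \<circ> \<sigma> \<in> fib_perms B f" by (rule fib_perms_comp[OF fib_perms_inv[OF t] s])
  qed
  then show ?thesis by (simp add: fsym_def sum_distrib_left)
qed

lemma fsym_idem:
  fixes y :: "(nat \<Rightarrow> nat) \<Rightarrow> 'k :: field"
  assumes B: "finite B" and w: "perm_char w"
  shows "fsym w B f (fsym w B f y) I = of_nat (card (fib_perms B f)) * fsym w B f y I"
proof -
  have "fsym w B f (fsym w B f y) I = (\<Sum>\<sigma>\<in>fib_perms B f. fsym w B f y I)"
    unfolding fsym_def[of w B f "fsym w B f y"]
  proof (rule sum.cong[OF refl])
    fix \<sigma> assume s: "\<sigma> \<in> fib_perms B f"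
    have "w \<sigma> * w \<sigma> = 1" using w by (auto simp: perm_char_def)
    then have "of_int (w \<sigma>) * of_int (w \<sigma>) = (1 :: 'k)" by (metis of_int_mult of_int_1)
    then show "of_int (w \<sigma>) * fsym w B f y (I \<circ> \<sigma>) = fsym w B f y I"
      unfolding fsym_perm[OF B w s] by (simp add: mult.assoc[symmetric])
  qed
  then show ?thesis by simp
qed

lemma sum_fib_perms_inv:
  "(\<Sum>\<sigma>\<in>fib_perms B f. g (pinv \<sigma>)) = (\<Sum>\<sigma>\<in>fib_perms B f. g \<sigma>)"
  by (rule sum.reindex_bij_witness[of _ pinv pinv])
     (auto simp: fib_perms_inv permutes_inv_inv[OF fib_perms_permutes])

text \<open>A place permutation is adjoint to its inverse for the standard pairing, and the weighted
  sum over the group is stable under inversion.\<close>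

lemma fsym_adjoint:
  assumes B: "finite B" and w: "perm_char w"
  shows "(\<Sum>I\<in>idx n B. x I * fsym w B f y I) = (\<Sum>I\<in>idx n B. fsym w B f x I * y I)"
proof -
  have "(\<Sum>I\<in>idx n B. x I * fsym w B f y I)
      = (\<Sum>\<sigma>\<in>fib_perms B f. \<Sum>I\<in>idx n B. x I * (of_int (w \<sigma>) * y (I \<circ> \<sigma>)))"
    unfolding fsym_def sum_distrib_left by (rule sum.swap)
  also have "\<dots> = (\<Sum>\<sigma>\<in>fib_perms B f. \<Sum>I\<in>idx n B. x (I \<circ> pinv \<sigma>) * (of_int (w (pinv \<sigma>)) * y I))"
  proof (rule sum.cong[OF refl])
    fix \<sigma> assume s: "\<sigma> \<in> fib_perms B f"
    note p = fib_perms_permutes[OF s]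
    have "(\<Sum>I\<in>idx n B. x I * (of_int (w \<sigma>) * y (I \<circ> \<sigma>)))
        = (\<Sum>I\<in>idx n B. x (I \<circ> \<sigma> \<circ> pinv \<sigma>) * (of_int (w \<sigma>) * y (I \<circ> \<sigma>)))"
      using permutes_inv_o(1)[OF p] by (simp add: comp_assoc)
    also have "\<dots> = (\<Sum>I\<in>idx n B. x (I \<circ> pinv \<sigma>) * (of_int (w \<sigma>) * y I))"
      using sum_idx_comp[OF p, of "\<lambda>I. x (I \<circ> pinv \<sigma>) * (of_int (w \<sigma>) * y I)"] by simp
    moreover have "w (pinv \<sigma>) = w \<sigma>"
      using w fib_perms_permutation[OF B s] by (simp add: perm_char_def)
    ultimately show "(\<Sum>I\<in>idx n B. x I * (of_int (w \<sigma>) * y (I \<circ> \<sigma>)))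
        = (\<Sum>I\<in>idx n B. x (I \<circ> pinv \<sigma>) * (of_int (w (pinv \<sigma>)) * y I))" by simp
  qed
  also have "\<dots> = (\<Sum>\<sigma>\<in>fib_perms B f. \<Sum>I\<in>idx n B. x (I \<circ> \<sigma>) * (of_int (w \<sigma>) * y I))"
    by (rule sum_fib_perms_inv[of "\<lambda>\<sigma>. \<Sum>I\<in>idx n B. x (I \<circ> \<sigma>) * (of_int (w \<sigma>) * y I)"])
  also have "\<dots> = (\<Sum>I\<in>idx n B. \<Sum>\<sigma>\<in>fib_perms B f. x (I \<circ> \<sigma>) * (of_int (w \<sigma>) * y I))"
    by (rule sum.swap)
  also have "\<dots> = (\<Sum>I\<in>idx n B. fsym w B f x I * y I)"
    by (intro sum.cong refl) (simp add: fsym_def sum_distrib_left sum_distrib_right mult_ac)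
  finally show ?thesis .
qed

lemma prod_comp_permutes: "\<sigma> permutes B \<Longrightarrow> (\<Prod>k\<in>B. g (\<sigma> k)) = (\<Prod>k\<in>B. g k)"
  by (simp add: prod.permute[of \<sigma> B g] comp_def)

text \<open>The tensor power of a matrix commutes with every place permutation: permuting the boxes
  in the product of entries and in the summation index at once changes nothing.\<close>

lemma fsym_tmul:
  assumes B: "finite B"
  shows "tmul B A (fsym w B f y) = fsym w B f (tmul B A y)"
proof
  fix I
  show "tmul B A (fsym w B f y) I = fsym w B f (tmul B A y) I"
  proof (cases "I \<in> idx (dim_row A) B")
    case False
    then show ?thesis by (auto simp: tmul_def fsym_def idx_comp_iff[OF fib_perms_permutes])
  next
    case True
    have "tmul B A (fsym w B f y) I
        = (\<Sum>\<sigma>\<in>fib_perms B f. \<Sum>J\<in>idx (dim_col A) B. (\<Prod>k\<in>B. A $$ (I k, J k)) * (of_int (w \<sigma>) * y (J \<circ> \<sigma>)))"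
      using True unfolding tmul_def fsym_def sum_distrib_left by (subst sum.swap) simp
    also have "\<dots> = (\<Sum>\<sigma>\<in>fib_perms B f. of_int (w \<sigma>) * tmul B A y (I \<circ> \<sigma>))"
    proof (rule sum.cong[OF refl])
      fix \<sigma> assume s: "\<sigma> \<in> fib_perms B f"
      note p = fib_perms_permutes[OF s]
      have "(\<Sum>J\<in>idx (dim_col A) B. (\<Prod>k\<in>B. A $$ (I k, J k)) * (of_int (w \<sigma>) * y (J \<circ> \<sigma>)))
          = (\<Sum>J\<in>idx (dim_col A) B. (\<Prod>k\<in>B. A $$ ((I \<circ> \<sigma>) k, (J \<circ> \<sigma>) k)) * (of_int (w \<sigma>) * y (J \<circ> \<sigma>)))"
      proof (rule sum.cong[OF refl])
        fix J
        show "(\<Prod>k\<in>B. A $$ (I k, J k)) * (of_int (w \<sigma>) * y (J \<circ> \<sigma>))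
          = (\<Prod>k\<in>B. A $$ ((I \<circ> \<sigma>) k, (J \<circ> \<sigma>) k)) * (of_int (w \<sigma>) * y (J \<circ> \<sigma>))"
          using prod_comp_permutes[OF p, of "\<lambda>k. A $$ (I k, J k)"] by simp
      qed
      also have "\<dots> = (\<Sum>J\<in>idx (dim_col A) B. (\<Prod>k\<in>B. A $$ ((I \<circ> \<sigma>) k, J k)) * (of_int (w \<sigma>) * y J))"
        by (rule sum_idx_comp[OF p, of "\<lambda>J. (\<Prod>k\<in>B. A $$ ((I \<circ> \<sigma>) k, J k)) * (of_int (w \<sigma>) * y J)"])
      also have "\<dots> = of_int (w \<sigma>) * tmul B A y (I \<circ> \<sigma>)"
        using True idx_comp_iff[OF p, of I "dim_row A"] by (simp add: tmul_def sum_distrib_left mult_ac)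
      finally show "(\<Sum>J\<in>idx (dim_col A) B. (\<Prod>k\<in>B. A $$ (I k, J k)) * (of_int (w \<sigma>) * y (J \<circ> \<sigma>)))
          = of_int (w \<sigma>) * tmul B A y (I \<circ> \<sigma>)" .
    qed
    finally show ?thesis by (simp add: fsym_def)
  qed
qed

text \<open>The matrix of the operator has integer entries, which is what lets positivity over the
  rationals act on tensors over any field of characteristic zero.\<close>

definition fsym_mat :: "((nat \<Rightarrow> nat) \<Rightarrow> int) \<Rightarrow> nat set \<Rightarrow> (nat \<Rightarrow> 'c) \<Rightarrow> (nat \<Rightarrow> nat) \<Rightarrow> (nat \<Rightarrow> nat) \<Rightarrow> int" where
  "fsym_mat w B f I J = (\<Sum>\<sigma>\<in>fib_perms B f. if I \<circ> \<sigma> = J then w \<sigma> else 0)"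

lemma fsym_eq_mat:
  assumes B: "finite B" and I: "I \<in> idx n B"
  shows "fsym w B f y I = (\<Sum>J\<in>idx n B. of_int (fsym_mat w B f I J) * y J)"
proof -
  have "(\<Sum>J\<in>idx n B. of_int (fsym_mat w B f I J) * y J)
      = (\<Sum>\<sigma>\<in>fib_perms B f. \<Sum>J\<in>idx n B. if I \<circ> \<sigma> = J then of_int (w \<sigma>) * y J else 0)"
    unfolding fsym_mat_def of_int_sum sum_distrib_right
    by (subst sum.swap) (intro sum.cong refl, simp)
  also have "\<dots> = fsym w B f y I"
    unfolding fsym_def
    by (rule sum.cong[OF refl]) (use B I in \<open>simp add: idx_comp_iff[OF fib_perms_permutes]\<close>)
  finally show ?thesis by simp
qed

lemma fsym_mat_sym:
  assumes B: "finite B" and w: "perm_char w"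
  shows "fsym_mat w B f I J = fsym_mat w B f J I"
proof -
  have "fsym_mat w B f I J = (\<Sum>\<sigma>\<in>fib_perms B f. if J \<circ> pinv \<sigma> = I then w (pinv \<sigma>) else 0)"
    unfolding fsym_mat_def
  proof (rule sum.cong[OF refl])
    fix \<sigma> assume s: "\<sigma> \<in> fib_perms B f"
    note p = fib_perms_permutes[OF s]
    have "I \<circ> \<sigma> = J \<longleftrightarrow> J \<circ> pinv \<sigma> = I"
      using permutes_inv_o[OF p] by (metis comp_assoc comp_id)
    moreover have "w \<sigma> = w (pinv \<sigma>)"
      using w fib_perms_permutation[OF B s] by (simp add: perm_char_def)
    ultimately show "(if I \<circ> \<sigma> = J then w \<sigma> else 0) = (if J \<circ> pinv \<sigma> = I then w (pinv \<sigma>) else 0)" by simp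
  qed
  then show ?thesis
    unfolding fsym_mat_def
    using sum_fib_perms_inv[of "\<lambda>\<sigma>. if J \<circ> \<sigma> = I then w \<sigma> else 0" B f] by simp
qed

lemma fsym_cong:
  assumes "\<And>I. I \<in> idx n B \<Longrightarrow> x I = y I" "I \<in> idx n B"
  shows "fsym w B f x I = fsym w B f y I"
  unfolding fsym_def
  by (rule sum.cong[OF refl], subst assms(1)) (simp_all add: idx_comp_iff[OF fib_perms_permutes] assms(2))

abbreviation rsym where "rsym \<equiv> fsym (\<lambda>_. 1)"
abbreviation csym where "csym \<equiv> fsym sign"

lemma fsym_scale: "fsym w B f (\<lambda>I. c * y I) I = c * fsym w B f y I"
  by (simp add: fsym_def sum_distrib_left mult_ac)

lemma fsym_zero [simp]: "fsym w B f (\<lambda>I. 0) I = 0"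
  by (simp add: fsym_def)

lemma fsym_add: "fsym w B f (\<lambda>I. x I + y I) I = fsym w B f x I + fsym w B f y I"
  by (simp add: fsym_def distrib_left sum.distrib)

text \<open>Let \<open>N\<close> be the matrix of \<open>csym\<close> after \<open>rsym\<close>.
  Both factors are symmetric, so the transpose of \<open>N\<close> is \<open>rsym\<close> after
  \<open>csym\<close>, and the normal matrix is row, column, column, row. As \<open>csym\<close> is
  idempotent up to the nonzero factor \<open>\<beta>\<close>, this is \<open>\<beta>\<close> times
  row, column, row. The two claims are then the kernel and image statements for integer
  matrices.\<close>

lemma
  fixes z :: "(nat \<Rightarrow> nat) \<Rightarrow> 'k :: field_char_0"
  assumes B: "finite B"
  shows symmetrizer_kernel:
    "\<lbrakk>\<And>I. I \<in> idx n B \<Longrightarrow> rsym B rw (csym B cl (rsym B rw z)) I = 0; I \<in> idx n B\<rbrakk>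
      \<Longrightarrow> csym B cl (rsym B rw z) I = 0" (is "\<lbrakk>PROP ?P; _\<rbrakk> \<Longrightarrow> _")
    and symmetrizer_image:
    "\<exists>z'. \<forall>I\<in>idx n B. rsym B rw (csym B cl z) I = rsym B rw (csym B cl (rsym B rw z')) I"
proof -
  let ?X = "idx n B"
  let ?a = "fsym_mat (\<lambda>_. 1) B rw" and ?b = "fsym_mat sign B cl"
  define N where "N I J = (\<Sum>K\<in>?X. ?b I K * ?a K J)" for I J
  define \<beta> where "\<beta> = (of_nat (card (fib_perms B cl)) :: 'k)"
  have \<beta>: "\<beta> \<noteq> 0" using card_fib_perms[OF B, of cl] by (simp add: \<beta>_def)
  have ba: "csym B cl (rsym B rw y) I = (\<Sum>J\<in>?X. of_int (N I J) * y J)" if "I \<in> ?X" for I and y :: "(nat \<Rightarrow> nat) \<Rightarrow> 'k"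
  proof -
    have "csym B cl (rsym B rw y) I = (\<Sum>K\<in>?X. \<Sum>J\<in>?X. of_int (?b I K) * (of_int (?a K J) * y J))"
      unfolding fsym_eq_mat[OF B that] sum_distrib_left
      by (intro sum.cong refl) (simp add: fsym_eq_mat[OF B, of _ n] sum_distrib_left)
    also have "\<dots> = (\<Sum>J\<in>?X. of_int (N I J) * y J)"
      by (subst sum.swap) (simp add: N_def sum_distrib_right mult.assoc)
    finally show ?thesis .
  qed
  have ab: "rsym B rw (csym B cl y) K = (\<Sum>I\<in>?X. of_int (N I K) * y I)" if "K \<in> ?X" for K and y :: "(nat \<Rightarrow> nat) \<Rightarrow> 'k"
  proof -
    have "rsym B rw (csym B cl y) K = (\<Sum>L\<in>?X. \<Sum>I\<in>?X. of_int (?a K L) * (of_int (?b L I) * y I))"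
      unfolding fsym_eq_mat[OF B that] sum_distrib_left
      by (intro sum.cong refl) (simp add: fsym_eq_mat[OF B, of _ n] sum_distrib_left)
    also have "\<dots> = (\<Sum>L\<in>?X. \<Sum>I\<in>?X. of_int (?a L K) * (of_int (?b I L) * y I))"
      by (simp only: fsym_mat_sym[OF B perm_char_one, of rw K] fsym_mat_sym[OF B perm_char_sign, of cl _ "_ :: nat \<Rightarrow> nat"])
    also have "\<dots> = (\<Sum>I\<in>?X. of_int (N I K) * y I)"
      by (subst sum.swap) (simp add: N_def sum_distrib_left sum_distrib_right mult_ac)
    finally show ?thesis .
  qed
  have abba: "(\<Sum>L\<in>?X. of_int (N L K) * (\<Sum>J\<in>?X. of_int (N L J) * y J))
      = \<beta> * rsym B rw (csym B cl (rsym B rw y)) K" if "K \<in> ?X" for K and y :: "(nat \<Rightarrow> nat) \<Rightarrow> 'k"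
  proof -
    have "(\<Sum>L\<in>?X. of_int (N L K) * (\<Sum>J\<in>?X. of_int (N L J) * y J))
        = rsym B rw (csym B cl (csym B cl (rsym B rw y))) K"
      using that by (simp add: ab ba)
    also have "csym B cl (csym B cl (rsym B rw y)) = (\<lambda>I. \<beta> * csym B cl (rsym B rw y) I)"
      by (simp add: fun_eq_iff fsym_idem[OF B perm_char_sign] \<beta>_def)
    finally show ?thesis by (simp add: fsym_scale)
  qed
  show "csym B cl (rsym B rw z) I = 0" if "PROP ?P" "I \<in> ?X" for I
  proof -
    have "(\<Sum>J\<in>?X. of_int (N I J) * z J) = 0"
      by (rule int_matrix_normal_kernel[OF finite_idx[OF B] that(2)]) (simp add: abba that(1))
    then show ?thesis by (simp add: ba that(2))
  qed
  obtain z' :: "(nat \<Rightarrow> nat) \<Rightarrow> 'k" where z': "\<And>K. K \<in> ?X \<Longrightarrow>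
    (\<Sum>I\<in>?X. of_int (N I K) * z I) = (\<Sum>L\<in>?X. of_int (N L K) * (\<Sum>J\<in>?X. of_int (N L J) * z' J))"
    using int_matrix_normal_image[OF finite_idx[OF B], of n N z] by blast
  have "rsym B rw (csym B cl z) I = rsym B rw (csym B cl (rsym B rw (\<lambda>I. \<beta> * z' I))) I" if "I \<in> ?X" for I
  proof -
    have "rsym B rw (csym B cl (rsym B rw (\<lambda>I. \<beta> * z' I))) I = \<beta> * rsym B rw (csym B cl (rsym B rw z')) I"
      by (simp add: fsym_scale[abs_def])
    then show ?thesis using that z' by (simp add: ab abba)
  qed
  then show "\<exists>z'. \<forall>I\<in>?X. rsym B rw (csym B cl z) I = rsym B rw (csym B cl (rsym B rw z')) I" by blast
qed

lemma idx_less: "I \<in> idx n B \<Longrightarrow> k \<in> B \<Longrightarrow> I k < n"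
  by (auto simp: idx_def)

lemma idx_eqI: "I \<in> idx n B \<Longrightarrow> J \<in> idx m B \<Longrightarrow> (\<And>k. k \<in> B \<Longrightarrow> I k = J k) \<Longrightarrow> I = J"
  unfolding idx_def using PiE_ext[of I B "\<lambda>_. UNIV" J] by (auto simp: PiE_iff)

lemma tmul_outside: "I \<notin> idx (dim_row A) B \<Longrightarrow> tmul B A y I = 0"
  by (simp add: tmul_def)

lemma tmul_mult:
  assumes B: "finite B" and A: "A \<in> carrier_mat p q" and C: "C \<in> carrier_mat q s"
  shows "tmul B (A * C) y = tmul B A (tmul B C y)"
proof
  fix I
  show "tmul B (A * C) y I = tmul B A (tmul B C y) I"
  proof (cases "I \<in> idx p B")
    case False
    then show ?thesis using A by (simp add: tmul_def)
  next
    case I: True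
    have "(\<Prod>k\<in>B. (A * C) $$ (I k, J k)) = (\<Sum>K\<in>idx q B. (\<Prod>k\<in>B. A $$ (I k, K k)) * (\<Prod>k\<in>B. C $$ (K k, J k)))"
      if J: "J \<in> idx s B" for J
    proof -
      have "(\<Prod>k\<in>B. (A * C) $$ (I k, J k)) = (\<Prod>k\<in>B. \<Sum>m<q. A $$ (I k, m) * C $$ (m, J k))"
        using A C idx_less[OF I] idx_less[OF J]
        by (intro prod.cong refl) (simp add: scalar_prod_def atLeast0LessThan)
      also have "\<dots> = (\<Sum>K\<in>idx q B. \<Prod>k\<in>B. A $$ (I k, K k) * C $$ (K k, J k))"
        unfolding idx_def by (rule prod_sum_PiE) (use B in auto)
      finally show ?thesis by (simp add: prod.distrib)
    qed
    then have "tmul B (A * C) y I = (\<Sum>J\<in>idx s B. \<Sum>K\<in>idx q B. (\<Prod>k\<in>B. A $$ (I k, K k)) * ((\<Prod>k\<in>B. C $$ (K k, J k)) * y J))"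
      using A C I by (simp add: tmul_def sum_distrib_right mult.assoc)
    also have "\<dots> = (\<Sum>K\<in>idx q B. \<Sum>J\<in>idx s B. (\<Prod>k\<in>B. A $$ (I k, K k)) * ((\<Prod>k\<in>B. C $$ (K k, J k)) * y J))"
      by (rule sum.swap)
    also have "\<dots> = tmul B A (tmul B C y) I"
      using A C I by (simp add: tmul_def sum_distrib_left)
    finally show ?thesis .
  qed
qed

lemma tmul_one:
  assumes B: "finite B" and y: "\<And>I. I \<notin> idx n B \<Longrightarrow> y I = 0"
  shows "tmul B (1\<^sub>m n) y = y"
proof
  fix I
  show "tmul B (1\<^sub>m n) y I = y I"
  proof (cases "I \<in> idx n B")
    case False
    then show ?thesis using y by (simp add: tmul_def)
  next
    case I: True
    have "(\<Prod>k\<in>B. 1\<^sub>m n $$ (I k, J k)) * y J = (if J = I then y I else 0)" if J: "J \<in> idx n B" for J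
    proof (cases "J = I")
      case True
      then show ?thesis using idx_less[OF I] by simp
    next
      case False
      then obtain k where "k \<in> B" "I k \<noteq> J k" using idx_eqI[OF J I] by metis
      then have "(\<Prod>k\<in>B. 1\<^sub>m n $$ (I k, J k)) = (0 :: 'a)"
        using B idx_less[OF I] idx_less[OF J] by (intro prod_zero) auto
      then show ?thesis using False by simp
    qed
    then show ?thesis using I B by (simp add: tmul_def)
  qed
qed

lemma tmul_add: "tmul B A (\<lambda>I. x I + y I) = (\<lambda>I. tmul B A x I + tmul B A y I)"
  by (auto simp: tmul_def fun_eq_iff distrib_left sum.distrib)

lemma tmul_scale: "tmul B A (\<lambda>I. c * y I) = (\<lambda>I. c * tmul B A y I)"
  by (auto simp: tmul_def fun_eq_iff sum_distrib_left mult_ac)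

lemma tmul_zero: "tmul B A (\<lambda>I. 0) = (\<lambda>I. 0)"
  by (auto simp: tmul_def fun_eq_iff)

lemma tmul_cong:
  "(\<And>I. I \<in> idx (dim_col A) B \<Longrightarrow> x I = y I) \<Longrightarrow> tmul B A x = tmul B A y"
  by (auto simp: tmul_def fun_eq_iff)

lemma tmul_adjoint:
  assumes A: "A \<in> carrier_mat p q"
  shows "(\<Sum>I\<in>idx p B. x I * tmul B A y I) = (\<Sum>J\<in>idx q B. tmul B (transpose_mat A) x J * y J)"
proof -
  have "(\<Sum>I\<in>idx p B. x I * tmul B A y I) = (\<Sum>I\<in>idx p B. \<Sum>J\<in>idx q B. x I * ((\<Prod>k\<in>B. A $$ (I k, J k)) * y J))"
    using A by (simp add: tmul_def sum_distrib_left)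
  also have "\<dots> = (\<Sum>J\<in>idx q B. \<Sum>I\<in>idx p B. x I * ((\<Prod>k\<in>B. A $$ (I k, J k)) * y J))"
    by (rule sum.swap)
  also have "\<dots> = (\<Sum>J\<in>idx q B. \<Sum>I\<in>idx p B. (\<Prod>k\<in>B. transpose_mat A $$ (J k, I k)) * x I * y J)"
  proof (intro sum.cong refl)
    fix I J assume "I \<in> idx p B" "J \<in> idx q B"
    then have "(\<Prod>k\<in>B. transpose_mat A $$ (J k, I k)) = (\<Prod>k\<in>B. A $$ (I k, J k))"
      using A idx_less by (intro prod.cong refl) auto
    then show "x I * ((\<Prod>k\<in>B. A $$ (I k, J k)) * y J) = (\<Prod>k\<in>B. transpose_mat A $$ (J k, I k)) * x I * y J"
      by simp
  qed
  finally show ?thesis using A by (simp add: tmul_def sum_distrib_right)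
qed

section \<open>The polynomial of a tensor\<close>

text \<open>The tensor evaluated on the rows of \<open>A\<close> as on linear forms: box
  \<open>k\<close> receives row \<open>rw k\<close>.\<close>

definition pfun :: "nat set \<Rightarrow> (nat \<Rightarrow> nat) \<Rightarrow> nat \<Rightarrow> ((nat \<Rightarrow> nat) \<Rightarrow> 'k :: field) \<Rightarrow> 'k mat \<Rightarrow> 'k" where
  "pfun B rw n y A = (\<Sum>J\<in>idx n B. (\<Prod>k\<in>B. A $$ (rw k, J k)) * y J)"

definition fcontent :: "nat set \<Rightarrow> (nat \<Rightarrow> nat) \<Rightarrow> (nat \<Rightarrow> nat) \<Rightarrow> nat \<Rightarrow> nat \<Rightarrow> nat" where
  "fcontent B rw I i j = card {k \<in> B. rw k = i \<and> I k = j}"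

lemma fcontent_exponents:
  assumes "I \<in> idx n B" "\<And>k. k \<in> B \<Longrightarrow> rw k < r"
  shows "fcontent B rw I \<in> exponents r n"
proof -
  have "{k \<in> B. rw k = i \<and> I k = j} = {}" if "\<not> (i < r \<and> j < n)" for i j
    using that assms idx_less by blast
  then have "fcontent B rw I i j = 0" if "\<not> (i < r \<and> j < n)" for i j
    using that unfolding fcontent_def by (metis card.empty)
  then show ?thesis by (simp add: exponents_def)
qed

lemma prod_fcontent:
  assumes B: "finite B" and I: "I \<in> idx n B" and r: "\<And>k. k \<in> B \<Longrightarrow> rw k < r"
  shows "(\<Prod>k\<in>B. A $$ (rw k, I k)) = monom_fun r n (fcontent B rw I) A"
proof -
  let ?g = "\<lambda>k. (rw k, I k)"
  have "(\<Prod>k\<in>B. A $$ (rw k, I k)) = (\<Prod>x\<in>{..<r} \<times> {..<n}. \<Prod>k\<in>{k \<in> B. ?g k = x}. A $$ ?g k)"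
    by (rule prod.group[symmetric]) (use B r idx_less[OF I] in auto)
  also have "\<dots> = (\<Prod>x\<in>{..<r} \<times> {..<n}. A $$ x ^ fcontent B rw I (fst x) (snd x))"
  proof (rule prod.cong[OF refl])
    fix x
    have "(\<Prod>k\<in>{k \<in> B. ?g k = x}. A $$ ?g k) = (\<Prod>k\<in>{k \<in> B. ?g k = x}. A $$ x)"
      by (rule prod.cong) auto
    also have "\<dots> = A $$ x ^ fcontent B rw I (fst x) (snd x)"
      by (simp add: fcontent_def prod_eq_iff)
    finally show "(\<Prod>k\<in>{k \<in> B. ?g k = x}. A $$ ?g k) = A $$ x ^ fcontent B rw I (fst x) (snd x)" .
  qed
  finally show ?thesis by (simp add: monom_fun_def prod.cartesian_product case_prod_beta)
qed

text \<open>Equal contents mean that the pairs (row, value) form the same multiset over the boxes,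
  so a permutation of the boxes matches the pairs; matching the first components keeps every box in
  its row.\<close>

lemma fcontent_eq_perm:
  assumes B: "finite B" and eq: "fcontent B rw I = fcontent B rw J"
    and I: "I \<in> idx n B" and J: "J \<in> idx n B"
  obtains \<sigma> where "\<sigma> \<in> fib_perms B rw" "J = I \<circ> \<sigma>"
proof -
  let ?f = "\<lambda>k. (rw k, J k)" and ?g = "\<lambda>k. (rw k, I k)"
  have c: "count (image_mset (\<lambda>k. (rw k, K k)) (mset_set B)) x = fcontent B rw K (fst x) (snd x)" for K x
  proof -
    have "count (image_mset (\<lambda>k. (rw k, K k)) (mset_set B)) x = card {k \<in> B. (rw k, K k) = x}"
      using B by (simp add: count_image_mset_eq_card_vimage)
    then show ?thesis by (simp add: fcontent_def prod_eq_iff)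
  qed
  have "image_mset ?f (mset_set B) = image_mset ?g (mset_set B)"
    by (rule multiset_eqI) (simp add: c eq)
  from image_mset_eq_implies_permutes[OF B this]
  obtain p where p: "p permutes B" "\<forall>x\<in>B. ?f x = ?g (p x)" by blast
  have "p \<in> fib_perms B rw" using p by (auto simp: fib_perms_def)
  moreover have "J = I \<circ> p"
    by (rule idx_eqI[OF J]) (use p idx_comp_iff[OF p(1)] I in auto)
  ultimately show ?thesis by (rule that)
qed

lemma fcontent_comp:
  assumes "\<sigma> \<in> fib_perms B rw"
  shows "fcontent B rw (I \<circ> \<sigma>) = fcontent B rw I"
proof (intro ext)
  fix i j
  note p = fib_perms_permutes[OF assms]
  have rw: "rw (\<sigma> k) = rw k" if "k \<in> B" for k using assms that by (auto simp: fib_perms_def)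
  have "bij_betw \<sigma> {k \<in> B. rw k = i \<and> (I \<circ> \<sigma>) k = j} {k \<in> B. rw k = i \<and> I k = j}"
  proof (rule bij_betwI[where g = "pinv \<sigma>"])
    show "\<sigma> \<in> {k \<in> B. rw k = i \<and> (I \<circ> \<sigma>) k = j} \<rightarrow> {k \<in> B. rw k = i \<and> I k = j}"
      using rw permutes_in_image[OF p] by auto
    show "pinv \<sigma> \<in> {k \<in> B. rw k = i \<and> I k = j} \<rightarrow> {k \<in> B. rw k = i \<and> (I \<circ> \<sigma>) k = j}"
      using fib_perms_inv[OF assms] permutes_in_image[OF permutes_inv[OF p]] permutes_inverses[OF p]
      by (auto simp: fib_perms_def)
  qed (use permutes_inverses[OF p] in auto)
  then show "fcontent B rw (I \<circ> \<sigma>) i j = fcontent B rw I i j"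
    unfolding fcontent_def by (rule bij_betw_same_card)
qed

lemma pfun_monomials:
  assumes B: "finite B" and r: "\<And>k. k \<in> B \<Longrightarrow> rw k < r"
  shows "pfun B rw n y A = (\<Sum>T\<in>fcontent B rw ` idx n B.
           (\<Sum>J\<in>{J \<in> idx n B. fcontent B rw J = T}. y J) * monom_fun r n T A)"
proof -
  have "pfun B rw n y A = (\<Sum>J\<in>idx n B. monom_fun r n (fcontent B rw J) A * y J)"
    unfolding pfun_def using prod_fcontent[where r = r and A = A, OF B _ r] by (intro sum.cong refl) auto
  also have "\<dots> = (\<Sum>T\<in>fcontent B rw ` idx n B. \<Sum>J\<in>{J \<in> idx n B. fcontent B rw J = T}.
      monom_fun r n (fcontent B rw J) A * y J)"
    by (rule sum.image_gen) (use B in simp)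
  also have "\<dots> = (\<Sum>T\<in>fcontent B rw ` idx n B.
           (\<Sum>J\<in>{J \<in> idx n B. fcontent B rw J = T}. y J) * monom_fun r n T A)"
    by (intro sum.cong refl) (simp add: sum_distrib_left mult.commute)
  finally show ?thesis .
qed

lemma pfun_poly_funs:
  assumes B: "finite B" and r: "\<And>k. k \<in> B \<Longrightarrow> rw k < r"
  shows "pfun B rw n y \<in> poly_funs r n"
proof -
  have "(\<lambda>A. \<Sum>J\<in>idx n B. (\<Prod>k\<in>B. A $$ (rw k, J k)) * y J) \<in> poly_funs r n"
    using r idx_less by (intro poly_funs_sum poly_funs.mult poly_funs_prod poly_funs.coord poly_funs.const) auto
  then show ?thesis by (simp add: pfun_def[abs_def])
qed

text \<open>The coefficient of a monomial is the sum of \<open>y\<close> over all fillings of one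
  content, and these fillings are a single orbit of the row group. On this orbit
  \<open>rsym y\<close> is constant, and its sum there is the order of the row group times the
  coefficient.\<close>

lemma pfun_zero_imp_rsym_zero:
  fixes y :: "(nat \<Rightarrow> nat) \<Rightarrow> 'k :: field_char_0"
  assumes B: "finite B" and r: "\<And>k. k \<in> B \<Longrightarrow> rw k < r"
    and 0: "\<And>A. A \<in> carrier_mat r n \<Longrightarrow> pfun B rw n y A = 0" and I: "I \<in> idx n B"
  shows "rsym B rw y I = 0"
proof -
  let ?C = "{J \<in> idx n B. fcontent B rw J = fcontent B rw I}"
  have s0: "(\<Sum>J\<in>?C. y J) = 0"
  proof (rule monom_fun_indep[where M = "fcontent B rw ` idx n B" and r = r and n = n
        and c = "\<lambda>T. \<Sum>J\<in>{J \<in> idx n B. fcontent B rw J = T}. y J"])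
    show "fcontent B rw ` idx n B \<subseteq> exponents r n" using fcontent_exponents r by blast
    show "(\<Sum>T\<in>fcontent B rw ` idx n B. (\<Sum>J\<in>{J \<in> idx n B. fcontent B rw J = T}. y J) * monom_fun r n T A) = 0"
      if "A \<in> carrier_mat r n" for A
      using 0[OF that] pfun_monomials[where rw = rw and r = r and n = n and y = y and A = A, OF B r] by simp
  qed (use I B in auto)
  have const: "rsym B rw y J = rsym B rw y I" if J: "J \<in> ?C" for J
  proof -
    obtain \<sigma> where "\<sigma> \<in> fib_perms B rw" "J = I \<circ> \<sigma>"
      using fcontent_eq_perm[OF B _ I, of rw J] J by auto
    then show ?thesis using fsym_perm[OF B perm_char_one] by simp
  qed
  have "of_nat (card ?C) * rsym B rw y I = (\<Sum>J\<in>?C. rsym B rw y J)"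
    using const by simp
  also have "\<dots> = (\<Sum>\<sigma>\<in>fib_perms B rw. \<Sum>J\<in>?C. y (J \<circ> \<sigma>))"
    unfolding fsym_def by (subst sum.swap) simp
  also have "\<dots> = (\<Sum>\<sigma>\<in>fib_perms B rw. \<Sum>J\<in>?C. y J)"
  proof (rule sum.cong[OF refl])
    fix \<sigma> assume s: "\<sigma> \<in> fib_perms B rw"
    note p = fib_perms_permutes[OF s]
    show "(\<Sum>J\<in>?C. y (J \<circ> \<sigma>)) = (\<Sum>J\<in>?C. y J)"
    proof (rule sum.reindex_bij_witness[of _ "\<lambda>I. I \<circ> pinv \<sigma>" "\<lambda>I. I \<circ> \<sigma>"])
      show "J \<circ> pinv \<sigma> \<circ> \<sigma> = J" "J \<circ> \<sigma> \<circ> pinv \<sigma> = J" for J :: "nat \<Rightarrow> nat"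
        using permutes_inv_o[OF p] by (simp_all add: comp_assoc)
      show "J \<circ> \<sigma> \<in> ?C" if "J \<in> ?C" for J
        using that idx_comp_iff[OF p] fcontent_comp[OF s] by auto
      show "J \<circ> pinv \<sigma> \<in> ?C" if "J \<in> ?C" for J
        using that idx_comp_iff[OF permutes_inv[OF p]] fcontent_comp[OF fib_perms_inv[OF s]] by auto
    qed simp
  qed
  also have "\<dots> = 0" by (simp add: s0)
  finally have "of_nat (card ?C) * rsym B rw y I = 0" .
  moreover have "card ?C \<noteq> 0" using I B by auto
  ultimately show ?thesis by simp
qed

text \<open>The product of entries is invariant under the row group, so moving the symmetrizer onto
  it by adjointness only counts the group.\<close>

lemma pfun_rsym:
  assumes B: "finite B"
  shows "pfun B rw n (rsym B rw y) A = of_nat (card (fib_perms B rw)) * pfun B rw n y A"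
proof -
  have "pfun B rw n (rsym B rw y) A = (\<Sum>J\<in>idx n B. rsym B rw (\<lambda>J. \<Prod>k\<in>B. A $$ (rw k, J k)) J * y J)"
    unfolding pfun_def by (rule fsym_adjoint[OF B perm_char_one])
  also have "\<dots> = (\<Sum>J\<in>idx n B. of_nat (card (fib_perms B rw)) * ((\<Prod>k\<in>B. A $$ (rw k, J k)) * y J))"
  proof (rule sum.cong[OF refl])
    fix J
    have "rsym B rw (\<lambda>J. \<Prod>k\<in>B. A $$ (rw k, J k)) J = (\<Sum>\<sigma>\<in>fib_perms B rw. \<Prod>k\<in>B. A $$ (rw k, J k))"
      unfolding fsym_def
    proof (intro sum.cong refl)
      fix \<sigma> assume s: "\<sigma> \<in> fib_perms B rw"
      have "(\<Prod>k\<in>B. A $$ (rw k, (J \<circ> \<sigma>) k)) = (\<Prod>k\<in>B. A $$ (rw (\<sigma> k), J (\<sigma> k)))"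
        using s by (intro prod.cong refl) (auto simp: fib_perms_def)
      then show "of_int 1 * (\<Prod>k\<in>B. A $$ (rw k, (J \<circ> \<sigma>) k)) = (\<Prod>k\<in>B. A $$ (rw k, J k))"
        using prod_comp_permutes[OF fib_perms_permutes[OF s], of "\<lambda>k. A $$ (rw k, J k)"] by simp
    qed
    then show "rsym B rw (\<lambda>J. \<Prod>k\<in>B. A $$ (rw k, J k)) J * y J
      = of_nat (card (fib_perms B rw)) * ((\<Prod>k\<in>B. A $$ (rw k, J k)) * y J)" by simp
  qed
  finally show ?thesis by (simp add: pfun_def sum_distrib_left)
qed

text \<open>The transposition of the two boxes fixes \<open>I\<close> but has sign -1, so the value
  equals its own negative.\<close>

lemma csym_repeated:
  fixes y :: "(nat \<Rightarrow> nat) \<Rightarrow> 'k :: field_char_0"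
  assumes B: "finite B" and k: "k \<in> B" "k' \<in> B" "k \<noteq> k'" "cl k = cl k'" "I k = I k'"
  shows "csym B cl y I = 0"
proof -
  let ?t = "Transposition.transpose k k'"
  have t: "?t \<in> fib_perms B cl"
    using k permutes_swap_id[of k B k'] by (auto simp: fib_perms_def Transposition.transpose_def)
  have "I \<circ> ?t = I" using k(5) by (auto simp: fun_eq_iff Transposition.transpose_def)
  then have "csym B cl y I = of_int (sign ?t) * csym B cl y I"
    using fsym_perm[OF B perm_char_sign t, of y I] by simp
  also have "sign ?t = -1" using k(3) by (simp add: sign_swap_id)
  finally show ?thesis by simp
qed

section \<open>Regular functions along polynomial curves\<close>

text \<open>A quotient of polynomials that is defined at \<open>t0\<close> and agrees with
  \<open>f\<close> at \<open>t0\<close> and at all but finitely many parameters. Cofinite sets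
  replace neighbourhoods, so that the value at \<open>t0\<close> acts as a limit.\<close>

definition germ_at :: "('k :: field \<Rightarrow> 'k) \<Rightarrow> 'k \<Rightarrow> bool" where
  "germ_at f t0 \<longleftrightarrow> (\<exists>G H. poly H t0 \<noteq> 0 \<and> finite {t. f t * poly H t \<noteq> poly G t} \<and>
     f t0 * poly H t0 = poly G t0)"

lemma germ_at_poly: "(\<And>t. f t = poly P t) \<Longrightarrow> germ_at f t0"
  unfolding germ_at_def by (intro exI[of _ P] exI[of _ 1]) simp

lemma germ_at_const: "germ_at (\<lambda>t. c) t0"
  by (rule germ_at_poly[of _ "[:c:]"]) simp

lemma germ_at_add:
  assumes "germ_at f t0" "germ_at g t0"
  shows "germ_at (\<lambda>t. f t + g t) t0"
proof -
  obtain G H where 1: "poly H t0 \<noteq> 0" "finite {t. f t * poly H t \<noteq> poly G t}" "f t0 * poly H t0 = poly G t0"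
    using assms(1) unfolding germ_at_def by blast
  obtain G' H' where 2: "poly H' t0 \<noteq> 0" "finite {t. g t * poly H' t \<noteq> poly G' t}" "g t0 * poly H' t0 = poly G' t0"
    using assms(2) unfolding germ_at_def by blast
  have e: "(f t + g t) * poly (H * H') t = poly (G * H' + G' * H) t"
    if "f t * poly H t = poly G t" "g t * poly H' t = poly G' t" for t
    using that by (simp add: algebra_simps flip: that)
  show ?thesis unfolding germ_at_def
  proof (intro exI conjI)
    show "poly (H * H') t0 \<noteq> 0" using 1 2 by simp
    show "finite {t. (f t + g t) * poly (H * H') t \<noteq> poly (G * H' + G' * H) t}"
      by (rule finite_subset[OF _ finite_UnI[OF 1(2) 2(2)]]) (use e in blast)
    show "(f t0 + g t0) * poly (H * H') t0 = poly (G * H' + G' * H) t0" using e 1 2 by blast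
  qed
qed

lemma germ_at_mult:
  assumes "germ_at f t0" "germ_at g t0"
  shows "germ_at (\<lambda>t. f t * g t) t0"
proof -
  obtain G H where 1: "poly H t0 \<noteq> 0" "finite {t. f t * poly H t \<noteq> poly G t}" "f t0 * poly H t0 = poly G t0"
    using assms(1) unfolding germ_at_def by blast
  obtain G' H' where 2: "poly H' t0 \<noteq> 0" "finite {t. g t * poly H' t \<noteq> poly G' t}" "g t0 * poly H' t0 = poly G' t0"
    using assms(2) unfolding germ_at_def by blast
  have e: "f t * g t * poly (H * H') t = poly (G * G') t"
    if "f t * poly H t = poly G t" "g t * poly H' t = poly G' t" for t
    using that by (simp add: algebra_simps flip: that)
  show ?thesis unfolding germ_at_def
  proof (intro exI conjI)
    show "poly (H * H') t0 \<noteq> 0" using 1 2 by simp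
    show "finite {t. f t * g t * poly (H * H') t \<noteq> poly (G * G') t}"
      by (rule finite_subset[OF _ finite_UnI[OF 1(2) 2(2)]]) (use e in blast)
    show "f t0 * g t0 * poly (H * H') t0 = poly (G * G') t0" using e 1 2 by blast
  qed
qed

lemma poly_zero_cofinite:
  fixes G :: "'k :: field_char_0 poly"
  assumes "finite {t. poly G t \<noteq> 0}"
  shows "G = 0"
proof (rule ccontr)
  assume "G \<noteq> 0"
  then have "finite {t. poly G t = 0}" by (rule poly_roots_finite)
  then have "finite ({t. poly G t = 0} \<union> {t. poly G t \<noteq> 0})" using assms by simp
  moreover have "{t. poly G t = 0} \<union> {t. poly G t \<noteq> 0} = UNIV" by auto
  ultimately show False using infinite_field[where 'k = 'k] by simp
qed

text \<open>The numerator vanishes at cofinitely many parameters, hence identically. This is the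
  form in which limits are taken throughout.\<close>

lemma germ_at_zero:
  fixes f :: "'k :: field_char_0 \<Rightarrow> 'k"
  assumes "germ_at f t0" "finite {t. f t \<noteq> 0}"
  shows "f t0 = 0"
proof -
  obtain G H where 1: "poly H t0 \<noteq> 0" "finite {t. f t * poly H t \<noteq> poly G t}" "f t0 * poly H t0 = poly G t0"
    using assms(1) unfolding germ_at_def by blast
  have "finite {t. poly G t \<noteq> 0}"
    by (rule finite_subset[OF _ finite_UnI[OF 1(2) assms(2)]]) auto
  then have "G = 0" by (rule poly_zero_cofinite)
  then show ?thesis using 1 by simp
qed

section \<open>Zariski open sets and regular functions\<close>

lemma zariski_open_carrier: "zariski_open p q U \<Longrightarrow> U \<subseteq> carrier_mat p q"
  by (auto simp: zariski_open_def)

lemma zariski_open_basic: "e \<in> poly_funs p q \<Longrightarrow> zariski_open p q {A \<in> carrier_mat p q. e A \<noteq> 0}"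
  unfolding zariski_open_def by (rule exI[of _ "{e}"]) auto

lemma zariski_open_Int:
  assumes "zariski_open p q U" "zariski_open p q V"
  shows "zariski_open p q (U \<inter> V)"
proof -
  obtain S T where S: "S \<subseteq> poly_funs p q" "U = {A \<in> carrier_mat p q. \<exists>f\<in>S. f A \<noteq> 0}"
    and T: "T \<subseteq> poly_funs p q" "V = {A \<in> carrier_mat p q. \<exists>f\<in>T. f A \<noteq> 0}"
    using assms unfolding zariski_open_def by blast
  let ?R = "{\<lambda>A. f A * g A | f g. f \<in> S \<and> g \<in> T}"
  have "?R \<subseteq> poly_funs p q" using S T by (auto intro: poly_funs.mult)
  moreover have "U \<inter> V = {A \<in> carrier_mat p q. \<exists>f\<in>?R. f A \<noteq> 0}"
  proof (intro equalityI subsetI)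
    fix A assume "A \<in> U \<inter> V"
    then obtain f g where "f \<in> S" "g \<in> T" "f A \<noteq> 0" "g A \<noteq> 0" "A \<in> carrier_mat p q" using S T by auto
    then show "A \<in> {A \<in> carrier_mat p q. \<exists>f\<in>?R. f A \<noteq> 0}"
      by (intro CollectI conjI bexI[of _ "\<lambda>A. f A * g A"]) auto
  qed (use S T in auto)
  ultimately show ?thesis unfolding zariski_open_def by blast
qed

lemma zariski_open_basic_nbhd:
  assumes "zariski_open p q W" "A \<in> W"
  obtains e where "e \<in> poly_funs p q" "e A \<noteq> 0" "\<And>B. B \<in> carrier_mat p q \<Longrightarrow> e B \<noteq> 0 \<Longrightarrow> B \<in> W"
  using assms unfolding zariski_open_def by blast

lemma regular_on_germ:
  assumes f: "regular_on p q U f" and c: "\<And>t. c t \<in> carrier_mat p q" "c t0 \<in> U"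
    and poly: "\<And>i j. i < p \<Longrightarrow> j < q \<Longrightarrow> \<exists>P. \<forall>t. c t $$ (i, j) = poly P t"
  shows "germ_at (\<lambda>t. f (c t)) t0" and "finite {t. c t \<notin> U}"
proof -
  obtain W g h where W: "zariski_open p q W" "c t0 \<in> W" "W \<subseteq> U" "g \<in> poly_funs p q" "h \<in> poly_funs p q"
    and gh: "\<And>B. B \<in> W \<Longrightarrow> h B \<noteq> 0 \<and> f B = g B / h B"
    using f c(2) unfolding regular_on_def by metis
  obtain e where e: "e \<in> poly_funs p q" "e (c t0) \<noteq> 0" "\<And>B. B \<in> carrier_mat p q \<Longrightarrow> e B \<noteq> 0 \<Longrightarrow> B \<in> W"
    using zariski_open_basic_nbhd[OF W(1,2)] by blast
  obtain E G H where E: "\<And>t. e (c t) = poly E t" and G: "\<And>t. g (c t) = poly G t" and H: "\<And>t. h (c t) = poly H t"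
    using poly_funs_curve[OF e(1) poly] poly_funs_curve[OF W(4) poly] poly_funs_curve[OF W(5) poly] by blast
  have "E \<noteq> 0" using e(2) E by auto
  then have fin: "finite {t. poly E t = 0}" by (rule poly_roots_finite)
  have cW: "c t \<in> W" if "poly E t \<noteq> 0" for t using that e(3) c(1) E by auto
  show "germ_at (\<lambda>t. f (c t)) t0"
    unfolding germ_at_def
  proof (intro exI conjI)
    show "poly H t0 \<noteq> 0" using gh W(2) H by metis
    have *: "f (c t) * poly H t = poly G t" if "c t \<in> W" for t
      using gh[OF that] by (simp add: G H)
    show "f (c t0) * poly H t0 = poly G t0" using * W(2) by blast
    show "finite {t. f (c t) * poly H t \<noteq> poly G t}"
      by (rule finite_subset[OF _ fin]) (use * cW in blast)
  qed
  show "finite {t. c t \<notin> U}" by (rule finite_subset[OF _ fin]) (use cW W(3) in blast)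
qed

text \<open>On the line from \<open>P\<close> to \<open>Q\<close> all but finitely many points lie
  in \<open>U\<close> and off the zeros of \<open>e\<close>, so \<open>f\<close> vanishes there; the
  germ at \<open>P\<close> then forces the value 0.\<close>

lemma regular_on_identity:
  fixes f :: "'k :: field_char_0 mat \<Rightarrow> 'k"
  assumes f: "regular_on p q U f" and U: "U \<subseteq> carrier_mat p q"
    and e: "e \<in> poly_funs p q" "Q \<in> carrier_mat p q" "e Q \<noteq> 0"
    and 0: "\<And>A. A \<in> U \<Longrightarrow> e A \<noteq> 0 \<Longrightarrow> f A = 0"
    and P: "P \<in> U"
  shows "f P = 0"
proof -
  have Pc: "P \<in> carrier_mat p q" using P U by auto
  obtain E where E: "\<And>t. e (line P Q t) = poly E t" using poly_funs_line[OF e(1) Pc] by blast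
  have "E \<noteq> 0" using E[of 1] e Pc by auto
  then have fin: "finite {t. poly E t = 0}" by (rule poly_roots_finite)
  have P0: "line P Q 0 \<in> U" using P Pc e(2) by simp
  note germ = regular_on_germ[OF f line_carrier[OF Pc] P0 line_poly[OF Pc]]
  have "f (line P Q 0) = 0"
  proof (rule germ_at_zero[OF germ(1)])
    show "finite {t. f (line P Q t) \<noteq> 0}"
      by (rule finite_subset[OF _ finite_UnI[OF germ(2) fin]]) (use 0 E in auto)
  qed
  then show ?thesis using Pc e(2) by simp
qed

lemma regular_on_const: "zariski_open p q U \<Longrightarrow> regular_on p q U (\<lambda>A. c)"
  unfolding regular_on_def
  by (intro ballI exI[of _ U] exI[of _ "\<lambda>A. c"] exI[of _ "\<lambda>A. 1"]) (auto intro: poly_funs.const)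

lemma regular_on_poly: "zariski_open p q U \<Longrightarrow> f \<in> poly_funs p q \<Longrightarrow> regular_on p q U f"
  unfolding regular_on_def
  by (intro ballI exI[of _ U] exI[of _ f] exI[of _ "\<lambda>A. 1"]) (auto intro: poly_funs.const)

lemma regular_on_cong:
  assumes "regular_on p q U f" "\<And>A. A \<in> U \<Longrightarrow> f A = g A"
  shows "regular_on p q U g"
  unfolding regular_on_def
proof
  fix A assume "A \<in> U"
  then obtain W g' h where W: "zariski_open p q W" "A \<in> W" "W \<subseteq> U" "g' \<in> poly_funs p q" "h \<in> poly_funs p q"
    "\<forall>B\<in>W. h B \<noteq> 0 \<and> f B = g' B / h B"
    using assms(1) unfolding regular_on_def by metis
  have "\<forall>B\<in>W. h B \<noteq> 0 \<and> g B = g' B / h B" using W(3,6) assms(2) by (metis subsetD)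
  with W(1-5) show "\<exists>W g' h. zariski_open p q W \<and> A \<in> W \<and> W \<subseteq> U \<and> g' \<in> poly_funs p q \<and> h \<in> poly_funs p q \<and>
     (\<forall>B\<in>W. h B \<noteq> 0 \<and> g B = g' B / h B)"
    by blast
qed

lemma regular_on_binop:
  assumes f: "regular_on p q U f" and g: "regular_on p q U g"
    and op: "\<And>a b c d :: 'k :: field. b \<noteq> 0 \<Longrightarrow> d \<noteq> 0 \<Longrightarrow> op (a / b) (c / d) = num a b c d / (b * d)"
    and num: "\<And>a b c d. a \<in> poly_funs p q \<Longrightarrow> b \<in> poly_funs p q \<Longrightarrow> c \<in> poly_funs p q \<Longrightarrow> d \<in> poly_funs p q
       \<Longrightarrow> (\<lambda>A. num (a A) (b A) (c A) (d A)) \<in> poly_funs p q"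
  shows "regular_on p q U (\<lambda>A. op (f A) (g A))"
  unfolding regular_on_def
proof
  fix A assume A: "A \<in> U"
  obtain W a b where W: "zariski_open p q W" "A \<in> W" "W \<subseteq> U" "a \<in> poly_funs p q" "b \<in> poly_funs p q"
    "\<And>B. B \<in> W \<Longrightarrow> b B \<noteq> 0 \<and> f B = a B / b B"
    using f A unfolding regular_on_def by metis
  obtain V c d where V: "zariski_open p q V" "A \<in> V" "V \<subseteq> U" "c \<in> poly_funs p q" "d \<in> poly_funs p q"
    "\<And>B. B \<in> V \<Longrightarrow> d B \<noteq> 0 \<and> g B = c B / d B"
    using g A unfolding regular_on_def by metis
  show "\<exists>W g' h. zariski_open p q W \<and> A \<in> W \<and> W \<subseteq> U \<and> g' \<in> poly_funs p q \<and> h \<in> poly_funs p q \<and>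
     (\<forall>B\<in>W. h B \<noteq> 0 \<and> op (f B) (g B) = g' B / h B)"
  proof (intro exI conjI ballI)
    show "zariski_open p q (W \<inter> V)" by (rule zariski_open_Int[OF W(1) V(1)])
    show "(\<lambda>A. num (a A) (b A) (c A) (d A)) \<in> poly_funs p q" using num W V by blast
    show "(\<lambda>A. b A * d A) \<in> poly_funs p q" using W V by (auto intro: poly_funs.mult)
    fix B assume B: "B \<in> W \<inter> V"
    show "b B * d B \<noteq> 0" using B W(6) V(6) by auto
    show "op (f B) (g B) = num (a B) (b B) (c B) (d B) / (b B * d B)"
      using B W(6)[of B] V(6)[of B] op by auto
  qed (use W V in auto)
qed

lemma regular_on_add:
  "regular_on p q U f \<Longrightarrow> regular_on p q U g \<Longrightarrow> regular_on p q U (\<lambda>A. f A + g A)"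
  by (rule regular_on_binop[where num = "\<lambda>a b c d. a * d + c * b"])
     (auto intro!: poly_funs.intros simp: field_simps)

lemma regular_on_mult:
  "regular_on p q U f \<Longrightarrow> regular_on p q U g \<Longrightarrow> regular_on p q U (\<lambda>A. f A * g A)"
  by (rule regular_on_binop[where num = "\<lambda>a b c d. a * c"]) (auto intro!: poly_funs.intros)

lemma regular_on_sum:
  assumes "zariski_open p q U" "\<And>i. i \<in> S \<Longrightarrow> regular_on p q U (f i)"
  shows "regular_on p q U (\<lambda>A. \<Sum>i\<in>S. f i A)"
  using assms(2)
  by (induction S rule: infinite_finite_induct) (auto intro: regular_on_add regular_on_const[OF assms(1)])

lemma regular_on_prod:
  assumes "zariski_open p q U" "\<And>i. i \<in> S \<Longrightarrow> regular_on p q U (f i)"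
  shows "regular_on p q U (\<lambda>A. \<Prod>i\<in>S. f i A)"
  using assms(2)
  by (induction S rule: infinite_finite_induct) (auto intro: regular_on_mult regular_on_const[OF assms(1)])

lemma regular_on_inverse:
  assumes f: "regular_on p q U f" and nz: "\<And>A. A \<in> U \<Longrightarrow> f A \<noteq> 0"
  shows "regular_on p q U (\<lambda>A. 1 / f A)"
  unfolding regular_on_def
proof
  fix A assume A: "A \<in> U"
  obtain W a b where W: "zariski_open p q W" "A \<in> W" "W \<subseteq> U" "a \<in> poly_funs p q" "b \<in> poly_funs p q"
    "\<And>B. B \<in> W \<Longrightarrow> b B \<noteq> 0 \<and> f B = a B / b B"
    using f A unfolding regular_on_def by metis
  show "\<exists>W g' h. zariski_open p q W \<and> A \<in> W \<and> W \<subseteq> U \<and> g' \<in> poly_funs p q \<and> h \<in> poly_funs p q \<and>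
     (\<forall>B\<in>W. h B \<noteq> 0 \<and> 1 / f B = g' B / h B)"
  proof (intro exI conjI ballI)
    fix B assume B: "B \<in> W"
    show "a B \<noteq> 0" using W(6)[OF B] nz[of B] B W(3) by auto
    show "1 / f B = b B / a B" using W(6)[OF B] by simp
  qed (use W in auto)
qed

lemma regular_on_subset:
  assumes f: "regular_on p q U f" and V: "zariski_open p q V" "V \<subseteq> U"
  shows "regular_on p q V f"
  unfolding regular_on_def
proof
  fix A assume A: "A \<in> V"
  then have "A \<in> U" using V(2) by auto
  then obtain W a b where W: "zariski_open p q W" "A \<in> W" "W \<subseteq> U" "a \<in> poly_funs p q" "b \<in> poly_funs p q"
    "\<And>B. B \<in> W \<Longrightarrow> b B \<noteq> 0 \<and> f B = a B / b B"
    using f unfolding regular_on_def by metis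
  then show "\<exists>W g' h. zariski_open p q W \<and> A \<in> W \<and> W \<subseteq> V \<and> g' \<in> poly_funs p q \<and> h \<in> poly_funs p q \<and>
     (\<forall>B\<in>W. h B \<noteq> 0 \<and> f B = g' B / h B)"
    using A V(1) by (intro exI[of _ "W \<inter> V"] exI[of _ a] exI[of _ b]) (auto intro: zariski_open_Int)
qed

lemma regular_on_local:
  assumes "\<And>A. A \<in> U \<Longrightarrow> \<exists>V. A \<in> V \<and> V \<subseteq> U \<and> regular_on p q V f"
  shows "regular_on p q U f"
  unfolding regular_on_def
proof
  fix A assume "A \<in> U"
  then obtain V where V: "A \<in> V" "V \<subseteq> U" "regular_on p q V f" using assms by blast
  then obtain W a b where W: "zariski_open p q W" "A \<in> W" "W \<subseteq> V" "a \<in> poly_funs p q" "b \<in> poly_funs p q"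
    "\<forall>B\<in>W. b B \<noteq> 0 \<and> f B = a B / b B"
    unfolding regular_on_def by metis
  then show "\<exists>W g' h. zariski_open p q W \<and> A \<in> W \<and> W \<subseteq> U \<and> g' \<in> poly_funs p q \<and> h \<in> poly_funs p q \<and>
     (\<forall>B\<in>W. h B \<noteq> 0 \<and> f B = g' B / h B)"
    using V(2) by (intro exI[of _ W] exI[of _ a] exI[of _ b]) auto
qed

lemma regular_on_compose:
  assumes f: "regular_on p q U f" and V: "zariski_open p' q' V"
    and \<Phi>: "\<And>A. A \<in> V \<Longrightarrow> \<Phi> A \<in> U"
    and poly: "\<And>i j. i < p \<Longrightarrow> j < q \<Longrightarrow> (\<lambda>A. \<Phi> A $$ (i, j)) \<in> poly_funs p' q'"
    and U: "U \<subseteq> carrier_mat p q"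
  shows "regular_on p' q' V (\<lambda>A. f (\<Phi> A))"
  unfolding regular_on_def
proof
  fix A assume A: "A \<in> V"
  obtain W a b where W: "zariski_open p q W" "\<Phi> A \<in> W" "W \<subseteq> U" "a \<in> poly_funs p q" "b \<in> poly_funs p q"
    "\<And>B. B \<in> W \<Longrightarrow> b B \<noteq> 0 \<and> f B = a B / b B"
    using f \<Phi>[OF A] unfolding regular_on_def by metis
  obtain e where e: "e \<in> poly_funs p q" "e (\<Phi> A) \<noteq> 0" "\<And>B. B \<in> carrier_mat p q \<Longrightarrow> e B \<noteq> 0 \<Longrightarrow> B \<in> W"
    using zariski_open_basic_nbhd[OF W(1,2)] by blast
  let ?W = "V \<inter> {A \<in> carrier_mat p' q'. e (\<Phi> A) \<noteq> 0}"
  show "\<exists>W g' h. zariski_open p' q' W \<and> A \<in> W \<and> W \<subseteq> V \<and> g' \<in> poly_funs p' q' \<and> h \<in> poly_funs p' q' \<and>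
     (\<forall>B\<in>W. h B \<noteq> 0 \<and> f (\<Phi> B) = g' B / h B)"
  proof (intro exI conjI ballI)
    show "zariski_open p' q' ?W"
      by (intro zariski_open_Int V zariski_open_basic poly_funs_compose[OF e(1)] poly)
    show "A \<in> ?W" using A e(2) zariski_open_carrier[OF V] by auto
    show "(\<lambda>A. a (\<Phi> A)) \<in> poly_funs p' q'" "(\<lambda>A. b (\<Phi> A)) \<in> poly_funs p' q'"
      by (intro poly_funs_compose[OF W(4)] poly_funs_compose[OF W(5)] poly; assumption)+
    fix B assume "B \<in> ?W"
    then have "\<Phi> B \<in> W" using e(3) \<Phi> U by auto
    then show "b (\<Phi> B) \<noteq> 0" "f (\<Phi> B) = a (\<Phi> B) / b (\<Phi> B)" using W(6) by auto
  qed auto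
qed

lemma regular_on_det:
  assumes U: "zariski_open p q U"
    and M: "\<And>A. A \<in> U \<Longrightarrow> M A \<in> carrier_mat m m"
    and reg: "\<And>i j. i < m \<Longrightarrow> j < m \<Longrightarrow> regular_on p q U (\<lambda>A. M A $$ (i, j))"
  shows "regular_on p q U (\<lambda>A. det (M A))"
proof (rule regular_on_cong)
  show "regular_on p q U (\<lambda>A. \<Sum>\<pi>\<in>{\<pi>. \<pi> permutes {0..<m}}. signof \<pi> * (\<Prod>i\<in>{0..<m}. M A $$ (i, \<pi> i)))"
    by (intro regular_on_sum[OF U] regular_on_mult regular_on_const[OF U] regular_on_prod[OF U] reg)
       (auto simp: permutes_in_image)
qed (use det_def'[OF M] in auto)

text \<open>Cramer's rule writes each coordinate of the solution as a quotient of two determinants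
  with regular entries.\<close>

lemma regular_on_solution:
  assumes U: "zariski_open p q U"
    and M: "\<And>A. A \<in> U \<Longrightarrow> M A \<in> carrier_mat m m" "\<And>A. A \<in> U \<Longrightarrow> det (M A) \<noteq> 0"
    and reg: "\<And>i j. i < m \<Longrightarrow> j < m \<Longrightarrow> regular_on p q U (\<lambda>A. M A $$ (i, j))"
    and x: "\<And>A. A \<in> U \<Longrightarrow> x A \<in> carrier_vec m"
    and y: "\<And>i. i < m \<Longrightarrow> regular_on p q U (\<lambda>A. (M A *\<^sub>v x A) $ i)"
    and k: "k < m"
  shows "regular_on p q U (\<lambda>A. x A $ k)"
proof -
  let ?R = "\<lambda>A. replace_col (M A) (M A *\<^sub>v x A) k"
  have "regular_on p q U (\<lambda>A. det (?R A))"
  proof (rule regular_on_det[OF U])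
    show "?R A \<in> carrier_mat m m" if "A \<in> U" for A using M(1)[OF that] by (auto simp: replace_col_def)
    fix i j assume ij: "i < m" "j < m"
    show "regular_on p q U (\<lambda>A. ?R A $$ (i, j))"
    proof (cases "j = k")
      case True
      show ?thesis
      proof (rule regular_on_cong[OF y[OF ij(1)]])
        fix A assume "A \<in> U"
        from M(1)[OF this] show "(M A *\<^sub>v x A) $ i = ?R A $$ (i, j)" using ij True by (simp add: replace_col_def)
      qed
    next
      case False
      show ?thesis
      proof (rule regular_on_cong[OF reg[OF ij]])
        fix A assume "A \<in> U"
        from M(1)[OF this] show "M A $$ (i, j) = ?R A $$ (i, j)" using ij False by (simp add: replace_col_def)
      qed
    qed
  qed
  then have "regular_on p q U (\<lambda>A. 1 / det (M A) * det (?R A))"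
    by (intro regular_on_mult regular_on_inverse regular_on_det[OF U M(1) reg] M(2))
  then show ?thesis
  proof (rule regular_on_cong)
    fix A assume A: "A \<in> U"
    show "1 / det (M A) * det (?R A) = x A $ k"
      using cramer_lemma_mat[OF M(1)[OF A] x[OF A] k] M(2)[OF A] by simp
  qed
qed

section \<open>The general linear group\<close>

lemma GL_iff: "(g :: 'k :: field mat) \<in> GL r \<longleftrightarrow> g \<in> carrier_mat r r \<and> det g \<noteq> 0"
proof
  assume g: "g \<in> GL r"
  then obtain h where "g \<in> carrier_mat r r" "inverts_mat g h" "inverts_mat h g"
    by (auto simp: GL_def invertible_mat_def)
  moreover from this have "h \<in> carrier_mat r r"
    unfolding inverts_mat_def by (metis carrier_matD carrier_matI index_mult_mat index_one_mat(2,3))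
  ultimately have "det g * det h = 1"
    using det_mult[of g r h] unfolding inverts_mat_def by simp
  then show "g \<in> carrier_mat r r \<and> det g \<noteq> 0" using \<open>g \<in> carrier_mat r r\<close> by auto
next
  assume g: "g \<in> carrier_mat r r \<and> det g \<noteq> 0"
  let ?h = "(1 / det g) \<cdot>\<^sub>m adj_mat g"
  have a: "adj_mat g \<in> carrier_mat r r" "g * adj_mat g = det g \<cdot>\<^sub>m 1\<^sub>m r" "adj_mat g * g = det g \<cdot>\<^sub>m 1\<^sub>m r"
    using adj_mat[of g r] g by auto
  have "(1 / det g) \<cdot>\<^sub>m (det g \<cdot>\<^sub>m 1\<^sub>m r) = 1\<^sub>m r" by (rule eq_matI) (use g in auto)
  then have "g * ?h = 1\<^sub>m r" "?h * g = 1\<^sub>m r"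
    using g a by (simp_all add: mult_smult_distrib[of g r r _ r] mult_smult_assoc_mat[of _ r r g r])
  then show "g \<in> GL r" using g a(1)
    unfolding GL_def invertible_mat_def inverts_mat_def by auto
qed

text \<open>The leading principal minor of size \<open>r\<close>. It reads a corner of a possibly
  larger matrix, so it is also polynomial on non-square ones.\<close>

definition dets :: "nat \<Rightarrow> 'k :: field mat \<Rightarrow> 'k" where
  "dets r A = det (mat r r (\<lambda>(i, j). A $$ (i, j)))"

lemma dets_poly_funs: "k \<le> p \<Longrightarrow> k \<le> q \<Longrightarrow> dets k \<in> poly_funs p q"
  unfolding dets_def[abs_def] by (rule poly_funs_det[where m = k]) (auto intro: poly_funs.coord)

lemma dets_eq_det: "A \<in> carrier_mat r r \<Longrightarrow> dets r A = det A"
  unfolding dets_def by (rule arg_cong[of _ _ det]) auto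

lemma GL_zariski_open: "zariski_open r r (GL r :: 'k :: field mat set)"
proof -
  have "(GL r :: 'k mat set) = {A \<in> carrier_mat r r. dets r A \<noteq> 0}"
    by (auto simp: GL_iff dets_eq_det)
  then show ?thesis using zariski_open_basic[OF dets_poly_funs[of r r r]] by simp
qed

lemma GL_carrier: "g \<in> GL r \<Longrightarrow> g \<in> carrier_mat r r"
  by (simp add: GL_def)

lemma GL_inverse:
  assumes "(g :: 'k :: field mat) \<in> GL r"
  obtains h where "h \<in> GL r" "g * h = 1\<^sub>m r" "h * g = 1\<^sub>m r"
proof -
  obtain h where h: "g \<in> carrier_mat r r" "inverts_mat g h" "inverts_mat h g"
    using assms by (auto simp: GL_def invertible_mat_def)
  then have "h \<in> carrier_mat r r"
    unfolding inverts_mat_def by (metis carrier_matD carrier_matI index_mult_mat(2,3) index_one_mat(2,3))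
  then show ?thesis using that[of h] h unfolding GL_def invertible_mat_def inverts_mat_def by auto
qed

lemma GL_one [simp]: "(1\<^sub>m r :: 'k :: field mat) \<in> GL r"
  by (simp add: GL_iff)

lemma GL_mult: "(g :: 'k :: field mat) \<in> GL r \<Longrightarrow> h \<in> GL r \<Longrightarrow> g * h \<in> GL r"
  by (auto simp: GL_iff det_mult)

lemma GL_transpose: "(g :: 'k :: field mat) \<in> GL r \<Longrightarrow> transpose_mat g \<in> GL r"
  by (auto simp: GL_iff det_transpose)

lemma GL_I: "g \<in> carrier_mat r r \<Longrightarrow> h \<in> carrier_mat r r \<Longrightarrow> g * h = 1\<^sub>m r \<Longrightarrow> (g :: 'k :: field mat) \<in> GL r"
  using det_mult[of g r h] by (auto simp: GL_iff)

section \<open>Triangular matrices\<close>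

definition lower_unitri :: "nat \<Rightarrow> 'k :: field mat \<Rightarrow> bool" where
  "lower_unitri r L \<longleftrightarrow> L \<in> carrier_mat r r \<and> (\<forall>i<r. \<forall>j<r. i < j \<longrightarrow> L $$ (i, j) = 0) \<and> (\<forall>i<r. L $$ (i, i) = 1)"

lemma lower_unitri_det: "lower_unitri r L \<Longrightarrow> det L = 1"
proof -
  assume L: "lower_unitri r L"
  then have c: "L \<in> carrier_mat r r" and z: "\<And>i j. i < j \<Longrightarrow> j < r \<Longrightarrow> L $$ (i, j) = 0"
    by (auto simp: lower_unitri_def)
  have "det L = prod_list (diag_mat L)" by (rule det_lower_triangular[OF _ c]) (use z in auto)
  also have "\<dots> = (\<Prod>i<r. L $$ (i, i))"
    using c by (simp add: diag_mat_def prod.distinct_set_conv_list[symmetric] atLeast0LessThan)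
  finally show ?thesis using L by (simp add: lower_unitri_def)
qed

lemma lower_unitri_GL: "lower_unitri r L \<Longrightarrow> L \<in> GL r"
  using lower_unitri_det[of r L] by (simp add: GL_iff lower_unitri_def)

lemma lower_unitri_inverse:
  assumes N: "lower_unitri r N" and L: "L \<in> carrier_mat r r" and NL: "N * L = 1\<^sub>m r"
  shows "lower_unitri r L"
proof -
  have Nc: "N \<in> carrier_mat r r" using N by (simp add: lower_unitri_def)
  have *: "L $$ (i, j) = (if i = j then 1 else 0)" if "i < r" "j < r" "i \<le> j" for i j
    using that
  proof (induction i rule: less_induct)
    case (less i)
    have "i < r" using less.prems by simp
    then have "(N * L) $$ (i, j) = (\<Sum>k<r. N $$ (i, k) * L $$ (k, j))"
      using less.prems(2) Nc L by (simp add: scalar_prod_def atLeast0LessThan)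
    also have "\<dots> = (\<Sum>k<r. if k = i then L $$ (i, j) else 0)"
    proof (rule sum.cong[OF refl])
      fix k assume "k \<in> {..<r}"
      then consider "k < i" | "k = i" | "i < k" "k < r" by fastforce
      then show "N $$ (i, k) * L $$ (k, j) = (if k = i then L $$ (i, j) else 0)"
      proof cases
        case 1
        then have "L $$ (k, j) = 0" using less.IH[of k] less.prems by simp
        then show ?thesis using 1 by simp
      qed (use N less.prems in \<open>auto simp: lower_unitri_def\<close>)
    qed
    finally show ?case using less.prems NL by simp
  qed
  show ?thesis unfolding lower_unitri_def using L * by auto
qed

text \<open>The nonvanishing of all leading principal minors cuts out the open cell of matrices with
  a factorization into a lower unitriangular and an upper triangular matrix.\<close>

definition big_cell :: "nat \<Rightarrow> 'k :: field mat \<Rightarrow> 'k" where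
  "big_cell r g = (\<Prod>k\<le>r. dets k g)"

lemma big_cell_poly_funs: "big_cell r \<in> poly_funs r r"
  unfolding big_cell_def[abs_def] by (intro poly_funs_prod dets_poly_funs) auto

lemma big_cell_one: "big_cell r (1\<^sub>m r) = (1 :: 'k :: field)"
proof -
  have "dets k (1\<^sub>m r) = (1 :: 'k)" if "k \<le> r" for k
  proof -
    have "mat k k (\<lambda>(i, j). 1\<^sub>m r $$ (i, j)) = (1\<^sub>m k :: 'k mat)" by (rule eq_matI) (use that in auto)
    then show ?thesis unfolding dets_def by (simp only: det_one)
  qed
  then show ?thesis unfolding big_cell_def by (intro prod.neutral) auto
qed

text \<open>Gaussian elimination without pivoting: the combination of the rows above row
  \<open>i\<close> that cancels its entries left of the diagonal solves a system whose matrix is the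
  transposed leading block of size \<open>i\<close>, invertible by assumption. These combinations
  form \<open>N\<close>, and \<open>N * g\<close> is upper triangular.\<close>

lemma big_cell_decomp:
  fixes g :: "'k :: field mat"
  assumes g: "g \<in> carrier_mat r r" and nz: "big_cell r g \<noteq> 0"
  obtains L U where "lower_unitri r L" "U \<in> GL r" "upper_triangular U" "g = L * U" "g \<in> GL r"
proof -
  have lead: "dets i g \<noteq> 0" if "i \<le> r" for i using nz that by (auto simp: big_cell_def)
  have gGL: "g \<in> GL r" using lead[of r] dets_eq_det[OF g] g by (simp add: GL_iff)
  have "\<exists>x. x \<in> carrier_vec i \<and> (\<forall>c<i. (\<Sum>j<i. x $ j * g $$ (j, c)) = - g $$ (i, c))" if i: "i < r" for i
  proof -
    let ?G = "mat i i (\<lambda>(a, b). g $$ (a, b))"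
    have "transpose_mat ?G \<in> GL i"
      using lead[of i] i by (intro GL_transpose) (simp add: GL_iff dets_def)
    then obtain H where H: "H \<in> GL i" "transpose_mat ?G * H = 1\<^sub>m i" using GL_inverse by blast
    let ?b = "vec i (\<lambda>c. - g $$ (i, c))"
    define x where "x = H *\<^sub>v ?b"
    have x: "x \<in> carrier_vec i" using GL_carrier[OF H(1)] by (auto simp: x_def)
    have "transpose_mat ?G *\<^sub>v x = (transpose_mat ?G * H) *\<^sub>v ?b"
      unfolding x_def using GL_carrier[OF H(1)] by (intro assoc_mult_mat_vec[symmetric, of _ i i _ i]) auto
    then have e: "transpose_mat ?G *\<^sub>v x = ?b" using H(2) by simp
    have "(\<Sum>j<i. x $ j * g $$ (j, c)) = - g $$ (i, c)" if c: "c < i" for c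
    proof -
      have "(transpose_mat ?G *\<^sub>v x) $ c = (\<Sum>j<i. g $$ (j, c) * x $ j)"
        using c x by (simp add: scalar_prod_def atLeast0LessThan)
      then show ?thesis using arg_cong[OF e, of "\<lambda>v. v $ c"] c by (simp add: mult.commute)
    qed
    then show ?thesis using x by blast
  qed
  then obtain x where x: "\<And>i c. i < r \<Longrightarrow> c < i \<Longrightarrow> (\<Sum>j<i. x i $ j * g $$ (j, c)) = - g $$ (i, c)"
    by metis
  define N where "N = mat r r (\<lambda>(i, j). if j < i then x i $ j else if j = i then 1 else 0)"
  have N: "lower_unitri r N" by (auto simp: lower_unitri_def N_def)
  then have Nc: "N \<in> carrier_mat r r" by (simp add: lower_unitri_def)
  have up: "(N * g) $$ (i, c) = 0" if "i < r" "c < i" for i c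
  proof -
    have "(N * g) $$ (i, c) = (\<Sum>j<r. N $$ (i, j) * g $$ (j, c))"
      using that Nc g by (simp add: scalar_prod_def atLeast0LessThan)
    also have "\<dots> = (\<Sum>j<Suc i. N $$ (i, j) * g $$ (j, c))"
      by (rule sum.mono_neutral_right) (use that in \<open>auto simp: N_def\<close>)
    also have "\<dots> = (\<Sum>j<i. x i $ j * g $$ (j, c)) + g $$ (i, c)"
      using that by (simp add: N_def)
    finally show ?thesis using x[OF that] by simp
  qed
  obtain L where L: "L \<in> GL r" "N * L = 1\<^sub>m r" "L * N = 1\<^sub>m r" using GL_inverse[OF lower_unitri_GL[OF N]] by blast
  have Lc: "L \<in> carrier_mat r r" by (rule GL_carrier[OF L(1)])
  show ?thesis
  proof (rule that[of L "N * g"])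
    show "lower_unitri r L" by (rule lower_unitri_inverse[OF N Lc L(2)])
    show "N * g \<in> GL r" by (rule GL_mult[OF lower_unitri_GL[OF N] gGL])
    show "upper_triangular (N * g)" using up Nc g by (auto simp: upper_triangular_def)
    show "g = L * (N * g)" using L(3) Lc Nc g by (simp add: assoc_mult_mat[symmetric, of L r r N r g r])
    show "g \<in> GL r" by (rule gGL)
  qed
qed

lemma poly_bounded_sum:
  "(\<And>i. i \<in> S \<Longrightarrow> \<exists>P. degree P \<le> m \<and> (\<forall>s. f i s = poly P s))
    \<Longrightarrow> \<exists>P. degree P \<le> m \<and> (\<forall>s. (\<Sum>i\<in>S. f i s) = poly P s)"
proof (induction S rule: infinite_finite_induct)
  case (insert x F)
  obtain P where "degree P \<le> m" "\<forall>s. f x s = poly P s" using insert.prems by blast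
  moreover obtain Q where "degree Q \<le> m" "\<forall>s. (\<Sum>i\<in>F. f i s) = poly Q s" using insert by blast
  ultimately show ?case using insert.hyps by (intro exI[of _ "P + Q"]) (auto intro: degree_add_le)
qed (auto intro: exI[of _ 0])

lemma poly_bounded_scale:
  "\<exists>P. degree P \<le> m \<and> (\<forall>s. f s = poly P s) \<Longrightarrow> \<exists>P. degree P \<le> m \<and> (\<forall>s. c * f s = poly P s)"
proof -
  assume "\<exists>P. degree P \<le> m \<and> (\<forall>s. f s = poly P s)"
  then obtain P where "degree P \<le> m" "\<forall>s. f s = poly P s" by blast
  then show ?thesis by (intro exI[of _ "[:c:] * P"]) (auto intro: order.trans[OF Polynomial.degree_smult_le])
qed

text \<open>Boxes are bare numbers carrying a row and a column, so that the diagrams of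
  \<open>lam\<close>, \<open>mu/lam\<close> and \<open>mu\<close> can be sets of numbers with common
  maps \<open>rw\<close> and \<open>cl\<close>.\<close>

locale boxes =
  fixes r :: nat and B :: "nat set" and rw :: "nat \<Rightarrow> nat" and cl :: "nat \<Rightarrow> int"
  assumes fin: "finite B"
    and rw_less: "k \<in> B \<Longrightarrow> rw k < r"
    and box_inj: "k \<in> B \<Longrightarrow> k' \<in> B \<Longrightarrow> rw k = rw k' \<Longrightarrow> cl k = cl k' \<Longrightarrow> k = k'"
begin

text \<open>The superstandard filling, in which every box carries its own row number.\<close>

definition eB :: "nat \<Rightarrow> nat" where "eB = restrict rw B"

definition col_inj :: "(nat \<Rightarrow> nat) \<Rightarrow> bool" where
  "col_inj I \<longleftrightarrow> (\<forall>k\<in>B. \<forall>k'\<in>B. k \<noteq> k' \<longrightarrow> cl k = cl k' \<longrightarrow> I k \<noteq> I k')"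

lemma eB_idx: "eB \<in> idx r B"
  using rw_less by (auto simp: eB_def idx_def)

lemma pfun_tmul: "A \<in> carrier_mat r n \<Longrightarrow> pfun B rw n y A = tmul B A y eB"
  using eB_idx by (auto simp: pfun_def tmul_def eB_def intro!: sum.cong)

lemma pfun_mult:
  assumes "A \<in> carrier_mat r q" "C \<in> carrier_mat q n"
  shows "pfun B rw n y (A * C) = pfun B rw q (tmul B C y) A"
  using assms pfun_tmul[of "A * C" n y] pfun_tmul[of A q] by (simp add: tmul_mult[OF fin assms])

lemma csym_zero: "\<not> col_inj I \<Longrightarrow> csym B cl y I = (0 :: 'k :: field_char_0)"
  unfolding col_inj_def using csym_repeated[OF fin] by blast

lemma col_inj_comp:
  assumes "\<sigma> \<in> fib_perms B cl" "col_inj I"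
  shows "col_inj (I \<circ> \<sigma>)"
  unfolding col_inj_def
proof (intro ballI impI)
  fix k k' assume k: "k \<in> B" "k' \<in> B" "k \<noteq> k'" "cl k = cl k'"
  note p = fib_perms_permutes[OF assms(1)]
  have "\<sigma> k \<in> B" "\<sigma> k' \<in> B" using permutes_in_image[OF p] k by auto
  moreover have "\<sigma> k \<noteq> \<sigma> k'" using permutes_inj[OF p] k(3) by (metis injD)
  moreover have "cl (\<sigma> k) = cl (\<sigma> k')" using assms(1) k by (auto simp: fib_perms_def)
  ultimately show "(I \<circ> \<sigma>) k \<noteq> (I \<circ> \<sigma>) k'" using assms(2) by (auto simp: col_inj_def)
qed

text \<open>The one-parameter group of a simple lowering operator: multiplication from the left adds
  \<open>s\<close> times row \<open>i\<close> to row \<open>Suc i\<close>.\<close>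

definition lowmat :: "nat \<Rightarrow> 'k :: field \<Rightarrow> 'k mat" where
  "lowmat i s = mat r r (\<lambda>(a, b). if a = b then 1 else if a = Suc i \<and> b = i then s else 0)"

end

section \<open>The highest weight vector of a straight shape\<close>

locale straight = boxes +
  assumes above: "k \<in> B \<Longrightarrow> i < rw k \<Longrightarrow> \<exists>k'\<in>B. rw k' = i \<and> cl k' = cl k"
begin

definition erow :: "(nat \<Rightarrow> nat) \<Rightarrow> 'k :: field" where "erow I = (if I = eB then 1 else 0)"

text \<open>The highest weight vector in its tensor model: the antisymmetrization of the basis
  tensor of the superstandard filling.\<close>

definition y0 :: "(nat \<Rightarrow> nat) \<Rightarrow> 'k :: field" where "y0 = csym B cl erow"

definition wt :: "'k :: field mat \<Rightarrow> 'k" where "wt A = (\<Prod>k\<in>B. A $$ (rw k, rw k))"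

text \<open>A product of leading principal minors, one for each column of the diagram and of the
  size of that column. It will be the matrix coefficient of the highest weight vector and the
  functional \<open>\<omega>\<close>.\<close>

definition \<Delta> :: "'k :: field mat \<Rightarrow> 'k" where "\<Delta> = pfun B rw r y0"

text \<open>Going down a column, a value below the row number of its box is already taken by the box
  of the same column in the row with that number. So the superstandard filling is the only
  column-injective one bounded by the row numbers, which is behind all triangularity statements
  below.\<close>

lemma col_inj_le_eq:
  assumes I: "I \<in> idx n B" and inj: "col_inj I" and le: "\<And>k. k \<in> B \<Longrightarrow> I k \<le> rw k"
  shows "I = eB"
proof (rule idx_eqI[OF I eB_idx])
  fix k assume "k \<in> B"
  then have "I k = rw k"
  proof (induction "rw k" arbitrary: k rule: less_induct)
    case less
    show ?case
    proof (rule ccontr)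
      assume "I k \<noteq> rw k"
      then have lt: "I k < rw k" using le[OF less.prems] by simp
      from above[OF less.prems lt] obtain k' where k': "k' \<in> B" "rw k' = I k" "cl k' = cl k" by blast
      then have "I k' = I k" using less.hyps[of k'] lt by simp
      then show False using inj k' lt less.prems unfolding col_inj_def by force
    qed
  qed
  then show "I k = eB k" using \<open>k \<in> B\<close> by (simp add: eB_def)
qed

lemma fib_eB_eq_id:
  assumes "\<sigma> \<in> fib_perms B cl" "eB \<circ> \<sigma> = eB"
  shows "\<sigma> = id"
proof
  fix k
  note p = fib_perms_permutes[OF assms(1)]
  show "\<sigma> k = id k"
  proof (cases "k \<in> B")
    case True
    then have "\<sigma> k \<in> B" using permutes_in_image[OF p] by simp
    moreover have "rw (\<sigma> k) = rw k" using fun_cong[OF assms(2), of k] True \<open>\<sigma> k \<in> B\<close> by (simp add: eB_def)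
    moreover have "cl (\<sigma> k) = cl k" using assms(1) True by (auto simp: fib_perms_def)
    ultimately show ?thesis using box_inj[of "\<sigma> k" k] True by simp
  next
    case False
    then show ?thesis using permutes_not_in[OF p] by simp
  qed
qed

lemma y0_eB: "y0 eB = 1"
proof -
  have "(\<Sum>\<sigma>\<in>fib_perms B cl. of_int (sign \<sigma>) * erow (eB \<circ> \<sigma>)) = (\<Sum>\<sigma>\<in>fib_perms B cl. if \<sigma> = id then 1 else (0::'a))"
    by (intro sum.cong refl) (auto simp: erow_def sign_id dest: fib_eB_eq_id)
  then show ?thesis
    using id_fib_perms[of B cl] finite_fib_perms[OF fin, of cl] by (simp add: y0_def fsym_def)
qed

lemma y0_outside: "I \<notin> idx r B \<Longrightarrow> y0 I = 0"
proof -
  assume I: "I \<notin> idx r B"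
  have "erow (I \<circ> \<sigma>) = (0 :: 'a)" if "\<sigma> \<in> fib_perms B cl" for \<sigma>
    using idx_comp_iff[OF fib_perms_permutes[OF that], of I r] I eB_idx by (auto simp: erow_def)
  then show "y0 I = (0 :: 'a)" by (simp add: y0_def fsym_def)
qed

lemma tmul_erow: "A \<in> carrier_mat r r \<Longrightarrow> I \<in> idx r B \<Longrightarrow> tmul B A erow I = (\<Prod>k\<in>B. A $$ (I k, rw k))"
proof -
  assume A: "A \<in> carrier_mat r r" and I: "I \<in> idx r B"
  have "tmul B A erow I = (\<Sum>J\<in>idx r B. if J = eB then (\<Prod>k\<in>B. A $$ (I k, J k)) else 0)"
    using A I by (auto simp: tmul_def erow_def intro!: sum.cong)
  also have "\<dots> = (\<Prod>k\<in>B. A $$ (I k, eB k))" using eB_idx fin by simp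
  finally show ?thesis by (simp add: eB_def)
qed

lemma tmul_y0: "tmul B A y0 = csym B cl (tmul B A erow)"
  unfolding y0_def by (rule fsym_tmul[OF fin])

text \<open>\<open>eB\<close> is constant along rows, so \<open>erow\<close> is row-symmetric up to
  the order of the row group. This places \<open>y0\<close> in the image of \<open>csym\<close>
  after \<open>rsym\<close>.\<close>

lemma rsym_erow: "rsym B rw erow I = of_nat (card (fib_perms B rw)) * (erow I :: 'k :: field)"
proof -
  have "erow (I \<circ> \<sigma>) = (erow I :: 'k)" if s: "\<sigma> \<in> fib_perms B rw" for \<sigma>
  proof -
    note p = fib_perms_permutes[OF s]
    have e: "eB \<circ> \<tau> = eB" if t: "\<tau> \<in> fib_perms B rw" for \<tau>
    proof -
      have "eB \<circ> \<tau> \<in> idx r B" using idx_comp_iff[OF fib_perms_permutes[OF t]] eB_idx by blast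
      then show ?thesis
      proof (rule idx_eqI[OF _ eB_idx])
        show "(eB \<circ> \<tau>) k = eB k" if "k \<in> B" for k
          using t that permutes_in_image[OF fib_perms_permutes[OF t], of k] by (auto simp: eB_def fib_perms_def)
      qed
    qed
    have "I \<circ> \<sigma> = eB \<longleftrightarrow> I = eB"
    proof
      assume "I \<circ> \<sigma> = eB"
      then have "I \<circ> \<sigma> \<circ> pinv \<sigma> = eB" using e[OF fib_perms_inv[OF s]] by simp
      then show "I = eB" using permutes_inv_o(1)[OF p] by (simp add: comp_assoc)
    qed (use e[OF s] in simp)
    then show ?thesis by (simp add: erow_def)
  qed
  then show ?thesis by (simp add: fsym_def)
qed

text \<open>For a lower triangular \<open>L\<close> the product of entries is nonzero only if each
  value is at most the row number of its box, which leaves \<open>eB\<close> among the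
  column-injective fillings.\<close>

lemma pfun_lower:
  fixes z :: "(nat \<Rightarrow> nat) \<Rightarrow> 'k :: field"
  assumes L: "L \<in> carrier_mat r r" "\<And>i j. i < j \<Longrightarrow> j < r \<Longrightarrow> L $$ (i, j) = 0"
    and z: "\<And>I. I \<in> idx r B \<Longrightarrow> \<not> col_inj I \<Longrightarrow> z I = 0"
  shows "pfun B rw r z L = wt L * z eB"
proof -
  have "(\<Prod>k\<in>B. L $$ (rw k, J k)) * z J = (if J = eB then wt L * z eB else 0)" if J: "J \<in> idx r B" for J
  proof (cases "J = eB")
    case True
    then show ?thesis by (simp add: wt_def eB_def)
  next
    case False
    show ?thesis
    proof (cases "col_inj J")
      case inj: True
      then obtain k where "k \<in> B" "rw k < J k" using False col_inj_le_eq[OF J] by (meson not_le)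
      then have "L $$ (rw k, J k) = 0" using L(2) idx_less[OF J] by simp
      then have "(\<Prod>k\<in>B. L $$ (rw k, J k)) = 0" using \<open>k \<in> B\<close> fin by (intro prod_zero) auto
      then show ?thesis using False by simp
    qed (use z[OF J] False in simp)
  qed
  then show ?thesis using eB_idx fin by (simp add: pfun_def)
qed

lemma \<Delta>_lower:
  fixes L g :: "'k :: field_char_0 mat"
  assumes L: "L \<in> carrier_mat r r" "\<And>i j. i < j \<Longrightarrow> j < r \<Longrightarrow> L $$ (i, j) = 0" and g: "g \<in> carrier_mat r r"
  shows "\<Delta> (L * g) = wt L * \<Delta> g"
proof -
  have "\<Delta> (L * g) = pfun B rw r (tmul B g y0) L" unfolding \<Delta>_def by (rule pfun_mult[OF L(1) g])
  also have "\<dots> = wt L * tmul B g y0 eB"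
  proof (rule pfun_lower[OF L])
    fix I assume "\<not> col_inj I"
    then show "tmul B g y0 I = 0" unfolding tmul_y0 by (rule csym_zero)
  qed
  finally show ?thesis using pfun_tmul[OF g] by (simp add: \<Delta>_def)
qed

text \<open>An upper triangular matrix carries the superstandard filling only to fillings bounded by
  the row numbers, and antisymmetrization discards all of them but \<open>eB\<close> itself and its
  images under the column group.\<close>

lemma tmul_upper:
  fixes U :: "'k :: field_char_0 mat"
  assumes U: "U \<in> carrier_mat r r" "upper_triangular U"
  shows "tmul B U y0 = (\<lambda>I. wt U * y0 I)"
proof
  fix I
  show "tmul B U y0 I = wt U * y0 I"
  proof (cases "I \<in> idx r B")
    case False
    then show ?thesis using U by (simp add: tmul_outside y0_outside)
  next
    case I: True
    show ?thesis
    proof (cases "col_inj I")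
      case False
      then show ?thesis by (simp add: tmul_y0 csym_zero) (simp add: y0_def csym_zero)
    next
      case inj: True
      have "tmul B U erow J = wt U * erow J" if J: "J \<in> idx r B" "col_inj J" for J
      proof (cases "J = eB")
        case True
        then show ?thesis using tmul_erow[OF U(1) J(1)] by (simp add: wt_def erow_def eB_def)
      next
        case False
        then obtain k where "k \<in> B" "rw k < J k" using col_inj_le_eq[OF J] by (meson not_le)
        then have "U $$ (J k, rw k) = 0" using U idx_less[OF J(1)] by (auto simp: upper_triangular_def)
        then have "(\<Prod>k\<in>B. U $$ (J k, rw k)) = 0" using \<open>k \<in> B\<close> fin by (intro prod_zero) auto
        then show ?thesis using tmul_erow[OF U(1) J(1)] False by (simp add: erow_def)
      qed
      then have "csym B cl (tmul B U erow) I = csym B cl (\<lambda>I. wt U * erow I) I"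
        unfolding fsym_def
        by (intro sum.cong refl) (simp add: inj I col_inj_comp idx_comp_iff[OF fib_perms_permutes])
      then show ?thesis unfolding tmul_y0 by (simp add: fsym_scale y0_def)
    qed
  qed
qed

lemma \<Delta>_upper:
  fixes U g :: "'k :: field_char_0 mat"
  assumes "U \<in> carrier_mat r r" "upper_triangular U" "g \<in> carrier_mat r r"
  shows "\<Delta> (g * U) = wt U * \<Delta> g"
proof -
  have "\<Delta> (g * U) = pfun B rw r (tmul B U y0) g" unfolding \<Delta>_def by (rule pfun_mult[OF assms(3,1)])
  then show ?thesis unfolding tmul_upper[OF assms(1,2)] by (simp add: \<Delta>_def pfun_def sum_distrib_left mult_ac)
qed

lemma \<Delta>_one: "\<Delta> (1\<^sub>m r) = (1 :: 'a :: field)"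
proof -
  have "tmul B (1\<^sub>m r) y0 = (y0 :: (nat \<Rightarrow> nat) \<Rightarrow> 'a)" by (rule tmul_one[OF fin]) (rule y0_outside)
  then show ?thesis using pfun_tmul[of "1\<^sub>m r" r "y0 :: (nat \<Rightarrow> nat) \<Rightarrow> 'a"] y0_eB by (simp add: \<Delta>_def)
qed

lemma \<Delta>_poly_funs: "\<Delta> \<in> poly_funs r r"
  unfolding \<Delta>_def by (rule pfun_poly_funs[OF fin rw_less])

text \<open>Evaluation at \<open>eB\<close> is the pairing with \<open>erow\<close>;
  self-adjointness of the antisymmetrizer and the adjunction between \<open>g\<close> and its
  transpose then exchange the two sides. The symmetry is what the embedding of the dual module rests
  on.\<close>

lemma \<Delta>_transpose:
  assumes g: "g \<in> carrier_mat r r"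
  shows "\<Delta> (transpose_mat g) = (\<Delta> g :: 'k :: field)"
proof -
  have t: "transpose_mat g \<in> carrier_mat r r" using g by simp
  have e: "(\<Sum>I\<in>idx r B. erow I * h I) = h eB" for h :: "(nat \<Rightarrow> nat) \<Rightarrow> 'k"
  proof -
    have "(\<Sum>I\<in>idx r B. erow I * h I) = (\<Sum>I\<in>idx r B. if I = eB then h I else 0)"
      by (intro sum.cong refl) (simp add: erow_def)
    then show ?thesis using eB_idx fin by simp
  qed
  have "\<Delta> (transpose_mat g) = tmul B (transpose_mat g) y0 eB" using pfun_tmul[OF t] by (simp add: \<Delta>_def)
  also have "\<dots> = (\<Sum>I\<in>idx r B. erow I * csym B cl (tmul B (transpose_mat g) erow) I)" by (simp add: e tmul_y0)
  also have "\<dots> = (\<Sum>I\<in>idx r B. y0 I * tmul B (transpose_mat g) erow I)"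
    unfolding y0_def by (rule fsym_adjoint[OF fin perm_char_sign])
  also have "\<dots> = (\<Sum>I\<in>idx r B. tmul B g y0 I * erow I)"
    using tmul_adjoint[OF t, where B = B and x = y0 and y = erow] by simp
  also have "\<dots> = tmul B g y0 eB" using e[of "tmul B g y0"] by (simp add: mult.commute)
  finally show ?thesis using pfun_tmul[OF g] by (simp add: \<Delta>_def)
qed

lemma wt_lower_unitri: "lower_unitri r L \<Longrightarrow> wt L = 1"
  using rw_less by (simp add: wt_def lower_unitri_def)

text \<open>Vanishing on the dense set GL gives the zero polynomial, hence a zero row symmetrization
  of \<open>y\<close>; for a tensor of the form \<open>csym\<close> of \<open>rsym\<close> the
  kernel statement for the symmetrizers then gives \<open>y\<close> = 0.\<close>

lemma tensor_zero_criterion: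
  fixes y :: "(nat \<Rightarrow> nat) \<Rightarrow> 'k :: field_char_0"
  assumes y: "\<And>I. I \<in> idx r B \<Longrightarrow> y I = csym B cl (rsym B rw z) I"
    and out: "\<And>I. I \<notin> idx r B \<Longrightarrow> y I = 0"
    and 0: "\<And>g. g \<in> GL r \<Longrightarrow> pfun B rw r y g = 0"
  shows "y = (\<lambda>I. 0)"
proof
  fix I
  have p0: "pfun B rw r y A = 0" if "A \<in> carrier_mat r r" for A
  proof (rule poly_funs_dense[OF pfun_poly_funs[OF fin rw_less] dets_poly_funs[of r r r] one_carrier_mat _ _ that])
    show "dets r (1\<^sub>m r) \<noteq> (0 :: 'k)" by (simp add: dets_eq_det)
    show "pfun B rw r y A = 0" if "A \<in> carrier_mat r r" "dets r A \<noteq> 0" for A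
      using that 0 by (simp add: GL_iff dets_eq_det)
  qed simp_all
  have "rsym B rw y I = 0" if "I \<in> idx r B" for I
    by (rule pfun_zero_imp_rsym_zero[OF fin rw_less p0 that])
  then have "rsym B rw (csym B cl (rsym B rw z)) I = 0" if "I \<in> idx r B" for I
    using fsym_cong[of r B y "csym B cl (rsym B rw z)" I] y that by metis
  from symmetrizer_kernel[OF fin this] show "y I = 0" using y out by (cases "I \<in> idx r B") auto
qed

text \<open>A box above another one cannot be moved into its row without a repetition in its column, so that
  only the free boxes contribute to the degree in \<open>s\<close>.\<close>

definition free_boxes :: "nat \<Rightarrow> nat set" where
  "free_boxes i = {k \<in> B. rw k = i \<and> \<not> (\<exists>k'\<in>B. rw k' = Suc i \<and> cl k' = cl k)}"

lemma tmul_lowmat: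
  fixes I :: "nat \<Rightarrow> nat"
  assumes i: "Suc i < r"
  shows "\<exists>P :: 'k :: field_char_0 poly. degree P \<le> card (free_boxes i) \<and> (\<forall>s. tmul B (lowmat i s) y0 I = poly P s)"
proof (cases "I \<in> idx r B \<and> col_inj I")
  case False
  then have "tmul B (lowmat i s) y0 I = 0" for s :: 'k
    by (auto simp: tmul_y0 csym_zero) (simp add: tmul_y0[symmetric] tmul_outside lowmat_def)
  then show ?thesis by (intro exI[of _ 0]) simp
next
  case True
  have "\<exists>P :: 'k poly. degree P \<le> card (free_boxes i) \<and> (\<forall>s. tmul B (lowmat i s) erow J = poly P s)"
    if J: "J \<in> idx r B" "col_inj J" for J
  proof -
    have e: "tmul B (lowmat i s) erow J = (\<Prod>k\<in>B. lowmat i s $$ (J k, rw k))" for s :: 'k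
      by (rule tmul_erow[OF _ J(1)]) (simp add: lowmat_def)
    have ent: "lowmat i s $$ (J k, rw k) = (if J k = rw k then 1 else if J k = Suc i \<and> rw k = i then s else 0)"
      if "k \<in> B" for s :: 'k and k
      using that idx_less[OF J(1)] rw_less by (simp add: lowmat_def)
    \<comment> \<open>The boxes of row \<open>i\<close> whose value is raised to
      \<open>Suc i\<close>; each of them contributes one factor \<open>s\<close>.\<close>
    define R where "R = {k \<in> B. J k = Suc i \<and> rw k = i}"
    show ?thesis
    proof (cases "\<forall>k\<in>B. J k = rw k \<or> k \<in> R")
      case False
      then obtain k where k: "k \<in> B" "J k \<noteq> rw k" "k \<notin> R" by blast
      then have "lowmat i s $$ (J k, rw k) = 0" for s :: 'k
        using ent[OF k(1)] by (auto simp: R_def)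
      then have "(\<Prod>k\<in>B. lowmat i s $$ (J k, rw k)) = 0" for s :: 'k
        using fin k(1) by (intro prod_zero) auto
      then show ?thesis using e by (intro exI[of _ 0]) simp
    next
      case all: True
      have "(\<Prod>k\<in>B. lowmat i s $$ (J k, rw k)) = s ^ card R" for s :: 'k
      proof -
        have "(\<Prod>k\<in>B. lowmat i s $$ (J k, rw k)) = (\<Prod>k\<in>B. if k \<in> R then s else 1)"
          using all ent by (intro prod.cong refl) (auto simp: R_def)
        also have "\<dots> = (\<Prod>k\<in>R. s)"
          using fin by (simp add: prod.If_cases R_def Collect_conj_eq Int_assoc[symmetric])
        finally show ?thesis by simp
      qed
      moreover have "R \<subseteq> free_boxes i"
      proof
        fix k assume k: "k \<in> R"
        have False if k': "k' \<in> B" "rw k' = Suc i" "cl k' = cl k" for k'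
        proof -
          have "k' \<notin> R" using k' by (auto simp: R_def)
          then have "J k' = J k" using all k' k by (auto simp: R_def)
          moreover have "k' \<noteq> k" using k k' by (auto simp: R_def)
          ultimately show False using J(2) k k' unfolding col_inj_def R_def by (metis (mono_tags, lifting) mem_Collect_eq)
        qed
        then show "k \<in> free_boxes i" using k unfolding free_boxes_def R_def by blast
      qed
      then have "card R \<le> card (free_boxes i)" using fin by (intro card_mono) (auto simp: free_boxes_def)
      ultimately show ?thesis using e
        by (intro exI[of _ "monom 1 (card R)"]) (auto simp: poly_monom intro: order.trans[OF degree_monom_le])
    qed
  qed
  then show ?thesis
    unfolding tmul_y0 fsym_def
    by (intro poly_bounded_sum poly_bounded_scale) (simp add: True col_inj_comp idx_comp_iff[OF fib_perms_permutes])
qed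

lemma \<Delta>_lowmat:
  fixes g :: "'k :: field_char_0 mat"
  assumes i: "Suc i < r" and g: "g \<in> carrier_mat r r"
  shows "\<exists>P. degree P \<le> card (free_boxes i) \<and> (\<forall>s. \<Delta> (g * lowmat i s) = poly P s)"
proof -
  have "\<Delta> (g * lowmat i s) = (\<Sum>J\<in>idx r B. (\<Prod>k\<in>B. g $$ (rw k, J k)) * tmul B (lowmat i s) y0 J)" for s
    unfolding \<Delta>_def by (subst pfun_mult[OF g]) (simp_all add: lowmat_def pfun_def)
  moreover have "\<exists>P. degree P \<le> card (free_boxes i) \<and>
     (\<forall>s. (\<Sum>J\<in>idx r B. (\<Prod>k\<in>B. g $$ (rw k, J k)) * tmul B (lowmat i s) y0 J) = poly P s)"
    by (intro poly_bounded_sum poly_bounded_scale tmul_lowmat i)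
  ultimately show ?thesis by simp
qed

end

section \<open>Irreducible representations and their highest weight functional\<close>

lemma subspace_vecI:
  fixes W :: "'k :: field vec set"
  assumes "W \<subseteq> carrier_vec m" "0\<^sub>v m \<in> W" "\<And>x y. x \<in> W \<Longrightarrow> y \<in> W \<Longrightarrow> x + y \<in> W"
    and "\<And>c x. x \<in> W \<Longrightarrow> c \<cdot>\<^sub>v x \<in> W"
  shows "subspace class_ring W (module_vec TYPE('k) m)"
proof -
  interpret vec_space "TYPE('k)" m .
  have "submodule class_ring W V"
  proof (rule submodule.intro)
    show "Module.module class_ring V" by (rule module_axioms)
    show "W \<subseteq> carrier V" using assms(1) by (simp add: module_vec_simps)
    show "x \<oplus>\<^bsub>V\<^esub> y \<in> W" if "x \<in> W" "y \<in> W" for x y using assms(3) that by (simp add: module_vec_simps)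
    show "\<zero>\<^bsub>V\<^esub> \<in> W" using assms(2) by (simp add: module_vec_simps)
    show "c \<odot>\<^bsub>V\<^esub> x \<in> W" if "x \<in> W" for c x using assms(4) that by (simp add: module_vec_simps)
  qed
  then show ?thesis using vectorspace_axioms unfolding subspace_def by blast
qed

lemma vec_zeroI:
  fixes x :: "'k :: field vec"
  assumes "x \<in> carrier_vec m" "\<And>y. y \<in> carrier_vec m \<Longrightarrow> x \<bullet> y = 0"
  shows "x = 0\<^sub>v m"
proof (rule eq_vecI)
  fix i assume i: "i < dim_vec (0\<^sub>v m :: 'k vec)"
  then have "x $ i = x \<bullet> unit_vec m i" using assms(1) by simp
  then show "x $ i = 0\<^sub>v m $ i" using assms(2)[of "unit_vec m i"] i by simp
qed (use assms in auto)

lemma vspan_annihilator: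
  fixes \<xi> :: "'k :: field vec"
  assumes R: "R \<subseteq> carrier_vec m" and x: "\<xi> \<in> carrier_vec m" "\<And>y. y \<in> R \<Longrightarrow> \<xi> \<bullet> y = 0"
    and y: "y \<in> vspan m R"
  shows "\<xi> \<bullet> y = 0"
  using y
proof induction
  case zero
  show ?case using x(1) by simp
next
  case (step y q c)
  have q: "q \<in> carrier_vec m" using step R by auto
  show ?case
    using x step q vspan_carrier[OF R step(1)]
    by (simp add: scalar_prod_add_distrib[of _ m])
qed

lemma linear_functional_vec:
  fixes f :: "'k :: field vec \<Rightarrow> 'k"
  assumes add: "\<And>x y. x \<in> carrier_vec m \<Longrightarrow> y \<in> carrier_vec m \<Longrightarrow> f (x + y) = f x + f y"
    and sm: "\<And>c x. x \<in> carrier_vec m \<Longrightarrow> f (c \<cdot>\<^sub>v x) = c * f x"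
    and x: "x \<in> carrier_vec m"
  shows "f x = vec m (\<lambda>i. f (unit_vec m i)) \<bullet> x"
proof -
  define t where "t k = vec m (\<lambda>i. if i < k then x $ i else 0)" for k
  have "f (t k) = (\<Sum>i<k. f (unit_vec m i) * x $ i)" if "k \<le> m" for k
    using that
  proof (induction k)
    case 0
    have "t 0 = 0 \<cdot>\<^sub>v 0\<^sub>v m" by (rule eq_vecI) (auto simp: t_def)
    then show ?case using sm[of "0\<^sub>v m" 0] by simp
  next
    case (Suc k)
    have "t (Suc k) = t k + x $ k \<cdot>\<^sub>v unit_vec m k"
      by (rule eq_vecI) (auto simp: t_def less_Suc_eq unit_vec_def)
    then show ?case using Suc add[of "t k" "x $ k \<cdot>\<^sub>v unit_vec m k"] sm by (simp add: t_def)
  qed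
  from this[of m] have "f (t m) = (\<Sum>i<m. f (unit_vec m i) * x $ i)" by simp
  moreover have "t m = x" by (rule eq_vecI) (use x in \<open>auto simp: t_def\<close>)
  ultimately show ?thesis using x by (simp add: scalar_prod_def atLeast0LessThan)
qed

text \<open>Right multiplication by \<open>g\<close> with the size fixed in advance, so that its
  entries are polynomial functions even at arguments of other dimensions.\<close>

definition mulR :: "nat \<Rightarrow> 'k :: field mat \<Rightarrow> 'k mat \<Rightarrow> 'k mat" where
  "mulR r g h = mat r r (\<lambda>(i, j). \<Sum>k<r. h $$ (i, k) * g $$ (k, j))"

lemma mulR_eq: "g \<in> carrier_mat r r \<Longrightarrow> h \<in> carrier_mat r r \<Longrightarrow> mulR r g h = h * g"
  by (rule eq_matI) (auto simp: mulR_def scalar_prod_def atLeast0LessThan)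

lemma mulR_poly_funs: "f \<in> poly_funs r r \<Longrightarrow> (\<lambda>h. f (mulR r g h)) \<in> poly_funs r r"
proof (rule poly_funs_compose[where p = r and q = r])
  fix i j assume "i < r" "j < r"
  then have "(\<lambda>A. mulR r g A $$ (i, j)) = (\<lambda>A. \<Sum>k<r. A $$ (i, k) * g $$ (k, j))"
    by (simp add: mulR_def)
  also have "\<dots> \<in> poly_funs r r"
    using \<open>i < r\<close> by (intro poly_funs_sum poly_funs.mult poly_funs.coord poly_funs.const) auto
  finally show "(\<lambda>A. mulR r g A $$ (i, j)) \<in> poly_funs r r" .
qed

text \<open>The exponents increase along the diagonal, so that for \<open>s\<close> tending to 0
  conjugation contracts the lower triangular side; the upper one acts on \<open>v\<close> by scalars
  and needs no contraction.\<close>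

definition tor :: "nat \<Rightarrow> 'k :: field \<Rightarrow> 'k mat" where
  "tor r s = mat r r (\<lambda>(i, j). if i = j then s ^ i else 0)"

lemma tor_carrier [simp]: "tor r s \<in> carrier_mat r r"
  by (simp add: tor_def)

lemma tor_mult_index:
  assumes "L \<in> carrier_mat r r" "i < r" "j < r"
  shows "(tor r s * L) $$ (i, j) = s ^ i * L $$ (i, j)" "(L * tor r s) $$ (i, j) = L $$ (i, j) * s ^ j"
proof -
  have "(tor r s * L) $$ (i, j) = (\<Sum>k<r. (if i = k then s ^ i else 0) * L $$ (k, j))"
    using assms by (simp add: scalar_prod_def atLeast0LessThan tor_def)
  also have "\<dots> = (\<Sum>k<r. if k = i then s ^ i * L $$ (i, j) else 0)"
    by (intro sum.cong refl) auto
  finally show "(tor r s * L) $$ (i, j) = s ^ i * L $$ (i, j)" using assms by simp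
  have "(L * tor r s) $$ (i, j) = (\<Sum>k<r. L $$ (i, k) * (if k = j then s ^ k else 0))"
    using assms by (simp add: scalar_prod_def atLeast0LessThan tor_def)
  also have "\<dots> = (\<Sum>k<r. if k = j then L $$ (i, j) * s ^ j else 0)"
    by (intro sum.cong refl) auto
  finally show "(L * tor r s) $$ (i, j) = L $$ (i, j) * s ^ j" using assms by simp
qed

lemma tor_GL: "s \<noteq> 0 \<Longrightarrow> tor r s \<in> GL r"
  by (rule GL_I[of _ r "tor r (1 / s)"], simp, simp, rule eq_matI)
     (auto simp: tor_mult_index(1), auto simp: tor_def power_one_over)

lemma tor_upper: "upper_triangular (tor r s)"
  by (auto simp: upper_triangular_def tor_def)

text \<open>As \<open>s \<rightarrow> 0\<close>, conjugation by the torus contracts lower unitriangular matrices to the identity.\<close>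

definition contract :: "nat \<Rightarrow> 'k :: field mat \<Rightarrow> 'k \<Rightarrow> 'k mat" where
  "contract r L s = mat r r (\<lambda>(i, j). if j \<le> i then L $$ (i, j) * s ^ (i - j) else 0)"

lemma contract_unitri: "lower_unitri r L \<Longrightarrow> lower_unitri r (contract r L s)"
  by (auto simp: lower_unitri_def contract_def)

lemma contract_0: "lower_unitri r L \<Longrightarrow> contract r L 0 = 1\<^sub>m r"
  by (rule eq_matI) (auto simp: lower_unitri_def contract_def)

lemma contract_tor:
  assumes L: "lower_unitri r L"
  shows "tor r s * L = contract r L s * tor r s"
proof (rule eq_matI)
  have Lc: "L \<in> carrier_mat r r" using L by (simp add: lower_unitri_def)
  have Cc: "contract r L s \<in> carrier_mat r r" by (simp add: contract_def)
  fix i j assume "i < dim_row (contract r L s * tor r s)" "j < dim_col (contract r L s * tor r s)"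
  then have ij: "i < r" "j < r" by (auto simp: contract_def tor_def)
  have p: "s ^ i = s ^ (i - j) * s ^ j" if "j \<le> i" using that by (simp flip: power_add)
  show "(tor r s * L) $$ (i, j) = (contract r L s * tor r s) $$ (i, j)"
    unfolding tor_mult_index(1)[OF Lc ij] tor_mult_index(2)[OF Cc ij]
    using ij L p by (auto simp: contract_def lower_unitri_def mult_ac)
qed (use L in \<open>auto simp: lower_unitri_def contract_def tor_def\<close>)

locale rat_rep =
  fixes r l :: nat and \<rho> :: "'k :: field mat \<Rightarrow> 'k mat"
  assumes rat: "rational_rep r l \<rho>"
begin

lemma rho_GL:
  assumes "g \<in> GL r"
  shows "\<rho> g \<in> GL l"
  using rat assms unfolding rational_rep_def by blast

lemma rho_carrier [simp]: "g \<in> GL r \<Longrightarrow> \<rho> g \<in> carrier_mat l l"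
  by (rule GL_carrier[OF rho_GL])

lemma rho_mult:
  assumes "g \<in> GL r" "h \<in> GL r"
  shows "\<rho> (g * h) = \<rho> g * \<rho> h"
  using rat assms unfolding rational_rep_def by blast

lemma rho_regular:
  assumes "i < l" "j < l"
  shows "regular_on r r (GL r) (\<lambda>g. \<rho> g $$ (i, j))"
  using rat assms unfolding rational_rep_def by blast

lemma rho_one: "\<rho> (1\<^sub>m r) = 1\<^sub>m l"
proof -
  obtain h where h: "h \<in> GL l" "\<rho> (1\<^sub>m r) * h = 1\<^sub>m l" using GL_inverse[OF rho_GL[OF GL_one]] by blast
  note c = rho_carrier[OF GL_one] GL_carrier[OF h(1)]
  have "\<rho> (1\<^sub>m r) = \<rho> (1\<^sub>m r) * (\<rho> (1\<^sub>m r) * h)" using h(2) right_mult_one_mat[OF c(1)] by simp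
  also have "\<dots> = (\<rho> (1\<^sub>m r) * \<rho> (1\<^sub>m r)) * h" using assoc_mult_mat[OF c(1) c(1) c(2)] by simp
  also have "\<rho> (1\<^sub>m r) * \<rho> (1\<^sub>m r) = \<rho> (1\<^sub>m r)" using rho_mult[OF GL_one GL_one] by simp
  finally show ?thesis using h by simp
qed

lemma act_carrier [simp]: "g \<in> GL r \<Longrightarrow> x \<in> carrier_vec l \<Longrightarrow> \<rho> g *\<^sub>v x \<in> carrier_vec l"
  by (metis mult_mat_vec_carrier rho_carrier)

lemma act_mult: "g \<in> GL r \<Longrightarrow> h \<in> GL r \<Longrightarrow> x \<in> carrier_vec l \<Longrightarrow> \<rho> (g * h) *\<^sub>v x = \<rho> g *\<^sub>v (\<rho> h *\<^sub>v x)"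
  using rho_mult assoc_mult_mat_vec[of "\<rho> g" l l "\<rho> h" l x] by simp

lemma act_one: "x \<in> carrier_vec l \<Longrightarrow> \<rho> (1\<^sub>m r) *\<^sub>v x = x"
  by (simp add: rho_one)

lemma act_add: "g \<in> GL r \<Longrightarrow> x \<in> carrier_vec l \<Longrightarrow> y \<in> carrier_vec l \<Longrightarrow>
    \<rho> g *\<^sub>v (x + y) = \<rho> g *\<^sub>v x + \<rho> g *\<^sub>v y"
  using mult_add_distrib_mat_vec[OF rho_carrier] by blast

lemma act_smult: "g \<in> GL r \<Longrightarrow> x \<in> carrier_vec l \<Longrightarrow> \<rho> g *\<^sub>v (c \<cdot>\<^sub>v x) = c \<cdot>\<^sub>v (\<rho> g *\<^sub>v x)"
  using mult_mat_vec[OF rho_carrier] by blast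

end

locale hw_rep = straight r B rw cl + rat_rep r l \<rho>
  for r B rw cl l and \<rho> :: "'k :: field_char_0 mat \<Rightarrow> 'k mat" +
  fixes v :: "'k vec"
  assumes irr: "irreducible_rep r l \<rho>"
    and v: "v \<in> carrier_vec l" "v \<noteq> 0\<^sub>v l"
    and hw: "b \<in> GL r \<Longrightarrow> upper_triangular b \<Longrightarrow> \<rho> b *\<^sub>v v = wt b \<cdot>\<^sub>v v"
begin

lemma invariant_subspace:
  assumes "W \<subseteq> carrier_vec l" "0\<^sub>v l \<in> W" "\<And>x y. x \<in> W \<Longrightarrow> y \<in> W \<Longrightarrow> x + y \<in> W"
    and "\<And>c x. x \<in> W \<Longrightarrow> c \<cdot>\<^sub>v x \<in> W" and "\<And>g x. g \<in> GL r \<Longrightarrow> x \<in> W \<Longrightarrow> \<rho> g *\<^sub>v x \<in> W"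
  shows "W = {0\<^sub>v l} \<or> W = carrier_vec l"
proof -
  have "subspace class_ring W (module_vec TYPE('k) l) \<and> (\<forall>g\<in>GL r. \<forall>w\<in>W. \<rho> g *\<^sub>v w \<in> W)"
    by (intro conjI ballI subspace_vecI assms)
  then show ?thesis by (rule mp[OF spec[OF conjunct2[OF conjunct2[OF irr[unfolded irreducible_rep_def]]]]])
qed

definition orbit :: "'k vec set" where "orbit = (\<lambda>g. \<rho> g *\<^sub>v v) ` GL r"

lemma orbit_carrier: "orbit \<subseteq> carrier_vec l"
  using v by (auto simp: orbit_def)

lemma orbit_span: "vspan l orbit = carrier_vec l"
proof -
  have "vspan l orbit = {0\<^sub>v l} \<or> vspan l orbit = carrier_vec l"
  proof (rule invariant_subspace)
    fix g :: "'k mat" and x assume g: "g \<in> GL r" and x: "x \<in> vspan l orbit"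
    show "\<rho> g *\<^sub>v x \<in> vspan l orbit"
      using x
    proof induction
      case zero
      have "\<rho> g *\<^sub>v 0\<^sub>v l = 0\<^sub>v l" using rho_carrier[OF g] by (intro eq_vecI) (auto simp: scalar_prod_def)
      then show ?case by (simp add: vspan.zero)
    next
      case (step x q c)
      then obtain h where h: "h \<in> GL r" "q = \<rho> h *\<^sub>v v" by (auto simp: orbit_def)
      have "\<rho> g *\<^sub>v (c \<cdot>\<^sub>v q + x) = c \<cdot>\<^sub>v (\<rho> (g * h) *\<^sub>v v) + \<rho> g *\<^sub>v x"
        using g h v vspan_carrier[OF orbit_carrier step(1)] by (simp add: act_add act_smult act_mult)
      moreover have "\<rho> (g * h) *\<^sub>v v \<in> orbit" using GL_mult[OF g h(1)] by (auto simp: orbit_def)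
      ultimately show ?case using vspan.step[OF step(3)] by simp
    qed
  qed (use vspan_carrier[OF orbit_carrier] vspan_add[OF orbit_carrier] vspan_smult[OF orbit_carrier]
        in \<open>auto intro: vspan.zero\<close>)
  moreover have "v \<in> vspan l orbit"
  proof (rule vspan_base[OF orbit_carrier])
    have "\<rho> (1\<^sub>m r) *\<^sub>v v \<in> orbit" unfolding orbit_def by (rule imageI[OF GL_one])
    then show "v \<in> orbit" using act_one[OF v(1)] by simp
  qed
  ultimately show ?thesis using v by auto
qed

lemma matrix_coefficient_regular:
  assumes "\<xi> \<in> carrier_vec l" "x \<in> carrier_vec l"
  shows "regular_on r r (GL r) (\<lambda>g. \<xi> \<bullet> (\<rho> g *\<^sub>v x))"
proof (rule regular_on_cong)
  show "regular_on r r (GL r) (\<lambda>g. \<Sum>i<l. \<xi> $ i * (\<Sum>j<l. \<rho> g $$ (i, j) * x $ j))"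
    by (intro regular_on_sum regular_on_mult regular_on_const GL_zariski_open rho_regular) auto
  fix g :: "'k mat" assume "g \<in> GL r"
  then have "\<rho> g \<in> carrier_mat l l" by simp
  then show "(\<Sum>i<l. \<xi> $ i * (\<Sum>j<l. \<rho> g $$ (i, j) * x $ j)) = \<xi> \<bullet> (\<rho> g *\<^sub>v x)"
    using assms by (simp add: scalar_prod_def atLeast0LessThan)
qed

lemma orbit_annihilator:
  assumes "\<xi> \<in> carrier_vec l" "\<And>g. g \<in> GL r \<Longrightarrow> \<xi> \<bullet> (\<rho> g *\<^sub>v v) = 0"
  shows "\<xi> = 0\<^sub>v l"
proof (rule vec_zeroI[OF assms(1)])
  fix y :: "'k vec" assume "y \<in> carrier_vec l"
  then have "y \<in> vspan l orbit" by (simp add: orbit_span)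
  then show "\<xi> \<bullet> y = 0"
    by (rule vspan_annihilator[OF orbit_carrier assms(1), rotated]) (use assms(2) in \<open>auto simp: orbit_def\<close>)
qed

text \<open>Matrix coefficients are regular, so vanishing on the dense big cell extends to GL, where
  the orbit of \<open>v\<close> spans.\<close>

lemma big_cell_annihilator:
  assumes "\<xi> \<in> carrier_vec l" "\<And>g. g \<in> GL r \<Longrightarrow> big_cell r g \<noteq> 0 \<Longrightarrow> \<xi> \<bullet> (\<rho> g *\<^sub>v v) = 0"
  shows "\<xi> = 0\<^sub>v l"
proof (rule orbit_annihilator[OF assms(1)])
  fix g :: "'k mat" assume g: "g \<in> GL r"
  show "\<xi> \<bullet> (\<rho> g *\<^sub>v v) = 0"
    by (rule regular_on_identity[OF matrix_coefficient_regular[OF assms(1) v(1)] _ big_cell_poly_funs one_carrier_mat])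
       (use assms(2) g in \<open>auto simp: big_cell_one GL_carrier\<close>)
qed

lemma \<Delta>_big_cell:
  assumes "lower_unitri r L" "U \<in> GL r" "upper_triangular U"
  shows "\<Delta> (L * U) = (wt U :: 'k)"
proof -
  have L: "L \<in> carrier_mat r r" "\<And>i j. i < j \<Longrightarrow> j < r \<Longrightarrow> L $$ (i, j) = 0"
    using assms(1) by (auto simp: lower_unitri_def)
  have U: "U \<in> carrier_mat r r" by (rule GL_carrier[OF assms(2)])
  have "\<Delta> (L * U) = wt L * \<Delta> (1\<^sub>m r * U)" using \<Delta>_lower[OF L U] U by simp
  also have "\<Delta> (1\<^sub>m r * U) = wt U * \<Delta> (1\<^sub>m r)" by (rule \<Delta>_upper[OF U assms(3)]) simp
  finally show ?thesis using wt_lower_unitri[OF assms(1)] by (simp add: \<Delta>_one)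
qed

text \<open>This is the invariant that makes \<open>\<omega>\<close> well defined. Let x be a
  combination of vectors g v. For generic \<open>h\<close> each h g factors as L U, and moving the
  torus element past L gives t h g v = wt t * wt U times contract(L) v. After division by wt t the
  family \<open>\<xi>\<close> therefore makes sense at s = 0, where the contraction is the identity
  and only a multiple of \<open>v\<close> is left. Its coefficient \<open>D h\<close> is the same
  combination of the values \<open>\<Delta>\<close> (h g), polynomial in h, and at the identity it
  is the value that the relation assigns to x.\<close>

lemma hw_graph:
  assumes "(x, y) \<in> lin_graph l (GL r) (\<lambda>g. \<rho> g *\<^sub>v v) (\<lambda>g (_ :: unit). \<Delta> g)"
  shows "x \<in> carrier_vec l \<and> (\<exists>e D. e \<in> poly_funs r r \<and> (\<exists>Q\<in>carrier_mat r r. e Q \<noteq> 0) \<and> D \<in> poly_funs r r \<and> D (1\<^sub>m r) = y () \<and>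
    (\<forall>h\<in>GL r. e h \<noteq> 0 \<longrightarrow> (\<exists>\<xi>. (\<forall>s. \<xi> s \<in> carrier_vec l) \<and> (\<forall>i<l. germ_at (\<lambda>s. \<xi> s $ i) 0) \<and>
       (\<forall>s. s \<noteq> 0 \<longrightarrow> \<rho> (tor r s) *\<^sub>v (\<rho> h *\<^sub>v x) = wt (tor r s) \<cdot>\<^sub>v \<xi> s) \<and> \<xi> 0 = D h \<cdot>\<^sub>v v)))"
  using assms
proof induction
  case zero
  have z: "\<rho> g *\<^sub>v 0\<^sub>v l = 0\<^sub>v l" if "g \<in> GL r" for g
    using rho_carrier[OF that] by (intro eq_vecI) (auto simp: scalar_prod_def)
  have z': "c \<cdot>\<^sub>v 0\<^sub>v l = (0\<^sub>v l :: 'k vec)" for c by (intro eq_vecI) auto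
  have z'': "0 \<cdot>\<^sub>v v = 0\<^sub>v l" using v(1) by (intro eq_vecI) auto
  have c0: "(\<lambda>_. 0) \<in> poly_funs r r" "(\<lambda>_. 1) \<in> poly_funs r r" by (rule poly_funs.const)+
  have o: "\<exists>Q :: 'k mat\<in>carrier_mat r r. (1 :: 'k) \<noteq> 0" by (rule bexI[OF _ one_carrier_mat]) simp
  have \<xi>: "(\<forall>s. (\<lambda>_. 0\<^sub>v l) s \<in> carrier_vec l) \<and> (\<forall>i<l. germ_at (\<lambda>s. (\<lambda>_. 0\<^sub>v l) s $ i) 0) \<and>
       (\<forall>s. s \<noteq> 0 \<longrightarrow> \<rho> (tor r s) *\<^sub>v (\<rho> h *\<^sub>v 0\<^sub>v l) = wt (tor r s) \<cdot>\<^sub>v (\<lambda>_. 0\<^sub>v l) s) \<and> (\<lambda>_. 0\<^sub>v l) 0 = 0 \<cdot>\<^sub>v v"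
    if "h \<in> GL r" for h
    using that by (simp add: z z' z'' tor_GL germ_at_const)
  show ?case
    by (rule conjI[OF zero_carrier_vec], rule exI[of _ "\<lambda>_. 1"], rule exI[of _ "\<lambda>_. 0"],
        intro conjI ballI impI c0 o refl exI[of _ "\<lambda>_. 0\<^sub>v l"] \<xi>)
next
  case (step x y g c)
  then obtain e D where e: "e \<in> poly_funs r r" "\<exists>Q\<in>carrier_mat r r. e Q \<noteq> 0" and D: "D \<in> poly_funs r r" "D (1\<^sub>m r) = y ()"
    and \<xi>: "\<And>h. h \<in> GL r \<Longrightarrow> e h \<noteq> 0 \<Longrightarrow> (\<exists>\<xi>. (\<forall>s. \<xi> s \<in> carrier_vec l) \<and> (\<forall>i<l. germ_at (\<lambda>s. \<xi> s $ i) 0) \<and>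
       (\<forall>s. s \<noteq> 0 \<longrightarrow> \<rho> (tor r s) *\<^sub>v (\<rho> h *\<^sub>v x) = wt (tor r s) \<cdot>\<^sub>v \<xi> s) \<and> \<xi> 0 = D h \<cdot>\<^sub>v v)"
    by blast
  have x: "x \<in> carrier_vec l" using step by simp
  have g: "g \<in> GL r" "g \<in> carrier_mat r r" using step GL_carrier by auto
  obtain g' where g': "g' \<in> GL r" "g' * g = 1\<^sub>m r" using GL_inverse[OF g(1)] by blast
  \<comment> \<open>Genericity accumulates: \<open>h\<close> must bring h g into the big cell for
    every \<open>g\<close> that occurs in the combination.\<close>
  let ?e = "\<lambda>h. e h * big_cell r (mulR r g h)" and ?D = "\<lambda>h. c * \<Delta> (mulR r g h) + D h"
  have "big_cell r (mulR r g g') \<noteq> 0"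
    using g g' by (simp add: mulR_eq GL_carrier big_cell_one)
  moreover from e(2) obtain Q0 where Q0: "Q0 \<in> carrier_mat r r" "e Q0 \<noteq> 0" ..
  ultimately obtain Q where "Q \<in> carrier_mat r r" "e Q \<noteq> 0" "big_cell r (mulR r g Q) \<noteq> 0"
    using poly_funs_nonzero_mult[OF e(1) Q0 mulR_poly_funs[OF big_cell_poly_funs] GL_carrier[OF g'(1)]] by auto
  then have Q: "Q \<in> carrier_mat r r" "?e Q \<noteq> 0" by auto
  have cx: "c \<cdot>\<^sub>v (\<rho> g *\<^sub>v v) + x \<in> carrier_vec l" using g v x by simp
  show ?case
  proof (rule conjI[OF cx], rule exI[of _ ?e], rule exI[of _ ?D], intro conjI ballI impI)
    show "?e \<in> poly_funs r r" by (intro poly_funs.mult e(1) mulR_poly_funs big_cell_poly_funs)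
    show "\<exists>Q\<in>carrier_mat r r. ?e Q \<noteq> 0" using Q by blast
    show "?D \<in> poly_funs r r" by (intro poly_funs.add poly_funs_scale D(1) mulR_poly_funs \<Delta>_poly_funs)
    show "c * \<Delta> (mulR r g (1\<^sub>m r)) + D (1\<^sub>m r) = c * \<Delta> g + y ()" using g D by (simp add: mulR_eq)
    fix h :: "'k mat" assume h: "h \<in> GL r" and eh: "?e h \<noteq> 0"
    have hc: "h \<in> carrier_mat r r" by (rule GL_carrier[OF h])
    have hg: "big_cell r (h * g) \<noteq> 0" "h * g \<in> carrier_mat r r" using eh g hc by (auto simp: mulR_eq)
    obtain L U where LU: "lower_unitri r L" "U \<in> GL r" "upper_triangular U" "h * g = L * U"
      using big_cell_decomp[OF hg(2,1)] by blast
    have Lc: "L \<in> carrier_mat r r" using LU(1) by (simp add: lower_unitri_def)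
    obtain \<xi> where \<xi>': "\<And>s. \<xi> s \<in> carrier_vec l" "\<And>i. i < l \<Longrightarrow> germ_at (\<lambda>s. \<xi> s $ i) 0"
       "\<And>s. s \<noteq> 0 \<Longrightarrow> \<rho> (tor r s) *\<^sub>v (\<rho> h *\<^sub>v x) = wt (tor r s) \<cdot>\<^sub>v \<xi> s" "\<xi> 0 = D h \<cdot>\<^sub>v v"
      using \<xi>[OF h] eh by (auto simp: mult_eq_0_iff)
    let ?C = "contract r L"
    have CGL: "?C s \<in> GL r" for s by (rule lower_unitri_GL[OF contract_unitri[OF LU(1)]])
    \<comment> \<open>The new summand already divided by the weight of the torus element. At s = 0
      it is \<open>c * wt U\<close> times \<open>v\<close>, and \<open>wt U\<close> is
      \<open>\<Delta>\<close> at h g.\<close>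
    define \<zeta> where "\<zeta> s = c \<cdot>\<^sub>v (wt U \<cdot>\<^sub>v (\<rho> (?C s) *\<^sub>v v)) + \<xi> s" for s
    show "\<exists>\<zeta>. (\<forall>s. \<zeta> s \<in> carrier_vec l) \<and> (\<forall>i<l. germ_at (\<lambda>s. \<zeta> s $ i) 0) \<and>
       (\<forall>s. s \<noteq> 0 \<longrightarrow> \<rho> (tor r s) *\<^sub>v (\<rho> h *\<^sub>v (c \<cdot>\<^sub>v (\<rho> g *\<^sub>v v) + x)) = wt (tor r s) \<cdot>\<^sub>v \<zeta> s) \<and>
       \<zeta> 0 = ?D h \<cdot>\<^sub>v v"
    proof (intro exI[of _ \<zeta>] conjI allI impI)
      show "\<zeta> s \<in> carrier_vec l" for s using CGL v \<xi>' by (simp add: \<zeta>_def)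
      show "\<zeta> 0 = ?D h \<cdot>\<^sub>v v"
        using v(1) g hc LU \<Delta>_big_cell[OF LU(1-3)]
        by (simp add: \<zeta>_def contract_0 act_one \<xi>'(4) mulR_eq add_smult_distrib_vec smult_smult_assoc)
      fix s :: 'k assume s: "s \<noteq> 0"
      note T = tor_GL[OF s, of r]
      have "\<rho> (tor r s) *\<^sub>v (\<rho> h *\<^sub>v (\<rho> g *\<^sub>v v)) = \<rho> (tor r s * (h * g)) *\<^sub>v v"
        using T h g v by (simp add: act_mult GL_mult)
      also have "tor r s * (h * g) = ?C s * (tor r s * U)"
      proof -
        have "tor r s * (L * U) = (tor r s * L) * U"
          by (rule assoc_mult_mat[OF tor_carrier Lc GL_carrier[OF LU(2)], symmetric])
        also have "\<dots> = ?C s * (tor r s * U)"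
          unfolding contract_tor[OF LU(1)]
          by (rule assoc_mult_mat[OF GL_carrier[OF CGL[of s]] tor_carrier GL_carrier[OF LU(2)]])
        finally show ?thesis using LU(4) by simp
      qed
      also have "\<rho> (?C s * (tor r s * U)) *\<^sub>v v = wt (tor r s) \<cdot>\<^sub>v (wt U \<cdot>\<^sub>v (\<rho> (?C s) *\<^sub>v v))"
        using T LU(2,3) CGL v
        by (simp add: act_mult GL_mult hw tor_upper act_smult smult_smult_assoc mult.commute)
      finally have 1: "\<rho> (tor r s) *\<^sub>v (\<rho> h *\<^sub>v (\<rho> g *\<^sub>v v)) = wt (tor r s) \<cdot>\<^sub>v (wt U \<cdot>\<^sub>v (\<rho> (?C s) *\<^sub>v v))" .
      show "\<rho> (tor r s) *\<^sub>v (\<rho> h *\<^sub>v (c \<cdot>\<^sub>v (\<rho> g *\<^sub>v v) + x)) = wt (tor r s) \<cdot>\<^sub>v \<zeta> s"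
        using T h g v x CGL[of s] \<xi>'(1)[of s]
        by (simp add: act_add act_smult 1 \<xi>'(3)[OF s] \<zeta>_def smult_add_distrib_vec[of _ l] smult_smult_assoc mult_ac)
    next
      fix i assume i: "i < l"
      have "germ_at (\<lambda>s. unit_vec l i \<bullet> (\<rho> (?C s) *\<^sub>v v)) 0"
      proof (rule regular_on_germ(1)[OF matrix_coefficient_regular])
        fix a b assume ab: "a < r" "b < r"
        show "\<exists>P. \<forall>s. ?C s $$ (a, b) = poly P s"
          by (rule exI[of _ "if b \<le> a then monom (L $$ (a, b)) (a - b) else 0"])
             (use ab in \<open>auto simp: contract_def poly_monom\<close>)
      qed (use v CGL GL_carrier in auto)
      moreover have "\<zeta> s $ i = c * wt U * (unit_vec l i \<bullet> (\<rho> (?C s) *\<^sub>v v)) + \<xi> s $ i" for s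
      proof -
        have a: "\<rho> (?C s) *\<^sub>v v \<in> carrier_vec l" using CGL v by simp
        then have "dim_vec (\<rho> (?C s) *\<^sub>v v) = l" "dim_vec (\<xi> s) = l" using \<xi>'(1)[of s] carrier_vecD by blast+
        then show ?thesis using i scalar_prod_left_unit[OF a i] by (simp add: \<zeta>_def del: dim_mult_mat_vec)
      qed
      ultimately show "germ_at (\<lambda>s. \<zeta> s $ i) 0"
        using \<xi>'(2)[OF i] by (auto intro!: germ_at_add germ_at_mult germ_at_const)
    qed
  qed
qed

text \<open>If a combination of orbit vectors is 0, then its family \<open>\<xi>\<close> vanishes
  for every nonzero s, hence also at 0 as a germ. So \<open>D\<close> vanishes at generic
  \<open>h\<close>, by density at the identity too, and \<open>D\<close> there is the assigned
  value.\<close>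

lemma hw_functional_exists:
  "\<exists>\<omega>. \<omega> \<in> carrier_vec l \<and> (\<forall>g\<in>GL r. \<omega> \<bullet> (\<rho> g *\<^sub>v v) = \<Delta> g)"
proof -
  have wd: "y = (\<lambda>z. 0)" if y: "(0\<^sub>v l, y) \<in> lin_graph l (GL r) (\<lambda>g. \<rho> g *\<^sub>v v) (\<lambda>g (_ :: unit). \<Delta> g)" for y
  proof -
    obtain e D where e: "e \<in> poly_funs r r" "\<exists>Q\<in>carrier_mat r r. e Q \<noteq> 0" and D: "D \<in> poly_funs r r" "D (1\<^sub>m r) = y ()"
      and \<xi>: "\<And>h. h \<in> GL r \<Longrightarrow> e h \<noteq> 0 \<Longrightarrow> (\<exists>\<xi>. (\<forall>s. \<xi> s \<in> carrier_vec l) \<and> (\<forall>i<l. germ_at (\<lambda>s. \<xi> s $ i) 0) \<and>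
       (\<forall>s. s \<noteq> 0 \<longrightarrow> \<rho> (tor r s) *\<^sub>v (\<rho> h *\<^sub>v 0\<^sub>v l) = wt (tor r s) \<cdot>\<^sub>v \<xi> s) \<and> \<xi> 0 = D h \<cdot>\<^sub>v v)"
      using hw_graph[OF y] by blast
    have z: "\<rho> g *\<^sub>v 0\<^sub>v l = 0\<^sub>v l" if "g \<in> GL r" for g
      using rho_carrier[OF that] by (intro eq_vecI) (auto simp: scalar_prod_def)
    have D0: "D h = 0" if h: "h \<in> GL r" "e h \<noteq> 0" for h
    proof -
      obtain \<xi> where \<xi>': "\<And>s. \<xi> s \<in> carrier_vec l" "\<And>i. i < l \<Longrightarrow> germ_at (\<lambda>s. \<xi> s $ i) 0"
       "\<And>s. s \<noteq> 0 \<Longrightarrow> \<rho> (tor r s) *\<^sub>v (\<rho> h *\<^sub>v 0\<^sub>v l) = wt (tor r s) \<cdot>\<^sub>v \<xi> s" "\<xi> 0 = D h \<cdot>\<^sub>v v"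
        using \<xi>[OF h] by blast
      have s0: "\<xi> s $ i = 0" if "s \<noteq> 0" "i < l" for s i
      proof -
        have "wt (tor r s) \<cdot>\<^sub>v \<xi> s = 0\<^sub>v l" using \<xi>'(3)[OF that(1)] h(1) tor_GL[OF that(1)] by (simp add: z)
        then have "wt (tor r s) * \<xi> s $ i = 0"
          using \<xi>'(1)[of s] that(2) by (metis carrier_vecD index_smult_vec(1) index_zero_vec(1))
        moreover have "wt (tor r s) \<noteq> 0" using that(1) rw_less fin by (simp add: wt_def tor_def)
        ultimately show ?thesis by simp
      qed
      have "\<xi> 0 $ i = 0" if "i < l" for i
      proof (rule germ_at_zero[OF \<xi>'(2)[OF that]])
        show "finite {s. \<xi> s $ i \<noteq> 0}" by (rule finite_subset[of _ "{0}"]) (use s0 that in auto)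
      qed
      moreover obtain i where "i < l" "v $ i \<noteq> 0"
        using v by (metis carrier_vecD eq_vecI index_zero_vec(1,2))
      ultimately show ?thesis using \<xi>'(4) v(1) by (metis carrier_vecD index_smult_vec(1) mult_eq_0_iff)
    qed
    obtain Q where Q: "Q \<in> carrier_mat r r" "e Q \<noteq> 0" using e by blast
    have "dets r (1\<^sub>m r) \<noteq> (0 :: 'k)" by (simp add: dets_eq_det)
    then obtain C where "C \<in> carrier_mat r r" "e C \<noteq> 0" "dets r C \<noteq> 0"
      using poly_funs_nonzero_mult[OF e(1) Q dets_poly_funs[of r r r] one_carrier_mat] by auto
    then have C: "C \<in> carrier_mat r r" "e C * dets r C \<noteq> 0" by auto
    have "D (1\<^sub>m r) = 0"
      by (rule poly_funs_dense[OF D(1) poly_funs.mult[OF e(1) dets_poly_funs[of r r r]] C])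
         (use D0 in \<open>auto simp: GL_iff dets_eq_det\<close>)
    then show ?thesis using D(2) by (auto simp: fun_eq_iff)
  qed
  have or: "(\<lambda>g. \<rho> g *\<^sub>v v) ` GL r \<subseteq> carrier_vec l" "vspan l ((\<lambda>g. \<rho> g *\<^sub>v v) ` GL r) = carrier_vec l"
    using orbit_carrier orbit_span unfolding orbit_def by auto
  from linear_extension[OF or wd]
  obtain f where "(\<forall>g\<in>GL r. f (\<rho> g *\<^sub>v v) = (\<lambda>_ :: unit. \<Delta> g)) \<and>
     (\<forall>x\<in>carrier_vec l. \<forall>y\<in>carrier_vec l. f (x + y) = (\<lambda>z. f x z + f y z)) \<and>
     (\<forall>c. \<forall>x\<in>carrier_vec l. f (c \<cdot>\<^sub>v x) = (\<lambda>z. c * f x z))" ..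
  then have f: "\<And>g. g \<in> GL r \<Longrightarrow> f (\<rho> g *\<^sub>v v) = (\<lambda>_. \<Delta> g)"
    and add: "\<And>x y. x \<in> carrier_vec l \<Longrightarrow> y \<in> carrier_vec l \<Longrightarrow> f (x + y) = (\<lambda>z. f x z + f y z)"
    and sm: "\<And>c x. x \<in> carrier_vec l \<Longrightarrow> f (c \<cdot>\<^sub>v x) = (\<lambda>z. c * f x z)"
    by auto
  show ?thesis
  proof (intro exI[of _ "vec l (\<lambda>i. f (unit_vec l i) ())"] conjI ballI)
    fix g :: "'k mat" assume g: "g \<in> GL r"
    have "f (\<rho> g *\<^sub>v v) () = vec l (\<lambda>i. f (unit_vec l i) ()) \<bullet> (\<rho> g *\<^sub>v v)"
      by (rule linear_functional_vec[where f = "\<lambda>x. f x ()"]) (use add sm g v in auto)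
    then show "vec l (\<lambda>i. f (unit_vec l i) ()) \<bullet> (\<rho> g *\<^sub>v v) = \<Delta> g" using f[OF g] by simp
  qed simp
qed

definition \<omega> :: "'k vec" where "\<omega> = (SOME \<omega>. \<omega> \<in> carrier_vec l \<and> (\<forall>g\<in>GL r. \<omega> \<bullet> (\<rho> g *\<^sub>v v) = \<Delta> g))"

lemma \<omega>_carrier: "\<omega> \<in> carrier_vec l" and \<omega>_act: "g \<in> GL r \<Longrightarrow> \<omega> \<bullet> (\<rho> g *\<^sub>v v) = \<Delta> g"
  using someI_ex[OF hw_functional_exists] unfolding \<omega>_def[symmetric] by auto

text \<open>The vectors whose whole orbit is killed by \<open>\<omega>\<close> form an invariant
  subspace; it misses \<open>v\<close> because \<open>\<Delta>\<close> is 1 at the identity, so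
  irreducibility makes it zero.\<close>

lemma \<omega>_separates:
  assumes "x \<in> carrier_vec l" "\<And>g. g \<in> GL r \<Longrightarrow> \<omega> \<bullet> (\<rho> g *\<^sub>v x) = 0"
  shows "x = 0\<^sub>v l"
proof -
  let ?W = "{x \<in> carrier_vec l. \<forall>g\<in>GL r. \<omega> \<bullet> (\<rho> g *\<^sub>v x) = 0}"
  have z: "\<rho> g *\<^sub>v 0\<^sub>v l = 0\<^sub>v l" if "g \<in> GL r" for g
    using rho_carrier[OF that] by (intro eq_vecI) (auto simp: scalar_prod_def)
  have "?W = {0\<^sub>v l} \<or> ?W = carrier_vec l"
  proof (rule invariant_subspace)
    show "x + y \<in> ?W" if "x \<in> ?W" "y \<in> ?W" for x y
      using that \<omega>_carrier by (auto simp: act_add scalar_prod_add_distrib[of _ l])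
    show "c \<cdot>\<^sub>v x \<in> ?W" if "x \<in> ?W" for c x using that \<omega>_carrier by (auto simp: act_smult)
    show "\<rho> g *\<^sub>v x \<in> ?W" if "g \<in> GL r" "x \<in> ?W" for g x
    proof (intro CollectI conjI ballI)
      fix h :: "'k mat" assume "h \<in> GL r"
      then show "\<omega> \<bullet> (\<rho> h *\<^sub>v (\<rho> g *\<^sub>v x)) = 0" using that act_mult[of h g x] GL_mult[of h r g] by auto
    qed (use that in auto)
  qed (use \<omega>_carrier z in auto)
  moreover have "v \<notin> ?W"
  proof
    assume "v \<in> ?W"
    then have "\<omega> \<bullet> (\<rho> (1\<^sub>m r) *\<^sub>v v) = 0" using GL_one[of r, where 'k = 'k] by blast
    then show False using \<omega>_act[OF GL_one] by (simp add: \<Delta>_one)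
  qed
  ultimately have "?W = {0\<^sub>v l}" using v by auto
  then show ?thesis using assms by auto
qed

section \<open>Equivariant embeddings of the module and its dual into tensors\<close>

lemma orbit_induct [consumes 1, case_names zero step]:
  assumes "x \<in> carrier_vec l" "P (0\<^sub>v l)"
    and "\<And>x g c. x \<in> carrier_vec l \<Longrightarrow> g \<in> GL r \<Longrightarrow> P x \<Longrightarrow> P (c \<cdot>\<^sub>v (\<rho> g *\<^sub>v v) + x)"
  shows "P x"
proof -
  have "x \<in> vspan l orbit" using assms(1) by (simp add: orbit_span)
  then show ?thesis
  proof induction
    case (step x q c)
    then show ?case using assms(3) vspan_carrier[OF orbit_carrier] unfolding orbit_def by blast
  qed (rule assms(2))
qed

lemma \<omega>_lower:
  assumes L: "L \<in> GL r" "\<And>i j. i < j \<Longrightarrow> j < r \<Longrightarrow> L $$ (i, j) = 0" and x: "x \<in> carrier_vec l"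
  shows "\<omega> \<bullet> (\<rho> L *\<^sub>v x) = wt L * (\<omega> \<bullet> x)"
  using x
proof (induction rule: orbit_induct)
  case zero
  have "\<rho> L *\<^sub>v 0\<^sub>v l = 0\<^sub>v l" using rho_carrier[OF L(1)] by (intro eq_vecI) (auto simp: scalar_prod_def)
  then show ?case using \<omega>_carrier by simp
next
  case (step x g c)
  have "\<omega> \<bullet> (\<rho> L *\<^sub>v (\<rho> g *\<^sub>v v)) = wt L * \<Delta> g"
    using \<omega>_act[OF GL_mult[OF L(1) step(2)]] act_mult[OF L(1) step(2) v(1)]
      \<Delta>_lower[OF GL_carrier[OF L(1)] L(2) GL_carrier[OF step(2)]] by simp
  then show ?case
    using step L(1) v \<omega>_carrier \<omega>_act[OF step(2)]
    by (simp add: act_add act_smult scalar_prod_add_distrib[of _ l] algebra_simps)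
qed

text \<open>\<open>erow\<close> is a multiple of its row symmetrization and both symmetrizers
  commute with \<open>h\<close>, so the translates of \<open>y0\<close> and all their combinations
  have the form needed in \<open>tensor_zero_criterion\<close>.\<close>

lemma tmul_y0_symmetrized:
  assumes "\<exists>z. y = csym B cl (rsym B rw z)"
  shows "\<exists>z. (\<lambda>I. c * tmul B h y0 I + y I) = csym B cl (rsym B rw (z :: (nat \<Rightarrow> nat) \<Rightarrow> 'k))"
proof -
  obtain z where z: "y = csym B cl (rsym B rw z)" using assms by blast
  let ?n = "of_nat (card (fib_perms B rw)) :: 'k"
  have n: "?n \<noteq> 0" using card_fib_perms[OF fin, of rw] by simp
  have e: "erow = (\<lambda>I. (1 / ?n) * rsym B rw erow I)" using n by (simp add: rsym_erow)
  have "tmul B h y0 = csym B cl (tmul B h (\<lambda>I. (1 / ?n) * rsym B rw erow I))"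
    unfolding tmul_y0 e[symmetric] ..
  also have "\<dots> = (\<lambda>I. (1 / ?n) * csym B cl (rsym B rw (tmul B h erow)) I)"
    by (simp only: tmul_scale fsym_tmul[OF fin]) (rule ext, rule fsym_scale)
  finally have t: "tmul B h y0 = (\<lambda>I. (1 / ?n) * csym B cl (rsym B rw (tmul B h erow)) I)" .
  have "(\<lambda>I. c * tmul B h y0 I + y I) = csym B cl (rsym B rw (\<lambda>I. c * (1 / ?n) * tmul B h erow I + z I))"
    unfolding t z by (simp only: fsym_add[abs_def] fsym_scale[abs_def] mult.assoc)
  then show ?thesis by blast
qed

lemma pfun_step: "pfun B rw r (\<lambda>I. c * tmul B h y0 I + y I) g = c * pfun B rw r (tmul B h y0) g + pfun B rw r y g"
  by (simp add: pfun_def distrib_left sum.distrib sum_distrib_left mult_ac)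

text \<open>Along the relation between g v and the translate of \<open>y0\<close> by g, the
  polynomial of the tensor at g equals \<open>\<omega>\<close> at g x. For x = 0 the polynomial
  vanishes on GL, and a tensor of this form with zero polynomial is zero.\<close>

lemma embed_exists:
  "\<exists>j. (\<forall>g\<in>GL r. j (\<rho> g *\<^sub>v v) = tmul B g y0) \<and>
     (\<forall>x\<in>carrier_vec l. \<forall>y\<in>carrier_vec l. j (x + y) = (\<lambda>I. j x I + j y I)) \<and>
     (\<forall>c. \<forall>x\<in>carrier_vec l. j (c \<cdot>\<^sub>v x) = (\<lambda>I. c * j x I))"
proof -
  let ?G = "lin_graph l (GL r) (\<lambda>g. \<rho> g *\<^sub>v v) (\<lambda>g. tmul B g y0)"
  have inv: "x \<in> carrier_vec l \<and> (\<forall>I. I \<notin> idx r B \<longrightarrow> y I = 0) \<and> (\<exists>z. y = csym B cl (rsym B rw z)) \<and>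
     (\<forall>g\<in>GL r. pfun B rw r y g = \<omega> \<bullet> (\<rho> g *\<^sub>v x))" if "(x, y) \<in> ?G" for x y
    using that
  proof induction
    case zero
    have z: "\<rho> g *\<^sub>v 0\<^sub>v l = 0\<^sub>v l" if "g \<in> GL r" for g
      using rho_carrier[OF that] by (intro eq_vecI) (auto simp: scalar_prod_def)
    show ?case
      using z \<omega>_carrier by (auto simp: pfun_def fun_eq_iff fsym_def intro!: exI[of _ "\<lambda>_. 0"])
  next
    case (step x y h c)
    then have ex: "\<exists>z. (\<lambda>I. c * tmul B h y0 I + y I) = csym B cl (rsym B rw z)"
      by (intro tmul_y0_symmetrized) blast
    have x: "x \<in> carrier_vec l" using step by simp
    have hc: "h \<in> carrier_mat r r" by (rule GL_carrier[OF step(2)])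
    have pf: "pfun B rw r (\<lambda>I. c * tmul B h y0 I + y I) g = \<omega> \<bullet> (\<rho> g *\<^sub>v (c \<cdot>\<^sub>v (\<rho> h *\<^sub>v v) + x))" if g: "g \<in> GL r" for g
    proof -
      have "pfun B rw r (\<lambda>I. c * tmul B h y0 I + y I) g = c * pfun B rw r (tmul B h y0) g + pfun B rw r y g"
        by (rule pfun_step)
      also have "pfun B rw r (tmul B h y0) g = \<omega> \<bullet> (\<rho> (g * h) *\<^sub>v v)"
        using pfun_mult[OF GL_carrier[OF g] hc, of y0] \<omega>_act[OF GL_mult[OF g step(2)]] by (simp add: \<Delta>_def)
      finally show ?thesis using g step v \<omega>_carrier x
        by (simp add: act_add act_smult act_mult scalar_prod_add_distrib[of _ l])
    qed
    show ?case
    proof (intro conjI allI impI ballI)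
      show "c \<cdot>\<^sub>v (\<rho> h *\<^sub>v v) + x \<in> carrier_vec l" using x v step by simp
      show "c * tmul B h y0 I + y I = 0" if "I \<notin> idx r B" for I
        using that step hc by (simp add: tmul_outside)
      show "\<exists>z. (\<lambda>I. c * tmul B h y0 I + y I) = csym B cl (rsym B rw z)" by (rule ex)
    qed (rule pf)
  qed
  have wd: "y = (\<lambda>z. 0)" if y: "(0\<^sub>v l, y) \<in> ?G" for y
  proof -
    obtain z where z: "y = csym B cl (rsym B rw z)" using inv[OF y] by blast
    have zz: "\<rho> g *\<^sub>v 0\<^sub>v l = 0\<^sub>v l" if "g \<in> GL r" for g
      using rho_carrier[OF that] by (intro eq_vecI) (auto simp: scalar_prod_def)
    show ?thesis
      by (rule tensor_zero_criterion[where z = z]) (use inv[OF y] z zz \<omega>_carrier in auto)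
  qed
  have or: "(\<lambda>g. \<rho> g *\<^sub>v v) ` GL r \<subseteq> carrier_vec l" "vspan l ((\<lambda>g. \<rho> g *\<^sub>v v) ` GL r) = carrier_vec l"
    using orbit_carrier orbit_span unfolding orbit_def by auto
  show ?thesis by (rule linear_extension[OF or wd])
qed

lemma dual_orbit_span: "vspan l ((\<lambda>g. transpose_mat (\<rho> g) *\<^sub>v \<omega>) ` GL r) = carrier_vec l"
proof (rule vspan_eq_carrier)
  let ?X = "\<lambda>g. transpose_mat (\<rho> g) *\<^sub>v \<omega>"
  show "?X ` GL r \<subseteq> carrier_vec l"
    using rho_carrier \<omega>_carrier by (auto intro!: mult_mat_vec_carrier[of _ l l])
  fix x assume x: "x \<in> carrier_vec l" and 0: "\<And>q. q \<in> ?X ` GL r \<Longrightarrow> q \<bullet> x = 0"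
  show "x = 0\<^sub>v l"
  proof (rule \<omega>_separates[OF x])
    fix g :: "'k mat" assume g: "g \<in> GL r"
    then show "\<omega> \<bullet> (\<rho> g *\<^sub>v x) = 0"
      using 0[of "?X g"] transpose_vec_mult_scalar[OF rho_carrier[OF g] x \<omega>_carrier] by auto
  qed
qed

text \<open>The argument of the previous embedding for the action of the transposes, with the orbit
  of \<open>\<omega>\<close> in place of that of \<open>v\<close>. The transpose symmetry of
  \<open>\<Delta>\<close> identifies the polynomial of the tensor at the transpose of g with the
  pairing of x with g v.\<close>

lemma dual_embed_exists:
  "\<exists>j. (\<forall>g\<in>GL r. j (transpose_mat (\<rho> g) *\<^sub>v \<omega>) = tmul B (transpose_mat g) y0) \<and>
     (\<forall>x\<in>carrier_vec l. \<forall>y\<in>carrier_vec l. j (x + y) = (\<lambda>I. j x I + j y I)) \<and>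
     (\<forall>c. \<forall>x\<in>carrier_vec l. j (c \<cdot>\<^sub>v x) = (\<lambda>I. c * j x I))"
proof -
  let ?X = "\<lambda>g. transpose_mat (\<rho> g) *\<^sub>v \<omega>"
  let ?G = "lin_graph l (GL r) ?X (\<lambda>g. tmul B (transpose_mat g) y0)"
  have Xc: "?X g \<in> carrier_vec l" if "g \<in> GL r" for g
    using rho_carrier[OF that] \<omega>_carrier by (metis mult_mat_vec_carrier transpose_carrier_mat)
  have Xd: "?X g \<bullet> x = \<omega> \<bullet> (\<rho> g *\<^sub>v x)" if "g \<in> GL r" "x \<in> carrier_vec l" for g x
    by (rule transpose_vec_mult_scalar[OF rho_carrier[OF that(1)] that(2) \<omega>_carrier])
  have inv: "x \<in> carrier_vec l \<and> (\<forall>I. I \<notin> idx r B \<longrightarrow> y I = 0) \<and> (\<exists>z. y = csym B cl (rsym B rw z)) \<and>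
     (\<forall>g\<in>GL r. pfun B rw r y (transpose_mat g) = x \<bullet> (\<rho> g *\<^sub>v v))" if "(x, y) \<in> ?G" for x y
    using that
  proof induction
    case zero
    have "0\<^sub>v l \<bullet> (\<rho> g *\<^sub>v v) = 0" if "g \<in> GL r" for g using that v by simp
    then show ?case by (auto simp: pfun_def fun_eq_iff fsym_def intro!: exI[of _ "\<lambda>_. 0"])
  next
    case (step x y h c)
    then have ex: "\<exists>z. (\<lambda>I. c * tmul B (transpose_mat h) y0 I + y I) = csym B cl (rsym B rw z)"
      by (intro tmul_y0_symmetrized) blast
    have x: "x \<in> carrier_vec l" using step by simp
    have hc: "h \<in> carrier_mat r r" by (rule GL_carrier[OF step(2)])
    have pf: "pfun B rw r (\<lambda>I. c * tmul B (transpose_mat h) y0 I + y I) (transpose_mat g) = (c \<cdot>\<^sub>v ?X h + x) \<bullet> (\<rho> g *\<^sub>v v)"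
      if g: "g \<in> GL r" for g
    proof -
      have gc: "g \<in> carrier_mat r r" by (rule GL_carrier[OF g])
      have "pfun B rw r (tmul B (transpose_mat h) y0) (transpose_mat g) = \<Delta> (transpose_mat g * transpose_mat h)"
        using pfun_mult[of "transpose_mat g" r "transpose_mat h" r y0] gc hc by (simp add: \<Delta>_def)
      also have "transpose_mat g * transpose_mat h = transpose_mat (h * g)"
        using transpose_mult[OF hc gc] by simp
      also have "\<Delta> (transpose_mat (h * g)) = \<omega> \<bullet> (\<rho> (h * g) *\<^sub>v v)"
        using \<omega>_act[OF GL_mult[OF step(2) g]] gc hc by (simp add: \<Delta>_transpose)
      also have "\<dots> = ?X h \<bullet> (\<rho> g *\<^sub>v v)"
        using Xd[OF step(2)] g v act_mult[OF step(2) g v(1)] by simp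
      finally have "pfun B rw r (tmul B (transpose_mat h) y0) (transpose_mat g) = ?X h \<bullet> (\<rho> g *\<^sub>v v)" .
      then show ?thesis unfolding pfun_step
        using step g x v Xc[OF step(2)] by (simp add: add_scalar_prod_distrib[of _ l])
    qed
    show ?case
    proof (intro conjI allI impI ballI)
      show "c \<cdot>\<^sub>v ?X h + x \<in> carrier_vec l" using x Xc[OF step(2)] by simp
      show "c * tmul B (transpose_mat h) y0 I + y I = 0" if "I \<notin> idx r B" for I
        using that step hc by (simp add: tmul_outside)
      show "\<exists>z. (\<lambda>I. c * tmul B (transpose_mat h) y0 I + y I) = csym B cl (rsym B rw z)" by (rule ex)
    qed (rule pf)
  qed
  have wd: "y = (\<lambda>z. 0)" if y: "(0\<^sub>v l, y) \<in> ?G" for y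
  proof -
    obtain z where z: "y = csym B cl (rsym B rw z)" using inv[OF y] by blast
    show ?thesis
    proof (rule tensor_zero_criterion[where z = z])
      fix g :: "'k mat" assume g: "g \<in> GL r"
      have "pfun B rw r y (transpose_mat (transpose_mat g)) = 0\<^sub>v l \<bullet> (\<rho> (transpose_mat g) *\<^sub>v v)"
        using inv[OF y] GL_transpose[OF g] by blast
      then show "pfun B rw r y g = 0" using GL_transpose[OF g] v by simp
    qed (use inv[OF y] z in auto)
  qed
  have or: "?X ` GL r \<subseteq> carrier_vec l" using Xc by auto
  show ?thesis by (rule linear_extension[OF or dual_orbit_span wd])
qed

definition emb :: "'k vec \<Rightarrow> (nat \<Rightarrow> nat) \<Rightarrow> 'k" where
  "emb = (SOME j. (\<forall>g\<in>GL r. j (\<rho> g *\<^sub>v v) = tmul B g y0) \<and>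
     (\<forall>x\<in>carrier_vec l. \<forall>y\<in>carrier_vec l. j (x + y) = (\<lambda>I. j x I + j y I)) \<and>
     (\<forall>c. \<forall>x\<in>carrier_vec l. j (c \<cdot>\<^sub>v x) = (\<lambda>I. c * j x I)))"

definition demb :: "'k vec \<Rightarrow> (nat \<Rightarrow> nat) \<Rightarrow> 'k" where
  "demb = (SOME j. (\<forall>g\<in>GL r. j (transpose_mat (\<rho> g) *\<^sub>v \<omega>) = tmul B (transpose_mat g) y0) \<and>
     (\<forall>x\<in>carrier_vec l. \<forall>y\<in>carrier_vec l. j (x + y) = (\<lambda>I. j x I + j y I)) \<and>
     (\<forall>c. \<forall>x\<in>carrier_vec l. j (c \<cdot>\<^sub>v x) = (\<lambda>I. c * j x I)))"

lemma emb_orbit: "g \<in> GL r \<Longrightarrow> emb (\<rho> g *\<^sub>v v) = tmul B g y0"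
  and emb_add: "x \<in> carrier_vec l \<Longrightarrow> y \<in> carrier_vec l \<Longrightarrow> emb (x + y) = (\<lambda>I. emb x I + emb y I)"
  and emb_smult: "x \<in> carrier_vec l \<Longrightarrow> emb (c \<cdot>\<^sub>v x) = (\<lambda>I. c * emb x I)"
  using someI_ex[OF embed_exists] unfolding emb_def[symmetric] by auto

lemma demb_orbit: "g \<in> GL r \<Longrightarrow> demb (transpose_mat (\<rho> g) *\<^sub>v \<omega>) = tmul B (transpose_mat g) y0"
  and demb_add: "x \<in> carrier_vec l \<Longrightarrow> y \<in> carrier_vec l \<Longrightarrow> demb (x + y) = (\<lambda>I. demb x I + demb y I)"
  and demb_smult: "x \<in> carrier_vec l \<Longrightarrow> demb (c \<cdot>\<^sub>v x) = (\<lambda>I. c * demb x I)"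
  using someI_ex[OF dual_embed_exists] unfolding demb_def[symmetric] by auto

lemma tmul_one_y0: "tmul B (1\<^sub>m r) y0 = (y0 :: (nat \<Rightarrow> nat) \<Rightarrow> 'k)"
  by (rule tmul_one[OF fin]) (rule y0_outside)

lemma emb_v: "emb v = y0"
  using emb_orbit[OF GL_one] act_one[OF v(1)] tmul_one_y0 by simp

lemma demb_\<omega>: "demb \<omega> = y0"
  using demb_orbit[OF GL_one] tmul_one_y0 \<omega>_carrier by (simp add: rho_one)

end

section \<open>Regular functions on surjective matrices are polynomial\<close>

definition surj_mats :: "nat \<Rightarrow> nat \<Rightarrow> 'k :: field mat set" where
  "surj_mats r n = {A \<in> carrier_mat r n. (\<lambda>v. A *\<^sub>v v) ` carrier_vec n = carrier_vec r}"

text \<open>For a coordinate matrix \<open>C\<close> this is a maximal minor of \<open>A\<close>. A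
  general \<open>C\<close> lets every surjective matrix be detected by one of its own right
  inverses.\<close>

definition cdet :: "nat \<Rightarrow> nat \<Rightarrow> 'k :: field mat \<Rightarrow> 'k mat \<Rightarrow> 'k" where
  "cdet r n C A = det (mat r r (\<lambda>(i, j). \<Sum>k<n. A $$ (i, k) * C $$ (k, j)))"

lemma cdet_poly_funs: "cdet r n C \<in> poly_funs r n"
  unfolding cdet_def[abs_def]
  by (rule poly_funs_det[where m = r])
     (auto intro!: poly_funs_sum poly_funs.mult poly_funs.coord poly_funs.const)

lemma cdet_eq: "A \<in> carrier_mat r n \<Longrightarrow> C \<in> carrier_mat n r \<Longrightarrow> cdet r n C A = det (A * C)"
  unfolding cdet_def by (rule arg_cong[of _ _ det], rule eq_matI) (auto simp: scalar_prod_def atLeast0LessThan)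

lemma surj_mats_right_inverse:
  assumes "A \<in> surj_mats r n"
  obtains C where "C \<in> carrier_mat n r" "A * C = 1\<^sub>m r"
proof -
  have A: "A \<in> carrier_mat r n" using assms by (simp add: surj_mats_def)
  have "\<exists>c. c \<in> carrier_vec n \<and> A *\<^sub>v c = unit_vec r j" for j
  proof -
    have "unit_vec r j \<in> (\<lambda>v. A *\<^sub>v v) ` carrier_vec n" using assms by (simp add: surj_mats_def)
    then show ?thesis by auto
  qed
  then obtain c where c: "\<And>j. c j \<in> carrier_vec n" "\<And>j. A *\<^sub>v c j = unit_vec r j" by metis
  let ?C = "mat n r (\<lambda>(i, j). c j $ i)"
  have "A * ?C = 1\<^sub>m r"
  proof (rule eq_matI)
    fix i j assume "i < dim_row (1\<^sub>m r :: 'a mat)" "j < dim_col (1\<^sub>m r :: 'a mat)"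
    then have ij: "i < r" "j < r" by auto
    have "(A * ?C) $$ (i, j) = (A *\<^sub>v c j) $ i"
      using A ij c(1)[of j] by (simp add: scalar_prod_def)
    then show "(A * ?C) $$ (i, j) = 1\<^sub>m r $$ (i, j)" using ij c(2)[of j] by auto
  qed (use A in auto)
  then show ?thesis using that[of ?C] by auto
qed

lemma surj_matsI:
  assumes A: "A \<in> carrier_mat r n" and C: "C \<in> carrier_mat n r" and AC: "A * C \<in> GL r"
  shows "A \<in> surj_mats r n"
proof -
  obtain H where H: "H \<in> GL r" "A * C * H = 1\<^sub>m r" using GL_inverse[OF AC] by blast
  have Hc: "H \<in> carrier_mat r r" by (rule GL_carrier[OF H(1)])
  have "v \<in> (\<lambda>v. A *\<^sub>v v) ` carrier_vec n" if v: "v \<in> carrier_vec r" for v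
  proof -
    have hv: "H *\<^sub>v v \<in> carrier_vec r" using Hc v by auto
    have chv: "C *\<^sub>v (H *\<^sub>v v) \<in> carrier_vec n" using C hv by auto
    have "A *\<^sub>v (C *\<^sub>v (H *\<^sub>v v)) = (A * C) *\<^sub>v (H *\<^sub>v v)"
      by (rule assoc_mult_mat_vec[OF A C hv, symmetric])
    also have "\<dots> = (A * C * H) *\<^sub>v v"
      by (rule assoc_mult_mat_vec[OF _ Hc v, symmetric]) (use A C in auto)
    finally have "v = A *\<^sub>v (C *\<^sub>v (H *\<^sub>v v))" using H(2) v by simp
    then show ?thesis using chv by blast
  qed
  moreover have "A *\<^sub>v v \<in> carrier_vec r" if "v \<in> carrier_vec n" for v using A that by auto
  ultimately show ?thesis using A by (auto simp: surj_mats_def)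
qed

lemma surj_mats_open: "zariski_open r n (surj_mats r n :: 'a :: field mat set)"
proof -
  have "(surj_mats r n :: 'a mat set) = {A \<in> carrier_mat r n. \<exists>f\<in>cdet r n ` carrier_mat n r. f A \<noteq> 0}"
  proof (intro equalityI subsetI)
    fix A :: "'a mat" assume A: "A \<in> surj_mats r n"
    then obtain C where C: "C \<in> carrier_mat n r" "A * C = 1\<^sub>m r" by (rule surj_mats_right_inverse)
    have "A \<in> carrier_mat r n" using A by (simp add: surj_mats_def)
    then have "cdet r n C A \<noteq> 0" using C by (simp add: cdet_eq)
    then show "A \<in> {A \<in> carrier_mat r n. \<exists>f\<in>cdet r n ` carrier_mat n r. f A \<noteq> 0}"
      using C \<open>A \<in> carrier_mat r n\<close> by blast
  next
    fix A :: "'a mat" assume "A \<in> {A \<in> carrier_mat r n. \<exists>f\<in>cdet r n ` carrier_mat n r. f A \<noteq> 0}"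
    then obtain C where C: "A \<in> carrier_mat r n" "C \<in> carrier_mat n r" "cdet r n C A \<noteq> 0" by blast
    then have "A * C \<in> GL r" using cdet_eq[OF C(1,2)] by (auto simp: GL_iff)
    then show "A \<in> surj_mats r n" by (rule surj_matsI[OF C(1,2)])
  qed
  moreover have "cdet r n ` carrier_mat n r \<subseteq> (poly_funs r n :: ('a mat \<Rightarrow> 'a) set)"
    using cdet_poly_funs by auto
  ultimately show ?thesis unfolding zariski_open_def by (intro exI[of _ "cdet r n ` carrier_mat n r"] conjI)
qed

section \<open>Elimination of denominators by interpolation in one matrix entry\<close>

definition upd :: "nat \<Rightarrow> nat \<Rightarrow> nat \<Rightarrow> nat \<Rightarrow> 'k :: field mat \<Rightarrow> 'k \<Rightarrow> 'k mat" where
  "upd r n i j A t = mat r n (\<lambda>x. if x = (i, j) then t else A $$ x)"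

lemma upd_carrier [simp]: "upd r n i j A t \<in> carrier_mat r n"
  by (simp add: upd_def)

lemma upd_same: "A \<in> carrier_mat r n \<Longrightarrow> upd r n i j A (A $$ (i, j)) = A"
  by (rule eq_matI) (auto simp: upd_def)

lemma upd_curve: "a < r \<Longrightarrow> b < n \<Longrightarrow> \<exists>P. \<forall>t. upd r n i j A t $$ (a, b) = poly P t"
  by (rule exI[of _ "if (a, b) = (i, j) then [:0, 1:] else [:A $$ (a, b):]"]) (auto simp: upd_def)

lemma upd_poly_funs: "f \<in> poly_funs r n \<Longrightarrow> (\<lambda>A. f (upd r n i j A t)) \<in> poly_funs r n"
proof (rule poly_funs_compose[where p = r and q = n])
  fix a b assume "a < r" "b < n"
  then show "(\<lambda>A. upd r n i j A t $$ (a, b)) \<in> poly_funs r n"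
    by (cases "(a, b) = (i, j)") (auto simp: upd_def intro: poly_funs.const poly_funs.coord)
qed

text \<open>The bound on the degree is uniform in \<open>A\<close>, so that a fixed set of nodes
  serves for the interpolation at all matrices.\<close>

lemma upd_degree:
  assumes "f \<in> poly_funs r n"
  shows "\<exists>D. \<forall>A. \<exists>P. degree P \<le> D \<and> (\<forall>t. f (upd r n i j A t) = poly P t)"
  using assms
proof induction
  case (const c)
  show ?case by (rule exI[of _ 0], rule allI, rule exI[of _ "[:c:]"]) simp
next
  case (coord a b)
  show ?case
    by (rule exI[of _ 1], rule allI, rule exI[of _ "if (a, b) = (i, j) then [:0, 1:] else [:A $$ (a, b):]" for A])
       (use coord in \<open>auto simp: upd_def\<close>)
next
  case (add f g)
  obtain D E where D: "\<And>A. \<exists>P. degree P \<le> D \<and> (\<forall>t. f (upd r n i j A t) = poly P t)"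
    and E: "\<And>A. \<exists>P. degree P \<le> E \<and> (\<forall>t. g (upd r n i j A t) = poly P t)" using add.IH by blast
  show ?case
  proof (rule exI[of _ "max D E"], rule allI)
    fix A
    obtain P Q where P: "degree P \<le> D" "\<And>t. f (upd r n i j A t) = poly P t"
      and Q: "degree Q \<le> E" "\<And>t. g (upd r n i j A t) = poly Q t" using D[of A] E[of A] by auto
    have "degree (P + Q) \<le> max D E" using P(1) Q(1) by (meson degree_add_le max.coboundedI1 max.coboundedI2)
    then show "\<exists>P. degree P \<le> max D E \<and> (\<forall>t. f (upd r n i j A t) + g (upd r n i j A t) = poly P t)"
      using P(2) Q(2) by (intro exI[of _ "P + Q"]) simp
  qed
next
  case (mult f g)
  obtain D E where D: "\<And>A. \<exists>P. degree P \<le> D \<and> (\<forall>t. f (upd r n i j A t) = poly P t)"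
    and E: "\<And>A. \<exists>P. degree P \<le> E \<and> (\<forall>t. g (upd r n i j A t) = poly P t)" using mult.IH by blast
  show ?case
  proof (rule exI[of _ "D + E"], rule allI)
    fix A
    obtain P Q where P: "degree P \<le> D" "\<And>t. f (upd r n i j A t) = poly P t"
      and Q: "degree Q \<le> E" "\<And>t. g (upd r n i j A t) = poly Q t" using D[of A] E[of A] by auto
    have "degree (P * Q) \<le> D + E" using P(1) Q(1) by (meson add_mono degree_mult_le order_trans)
    then show "\<exists>P. degree P \<le> D + E \<and> (\<forall>t. f (upd r n i j A t) * g (upd r n i j A t) = poly P t)"
      using P(2) Q(2) by (intro exI[of _ "P * Q"]) simp
  qed
qed

text \<open>Algebraic closedness enters here: a nonconstant \<open>C\<close> has a root
  \<open>t0\<close>, where \<open>Q\<close> vanishes as well, and the common linear factor is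
  cancelled. Division establishes the new equation only for parameters other than \<open>t0\<close>;
  at \<open>t0\<close> it follows because \<open>f\<close> has a germ there.\<close>

lemma regular_line_poly:
  fixes f :: "'k :: {alg_closed_field, field_char_0} \<Rightarrow> 'k"
  assumes germ: "\<And>t0. germ_at f t0" and "C \<noteq> 0" and "\<And>t. poly C t * f t = poly Q t"
  shows "\<exists>P. degree P \<le> degree Q \<and> (\<forall>t. f t = poly P t)"
  using assms(2,3)
proof (induction "degree C" arbitrary: C Q rule: less_induct)
  case less
  show ?case
  proof (cases "degree C = 0")
    case True
    then obtain c where c: "C = [:c:]" by (metis degree_eq_zeroE)
    then have "c \<noteq> 0" using less.prems by auto
    have "f t = poly ([:1 / c:] * Q) t" for t
      using less.prems(2)[of t] c \<open>c \<noteq> 0\<close> by (simp add: field_simps)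
    moreover have "degree ([:1 / c:] * Q) \<le> degree Q" using degree_mult_le[of "[:1 / c:]" Q] by simp
    ultimately show ?thesis by blast
  next
    case False
    then obtain t0 where t0: "poly C t0 = 0" using alg_closed_imp_poly_has_root[of C] by auto
    then have "poly Q t0 = 0" using less.prems(2)[of t0] by simp
    then obtain C1 Q1 where C1: "C = [:- t0, 1:] * C1" and Q1: "Q = [:- t0, 1:] * Q1"
      using t0 by (metis dvd_def poly_eq_0_iff_dvd)
    have C1n: "C1 \<noteq> 0" using less.prems(1) C1 by auto
    have dC: "degree C = Suc (degree C1)" unfolding C1 using C1n by (subst degree_mult_eq) auto
    have dQ: "degree Q1 \<le> degree Q"
    proof (cases "Q1 = 0")
      case False
      then show ?thesis unfolding Q1 by (subst degree_mult_eq) auto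
    qed simp
    have e: "poly C1 t * f t + - poly Q1 t = 0" if "t \<noteq> t0" for t
    proof -
      have "(t - t0) * (poly C1 t * f t) = (t - t0) * poly Q1 t"
        using less.prems(2)[of t] by (simp add: C1 Q1 algebra_simps)
      then show ?thesis using that by simp
    qed
    have "germ_at (\<lambda>t. poly C1 t * f t + - poly Q1 t) t0"
    proof (intro germ_at_add germ_at_mult germ)
      show "germ_at (poly C1) t0" by (rule germ_at_poly) simp
      show "germ_at (\<lambda>t. - poly Q1 t) t0" by (rule germ_at_poly[of _ "- Q1"]) simp
    qed
    then have "poly C1 t0 * f t0 + - poly Q1 t0 = 0"
      by (rule germ_at_zero) (rule finite_subset[of _ "{t0}"], use e in auto)
    then have "poly C1 t * f t = poly Q1 t" for t using e[of t] by (cases "t = t0") (auto simp: algebra_simps)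
    from less.hyps[OF _ C1n this] dC dQ show ?thesis by (metis lessI order_trans)
  qed
qed

definition lagrange :: "'k :: field set \<Rightarrow> 'k \<Rightarrow> 'k \<Rightarrow> 'k" where
  "lagrange S s x = (\<Prod>s'\<in>S - {s}. (x - s') / (s - s'))"

lemma lagrange_combination:
  assumes S: "finite S"
  shows "\<exists>P. degree P \<le> card S - 1 \<and> (\<forall>x. poly P x = (\<Sum>s\<in>S. c s * lagrange S s x))"
proof (intro exI conjI allI)
  let ?Q = "\<Sum>s\<in>S. [:c s:] * (\<Prod>s'\<in>S - {s}. [:- s' / (s - s'), 1 / (s - s'):])"
  show "poly ?Q x = (\<Sum>s\<in>S. c s * lagrange S s x)" for x
    by (simp add: poly_sum poly_prod lagrange_def diff_divide_distrib)
  show "degree ?Q \<le> card S - 1"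
  proof (rule degree_sum_le[OF S])
    fix s assume s: "s \<in> S"
    have "degree (\<Prod>s'\<in>S - {s}. [:- s' / (s - s'), 1 / (s - s'):]) \<le> (\<Sum>s'\<in>S - {s}. 1)"
      by (rule order_trans[OF degree_prod_sum_le[OF finite_Diff[OF S]]]) (intro sum_mono, auto)
    then show "degree ([:c s:] * (\<Prod>s'\<in>S - {s}. [:- s' / (s - s'), 1 / (s - s'):])) \<le> card S - 1"
      using order_trans[OF degree_mult_le] s S by fastforce
  qed
qed

lemma lagrange_interpolation:
  fixes P :: "'k :: field poly"
  assumes S: "finite S" and deg: "degree P < card S"
  shows "poly P x = (\<Sum>s\<in>S. poly P s * lagrange S s x)"
proof -
  have "\<exists>Q. degree Q \<le> card S - 1 \<and> (\<forall>x. poly Q x = (\<Sum>s\<in>S. poly P s * lagrange S s x))"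
    by (rule lagrange_combination[OF S])
  then obtain Q where Q: "degree Q \<le> card S - 1" "\<And>x. poly Q x = (\<Sum>s\<in>S. poly P s * lagrange S s x)"
    by auto
  have lag: "lagrange S s y = (if s = y then 1 else 0)" if "s \<in> S" "y \<in> S" for s y
    using that S by (auto simp: lagrange_def intro!: prod_zero)
  have "P = Q"
  proof (rule poly_eqI_degree[of S])
    show "poly P y = poly Q y" if "y \<in> S" for y
    proof -
      have "poly Q y = (\<Sum>s\<in>S. if s = y then poly P y else 0)"
        unfolding Q using lag that by (intro sum.cong) auto
      then show ?thesis using that S by simp
    qed
    show "degree Q < card S" using deg Q(1) by linarith
  qed (rule deg)
  then show ?thesis using Q(2)[of x] by simp
qed

lemma lagrange_poly_funs:
  assumes "i < r" "j < n"
  shows "(\<lambda>A. lagrange S s (A $$ (i, j))) \<in> poly_funs r n"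
proof -
  have "(\<lambda>A. \<Prod>s'\<in>S - {s}. (1 / (s - s')) * (A $$ (i, j) - s')) \<in> poly_funs r n"
    by (intro poly_funs_prod poly_funs_scale poly_funs_diff poly_funs.coord poly_funs.const assms)
  then show ?thesis by (simp add: lagrange_def)
qed

text \<open>The minor formed by \<open>r\<close> columns different from \<open>j\<close> ensures that moving an entry in column \<open>j\<close>
  never leaves the set of surjective matrices.\<close>

definition skip_mat :: "nat \<Rightarrow> nat \<Rightarrow> nat \<Rightarrow> 'k :: field mat" where
  "skip_mat r n j = mat n r (\<lambda>(a, b). if a = (if b < j then b else Suc b) then 1 else 0)"

lemma cdet_skip_upd:
  assumes A: "A \<in> carrier_mat r n"
  shows "cdet r n (skip_mat r n j) (upd r n i j A t) = cdet r n (skip_mat r n j) A"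
proof -
  have "(\<Sum>k<n. upd r n i j A t $$ (a, k) * skip_mat r n j $$ (k, b)) = (\<Sum>k<n. A $$ (a, k) * skip_mat r n j $$ (k, b))"
    if "a < r" "b < r" for a b
    using that by (intro sum.cong) (auto simp: upd_def skip_mat_def)
  then show ?thesis unfolding cdet_def by (intro arg_cong[of _ _ det] eq_matI) auto
qed

lemma cdet_skip_nonzero:
  assumes "r < n"
  shows "\<exists>A\<in>carrier_mat r n. cdet r n (skip_mat r n j) A \<noteq> (0 :: 'k :: field)"
proof -
  let ?C = "skip_mat r n j :: 'k mat"
  let ?A = "transpose_mat ?C"
  have C: "?C \<in> carrier_mat n r" by (simp add: skip_mat_def)
  have "?A * ?C = 1\<^sub>m r"
  proof (rule eq_matI)
    fix a b assume "a < dim_row (1\<^sub>m r :: 'k mat)" "b < dim_col (1\<^sub>m r :: 'k mat)"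
    then have ab: "a < r" "b < r" by auto
    let ?s = "\<lambda>b. if b < j then b else Suc b"
    have "(?A * ?C) $$ (a, b) = (\<Sum>k<n. (if k = ?s a then 1 else 0) * (if k = ?s b then 1 else 0))"
      using ab by (simp add: scalar_prod_def atLeast0LessThan skip_mat_def cong: if_cong)
    also have "\<dots> = (\<Sum>k<n. if k = ?s b then (if ?s a = ?s b then 1 else 0) else 0)"
      by (intro sum.cong refl) auto
    also have "\<dots> = (if ?s a = ?s b then 1 else 0)" using ab assms by simp
    also have "?s a = ?s b \<longleftrightarrow> a = b" by auto
    finally show "(?A * ?C) $$ (a, b) = 1\<^sub>m r $$ (a, b)" using ab by simp
  qed (use C in auto)
  then have "cdet r n ?C ?A = 1" using cdet_eq[of ?A r n ?C] C by simp
  moreover have "?A \<in> carrier_mat r n" using C by simp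
  ultimately show ?thesis by (intro bexI[of _ ?A]) simp_all
qed

lemma upd_surj:
  assumes A: "A \<in> carrier_mat r n" and "cdet r n (skip_mat r n j) A \<noteq> 0"
  shows "upd r n i j A t \<in> surj_mats r n"
proof (rule surj_matsI[of _ r n "skip_mat r n j"])
  have C: "skip_mat r n j \<in> carrier_mat n r" by (simp add: skip_mat_def)
  have "det (upd r n i j A t * skip_mat r n j) \<noteq> 0"
    using assms(2) cdet_skip_upd[OF A, of j i t] cdet_eq[OF upd_carrier C] by metis
  moreover have "upd r n i j A t * skip_mat r n j \<in> carrier_mat r r" by (rule mult_carrier_mat[OF upd_carrier C])
  ultimately show "upd r n i j A t * skip_mat r n j \<in> GL r" by (simp add: GL_iff)
qed (simp_all add: skip_mat_def)

text \<open>The entry (a, b) has number a * n + b. At k = r * n the function is constant on the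
  matrices of this size, which means that the denominator has disappeared.\<close>

definition indep_below :: "nat \<Rightarrow> nat \<Rightarrow> nat \<Rightarrow> ('k :: field mat \<Rightarrow> 'k) \<Rightarrow> bool" where
  "indep_below r n k c \<longleftrightarrow> (\<forall>A\<in>carrier_mat r n. \<forall>B\<in>carrier_mat r n.
     (\<forall>a<r. \<forall>b<n. k \<le> a * n + b \<longrightarrow> A $$ (a, b) = B $$ (a, b)) \<longrightarrow> c A = c B)"

text \<open>One entry after another is removed from the denominator \<open>c\<close>, by interpolating \<open>f\<close> along lines
  in the direction of that entry.\<close>

lemma clear_denominator_step:
  fixes f :: "'k :: {alg_closed_field, field_char_0} mat \<Rightarrow> 'k"
  assumes rn: "r < n" and f: "regular_on r n (surj_mats r n) f" and i: "i < r" and j: "j < n"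
    and c: "c \<in> poly_funs r n" "A1 \<in> carrier_mat r n" "c A1 \<noteq> 0" "indep_below r n (i * n + j) c"
    and q: "q \<in> poly_funs r n" "\<And>A. A \<in> surj_mats r n \<Longrightarrow> c A * f A = q A"
  shows "\<exists>c\<in>poly_funs r n. \<exists>q\<in>poly_funs r n. (\<exists>A\<in>carrier_mat r n. c A \<noteq> 0) \<and>
     indep_below r n (Suc (i * n + j)) c \<and> (\<forall>A\<in>surj_mats r n. c A * f A = q A)"
proof -
  let ?u = "upd r n i j"
  obtain D where D: "\<And>A. \<exists>P. degree P \<le> D \<and> (\<forall>t. q (?u A t) = poly P t)"
    using upd_degree[OF q(1)] by blast
  obtain E where E: "\<And>t. c (?u A1 t) = poly E t" using poly_funs_curve[OF c(1) upd_curve] by blast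
  have "E \<noteq> 0" using E[of "A1 $$ (i, j)"] c(2,3) by (auto simp: upd_same)
  then have "finite {t. poly E t = 0}" by (rule poly_roots_finite)
  then have "infinite (- {t. poly E t = 0})"
    using infinite_field[where 'k = 'k] by (metis finite_compl)
  \<comment> \<open>One node more than the bound \<open>D\<close> on the degree of \<open>f\<close>
    along the entry. The nodes avoid the roots of \<open>E\<close>, so that the new denominator is
    nonzero at \<open>A1\<close>.\<close>
  then obtain S where S: "finite S" "card S = Suc D" "S \<subseteq> - {t. poly E t = 0}"
    using infinite_arbitrarily_large by blast
  \<comment> \<open>The entry (i, j) is overwritten by nodes, so \<open>c'\<close> does not depend
    on it. The numerator \<open>q'\<close> is the interpolation of the quotient of \<open>q\<close>
    and \<open>c\<close> at the nodes, multiplied by \<open>c'\<close>.\<close>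
  define c' where "c' A = (\<Prod>s\<in>S. c (?u A s))" for A
  define q' where "q' A = (\<Sum>s\<in>S. q (?u A s) * (\<Prod>s'\<in>S - {s}. c (?u A s')) * lagrange S s (A $$ (i, j)))" for A
  have c'p: "c' \<in> poly_funs r n"
    unfolding c'_def[abs_def] by (intro poly_funs_prod upd_poly_funs c(1))
  have q'p: "q' \<in> poly_funs r n"
    unfolding q'_def[abs_def]
    by (intro poly_funs_sum poly_funs.mult poly_funs_prod upd_poly_funs c(1) q(1) lagrange_poly_funs i j)
  have c'1: "c' A1 \<noteq> 0" using S E by (auto simp: c'_def)
  have ind: "indep_below r n (Suc (i * n + j)) c'"
    unfolding indep_below_def
  proof (intro ballI impI)
    fix A B :: "'k mat"
    assume AB: "A \<in> carrier_mat r n" "B \<in> carrier_mat r n"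
      "\<forall>a<r. \<forall>b<n. Suc (i * n + j) \<le> a * n + b \<longrightarrow> A $$ (a, b) = B $$ (a, b)"
    have "c (?u A s) = c (?u B s)" for s
    proof -
      have "?u A s $$ (a, b) = ?u B s $$ (a, b)" if ab: "a < r" "b < n" "i * n + j \<le> a * n + b" for a b
      proof (cases "(a, b) = (i, j)")
        case False
        have "i * n + j \<noteq> a * n + b"
        proof
          assume e: "i * n + j = a * n + b"
          then have "(i * n + j) div n = (a * n + b) div n" "(i * n + j) mod n = (a * n + b) mod n" by auto
          then show False using False j ab(2) by simp
        qed
        then show ?thesis using False AB(3) ab by (auto simp: upd_def)
      qed (use ab in \<open>auto simp: upd_def\<close>)
      then show ?thesis using c(4) unfolding indep_below_def by (meson upd_carrier)
    qed
    then show "c' A = c' B" by (simp add: c'_def)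
  qed
  let ?e = "cdet r n (skip_mat r n j)"
  have gen: "c' A * f A = q' A" if A: "A \<in> carrier_mat r n" "?e A \<noteq> 0" "c' A \<noteq> 0" for A
  proof -
    note us = upd_surj[OF A(1,2), of i]
    obtain Q where Q: "degree Q \<le> D" "\<And>t. q (?u A t) = poly Q t" using D[of A] by blast
    obtain C where C: "\<And>t. c (?u A t) = poly C t" using poly_funs_curve[OF c(1) upd_curve] by blast
    have cs: "c (?u A s) \<noteq> 0" if "s \<in> S" for s using A(3) S(1) that by (auto simp: c'_def)
    have "S \<noteq> {}" using S(2) by auto
    then have "C \<noteq> 0" using cs C by auto
    have "\<exists>P. degree P \<le> degree Q \<and> (\<forall>t. f (?u A t) = poly P t)"
    proof (rule regular_line_poly[OF _ \<open>C \<noteq> 0\<close>])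
      show "germ_at (\<lambda>t. f (?u A t)) t0" for t0
        by (rule regular_on_germ(1)[OF f upd_carrier us upd_curve])
      show "poly C t * f (?u A t) = poly Q t" for t using q(2)[OF us[of t]] C Q by simp
    qed
    then obtain P where P: "degree P \<le> D" "\<And>t. f (?u A t) = poly P t" using Q(1) by (meson order_trans)
    have "f A = poly P (A $$ (i, j))" using P(2)[of "A $$ (i, j)"] A(1) by (simp add: upd_same)
    also have "\<dots> = (\<Sum>s\<in>S. poly P s * lagrange S s (A $$ (i, j)))"
      by (rule lagrange_interpolation[OF S(1)]) (use P(1) S(2) in simp)
    finally have "c' A * f A = (\<Sum>s\<in>S. c' A * (poly P s * lagrange S s (A $$ (i, j))))"
      by (simp add: sum_distrib_left)
    also have "\<dots> = q' A"
      unfolding q'_def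
    proof (rule sum.cong[OF refl])
      fix s assume s: "s \<in> S"
      have "c' A = c (?u A s) * (\<Prod>s'\<in>S - {s}. c (?u A s'))"
        unfolding c'_def by (rule prod.remove[OF S(1) s])
      moreover have "c (?u A s) * poly P s = q (?u A s)" using q(2)[OF us[of s]] P(2)[of s] by simp
      ultimately show "c' A * (poly P s * lagrange S s (A $$ (i, j)))
          = q (?u A s) * (\<Prod>s'\<in>S - {s}. c (?u A s')) * lagrange S s (A $$ (i, j))"
        by (simp add: mult_ac)
    qed
    finally show ?thesis .
  qed
  obtain A2 :: "'k mat" where A2: "A2 \<in> carrier_mat r n" "?e A2 \<noteq> 0" using cdet_skip_nonzero[OF rn, of j] by (rule bexE)
  obtain Q where Q: "Q \<in> carrier_mat r n" "?e Q \<noteq> 0" "c' Q \<noteq> 0"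
    by (rule poly_funs_nonzero_mult[OF cdet_poly_funs A2 c'p c(2) c'1])
  have "c' A * f A = q' A" if A: "A \<in> surj_mats r n" for A
  proof -
    have "c' A * f A + - 1 * q' A = 0"
    proof (rule regular_on_identity[where f = "\<lambda>A. c' A * f A + - 1 * q' A" and e = "\<lambda>A. ?e A * c' A" and Q = Q])
      show "regular_on r n (surj_mats r n) (\<lambda>A. c' A * f A + - 1 * q' A)"
        by (intro regular_on_add regular_on_mult regular_on_const regular_on_poly surj_mats_open c'p q'p f)
      show "surj_mats r n \<subseteq> carrier_mat r n" by (auto simp: surj_mats_def)
      show "(\<lambda>A. ?e A * c' A) \<in> poly_funs r n" by (intro poly_funs.mult cdet_poly_funs c'p)
      show "c' A * f A + - 1 * q' A = 0" if "A \<in> surj_mats r n" "?e A * c' A \<noteq> 0" for A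
        using gen[of A] that by (auto simp: surj_mats_def)
    qed (use Q A in auto)
    then show ?thesis by simp
  qed
  then have "\<forall>A\<in>surj_mats r n. c' A * f A = q' A" by blast
  then show ?thesis using c'p q'p c'1 c(2) ind by (intro bexI[of _ c'] bexI[of _ q'] conjI bexI[of _ A1])
qed

text \<open>A Hartogs type extension. A local fraction for \<open>f\<close> gives an equation c f =
  q that holds on all surjective matrices by the identity principle; removing the entries one by one
  from \<open>c\<close> leaves a constant. The condition r < n provides, for every column, a minor
  that avoids it.\<close>

theorem regular_on_surj_mats_poly:
  fixes f :: "'k :: {alg_closed_field, field_char_0} mat \<Rightarrow> 'k"
  assumes rn: "r < n" and f: "regular_on r n (surj_mats r n) f"
  shows "\<exists>p\<in>poly_funs r n. \<forall>A\<in>surj_mats r n. f A = p A"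
proof -
  obtain A0 :: "'k mat" where A0: "A0 \<in> carrier_mat r n" "cdet r n (skip_mat r n 0) A0 \<noteq> 0"
    using cdet_skip_nonzero[OF rn, of 0] by (rule bexE)
  have sub: "surj_mats r n \<subseteq> carrier_mat r n" by (auto simp: surj_mats_def)
  have "A0 \<in> surj_mats r n"
    using A0 cdet_eq[OF A0(1), of "skip_mat r n 0"]
    by (intro surj_matsI[of _ r n "skip_mat r n 0"]) (auto simp: GL_iff skip_mat_def)
  then obtain W q c where W: "zariski_open r n W" "A0 \<in> W" "W \<subseteq> surj_mats r n" "q \<in> poly_funs r n" "c \<in> poly_funs r n"
    and qc: "\<And>B. B \<in> W \<Longrightarrow> c B \<noteq> 0 \<and> f B = q B / c B"
    using f unfolding regular_on_def by metis
  obtain e where e: "e \<in> poly_funs r n" "e A0 \<noteq> 0" "\<And>B. B \<in> carrier_mat r n \<Longrightarrow> e B \<noteq> 0 \<Longrightarrow> B \<in> W"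
    using zariski_open_basic_nbhd[OF W(1,2)] by blast
  have start: "c A * f A = q A" if A: "A \<in> surj_mats r n" for A
  proof -
    have "c A * f A + - 1 * q A = 0"
    proof (rule regular_on_identity[where f = "\<lambda>A. c A * f A + - 1 * q A" and e = e and Q = A0])
      show "regular_on r n (surj_mats r n) (\<lambda>A. c A * f A + - 1 * q A)"
        by (intro regular_on_add regular_on_mult regular_on_const regular_on_poly surj_mats_open W f)
      show "c A * f A + - 1 * q A = 0" if "A \<in> surj_mats r n" "e A \<noteq> 0" for A
        using qc[OF e(3)[OF _ that(2)]] that(1) sub by auto
    qed (use e A0 A sub in auto)
    then show ?thesis by simp
  qed
  have "\<exists>c\<in>poly_funs r n. \<exists>q\<in>poly_funs r n. (\<exists>A\<in>carrier_mat r n. c A \<noteq> 0) \<and>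
     indep_below r n k c \<and> (\<forall>A\<in>surj_mats r n. c A * f A = q A)" if "k \<le> r * n" for k
    using that
  proof (induction k)
    case 0
    have "indep_below r n 0 c"
      unfolding indep_below_def using poly_funs_cong_carrier[OF W(5)] by blast
    moreover have "\<exists>A\<in>carrier_mat r n. c A \<noteq> 0" using qc[OF W(2)] A0(1) by blast
    ultimately show ?case using W(4,5) start by blast
  next
    case (Suc k)
    then obtain c q A1 where c: "c \<in> poly_funs r n" "A1 \<in> carrier_mat r n" "c A1 \<noteq> 0" "indep_below r n k c"
      and q: "q \<in> poly_funs r n" "\<And>A. A \<in> surj_mats r n \<Longrightarrow> c A * f A = q A" by auto
    have n: "n > 0" using rn by simp
    have i: "k div n < r" using Suc.prems n by (simp add: div_less_iff_less_mult)
    have k: "indep_below r n (k div n * n + k mod n) c" using c(4) by simp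
    show ?case
      using clear_denominator_step[OF rn f i mod_less_divisor[OF n] c(1-3) k q] by simp
  qed
  from this[OF order_refl] obtain c q A1 where c: "c \<in> poly_funs r n" "A1 \<in> carrier_mat r n" "c A1 \<noteq> 0" "indep_below r n (r * n) c"
    and q: "q \<in> poly_funs r n" "\<And>A. A \<in> surj_mats r n \<Longrightarrow> c A * f A = q A" by auto
  have const: "c A = c A1" if "A \<in> carrier_mat r n" for A
  proof -
    have "\<not> r * n \<le> a * n + b" if "a < r" "b < n" for a b
    proof -
      have "a * n + b < Suc a * n" using that(2) by simp
      also have "\<dots> \<le> r * n" by (rule mult_le_mono1) (use that(1) in simp)
      finally show ?thesis by simp
    qed
    then show ?thesis using c(2,4) that unfolding indep_below_def by blast
  qed
  have "f A = 1 / c A1 * q A" if "A \<in> surj_mats r n" for A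
    using q(2)[OF that] const[of A] that sub c(3) by (auto simp: field_simps)
  then have "\<forall>A\<in>surj_mats r n. f A = 1 / c A1 * q A" by blast
  then show ?thesis by (rule bexI[of _ "\<lambda>A. 1 / c A1 * q A"]) (rule poly_funs_scale[OF q(1)])
qed

section \<open>Leading exponents\<close>

text \<open>Polynomials of degree at most \<open>N\<close> in a natural number, in the binomial
  basis, since the binomial theorem yields relations whose weights are binomial
  coefficients.\<close>

definition binpoly :: "nat \<Rightarrow> (nat \<Rightarrow> 'k :: field) \<Rightarrow> bool" where
  "binpoly N g \<longleftrightarrow> (\<exists>e. \<forall>x. g x = (\<Sum>k\<le>N. e k * of_nat (x choose k)))"

lemma binpoly_choose: "k \<le> N \<Longrightarrow> binpoly N (\<lambda>x. c * of_nat (x choose k))"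
  unfolding binpoly_def
  by (rule exI[of _ "\<lambda>i. if i = k then c else 0"]) (simp add: if_distrib[of "\<lambda>y. y * _"] cong: if_cong)

lemma binpoly_add:
  assumes "binpoly N g" "binpoly N h"
  shows "binpoly N (\<lambda>x. g x + h x)"
proof -
  obtain e d where "\<And>x. g x = (\<Sum>k\<le>N. e k * of_nat (x choose k))" "\<And>x. h x = (\<Sum>k\<le>N. d k * of_nat (x choose k))"
    using assms unfolding binpoly_def by blast
  then show ?thesis unfolding binpoly_def
    by (intro exI[of _ "\<lambda>k. e k + d k"]) (simp add: distrib_right sum.distrib)
qed

lemma binpoly_sum: "finite S \<Longrightarrow> (\<And>i. i \<in> S \<Longrightarrow> binpoly N (g i)) \<Longrightarrow> binpoly N (\<lambda>x. \<Sum>i\<in>S. g i x)"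
proof (induction S rule: finite_induct)
  case empty
  show ?case unfolding binpoly_def by (intro exI[of _ "\<lambda>_. 0"]) simp
qed (auto intro: binpoly_add)

lemma times_choose: "x * (x choose k) = Suc k * (x choose Suc k) + k * (x choose k)"
proof (cases "k \<le> x")
  case True
  have "(x - k) * (x choose k) = Suc k * (x choose Suc k)"
    using binomial_absorb_comp[of x k] binomial_absorption[of k x] by simp
  then show ?thesis using True by (metis add.commute diff_add_inverse2 distrib_right le_add_diff_inverse2)
next
  case False
  then show ?thesis by (simp add: binomial_eq_0)
qed

text \<open>Multiplication by x raises the binomial degree by one, since x (x choose k) = (k + 1) (x
  choose k + 1) + k (x choose k).\<close>

lemma binpoly_prod:
  assumes "finite V"
  shows "binpoly (card V) (\<lambda>x. \<Prod>v\<in>V. of_nat x - of_nat v :: 'k :: field)"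
  using assms
proof (induction V rule: finite_induct)
  case empty
  show ?case unfolding binpoly_def by (intro exI[of _ "\<lambda>_. 1"]) simp
next
  case (insert v V)
  obtain e where e: "\<And>x. (\<Prod>v\<in>V. of_nat x - of_nat v :: 'k) = (\<Sum>k\<le>card V. e k * of_nat (x choose k))"
    using insert.IH unfolding binpoly_def by blast
  have "(\<Prod>v\<in>insert v V. of_nat x - of_nat v :: 'k)
      = (\<Sum>k\<le>card V. e k * of_nat (Suc k) * of_nat (x choose Suc k) + e k * (of_nat k - of_nat v) * of_nat (x choose k))" for x
  proof -
    have "(of_nat x - of_nat v) * of_nat (x choose k)
        = (of_nat (Suc k) * of_nat (x choose Suc k) + (of_nat k - of_nat v) * of_nat (x choose k) :: 'k)" for k
      using arg_cong[OF times_choose[of x k], of "of_nat :: nat \<Rightarrow> 'k"] by (simp only: of_nat_add of_nat_mult) (simp add: algebra_simps)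
    then have "(of_nat x - of_nat v) * (e k * of_nat (x choose k))
        = (e k * of_nat (Suc k) * of_nat (x choose Suc k) + e k * (of_nat k - of_nat v) * of_nat (x choose k) :: 'k)" for k
      by (simp add: mult.left_commute[of _ "e k"] distrib_left mult.assoc)
    then show ?thesis using insert.hyps e by (simp add: sum_distrib_left)
  qed
  moreover have "binpoly (card (insert v V)) (\<lambda>x. \<Sum>k\<le>card V. e k * of_nat (Suc k) * of_nat (x choose Suc k)
       + e k * (of_nat k - of_nat v) * of_nat (x choose k))"
    by (intro binpoly_sum binpoly_add binpoly_choose) (use insert.hyps in auto)
  ultimately show ?case by presburger
qed

definition lexless :: "nat \<Rightarrow> nat \<Rightarrow> (nat \<Rightarrow> nat \<Rightarrow> nat) \<Rightarrow> (nat \<Rightarrow> nat \<Rightarrow> nat) \<Rightarrow> bool" where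
  "lexless r n S T \<longleftrightarrow> (\<exists>i j. i < r \<and> j < n \<and> S i j < T i j \<and> (\<forall>j'<j. S i j' = T i j') \<and> (\<forall>i'<i. \<forall>j'<n. S i' j' = T i' j'))"

lemma lexlessE:
  assumes "lexless r n S T"
  obtains i j where "i < r" "j < n" "S i j < T i j" "\<And>j'. j' < j \<Longrightarrow> S i j' = T i j'"
    "\<And>i' j'. i' < i \<Longrightarrow> j' < n \<Longrightarrow> S i' j' = T i' j'"
  using assms unfolding lexless_def by blast

lemma lexless_irrefl: "\<not> lexless r n S S"
  by (auto simp: lexless_def)

lemma lexless_trans:
  assumes "lexless r n S T" "lexless r n T U"
  shows "lexless r n S U"
proof -
  obtain i j where 1: "i < r" "j < n" "S i j < T i j" "\<And>j'. j' < j \<Longrightarrow> S i j' = T i j'"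
    "\<And>i' j'. i' < i \<Longrightarrow> j' < n \<Longrightarrow> S i' j' = T i' j'"
    using assms(1) unfolding lexless_def by blast
  obtain k l where 2: "k < r" "l < n" "T k l < U k l" "\<And>j'. j' < l \<Longrightarrow> T k j' = U k j'"
    "\<And>i' j'. i' < k \<Longrightarrow> j' < n \<Longrightarrow> T i' j' = U i' j'"
    using assms(2) unfolding lexless_def by blast
  consider "i < k" | "k < i" | "i = k" "j < l" | "i = k" "l < j" | "i = k" "j = l" by linarith
  then show ?thesis
  proof cases
    case 1
    then show ?thesis unfolding lexless_def using \<open>i < r\<close> \<open>j < n\<close> \<open>S i j < T i j\<close> 2(5)[of i] 2(5)
        \<open>\<And>j'. j' < j \<Longrightarrow> S i j' = T i j'\<close> \<open>\<And>i' j'. i' < i \<Longrightarrow> j' < n \<Longrightarrow> S i' j' = T i' j'\<close>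
      by (intro exI[of _ i] exI[of _ j]) auto
  next
    case 2
    then show ?thesis unfolding lexless_def using \<open>k < r\<close> \<open>l < n\<close> \<open>T k l < U k l\<close> 1(5)
        \<open>\<And>j'. j' < l \<Longrightarrow> T k j' = U k j'\<close> \<open>\<And>i' j'. i' < k \<Longrightarrow> j' < n \<Longrightarrow> T i' j' = U i' j'\<close>
      by (intro exI[of _ k] exI[of _ l]) auto
  next
    case 3
    then show ?thesis unfolding lexless_def using 1 2 by (intro exI[of _ i] exI[of _ j]) auto
  next
    case 4
    then show ?thesis unfolding lexless_def using 1 2 by (intro exI[of _ k] exI[of _ l]) auto
  next
    case 5
    then show ?thesis unfolding lexless_def using 1 2 by (intro exI[of _ k] exI[of _ l]) auto
  qed
qed

lemma lexless_total:
  assumes "S \<in> exponents r n" "T \<in> exponents r n" "S \<noteq> T"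
  shows "lexless r n S T \<or> lexless r n T S"
proof -
  have "\<exists>i. \<exists>j. S i j \<noteq> T i j" using assms(3) by (auto simp: fun_eq_iff)
  define i where "i = (LEAST i. \<exists>j. S i j \<noteq> T i j)"
  have i: "\<exists>j. S i j \<noteq> T i j" unfolding i_def by (rule LeastI_ex) fact
  have i': "S i' j = T i' j" if "i' < i" for i' j using that not_less_Least unfolding i_def by blast
  define j where "j = (LEAST j. S i j \<noteq> T i j)"
  have j: "S i j \<noteq> T i j" unfolding j_def by (rule LeastI_ex) fact
  have j': "S i j' = T i j'" if "j' < j" for j' using that not_less_Least unfolding j_def by blast
  have ij: "i < r \<and> j < n"
  proof (rule ccontr)
    assume "\<not> (i < r \<and> j < n)"
    then have "S i j = 0" "T i j = 0" using assms(1,2) by (auto simp: exponents_def)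
    then show False using j by simp
  qed
  show ?thesis
    using j i' j' ij unfolding lexless_def by (metis nat_neq_iff)
qed

section \<open>Row additions and the relations between coefficients\<close>

definition rowadd :: "nat \<Rightarrow> nat \<Rightarrow> nat \<Rightarrow> 'k :: field \<Rightarrow> 'k mat \<Rightarrow> 'k mat" where
  "rowadd r n i s A = mat r n (\<lambda>(a, b). if a = Suc i then A $$ (a, b) + s * A $$ (i, b) else A $$ (a, b))"

text \<open>The exponent of one term of the expansion after row \<open>i\<close> has been added to
  row \<open>Suc i\<close>: in column \<open>b\<close>, \<open>f b\<close> factors remain in row
  \<open>Suc i\<close> and the others are moved up to row \<open>i\<close>.\<close>

definition shift :: "nat \<Rightarrow> (nat \<Rightarrow> nat \<Rightarrow> nat) \<Rightarrow> (nat \<Rightarrow> nat) \<Rightarrow> nat \<Rightarrow> nat \<Rightarrow> nat" where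
  "shift i T f a b = (if a = i then T i b + T (Suc i) b - f b else if a = Suc i then f b else T a b)"

definition lowerings :: "nat \<Rightarrow> nat \<Rightarrow> (nat \<Rightarrow> nat \<Rightarrow> nat) \<Rightarrow> (nat \<Rightarrow> nat) set" where
  "lowerings n i T = {f. (\<forall>j<n. f j \<le> T (Suc i) j) \<and> (\<forall>j\<ge>n. f j = 0)}"

lemma finite_lowerings: "finite (lowerings n i T)"
proof -
  have "lowerings n i T \<subseteq> {f. \<forall>j. (j \<in> {..<n} \<longrightarrow> f j \<in> {.. Max (T (Suc i) ` {..<n})}) \<and> (j \<notin> {..<n} \<longrightarrow> f j = 0)}"
  proof
    fix f assume f: "f \<in> lowerings n i T"
    have "f j \<le> Max (T (Suc i) ` {..<n})" if "j < n" for j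
    proof -
      have "f j \<le> T (Suc i) j" using f that by (simp add: lowerings_def)
      also have "\<dots> \<le> Max (T (Suc i) ` {..<n})" using that by (intro Max_ge) auto
      finally show ?thesis .
    qed
    then show "f \<in> {f. \<forall>j. (j \<in> {..<n} \<longrightarrow> f j \<in> {.. Max (T (Suc i) ` {..<n})}) \<and> (j \<notin> {..<n} \<longrightarrow> f j = 0)}"
      using f by (auto simp: lowerings_def)
  qed
  then show ?thesis by (rule finite_subset) (rule finite_set_of_finite_funs, auto)
qed

lemma prod_sum_lowerings:
  fixes h :: "nat \<Rightarrow> nat \<Rightarrow> 'k :: comm_semiring_1"
  shows "(\<Prod>j<n. \<Sum>k\<le>T (Suc i) j. h j k) = (\<Sum>f\<in>lowerings n i T. \<Prod>j<n. h j (f j))"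
proof -
  have "(\<Prod>j<n. \<Sum>k\<le>T (Suc i) j. h j k) = (\<Sum>f\<in>(\<Pi>\<^sub>E j\<in>{..<n}. {..T (Suc i) j}). \<Prod>j<n. h j (f j))"
    by (rule prod_sum_PiE) auto
  also have "\<dots> = (\<Sum>f\<in>lowerings n i T. \<Prod>j<n. h j (f j))"
    by (rule sum.reindex_bij_witness[of _ "\<lambda>f. restrict f {..<n}" "\<lambda>f j. if j < n then f j else 0"])
       (auto simp: lowerings_def PiE_iff extensional_def fun_eq_iff)
  finally show ?thesis .
qed

text \<open>The binomial theorem in every column of row \<open>Suc i\<close>, multiplied out over
  the columns. The exponent of \<open>s\<close> is the number of factors moved up.\<close>

lemma monom_fun_rowadd:
  fixes A :: "'k :: field mat"
  assumes A: "A \<in> carrier_mat r n" and i: "Suc i < r"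
  shows "monom_fun r n T (rowadd r n i s A) = (\<Sum>f\<in>lowerings n i T.
     s ^ ((\<Sum>j<n. T (Suc i) j) - (\<Sum>j<n. f j)) * (\<Prod>j<n. of_nat (T (Suc i) j choose f j)) * monom_fun r n (shift i T f) A)"
proof -
  define R where "R = (\<Prod>a\<in>{..<r} - {i, Suc i}. \<Prod>j<n. A $$ (a, j) ^ T a j)"
  have split: "(\<Prod>a<r. g a) = g (Suc i) * (g i * (\<Prod>a\<in>{..<r} - {i, Suc i}. g a))" for g :: "nat \<Rightarrow> 'k"
  proof -
    have "(\<Prod>a<r. g a) = g (Suc i) * (\<Prod>a\<in>{..<r} - {Suc i}. g a)" by (rule prod.remove) (use i in auto)
    also have "(\<Prod>a\<in>{..<r} - {Suc i}. g a) = g i * (\<Prod>a\<in>{..<r} - {Suc i} - {i}. g a)" by (rule prod.remove) (use i in auto)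
    also have "{..<r} - {Suc i} - {i} = {..<r} - {i, Suc i}" by auto
    finally show ?thesis .
  qed
  have "monom_fun r n T (rowadd r n i s A)
      = (\<Prod>j<n. (A $$ (Suc i, j) + s * A $$ (i, j)) ^ T (Suc i) j) * ((\<Prod>j<n. A $$ (i, j) ^ T i j) * R)"
    unfolding monom_fun_def split R_def using i
    by (intro arg_cong2[where f = "(*)"] prod.cong refl) (auto simp: rowadd_def)
  also have "(\<Prod>j<n. (A $$ (Suc i, j) + s * A $$ (i, j)) ^ T (Suc i) j)
     = (\<Prod>j<n. \<Sum>k\<le>T (Suc i) j. of_nat (T (Suc i) j choose k) * A $$ (Suc i, j) ^ k * (s * A $$ (i, j)) ^ (T (Suc i) j - k))"
    by (intro prod.cong refl binomial_ring)
  also have "\<dots> = (\<Sum>f\<in>lowerings n i T. \<Prod>j<n. of_nat (T (Suc i) j choose f j) * A $$ (Suc i, j) ^ f j * (s * A $$ (i, j)) ^ (T (Suc i) j - f j))"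
    by (rule prod_sum_lowerings)
  also have "\<dots> * ((\<Prod>j<n. A $$ (i, j) ^ T i j) * R) = (\<Sum>f\<in>lowerings n i T.
     s ^ ((\<Sum>j<n. T (Suc i) j) - (\<Sum>j<n. f j)) * (\<Prod>j<n. of_nat (T (Suc i) j choose f j)) * monom_fun r n (shift i T f) A)"
    unfolding sum_distrib_right
  proof (rule sum.cong[OF refl])
    fix f assume f: "f \<in> lowerings n i T"
    then have le: "\<And>j. j < n \<Longrightarrow> f j \<le> T (Suc i) j" by (simp add: lowerings_def)
    have "(\<Sum>j<n. T (Suc i) j - f j) = (\<Sum>j<n. T (Suc i) j) - (\<Sum>j<n. f j)"
      by (rule sum_subtractf_nat) (use le in auto)
    then have s: "(\<Prod>j<n. s ^ (T (Suc i) j - f j)) = s ^ ((\<Sum>j<n. T (Suc i) j) - (\<Sum>j<n. f j))"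
      by (simp add: power_sum[symmetric])
    have m: "monom_fun r n (shift i T f) A = (\<Prod>j<n. A $$ (Suc i, j) ^ f j) * ((\<Prod>j<n. A $$ (i, j) ^ (T i j + T (Suc i) j - f j)) * R)"
      unfolding monom_fun_def split R_def
      by (intro arg_cong2[where f = "(*)"] prod.cong refl) (auto simp: shift_def)
    have p: "(\<Prod>j<n. A $$ (i, j) ^ (T i j + T (Suc i) j - f j)) = (\<Prod>j<n. A $$ (i, j) ^ (T (Suc i) j - f j)) * (\<Prod>j<n. A $$ (i, j) ^ T i j)"
      unfolding prod.distrib[symmetric] power_add[symmetric]
      by (intro prod.cong refl arg_cong2[where f = "(^)"]) (use le in force)
    show "(\<Prod>j<n. of_nat (T (Suc i) j choose f j) * A $$ (Suc i, j) ^ f j * (s * A $$ (i, j)) ^ (T (Suc i) j - f j)) *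
       ((\<Prod>j<n. A $$ (i, j) ^ T i j) * R) =
       s ^ ((\<Sum>j<n. T (Suc i) j) - (\<Sum>j<n. f j)) * (\<Prod>j<n. of_nat (T (Suc i) j choose f j)) * monom_fun r n (shift i T f) A"
      unfolding m p s[symmetric] by (simp add: prod.distrib power_mult_distrib mult_ac)
  qed
  finally show ?thesis .
qed

lemma shift_exponents: "T \<in> exponents r n \<Longrightarrow> Suc i < r \<Longrightarrow> f \<in> lowerings n i T \<Longrightarrow> shift i T f \<in> exponents r n"
  by (auto simp: exponents_def shift_def lowerings_def)

lemma shift_eqD:
  assumes T: "T \<in> exponents r n" and i: "Suc i < r" and f: "f \<in> lowerings n i T" and eq: "shift i T f = shift i T0 b"
    and b: "\<And>j. b j \<le> T0 i j + T0 (Suc i) j"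
  shows "f = b" and "\<And>j. T i j + T (Suc i) j = T0 i j + T0 (Suc i) j" and "\<And>a j. a \<noteq> i \<Longrightarrow> a \<noteq> Suc i \<Longrightarrow> T a j = T0 a j"
proof -
  have e: "shift i T f a j = shift i T0 b a j" for a j using eq by simp
  have fb: "f j = b j" for j using e[of "Suc i" j] by (simp add: shift_def)
  then show "f = b" by auto
  show "T i j + T (Suc i) j = T0 i j + T0 (Suc i) j" for j
  proof -
    have "f j \<le> T (Suc i) j" using f by (cases "j < n") (auto simp: lowerings_def)
    then show ?thesis using e[of i j] b[of j] fb[of j] by (simp add: shift_def)
  qed
  show "T a j = T0 a j" if "a \<noteq> i" "a \<noteq> Suc i" for a j using e[of a j] that by (simp add: shift_def)
qed

text \<open>For \<open>m < q\<close> the coefficient of \<open>s ^ q\<close> vanishes identically; its monomials have the exponents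
  \<open>shift i T f\<close>, which depend on \<open>T\<close> only through the column sums of the two rows and the other rows.\<close>

lemma coefficient_relations:
  fixes c :: "(nat \<Rightarrow> nat \<Rightarrow> nat) \<Rightarrow> 'k :: field_char_0"
  assumes E: "finite E" "E \<subseteq> exponents r n" and i: "Suc i < r"
    and row: "\<And>T. T \<in> E \<Longrightarrow> (\<Sum>j<n. T (Suc i) j) = d"
    and deg: "\<And>A. A \<in> carrier_mat r n \<Longrightarrow>
       \<exists>P. degree P \<le> m \<and> (\<forall>s. (\<Sum>T\<in>E. c T * monom_fun r n T (rowadd r n i s A)) = poly P s)"
    and T0: "T0 \<in> E" and b: "m + (\<Sum>j<n. b j) < d"
  shows "(\<Sum>T\<in>{T \<in> E. (\<forall>j. T i j + T (Suc i) j = T0 i j + T0 (Suc i) j) \<and> (\<forall>a j. a \<noteq> i \<longrightarrow> a \<noteq> Suc i \<longrightarrow> T a j = T0 a j)}.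
     c T * (\<Prod>j<n. of_nat (T (Suc i) j choose b j))) = 0"
proof (cases "\<forall>j<n. b j \<le> T0 i j + T0 (Suc i) j")
  case False
  then obtain j where j: "j < n" "T0 i j + T0 (Suc i) j < b j" by (meson not_le)
  show ?thesis
  proof (rule sum.neutral, rule ballI)
    fix T assume "T \<in> {T \<in> E. (\<forall>j. T i j + T (Suc i) j = T0 i j + T0 (Suc i) j) \<and> (\<forall>a j. a \<noteq> i \<longrightarrow> a \<noteq> Suc i \<longrightarrow> T a j = T0 a j)}"
    then have "T i j + T (Suc i) j = T0 i j + T0 (Suc i) j" by blast
    then have "T (Suc i) j < b j" using j(2) by linarith
    then have "T (Suc i) j choose b j = 0" by (rule binomial_eq_0)
    then have "(\<Prod>j<n. of_nat (T (Suc i) j choose b j)) = (0 :: 'k)" using j(1) by (intro prod_zero) auto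
    then show "c T * (\<Prod>j<n. of_nat (T (Suc i) j choose b j)) = 0" by simp
  qed
next
  case True
  define b' where "b' j = (if j < n then b j else 0)" for j
  have b'le: "b' j \<le> T0 i j + T0 (Suc i) j" for j using True by (simp add: b'_def)
  have sb: "(\<Sum>j<n. b' j) = (\<Sum>j<n. b j)" by (simp add: b'_def)
  \<comment> \<open>The power of \<open>s\<close> belonging to \<open>b\<close>: the number of
    factors moved up when \<open>b\<close> of them stay behind. It exceeds the degree bound, so its
    coefficient is zero; \<open>W\<close> collects the terms contributing to it.\<close>
  define q where "q = d - (\<Sum>j<n. b j)"
  have q: "m < q" using b by (simp add: q_def)
  define W where "W = Sigma E (\<lambda>T. {f \<in> lowerings n i T. d - (\<Sum>j<n. f j) = q})"
  have finW: "finite W" unfolding W_def using E finite_lowerings by auto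
  define C where "C x = c (fst x) * (\<Prod>j<n. of_nat (fst x (Suc i) j choose snd x j))" for x
  let ?sh = "\<lambda>x. shift i (fst x) (snd x)"
  have coeff0: "(\<Sum>x\<in>W. C x * monom_fun r n (?sh x) A) = 0" if A: "A \<in> carrier_mat r n" for A
  proof -
    obtain P where P: "degree P \<le> m" "\<And>s. (\<Sum>T\<in>E. c T * monom_fun r n T (rowadd r n i s A)) = poly P s"
      using deg[OF A] by blast
    define X where "X = Sigma E (lowerings n i)"
    define Q where "Q = (\<Sum>x\<in>X. monom (C x * monom_fun r n (?sh x) A) (d - (\<Sum>j<n. snd x j)))"
    have "poly Q s = poly P s" for s
    proof -
      have "poly P s = (\<Sum>T\<in>E. \<Sum>f\<in>lowerings n i T. C (T, f) * monom_fun r n (shift i T f) A * s ^ (d - (\<Sum>j<n. f j)))"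
        unfolding P(2)[symmetric] monom_fun_rowadd[OF A i] sum_distrib_left
        by (intro sum.cong refl) (simp add: row C_def mult_ac)
      also have "\<dots> = poly Q s"
        unfolding Q_def X_def poly_sum poly_monom
        by (subst sum.Sigma) (use E finite_lowerings in \<open>auto simp: case_prod_beta\<close>)
      finally show ?thesis by simp
    qed
    then have "poly Q = poly P" by (rule ext)
    then have "Q = P" by (simp only: poly_eq_poly_eq_iff)
    then have "poly.coeff Q q = 0" using P(1) q by (auto intro: coeff_eq_0)
    moreover have "poly.coeff Q q = (\<Sum>x\<in>X. if d - (\<Sum>j<n. snd x j) = q then C x * monom_fun r n (?sh x) A else 0)"
      by (simp add: Q_def coeff_sum)
    moreover have "\<dots> = (\<Sum>x\<in>W. C x * monom_fun r n (?sh x) A)"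
    proof -
      have "W = {x \<in> X. d - (\<Sum>j<n. snd x j) = q}" by (auto simp: W_def X_def)
      moreover have "finite X" using E finite_lowerings by (auto simp: X_def)
      ultimately show ?thesis by (simp add: sum.inter_filter)
    qed
    ultimately show ?thesis by simp
  qed
  let ?T = "shift i T0 b'"
  let ?C = "\<lambda>T. \<Sum>x\<in>{x \<in> W. ?sh x = T}. C x"
  have c0: "?C T = 0" if T: "T \<in> ?sh ` W" for T
  proof (rule monom_fun_indep[where M = "?sh ` W" and r = r and n = n and c = ?C])
    show "?sh ` W \<subseteq> exponents r n" using shift_exponents[OF _ i] E by (auto simp: W_def)
    show "(\<Sum>T\<in>?sh ` W. ?C T * monom_fun r n T A) = 0" if A: "A \<in> carrier_mat r n" for A
    proof -
      have "(\<Sum>x\<in>W. C x * monom_fun r n (?sh x) A) = (\<Sum>T\<in>?sh ` W. \<Sum>x\<in>{x \<in> W. ?sh x = T}. C x * monom_fun r n (?sh x) A)"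
        by (rule sum.image_gen[OF finW])
      also have "\<dots> = (\<Sum>T\<in>?sh ` W. ?C T * monom_fun r n T A)"
        by (intro sum.cong refl) (simp add: sum_distrib_right)
      finally show ?thesis using coeff0[OF A] by simp
    qed
  qed (use finW T in auto)
  let ?S = "{T \<in> E. (\<forall>j. T i j + T (Suc i) j = T0 i j + T0 (Suc i) j) \<and> (\<forall>a j. a \<noteq> i \<longrightarrow> a \<noteq> Suc i \<longrightarrow> T a j = T0 a j)}"
  have "?C ?T = 0"
  proof (cases "?T \<in> ?sh ` W")
    case False
    then have "{x \<in> W. ?sh x = ?T} = {}" by force
    then show ?thesis by (metis (no_types, lifting) sum.empty)
  qed (rule c0)
  also have "?C ?T = (\<Sum>T\<in>{T \<in> ?S. b' \<in> lowerings n i T}. C (T, b'))"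
  proof (rule sum.reindex_bij_witness[of _ "\<lambda>T. (T, b')" fst])
    fix x assume x: "x \<in> {x \<in> W. ?sh x = ?T}"
    then have xx: "fst x \<in> E" "snd x \<in> lowerings n i (fst x)" "shift i (fst x) (snd x) = shift i T0 b'" by (auto simp: W_def)
    then have "fst x \<in> exponents r n" using E by auto
    note sh = shift_eqD[OF this i xx(2,3) b'le]
    show "(fst x, b') = x" using sh(1) by (metis prod.collapse)
    show "fst x \<in> {T \<in> ?S. b' \<in> lowerings n i T}" using xx sh by auto
    show "C (fst x, b') = C x" using sh(1) by (metis prod.collapse)
  next
    fix T assume T: "T \<in> {T \<in> ?S. b' \<in> lowerings n i T}"
    have "shift i T b' = shift i T0 b'"
      using T by (intro ext) (auto simp: shift_def)
    moreover have "d - (\<Sum>j<n. b' j) = q" by (simp add: q_def sb)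
    ultimately show "(T, b') \<in> {x \<in> W. ?sh x = ?T}" using T by (auto simp: W_def)
  qed auto
  also have "\<dots> = (\<Sum>T\<in>?S. c T * (\<Prod>j<n. of_nat (T (Suc i) j choose b j)))"
  proof (rule sum.mono_neutral_cong_left)
    show "finite ?S" using E by simp
    show "C (T, b') = c T * (\<Prod>j<n. of_nat (T (Suc i) j choose b j))" for T
      by (simp add: C_def b'_def)
    show "\<forall>T\<in>?S - {T \<in> ?S. b' \<in> lowerings n i T}. c T * (\<Prod>j<n. of_nat (T (Suc i) j choose b j)) = 0"
    proof
      fix T assume "T \<in> ?S - {T \<in> ?S. b' \<in> lowerings n i T}"
      then have "b' \<notin> lowerings n i T" by blast
      then obtain j where "j < n" "T (Suc i) j < b j" by (auto simp: lowerings_def b'_def split: if_splits)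
      then have "(\<Prod>j<n. of_nat (T (Suc i) j choose b j)) = (0 :: 'k)"
        using binomial_eq_0 by (intro prod_zero) auto
      then show "c T * (\<Prod>j<n. of_nat (T (Suc i) j choose b j)) = 0" by simp
    qed
  qed auto
  finally show ?thesis .
qed

text \<open>Expanding each \<open>g j\<close> in binomial coefficients gives a combination of the
  given relations, all of them with exponents at most \<open>N\<close>, hence within the range where
  the relations hold.\<close>

lemma binpoly_relations:
  fixes c :: "(nat \<Rightarrow> nat \<Rightarrow> nat) \<Rightarrow> 'k :: field_char_0"
  assumes rel: "\<And>b. m + (\<Sum>j<n. b j) < d \<Longrightarrow> (\<Sum>T\<in>S. c T * (\<Prod>j<n. of_nat (T (Suc i) j choose b j))) = 0"
    and g: "\<And>j. j < n \<Longrightarrow> binpoly (N j) (g j)" and N: "m + (\<Sum>j<n. N j) < d"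
  shows "(\<Sum>T\<in>S. c T * (\<Prod>j<n. g j (T (Suc i) j))) = 0"
proof -
  have "\<exists>e. \<forall>x. g j x = (\<Sum>k\<le>N j. e k * of_nat (x choose k))" if "j < n" for j
    using g[OF that] by (simp add: binpoly_def)
  then have "\<exists>e. \<forall>j<n. \<forall>x. g j x = (\<Sum>k\<le>N j. e j k * of_nat (x choose k))" by metis
  then obtain e where e: "\<And>j x. j < n \<Longrightarrow> g j x = (\<Sum>k\<le>N j. e j k * of_nat (x choose k))" by blast
  let ?L = "lowerings n i (\<lambda>_. N)"
  have 1: "(\<Prod>j<n. g j (T (Suc i) j)) = (\<Sum>f\<in>?L. (\<Prod>j<n. e j (f j)) * (\<Prod>j<n. of_nat (T (Suc i) j choose f j)))"
    for T :: "nat \<Rightarrow> nat \<Rightarrow> nat"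
  proof -
    have "(\<Prod>j<n. g j (T (Suc i) j)) = (\<Prod>j<n. \<Sum>k\<le>(\<lambda>_::nat. N) (Suc i) j. e j k * of_nat (T (Suc i) j choose k))"
      by (intro prod.cong refl) (simp add: e)
    also have "\<dots> = (\<Sum>f\<in>?L. \<Prod>j<n. e j (f j) * of_nat (T (Suc i) j choose f j))" by (rule prod_sum_lowerings)
    finally show ?thesis by (simp only: prod.distrib)
  qed
  have "(\<Sum>T\<in>S. c T * (\<Prod>j<n. g j (T (Suc i) j)))
     = (\<Sum>f\<in>?L. (\<Prod>j<n. e j (f j)) * (\<Sum>T\<in>S. c T * (\<Prod>j<n. of_nat (T (Suc i) j choose f j))))"
    unfolding 1 sum_distrib_left
    by (subst sum.swap) (intro sum.cong refl, simp only: mult.left_commute mult.assoc)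
  also have "\<dots> = 0"
  proof (rule sum.neutral, rule ballI)
    fix f assume "f \<in> ?L"
    then have "(\<Sum>j<n. f j) \<le> (\<Sum>j<n. N j)" by (intro sum_mono) (simp add: lowerings_def)
    then have "m + (\<Sum>j<n. f j) < d" using N by linarith
    then show "(\<Prod>j<n. e j (f j)) * (\<Sum>T\<in>S. c T * (\<Prod>j<n. of_nat (T (Suc i) j choose f j))) = 0"
      using rel by simp
  qed
  finally show ?thesis .
qed

text \<open>The relations are applied to a product of polynomials in the entries of row \<open>i + 1\<close> that vanishes at
  every exponent below \<open>T0\<close>: the first difference lies to the left of column \<open>q\<close>, where all larger values
  are roots, or else some entry to the right of column \<open>q\<close> is too small for its binomial coefficient.\<close>

lemma leading_exponent:
  fixes c :: "(nat \<Rightarrow> nat \<Rightarrow> nat) \<Rightarrow> 'k :: field_char_0"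
  assumes E: "finite E" "E \<subseteq> exponents r n" and i: "Suc i < r"
    and row: "\<And>T. T \<in> E \<Longrightarrow> (\<Sum>j<n. T (Suc i) j) = d"
    and deg: "\<And>A. A \<in> carrier_mat r n \<Longrightarrow>
       \<exists>P. degree P \<le> m \<and> (\<forall>s. (\<Sum>T\<in>E. c T * monom_fun r n T (rowadd r n i s A)) = poly P s)"
    and T0: "T0 \<in> E" "c T0 \<noteq> 0" and lead: "\<And>T. T \<in> E \<Longrightarrow> T \<noteq> T0 \<Longrightarrow> lexless r n T T0"
    and q: "q < n"
  shows "(\<Sum>j\<le>q. T0 (Suc i) j) \<le> m + (\<Sum>j<q. T0 i j)"
proof (rule ccontr)
  assume neg: "\<not> ?thesis"
  define S where "S = {T \<in> E. (\<forall>j. T i j + T (Suc i) j = T0 i j + T0 (Suc i) j) \<and> (\<forall>a j. a \<noteq> i \<longrightarrow> a \<noteq> Suc i \<longrightarrow> T a j = T0 a j)}"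
  \<comment> \<open>Left of \<open>q\<close> the roots are exactly the values above
    \<open>T0 (Suc i) j\<close> that the fixed column sum permits. Right of \<open>q\<close> the
    binomial coefficient vanishes on all values below \<open>T0 (Suc i) j\<close>.\<close>
  define g where "g j x = (if j < q then \<Prod>v\<in>{T0 (Suc i) j<..T0 (Suc i) j + T0 i j}. of_nat x - of_nat v
     else if j = q then 1 else of_nat (x choose T0 (Suc i) j) :: 'k)" for j x
  \<comment> \<open>The degrees of the factors \<open>g\<close>. Their sum plus \<open>m\<close> is
    below \<open>d\<close> exactly when the asserted inequality fails, so the relation is available
    under \<open>neg\<close>.\<close>
  define N where "N j = (if j < q then T0 i j else if j = q then 0 else T0 (Suc i) j)" for j
  have splitq: "(\<Sum>j<n. h j) = (\<Sum>j<q. h j) + (h q + (\<Sum>j\<in>{q<..<n}. h j))" for h :: "nat \<Rightarrow> nat"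
  proof -
    have "{..<n} = {..<q} \<union> insert q {q<..<n}" using q by auto
    moreover have "sum h ({..<q} \<union> insert q {q<..<n}) = sum h {..<q} + sum h (insert q {q<..<n})"
      by (rule sum.union_disjoint) auto
    ultimately show ?thesis by simp
  qed
  have sN: "(\<Sum>j<n. N j) = (\<Sum>j<q. T0 i j) + (\<Sum>j\<in>{q<..<n}. T0 (Suc i) j)"
    unfolding splitq by (simp add: N_def)
  have d: "d = (\<Sum>j\<le>q. T0 (Suc i) j) + (\<Sum>j\<in>{q<..<n}. T0 (Suc i) j)"
    using row[OF T0(1)] unfolding splitq by (simp add: lessThan_Suc_atMost[symmetric])
  have "(\<Sum>T\<in>S. c T * (\<Prod>j<n. g j (T (Suc i) j))) = 0"
  proof (rule binpoly_relations[where m = m and d = d and N = N])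
    show "m + (\<Sum>j<n. N j) < d" using neg sN d by linarith
    show "binpoly (N j) (g j)" for j
    proof -
      consider "j < q" | "j = q" | "q < j" by linarith
      then show ?thesis
      proof cases
        case 1
        have "card {T0 (Suc i) j<..T0 (Suc i) j + T0 i j} = N j" using 1 by (simp add: N_def)
        then show ?thesis
          using binpoly_prod[of "{T0 (Suc i) j<..T0 (Suc i) j + T0 i j}", where 'k = 'k] 1 by (simp add: g_def[abs_def])
      next
        case 2
        then show ?thesis using binpoly_choose[of 0 0 "1 :: 'k"] by (simp add: g_def[abs_def] N_def)
      next
        case 3
        then show ?thesis using binpoly_choose[of "N j" "N j" "1 :: 'k"] by (simp add: g_def[abs_def] N_def)
      qed
    qed
    show "(\<Sum>T\<in>S. c T * (\<Prod>j<n. of_nat (T (Suc i) j choose b j))) = 0" if "m + (\<Sum>j<n. b j) < d" for b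
      unfolding S_def using E i row deg T0(1) that by (rule coefficient_relations)
  qed
  moreover have "(\<Sum>T\<in>S. c T * (\<Prod>j<n. g j (T (Suc i) j))) = (\<Sum>T\<in>{T0}. c T * (\<Prod>j<n. g j (T (Suc i) j)))"
  proof (rule sum.mono_neutral_right)
    show "finite S" using E by (simp add: S_def)
    show "{T0} \<subseteq> S" using T0 by (simp add: S_def)
    show "\<forall>T\<in>S - {T0}. c T * (\<Prod>j<n. g j (T (Suc i) j)) = 0"
    proof
      fix T assume T: "T \<in> S - {T0}"
      then have TE: "T \<in> E" "T \<noteq> T0" and cs: "\<And>j. T i j + T (Suc i) j = T0 i j + T0 (Suc i) j"
        and ot: "\<And>a j. a \<noteq> i \<Longrightarrow> a \<noteq> Suc i \<Longrightarrow> T a j = T0 a j" by (auto simp: S_def)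
      obtain a j where aj: "a < r" "j < n" "T a j < T0 a j" "\<And>j'. j' < j \<Longrightarrow> T a j' = T0 a j'"
        "\<And>i' j'. i' < a \<Longrightarrow> j' < n \<Longrightarrow> T i' j' = T0 i' j'"
        using lead[OF TE] by (rule lexlessE) (rule that)
      have "a = i"
      proof (rule ccontr)
        assume ai: "a \<noteq> i"
        then have a: "a = Suc i" using ot aj(3) by (metis less_irrefl)
        then have "T i j = T0 i j" using aj(2,5) by simp
        then show False using cs[of j] aj(3) a by simp
      qed
      then have lt: "T0 (Suc i) j < T (Suc i) j" using cs[of j] aj(3) by simp
      have eq: "T (Suc i) j' = T0 (Suc i) j'" if "j' < j"
        for j' using cs[of j'] aj(4)[of j'] that \<open>a = i\<close> by simp
      have "\<exists>j'<n. g j' (T (Suc i) j') = 0"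
      proof (cases "j < q")
        case True
        have "T (Suc i) j \<in> {T0 (Suc i) j<..T0 (Suc i) j + T0 i j}" using lt cs[of j] by simp
        then have "g j (T (Suc i) j) = 0" using True by (simp add: g_def)
        then show ?thesis using aj(2) by blast
      next
        case False
        \<comment> \<open>Row \<open>Suc i\<close> has the same total \<open>d\<close> in
          \<open>T\<close> and in \<open>T0\<close>, so the excess in column \<open>j\<close> is
          made up by a deficit further right, beyond column \<open>q\<close> since \<open>j\<close>
          is at least \<open>q\<close>.\<close>
        have "\<exists>j'\<in>{..<n} - {..<Suc j}. T (Suc i) j' < T0 (Suc i) j'"
        proof (rule ccontr)
          assume "\<not> ?thesis"
          then have le: "T0 (Suc i) j' \<le> T (Suc i) j'" if "j' < n" for j'
            using that lt eq by (metis DiffI lessThan_iff less_SucE less_imp_le order_refl not_less)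
          have "(\<Sum>j'<n. T0 (Suc i) j') < (\<Sum>j'<n. T (Suc i) j')"
            by (rule sum_strict_mono_ex1) (use le lt aj(2) in auto)
          then show False using row[OF TE(1)] row[OF T0(1)] by simp
        qed
        then obtain j' where j': "j' < n" "j < j'" "T (Suc i) j' < T0 (Suc i) j'" by auto
        then have "g j' (T (Suc i) j') = 0" using False by (simp add: g_def binomial_eq_0)
        then show ?thesis using j' by blast
      qed
      then have "(\<Prod>j<n. g j (T (Suc i) j)) = 0" by (intro prod_zero) auto
      then show "c T * (\<Prod>j<n. g j (T (Suc i) j)) = 0" by simp
    qed
  qed
  moreover have "g j (T0 (Suc i) j) \<noteq> 0" for j
    by (auto simp: g_def)
  ultimately show False using T0(2) by simp
qed

section \<open>The polynomials of a skew shape\<close>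

definition rowscale :: "nat \<Rightarrow> nat \<Rightarrow> nat \<Rightarrow> 'k :: field \<Rightarrow> 'k mat \<Rightarrow> 'k mat" where
  "rowscale r n i c A = mat r n (\<lambda>(a, b). if a = i then c * A $$ (a, b) else A $$ (a, b))"

lemma monom_fun_rowscale:
  assumes "i < r"
  shows "monom_fun r n T (rowscale r n i c A) = c ^ (\<Sum>j<n. T i j) * monom_fun r n T A"
proof -
  have "monom_fun r n T (rowscale r n i c A) = (\<Prod>a<r. (if a = i then c ^ (\<Sum>j<n. T i j) else 1) * (\<Prod>j<n. A $$ (a, j) ^ T a j))"
    unfolding monom_fun_def
    by (intro prod.cong refl) (auto simp: rowscale_def power_mult_distrib prod.distrib power_sum)
  then show ?thesis using assms by (simp add: prod.distrib monom_fun_def)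
qed

definition multidegree :: "nat \<Rightarrow> nat \<Rightarrow> (nat \<Rightarrow> nat) \<Rightarrow> (nat \<Rightarrow> nat \<Rightarrow> nat) set" where
  "multidegree r n d = {T \<in> exponents r n. \<forall>i<r. (\<Sum>j<n. T i j) = d i}"

lemma finite_multidegree: "finite (multidegree r n d)"
proof -
  have "multidegree r n d \<subseteq> (\<lambda>f i j. if i < r \<and> j < n then f (i, j) else 0) ` (\<Pi>\<^sub>E x\<in>{..<r} \<times> {..<n}. {..d (fst x)})"
  proof
    fix T assume T: "T \<in> multidegree r n d"
    have "T i j \<le> d i" if "i < r" "j < n" for i j
    proof -
      have "T i j \<le> (\<Sum>j<n. T i j)" using that by (intro member_le_sum) auto
      then show ?thesis using T that by (simp add: multidegree_def)
    qed
    then show "T \<in> (\<lambda>f i j. if i < r \<and> j < n then f (i, j) else 0) ` (\<Pi>\<^sub>E x\<in>{..<r} \<times> {..<n}. {..d (fst x)})"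
      using T by (intro image_eqI[of _ _ "restrict (\<lambda>(i, j). T i j) ({..<r} \<times> {..<n})"])
        (auto simp: multidegree_def exponents_def fun_eq_iff)
  qed
  then show ?thesis by (rule finite_subset) (intro finite_imageI finite_PiE, auto)
qed

text \<open>Scaling by the single number 2 suffices: its powers are distinct in characteristic zero,
  so comparing coefficients removes every monomial of another degree in some row.\<close>

lemma multihomogeneous:
  fixes p :: "'k :: field_char_0 mat \<Rightarrow> 'k"
  assumes p: "p \<in> poly_funs r n"
    and hom: "\<And>A i. A \<in> carrier_mat r n \<Longrightarrow> i < r \<Longrightarrow> p (rowscale r n i 2 A) = 2 ^ d i * p A"
  shows "\<exists>c. \<forall>A. p A = (\<Sum>T\<in>multidegree r n d. c T * monom_fun r n T A)"
proof -
  obtain M c where M: "finite M" "M \<subseteq> exponents r n" "\<And>A. p A = (\<Sum>T\<in>M. c T * monom_fun r n T A)"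
    using poly_funs_monomials[OF p] by auto
  have z: "c T = 0" if T: "T \<in> M" and nT: "T \<notin> multidegree r n d" for T
  proof -
    obtain i where i: "i < r" "(\<Sum>j<n. T i j) \<noteq> d i" using T nT M(2) by (auto simp: multidegree_def)
    have "c T * (2 ^ (\<Sum>j<n. T i j) - 2 ^ d i) = 0"
    proof (rule monom_fun_indep[OF M(1,2) _ T])
      fix A :: "'k mat" assume A: "A \<in> carrier_mat r n"
      show "(\<Sum>T\<in>M. c T * (2 ^ (\<Sum>j<n. T i j) - 2 ^ d i) * monom_fun r n T A) = 0"
        using hom[OF A i(1)] unfolding M(3) monom_fun_rowscale[OF i(1)]
        by (simp add: algebra_simps sum_subtractf sum_distrib_left)
    qed
    then show "c T = 0" using i(2) power_two_inject by auto
  qed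
  show ?thesis
  proof (intro exI allI)
    fix A
    show "p A = (\<Sum>T\<in>multidegree r n d. (if T \<in> M then c T else 0) * monom_fun r n T A)"
      unfolding M(3)
      by (rule sum.mono_neutral_cong) (use M(1) finite_multidegree z in auto)
  qed
qed

lemma lexless_max:
  assumes "finite E" "E \<noteq> {}" "E \<subseteq> exponents r n"
  shows "\<exists>T0\<in>E. \<forall>T\<in>E. T \<noteq> T0 \<longrightarrow> lexless r n T T0"
  using assms
proof (induction E rule: finite_ne_induct)
  case (insert x F)
  then obtain T0 where T0: "T0 \<in> F" "\<And>T. T \<in> F \<Longrightarrow> T \<noteq> T0 \<Longrightarrow> lexless r n T T0" by auto
  have "x \<noteq> T0" using insert T0 by auto
  then consider "lexless r n x T0" | "lexless r n T0 x"
    using lexless_total[of x r n T0] insert.prems T0(1) by auto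
  then show ?case
  proof cases
    case 1
    then show ?thesis using T0 by (intro bexI[of _ T0]) auto
  next
    case 2
    then have "lexless r n T x" if "T \<in> F" for T
      using T0(2)[OF that] lexless_trans[of r n T T0 x] by (cases "T = T0") auto
    then show ?thesis by (intro bexI[of _ x]) auto
  qed
qed simp

text \<open>The termination measure of the reduction. Cancelling the leading exponent may create new
  lower exponents, so the support itself need not shrink, but its closure downwards does.\<close>

definition downset :: "nat \<Rightarrow> nat \<Rightarrow> (nat \<Rightarrow> nat \<Rightarrow> nat) set \<Rightarrow> ((nat \<Rightarrow> nat \<Rightarrow> nat) \<Rightarrow> 'k :: zero) \<Rightarrow> (nat \<Rightarrow> nat \<Rightarrow> nat) set" where
  "downset r n X c = {S \<in> X. \<exists>T\<in>X. c T \<noteq> 0 \<and> (S = T \<or> lexless r n S T)}"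

lemma card_downset_less:
  assumes X: "finite X" and T0: "T0 \<in> X" "c T0 \<noteq> 0" and d: "\<And>T. T \<in> X \<Longrightarrow> d T \<noteq> 0 \<Longrightarrow> lexless r n T T0"
  shows "card (downset r n X d) < card (downset r n X c)"
proof (rule psubset_card_mono)
  show "finite (downset r n X c)" using X by (simp add: downset_def)
  have *: "lexless r n S T0" if S: "S \<in> downset r n X d" for S
  proof -
    from S have "\<exists>T\<in>X. d T \<noteq> 0 \<and> (S = T \<or> lexless r n S T)" by (simp add: downset_def)
    then show ?thesis
    proof (elim bexE conjE disjE)
      fix T assume "T \<in> X" "d T \<noteq> 0" "S = T"
      then show ?thesis using d[of T] by simp
    next
      fix T assume "T \<in> X" "d T \<noteq> 0" "lexless r n S T"
      then show ?thesis using d[of T] lexless_trans[of r n S T T0] by simp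
    qed
  qed
  have "downset r n X d \<subseteq> downset r n X c"
  proof
    fix S assume S: "S \<in> downset r n X d"
    then have "S \<in> X" by (simp add: downset_def)
    then show "S \<in> downset r n X c" using *[OF S] T0 by (auto simp: downset_def)
  qed
  moreover have "T0 \<notin> downset r n X d" using *[of T0] lexless_irrefl[of r n T0] by auto
  moreover have "T0 \<in> downset r n X c" using T0 by (auto simp: downset_def)
  ultimately show "downset r n X d \<subset> downset r n X c" by auto
qed

section \<open>Column strict fillings of a skew shape as leading exponents\<close>

context boxes begin

lemma lowmat_rowadd:
  assumes i: "Suc i < r" and A: "A \<in> carrier_mat r n"
  shows "rowadd r n i s A = lowmat i s * A"
proof (rule eq_matI)
  fix a b assume ab: "a < dim_row (lowmat i s * A)" "b < dim_col (lowmat i s * A)"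
  then have a: "a < r" and b: "b < n" using A by (auto simp: lowmat_def)
  have "(lowmat i s * A) $$ (a, b) = (\<Sum>j<r. lowmat i s $$ (a, j) * A $$ (j, b))"
    using a b A by (simp add: lowmat_def scalar_prod_def atLeast0LessThan)
  also have "\<dots> = (\<Sum>j<r. (if j = a then A $$ (a, b) else 0) + (if j = i then (if a = Suc i then s * A $$ (i, b) else 0) else 0))"
    by (intro sum.cong refl) (use a in \<open>auto simp: lowmat_def\<close>)
  also have "\<dots> = rowadd r n i s A $$ (a, b)"
    using a b i by (simp add: sum.distrib rowadd_def)
  finally show "rowadd r n i s A $$ (a, b) = (lowmat i s * A) $$ (a, b)" by simp
qed (use A in \<open>auto simp: rowadd_def lowmat_def\<close>)

end

locale skew_shape = boxes +
  fixes lam mu :: "nat \<Rightarrow> int"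
  assumes anti_lam: "i \<le> j \<Longrightarrow> j < r \<Longrightarrow> lam j \<le> lam i"
    and anti_mu: "i \<le> j \<Longrightarrow> j < r \<Longrightarrow> mu j \<le> mu i"
    and lam_le_mu: "i < r \<Longrightarrow> lam i \<le> mu i"
    and shape: "(\<lambda>k. (rw k, cl k)) ` B = {(i, c). i < r \<and> lam i < c \<and> c \<le> mu i}"
begin

definition len :: "nat \<Rightarrow> nat" where "len i = nat (mu i - lam i)"

definition gap :: "nat \<Rightarrow> nat" where "gap i = nat (lam i - lam (Suc i))"

lemma box_bounds: "k \<in> B \<Longrightarrow> lam (rw k) < cl k" "k \<in> B \<Longrightarrow> cl k \<le> mu (rw k)"
proof -
  assume "k \<in> B"
  then have "(rw k, cl k) \<in> {(i, c). i < r \<and> lam i < c \<and> c \<le> mu i}" unfolding shape[symmetric] by blast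
  then show "lam (rw k) < cl k" "cl k \<le> mu (rw k)" by auto
qed

lemma box_ex:
  assumes "i < r" "lam i < c" "c \<le> mu i"
  obtains k where "k \<in> B" "rw k = i" "cl k = c"
proof -
  have "(i, c) \<in> (\<lambda>k. (rw k, cl k)) ` B" unfolding shape using assms by blast
  then show ?thesis using that by auto
qed

lemma card_row_segment:
  assumes i: "i < r" and ab: "0 \<le> a" "a \<le> b" "b \<le> mu i - lam i"
  shows "card {k \<in> B. rw k = i \<and> a < cl k - lam i \<and> cl k - lam i \<le> b} = nat (b - a)"
proof -
  let ?S = "{k \<in> B. rw k = i \<and> a < cl k - lam i \<and> cl k - lam i \<le> b}"
  have "inj_on cl ?S" by (rule inj_onI) (use box_inj in auto)
  then have "card (cl ` ?S) = card ?S" by (rule card_image)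
  moreover have "cl ` ?S = {lam i + a <.. lam i + b}"
  proof (intro subset_antisym subsetI)
    fix c assume c: "c \<in> {lam i + a <.. lam i + b}"
    obtain k where "k \<in> B" "rw k = i" "cl k = c" by (rule box_ex[OF i, of c]) (use c ab in auto)
    then show "c \<in> cl ` ?S" using c by (intro image_eqI[of _ _ k]) auto
  qed auto
  ultimately show ?thesis by simp
qed

lemma card_row: "i < r \<Longrightarrow> card {k \<in> B. rw k = i} = len i"
proof -
  assume i: "i < r"
  have "{k \<in> B. rw k = i} = {k \<in> B. rw k = i \<and> 0 < cl k - lam i \<and> cl k - lam i \<le> mu i - lam i}"
    using box_bounds by auto
  then show ?thesis using card_row_segment[OF i, of 0 "mu i - lam i"] lam_le_mu[OF i] by (simp add: len_def)
qed

lemma pfun_csym_basis: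
  fixes A :: "'k :: field mat"
  assumes I: "I \<in> idx n B"
  shows "pfun B rw n (csym B cl (\<lambda>J. if J = I then c else 0)) A
    = (\<Sum>\<sigma>\<in>fib_perms B cl. c * of_int (sign \<sigma>) * monom_fun r n (fcontent B rw (I \<circ> \<sigma>)) A)"
proof -
  have "pfun B rw n (csym B cl (\<lambda>J. if J = I then c else 0)) A
      = (\<Sum>J\<in>idx n B. csym B cl (\<lambda>J. \<Prod>k\<in>B. A $$ (rw k, J k)) J * (if J = I then c else 0))"
    unfolding pfun_def by (rule fsym_adjoint[OF fin perm_char_sign])
  also have "\<dots> = c * csym B cl (\<lambda>J. \<Prod>k\<in>B. A $$ (rw k, J k)) I"
    using I fin by (simp add: if_distrib[of "\<lambda>x. _ * x"] cong: if_cong)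
  also have "\<dots> = (\<Sum>\<sigma>\<in>fib_perms B cl. c * of_int (sign \<sigma>) * monom_fun r n (fcontent B rw (I \<circ> \<sigma>)) A)"
    unfolding fsym_def sum_distrib_left
  proof (rule sum.cong[OF refl])
    fix \<sigma> assume s: "\<sigma> \<in> fib_perms B cl"
    have "I \<circ> \<sigma> \<in> idx n B" using idx_comp_iff[OF fib_perms_permutes[OF s]] I by blast
    then have "(\<Prod>k\<in>B. A $$ (rw k, (I \<circ> \<sigma>) k)) = monom_fun r n (fcontent B rw (I \<circ> \<sigma>)) A"
      by (rule prod_fcontent[OF fin]) (rule rw_less)
    then show "c * (of_int (sign \<sigma>) * (\<Prod>k\<in>B. A $$ (rw k, (I \<circ> \<sigma>) k))) = c * of_int (sign \<sigma>) * monom_fun r n (fcontent B rw (I \<circ> \<sigma>)) A"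
      by (simp only: mult.assoc)
  qed
  finally show ?thesis .
qed

definition col_strict :: "(nat \<Rightarrow> nat) \<Rightarrow> bool" where
  "col_strict I \<longleftrightarrow> (\<forall>k\<in>B. \<forall>k'\<in>B. cl k = cl k' \<longrightarrow> rw k < rw k' \<longrightarrow> I k < I k')"

text \<open>The columns of a skew shape have no gaps because \<open>lam\<close> and
  \<open>mu\<close> are antitone, so strictness between vertical neighbours propagates along a
  column.\<close>

lemma col_strictI:
  assumes step: "\<And>k k'. k \<in> B \<Longrightarrow> k' \<in> B \<Longrightarrow> cl k = cl k' \<Longrightarrow> rw k' = Suc (rw k) \<Longrightarrow> I k < I k'"
  shows "col_strict I"
proof -
  have "\<forall>k\<in>B. \<forall>k'\<in>B. cl k = cl k' \<longrightarrow> rw k' = rw k + Suc e \<longrightarrow> I k < I k'" for e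
  proof (induction e)
    case 0
    then show ?case using step by simp
  next
    case (Suc e)
    show ?case
    proof (intro ballI impI)
      fix k k' assume k: "k \<in> B" "k' \<in> B" "cl k = cl k'" "rw k' = rw k + Suc (Suc e)"
      have r: "rw k' < r" using rw_less k by blast
      have l: "lam (Suc (rw k)) < cl k"
        using box_bounds(1)[OF k(1)] anti_lam[of "rw k" "Suc (rw k)"] r k(4) by linarith
      have m: "cl k \<le> mu (Suc (rw k))"
        using box_bounds(2)[OF k(2)] anti_mu[of "Suc (rw k)" "rw k'"] r k(3,4) by linarith
      obtain k'' where k'': "k'' \<in> B" "rw k'' = Suc (rw k)" "cl k'' = cl k"
        by (rule box_ex[OF _ l m]) (use r k(4) in auto)
      have "I k < I k''" using step k'' k(1) by simp
      also have "I k'' < I k'" using Suc.IH k'' k by simp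
      finally show "I k < I k'" .
    qed
  qed
  then show ?thesis unfolding col_strict_def by (metis less_iff_Suc_add add_Suc_right)
qed

text \<open>Take the topmost row \<open>i\<close> in which \<open>\<sigma>\<close> moves a box.
  Boxes above are fixed, so each moved box of row \<open>i\<close> receives the entry of a lower box
  of its column, which is larger. The smallest entry \<open>j\<close> among the moved boxes then
  occurs less often in row \<open>i\<close> than before, and smaller entries as often as
  before.\<close>

lemma col_strict_leading:
  assumes I: "I \<in> idx n B" and st: "col_strict I" and s: "\<sigma> \<in> fib_perms B cl" "\<sigma> \<noteq> id"
  shows "lexless r n (fcontent B rw (I \<circ> \<sigma>)) (fcontent B rw I)"
proof -
  note p = fib_perms_permutes[OF s(1)]
  have "\<exists>k. \<sigma> k \<noteq> k" using s(2) by (auto simp: fun_eq_iff)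
  then have ex: "\<exists>i. \<exists>k\<in>B. rw k = i \<and> \<sigma> k \<noteq> k" using permutes_not_in[OF p] by metis
  define i where "i = (LEAST i. \<exists>k\<in>B. rw k = i \<and> \<sigma> k \<noteq> k)"
  have i: "\<exists>k\<in>B. rw k = i \<and> \<sigma> k \<noteq> k" unfolding i_def by (rule LeastI_ex) (rule ex)
  have fix_: "\<sigma> k = k" if "k \<in> B" "rw k < i" for k
    using not_less_Least[OF that(2)[unfolded i_def]] that(1) by blast
  define Mv where "Mv = {k \<in> B. rw k = i \<and> \<sigma> k \<noteq> k}"
  have Mv: "finite Mv" "Mv \<noteq> {}" using i fin by (auto simp: Mv_def)
  have up: "I k < I (\<sigma> k)" if k: "k \<in> Mv" for k
  proof -
    have kB: "k \<in> B" "rw k = i" "\<sigma> k \<noteq> k" using k by (auto simp: Mv_def)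
    have sB: "\<sigma> k \<in> B" using permutes_in_image[OF p] kB by blast
    have c: "cl (\<sigma> k) = cl k" using s(1) kB by (auto simp: fib_perms_def)
    have "\<sigma> (\<sigma> k) \<noteq> \<sigma> k" using permutes_inj[OF p] kB(3) by (metis injD)
    then have "\<not> rw (\<sigma> k) < i" using fix_[OF sB] by blast
    moreover have "rw (\<sigma> k) \<noteq> i" using box_inj[OF sB kB(1)] c kB(2,3) by auto
    ultimately have "rw k < rw (\<sigma> k)" using kB by simp
    then show ?thesis using st kB sB c by (simp add: col_strict_def)
  qed
  define j where "j = Min (I ` Mv)"
  have j: "j \<in> I ` Mv" unfolding j_def by (rule Min_in) (use Mv in auto)
  have jle: "j \<le> I k" if "k \<in> Mv" for k unfolding j_def by (rule Min_le) (use Mv that in auto)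
  obtain k0 where k0: "k0 \<in> Mv" "I k0 = j" using j by blast
  have k0B: "k0 \<in> B" "rw k0 = i" "\<sigma> k0 \<noteq> k0" using k0 by (auto simp: Mv_def)
  have sub: "I (\<sigma> k) = j' \<Longrightarrow> j' \<le> j \<Longrightarrow> k \<in> B \<Longrightarrow> rw k = i \<Longrightarrow> \<sigma> k = k" for k j'
    using up[of k] jle[of k] by (force simp: Mv_def)
  show ?thesis unfolding lexless_def
  proof (intro exI conjI allI impI)
    show "i < r" using rw_less k0B by blast
    show "j < n" using idx_less[OF I k0B(1)] k0 by simp
    show "fcontent B rw (I \<circ> \<sigma>) i j < fcontent B rw I i j"
      unfolding fcontent_def
    proof (rule psubset_card_mono)
      show "{k \<in> B. rw k = i \<and> (I \<circ> \<sigma>) k = j} \<subset> {k \<in> B. rw k = i \<and> I k = j}"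
      proof
        show "{k \<in> B. rw k = i \<and> (I \<circ> \<sigma>) k = j} \<subseteq> {k \<in> B. rw k = i \<and> I k = j}"
          using sub by fastforce
        have "I (\<sigma> k0) \<noteq> j" using up[OF k0(1)] k0(2) by simp
        then show "{k \<in> B. rw k = i \<and> (I \<circ> \<sigma>) k = j} \<noteq> {k \<in> B. rw k = i \<and> I k = j}"
          using k0B k0(2) by auto
      qed
    qed (use fin in simp)
    show "fcontent B rw (I \<circ> \<sigma>) i j' = fcontent B rw I i j'" if "j' < j" for j'
    proof -
      have "{k \<in> B. rw k = i \<and> (I \<circ> \<sigma>) k = j'} = {k \<in> B. rw k = i \<and> I k = j'}"
      proof (intro Collect_cong conj_cong refl)
        fix k assume k: "k \<in> B" "rw k = i"
        show "((I \<circ> \<sigma>) k = j') = (I k = j')"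
        proof (cases "\<sigma> k = k")
          case False
          then have "k \<in> Mv" using k by (simp add: Mv_def)
          then show ?thesis using up[of k] jle[of k] that by simp
        qed simp
      qed
      then show ?thesis by (simp add: fcontent_def)
    qed
    show "fcontent B rw (I \<circ> \<sigma>) i' j' = fcontent B rw I i' j'" if "i' < i" for i' j'
    proof -
      have "{k \<in> B. rw k = i' \<and> (I \<circ> \<sigma>) k = j'} = {k \<in> B. rw k = i' \<and> I k = j'}"
        using fix_ that by (intro Collect_cong conj_cong refl) auto
      then show ?thesis by (simp add: fcontent_def)
    qed
  qed
qed

lemma box_above:
  assumes k: "k' \<in> B" "rw k' = Suc i" and c: "lam i < cl k'"
  obtains k where "k \<in> B" "rw k = i" "cl k = cl k'"
proof -
  have r: "Suc i < r" using rw_less[OF k(1)] k(2) by simp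
  have "cl k' \<le> mu i" using box_bounds(2)[OF k(1)] anti_mu[of i "Suc i"] r k(2) by simp
  then show ?thesis using box_ex[of i "cl k'"] c r that by auto
qed

text \<open>The power of \<open>s\<close> counts the boxes of row \<open>Suc i\<close> filled with
  \<open>i\<close>. Such a box has no box of the shape directly above it, since that one would carry
  \<open>i\<close> too; it lies in one of the \<open>gap i\<close> columns between
  \<open>lam (Suc i)\<close> and \<open>lam i\<close>.\<close>

lemma pfun_rowadd:
  fixes A :: "'k :: field_char_0 mat"
  assumes i: "Suc i < r" and A: "A \<in> carrier_mat r n"
  shows "\<exists>P. degree P \<le> gap i \<and> (\<forall>s. pfun B rw n (csym B cl y) (rowadd r n i s A) = poly P s)"
proof -
  let ?z = "csym B cl (tmul B A y)"
  have lowA: "rowadd r n i s A = lowmat i s * A" for s by (rule lowmat_rowadd[OF i A])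
  have lc: "lowmat i s \<in> carrier_mat r r" for s :: 'k by (simp add: lowmat_def)
  have e: "pfun B rw n (csym B cl y) (rowadd r n i s A) = (\<Sum>J\<in>idx r B. ?z J * (\<Prod>k\<in>B. lowmat i s $$ (rw k, J k)))" for s
    unfolding lowA pfun_mult[OF lc A] fsym_tmul[OF fin] by (simp add: pfun_def mult.commute)
  have "\<exists>P. degree P \<le> gap i \<and> (\<forall>s. ?z J * (\<Prod>k\<in>B. lowmat i s $$ (rw k, J k)) = poly P s)"
    if J: "J \<in> idx r B" for J
  proof (cases "col_inj J")
    case False
    then show ?thesis by (intro exI[of _ 0]) (simp add: csym_zero)
  next
    case inj: True
    define R where "R = {k \<in> B. rw k = Suc i \<and> J k = i}"
    have ent: "lowmat i s $$ (rw k, J k) = (if rw k = J k then 1 else if k \<in> R then s else 0)"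
      if "k \<in> B" for s :: 'k and k
      using that idx_less[OF J] rw_less by (simp add: lowmat_def R_def)
    have "\<exists>P :: 'k poly. degree P \<le> gap i \<and> (\<forall>s. (\<Prod>k\<in>B. lowmat i s $$ (rw k, J k)) = poly P s)"
    proof (cases "\<forall>k\<in>B. rw k = J k \<or> k \<in> R")
      case False
      then obtain k where k: "k \<in> B" "rw k \<noteq> J k" "k \<notin> R" by blast
      then have "(\<Prod>k\<in>B. lowmat i s $$ (rw k, J k)) = 0" for s :: 'k
        using fin ent[OF k(1)] by (intro prod_zero) auto
      then show ?thesis by (intro exI[of _ 0]) simp
    next
      case all: True
      have p: "(\<Prod>k\<in>B. lowmat i s $$ (rw k, J k)) = s ^ card R" for s :: 'k
      proof -
        have "(\<Prod>k\<in>B. lowmat i s $$ (rw k, J k)) = (\<Prod>k\<in>B. if k \<in> R then s else 1)"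
          using all ent by (intro prod.cong refl) (auto simp: R_def)
        also have "\<dots> = (\<Prod>k\<in>R. s)"
          using fin by (simp add: prod.If_cases R_def Collect_conj_eq Int_assoc[symmetric])
        finally show ?thesis by simp
      qed
      have "cl ` R \<subseteq> {lam (Suc i)<..lam i}"
      proof
        fix c assume "c \<in> cl ` R"
        then obtain k where k: "k \<in> B" "rw k = Suc i" "J k = i" "c = cl k" by (auto simp: R_def)
        have "\<not> lam i < c"
        proof
          assume "lam i < c"
          then obtain k' where k': "k' \<in> B" "rw k' = i" "cl k' = cl k"
            using box_above[OF k(1,2)] k(4) by metis
          have "k' \<notin> R" using k' by (simp add: R_def)
          then have "J k' = i" using all k' by auto
          moreover have "k \<noteq> k'" using k k' by auto
          ultimately show False using inj k k' unfolding col_inj_def by metis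
        qed
        then show "c \<in> {lam (Suc i)<..lam i}" using box_bounds(1)[OF k(1)] k by simp
      qed
      moreover have "inj_on cl R" by (rule inj_onI) (use box_inj in \<open>auto simp: R_def\<close>)
      ultimately have "card R \<le> card {lam (Suc i)<..lam i}"
        by (intro card_inj_on_le) auto
      then have "card R \<le> gap i" by (simp add: gap_def)
      then show ?thesis
        using p by (intro exI[of _ "monom 1 (card R)"]) (auto simp: poly_monom intro: order.trans[OF degree_monom_le])
    qed
    then show ?thesis by (rule poly_bounded_scale)
  qed
  then show ?thesis unfolding e by (rule poly_bounded_sum)
qed

text \<open>The exponents satisfying the inequalities of \<open>leading_exponent\<close> are the contents of the column
  strict fillings.\<close>

lemma filling:
  assumes T: "T \<in> multidegree r n len"
    and ineq: "\<And>i q. Suc i < r \<Longrightarrow> q < n \<Longrightarrow> (\<Sum>j\<le>q. T (Suc i) j) \<le> gap i + (\<Sum>j<q. T i j)"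
  obtains I where "I \<in> idx n B" "col_strict I" "fcontent B rw I = T"
proof -
  \<comment> \<open>Each row is filled weakly increasingly, with \<open>T i j\<close> copies of
    \<open>j\<close>; so \<open>S i q\<close> is the number of positions of row \<open>i\<close>
    with an entry below \<open>q\<close>.\<close>
  define S where "S i q = int (\<Sum>j<q. T i j)" for i q
  have mono: "S i q \<le> S i q'" if "q \<le> q'" for i q q'
    unfolding S_def of_nat_le_iff by (rule sum_mono2) (use that in auto)
  have Sn: "S i n = mu i - lam i" if "i < r" for i
    using T that lam_le_mu[OF that] by (simp add: S_def multidegree_def len_def)
  have S0: "S i 0 = 0" for i by (simp add: S_def)
  define pos where "pos k = cl k - lam (rw k)" for k
  have pos1: "1 \<le> pos k" if "k \<in> B" for k using box_bounds(1)[OF that] by (simp add: pos_def)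
  \<comment> \<open>The entry at a position of its row: the unique \<open>j\<close> for which the
    position lies after the first \<open>S (rw k) j\<close> ones and within the first
    \<open>S (rw k) (Suc j)\<close>.\<close>
  define f where "f k = (LEAST j. pos k \<le> S (rw k) (Suc j))" for k
  have exn: "pos k \<le> S (rw k) n" if "k \<in> B" for k
    using Sn[OF rw_less[OF that]] box_bounds(2)[OF that] by (simp add: pos_def)
  have npos: "0 < n" if "k \<in> B" for k
  proof (rule ccontr)
    assume "\<not> 0 < n"
    then show False using exn[OF that] pos1[OF that] S0 by simp
  qed
  have exn': "pos k \<le> S (rw k) (Suc (n - 1))" if "k \<in> B" for k
    using exn[OF that] npos[OF that] by simp
  have f1: "pos k \<le> S (rw k) (Suc (f k))" if "k \<in> B" for k
    unfolding f_def by (rule LeastI[where P = "\<lambda>j. pos k \<le> S (rw k) (Suc j)"]) (rule exn'[OF that])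
  have f_le: "f k \<le> j" if "pos k \<le> S (rw k) (Suc j)" for k j
    unfolding f_def by (rule Least_le) (rule that)
  have f2: "S (rw k) (f k) < pos k" if "k \<in> B" for k
  proof (cases "f k")
    case 0
    then show ?thesis using pos1[OF that] S0 by simp
  next
    case (Suc q)
    then have "\<not> pos k \<le> S (rw k) (Suc q)" using f_le[of k q] by auto
    then show ?thesis using Suc by simp
  qed
  have f_eq: "f k = j \<longleftrightarrow> S (rw k) j < pos k \<and> pos k \<le> S (rw k) (Suc j)" if "k \<in> B" for k j
  proof
    assume *: "S (rw k) j < pos k \<and> pos k \<le> S (rw k) (Suc j)"
    then have "f k \<le> j" using f_le by blast
    moreover have "\<not> f k < j"
    proof
      assume "f k < j"
      then have "S (rw k) (Suc (f k)) \<le> S (rw k) j" by (intro mono) simp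
      then show False using f1[OF that] * by simp
    qed
    ultimately show "f k = j" by simp
  qed (use f1[OF that] f2[OF that] in auto)
  have fn: "f k < n" if "k \<in> B" for k using f_le[OF exn'[OF that]] npos[OF that] by simp
  define I where "I = restrict f B"
  have If: "I k = f k" if "k \<in> B" for k using that by (simp add: I_def)
  have "I \<in> idx n B" using fn by (auto simp: I_def idx_def)
  moreover have "col_strict I"
  proof (rule col_strictI)
    fix k k' assume k: "k \<in> B" "k' \<in> B" "cl k = cl k'" "rw k' = Suc (rw k)"
    have r: "Suc (rw k) < r" using rw_less[OF k(2)] k(4) by simp
    \<comment> \<open>Boxes in one column have positions that differ by the gap. The assumed
      inequality at \<open>q = f k'\<close> absorbs this gap and places \<open>pos k\<close> among
      the positions with entries below \<open>f k'\<close>.\<close>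
    have g: "int (gap (rw k)) = lam (rw k) - lam (Suc (rw k))"
      using anti_lam[of "rw k" "Suc (rw k)"] r by (simp add: gap_def)
    have "pos k' \<le> S (Suc (rw k)) (Suc (f k'))" using f1[OF k(2)] k(4) by simp
    also have "\<dots> \<le> int (gap (rw k) + (\<Sum>j<f k'. T (rw k) j))"
      unfolding S_def of_nat_le_iff using ineq[OF r fn[OF k(2)]] by (simp only: lessThan_Suc_atMost)
    finally have le: "pos k \<le> S (rw k) (f k')" using g k(3,4) by (simp add: pos_def S_def)
    have "f k' \<noteq> 0"
    proof
      assume "f k' = 0"
      then show False using le S0[of "rw k"] pos1[OF k(1)] by simp
    qed
    then obtain q where q: "f k' = Suc q" by (cases "f k'") simp_all
    then have "f k \<le> q" using f_le le by simp
    then show "I k < I k'" using q If k by simp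
  qed
  moreover have "fcontent B rw I = T"
  proof (intro ext)
    fix i j
    show "fcontent B rw I i j = T i j"
    proof (cases "i < r \<and> j < n")
      case True
      have "{k \<in> B. rw k = i \<and> I k = j} = {k \<in> B. rw k = i \<and> S i j < cl k - lam i \<and> cl k - lam i \<le> S i (Suc j)}"
      proof (rule Collect_cong)
        fix k
        show "(k \<in> B \<and> rw k = i \<and> I k = j) = (k \<in> B \<and> rw k = i \<and> S i j < cl k - lam i \<and> cl k - lam i \<le> S i (Suc j))"
        proof (cases "k \<in> B \<and> rw k = i")
          case True
          then show ?thesis using If[of k] f_eq[of k j] unfolding pos_def by simp
        qed auto
      qed
      moreover have "card \<dots> = nat (S i (Suc j) - S i j)"
        by (rule card_row_segment) (use True mono[of j "Suc j" i] mono[of "Suc j" n i] mono[of 0 j i] S0 Sn in auto)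
      moreover have "S i (Suc j) - S i j = int (T i j)" by (simp add: S_def)
      ultimately show ?thesis by (simp add: fcontent_def)
    next
      case False
      have "fcontent B rw I \<in> exponents r n" by (rule fcontent_exponents[OF \<open>I \<in> idx n B\<close> rw_less])
      then show ?thesis using False T by (simp add: exponents_def multidegree_def)
    qed
  qed
  ultimately show ?thesis by (rule that)
qed

definition admissible :: "nat \<Rightarrow> ((nat \<Rightarrow> nat \<Rightarrow> nat) \<Rightarrow> 'k :: field_char_0) \<Rightarrow> bool" where
  "admissible n c \<longleftrightarrow> (\<forall>i A. Suc i < r \<longrightarrow> A \<in> carrier_mat r n \<longrightarrow>
     (\<exists>P. degree P \<le> gap i \<and> (\<forall>s. (\<Sum>T\<in>multidegree r n len. c T * monom_fun r n T (rowadd r n i s A)) = poly P s)))"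

lemma fcontent_multidegree:
  assumes I: "I \<in> idx n B"
  shows "fcontent B rw I \<in> multidegree r n len"
proof -
  have "(\<Sum>j<n. fcontent B rw I i j) = len i" if "i < r" for i
  proof -
    have "(\<Sum>j<n. fcontent B rw I i j) = (\<Sum>j<n. card {k \<in> {k \<in> B. rw k = i}. I k = j})"
      by (simp add: fcontent_def)
    also have "\<dots> = card {k \<in> B. rw k = i}"
      using sum.group[of "{k \<in> B. rw k = i}" "{..<n}" I "\<lambda>_. 1 :: nat"] fin idx_less[OF I] by auto
    finally show ?thesis using card_row[OF that] by simp
  qed
  then show ?thesis using fcontent_exponents[OF I rw_less] by (simp add: multidegree_def)
qed

text \<open>Reduction by leading terms. The leading exponent \<open>T0\<close> is the content of a
  column strict filling \<open>I\<close>; the polynomial of the antisymmetrized basis tensor of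
  \<open>I\<close> is admissible too and has leading exponent \<open>T0\<close> with coefficient 1.
  Subtracting \<open>c T0\<close> times this polynomial decreases the measure.\<close>

lemma admissible_spanned:
  fixes c :: "(nat \<Rightarrow> nat \<Rightarrow> nat) \<Rightarrow> 'k :: field_char_0"
  assumes "admissible n c"
  shows "\<exists>t. \<forall>A. (\<Sum>T\<in>multidegree r n len. c T * monom_fun r n T A) = pfun B rw n (csym B cl t) A"
  using assms
proof (induction "card (downset r n (multidegree r n len) c)" arbitrary: c rule: less_induct)
  case less
  let ?X = "multidegree r n len"
  define E where "E = {T \<in> ?X. c T \<noteq> 0}"
  have E: "finite E" using finite_multidegree[of r n len] by (simp add: E_def)
  have "E \<subseteq> exponents r n" by (auto simp: E_def multidegree_def)
  note E = E this
  have sE: "(\<Sum>T\<in>?X. c T * monom_fun r n T A) = (\<Sum>T\<in>E. c T * monom_fun r n T A)" for A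
    by (rule sum.mono_neutral_right) (use finite_multidegree in \<open>auto simp: E_def\<close>)
  show ?case
  proof (cases "E = {}")
    case True
    have "(\<Sum>T\<in>?X. c T * monom_fun r n T A) = pfun B rw n (csym B cl (\<lambda>_. 0)) A" for A
      unfolding sE by (simp add: True pfun_def)
    then show ?thesis by blast
  next
    case False
    obtain T0 where T0: "T0 \<in> E" "\<And>T. T \<in> E \<Longrightarrow> T \<noteq> T0 \<Longrightarrow> lexless r n T T0"
      using lexless_max[OF E(1) False E(2)] by auto
    have T0X: "T0 \<in> ?X" "c T0 \<noteq> 0" using T0(1) by (auto simp: E_def)
    have ineq: "(\<Sum>j\<le>q. T0 (Suc i) j) \<le> gap i + (\<Sum>j<q. T0 i j)" if i: "Suc i < r" and q: "q < n" for i q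
    proof (rule leading_exponent[OF E i, where c = c and d = "len (Suc i)"])
      show "(\<Sum>j<n. T (Suc i) j) = len (Suc i)" if "T \<in> E" for T
        using that i by (simp add: E_def multidegree_def)
      show "\<exists>P. degree P \<le> gap i \<and> (\<forall>s. (\<Sum>T\<in>E. c T * monom_fun r n T (rowadd r n i s A)) = poly P s)"
        if "A \<in> carrier_mat r n" for A
        using less.prems i that unfolding admissible_def sE by blast
    qed (use T0 T0X q in auto)
    obtain I where I: "I \<in> idx n B" "col_strict I" "fcontent B rw I = T0"
      using filling[OF T0X(1) ineq] by blast
    let ?e = "\<lambda>J. if J = I then c T0 else 0"
    let ?g = "\<lambda>\<sigma>. fcontent B rw (I \<circ> \<sigma>)"
    define c' where "c' T = (\<Sum>\<sigma>\<in>{\<sigma> \<in> fib_perms B cl. ?g \<sigma> = T}. c T0 * of_int (sign \<sigma>))" for T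
    have gX: "?g \<sigma> \<in> ?X" if "\<sigma> \<in> fib_perms B cl" for \<sigma>
      using fcontent_multidegree idx_comp_iff[OF fib_perms_permutes[OF that]] I(1) by blast
    have c'sum: "(\<Sum>T\<in>?X. c' T * monom_fun r n T A) = pfun B rw n (csym B cl ?e) A" for A
      unfolding pfun_csym_basis[OF I(1)]
      using sum.group[OF finite_fib_perms[OF fin] finite_multidegree, of ?g cl r n len "\<lambda>\<sigma>. c T0 * of_int (sign \<sigma>) * monom_fun r n (?g \<sigma>) A", symmetric]
        gX by (simp add: c'_def sum_distrib_right image_subset_iff)
    have gid: "?g \<sigma> = T0 \<longleftrightarrow> \<sigma> = id" if "\<sigma> \<in> fib_perms B cl" for \<sigma>
    proof
      assume "?g \<sigma> = T0"
      then show "\<sigma> = id"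
        using col_strict_leading[OF I(1,2) that] I(3) lexless_irrefl[of r n T0] by (cases "\<sigma> = id") simp_all
    qed (use I(3) in simp)
    have "{\<sigma> \<in> fib_perms B cl. ?g \<sigma> = T0} = {id}"
    proof (intro subset_antisym subsetI)
      fix \<sigma> assume "\<sigma> \<in> {\<sigma> \<in> fib_perms B cl. ?g \<sigma> = T0}"
      then show "\<sigma> \<in> {id}" using gid[of \<sigma>] by simp
    next
      fix \<sigma> :: "nat \<Rightarrow> nat" assume "\<sigma> \<in> {id}"
      then show "\<sigma> \<in> {\<sigma> \<in> fib_perms B cl. ?g \<sigma> = T0}" using id_fib_perms[of B cl] I(3) by simp
    qed
    then have c'T0: "c' T0 = c T0" by (simp add: c'_def)
    have c'less: "lexless r n T T0" if "c' T \<noteq> 0" "T \<noteq> T0" for T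
    proof -
      have "{\<sigma> \<in> fib_perms B cl. ?g \<sigma> = T} \<noteq> {}"
      proof
        assume "{\<sigma> \<in> fib_perms B cl. ?g \<sigma> = T} = {}"
        then have "c' T = 0" unfolding c'_def by (simp only: sum.empty)
        then show False using that(1) by simp
      qed
      then obtain \<sigma> where s: "\<sigma> \<in> fib_perms B cl" "?g \<sigma> = T" by auto
      then have "\<sigma> \<noteq> id" using gid[OF s(1)] that(2) by simp
      then show ?thesis using col_strict_leading[OF I(1,2) s(1)] s(2) I(3) by simp
    qed
    let ?c = "\<lambda>T. c T - c' T"
    have sub: "(\<Sum>T\<in>?X. ?c T * monom_fun r n T A) = (\<Sum>T\<in>?X. c T * monom_fun r n T A) - pfun B rw n (csym B cl ?e) A" for A
      by (simp add: c'sum[symmetric] left_diff_distrib sum_subtractf)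
    have adm: "admissible n ?c" unfolding admissible_def
    proof (intro allI impI)
      fix i and A :: "'k mat" assume i: "Suc i < r" and A: "A \<in> carrier_mat r n"
      obtain P where P: "degree P \<le> gap i" "\<And>s. (\<Sum>T\<in>?X. c T * monom_fun r n T (rowadd r n i s A)) = poly P s"
        using less.prems i A unfolding admissible_def by blast
      obtain Q where Q: "degree Q \<le> gap i" "\<And>s. pfun B rw n (csym B cl ?e) (rowadd r n i s A) = poly Q s"
        using pfun_rowadd[OF i A] by blast
      show "\<exists>P. degree P \<le> gap i \<and> (\<forall>s. (\<Sum>T\<in>?X. ?c T * monom_fun r n T (rowadd r n i s A)) = poly P s)"
        unfolding sub P(2) Q(2) using P(1) Q(1) by (intro exI[of _ "P - Q"]) (auto intro: degree_diff_le)
    qed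
    have cless: "lexless r n T T0" if "T \<in> ?X" "?c T \<noteq> 0" for T
    proof (cases "T = T0")
      case True
      then show ?thesis using that c'T0 by simp
    next
      case False
      then show ?thesis using that T0(2)[of T] c'less[of T] by (cases "c T = 0") (auto simp: E_def)
    qed
    have "card (downset r n ?X ?c) < card (downset r n ?X c)"
      using finite_multidegree T0X cless by (rule card_downset_less)
    from less.hyps[OF this adm] obtain t where
      t: "\<And>A. (\<Sum>T\<in>?X. ?c T * monom_fun r n T A) = pfun B rw n (csym B cl t) A" by blast
    have "(\<Sum>T\<in>?X. c T * monom_fun r n T A) = pfun B rw n (csym B cl (\<lambda>J. t J + ?e J)) A" for A
    proof -
      have "pfun B rw n (csym B cl (\<lambda>J. t J + ?e J)) A = pfun B rw n (csym B cl t) A + pfun B rw n (csym B cl ?e) A"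
        unfolding pfun_def by (simp only: fsym_add distrib_left sum.distrib)
      then show ?thesis using sub[of A] t[of A] by simp
    qed
    then show ?thesis by blast
  qed
qed

theorem skew_spanning:
  fixes p :: "'k :: field_char_0 mat \<Rightarrow> 'k"
  assumes p: "p \<in> poly_funs r n"
    and hom: "\<And>A i. A \<in> carrier_mat r n \<Longrightarrow> i < r \<Longrightarrow> p (rowscale r n i 2 A) = 2 ^ len i * p A"
    and deg: "\<And>A i. A \<in> carrier_mat r n \<Longrightarrow> Suc i < r \<Longrightarrow>
       \<exists>P. degree P \<le> gap i \<and> (\<forall>s. p (rowadd r n i s A) = poly P s)"
  shows "\<exists>t. \<forall>A. p A = pfun B rw n (csym B cl t) A"
proof -
  obtain c where c: "\<And>A. p A = (\<Sum>T\<in>multidegree r n len. c T * monom_fun r n T A)"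
    using multihomogeneous[where d = len, OF p hom] by blast
  have "admissible n c" using deg unfolding admissible_def c by blast
  from admissible_spanned[OF this] show ?thesis unfolding c .
qed

end

section \<open>Equivariance of the embeddings and coefficients of lowering matrices\<close>

context boxes begin

lemma lowmat_mult:
  assumes i: "Suc i < r"
  shows "lowmat i s * lowmat i t = lowmat i (s + t)"
proof (rule eq_matI)
  fix a b assume "a < dim_row (lowmat i (s + t))" "b < dim_col (lowmat i (s + t))"
  then have a: "a < r" and b: "b < r" by (simp_all add: lowmat_def)
  have "(lowmat i s * lowmat i t) $$ (a, b) = (\<Sum>j<r. lowmat i s $$ (a, j) * lowmat i t $$ (j, b))"
    using a b by (simp add: lowmat_def scalar_prod_def atLeast0LessThan)
  also have "\<dots> = (\<Sum>j<r. (if j = a then lowmat i t $$ (a, b) else 0) + (if j = i then (if a = Suc i then s * lowmat i t $$ (i, b) else 0) else 0))"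
    by (intro sum.cong refl) (use a in \<open>auto simp: lowmat_def\<close>)
  also have "\<dots> = lowmat i (s + t) $$ (a, b)"
    using a b i by (simp add: sum.distrib) (auto simp: lowmat_def)
  finally show "(lowmat i s * lowmat i t) $$ (a, b) = lowmat i (s + t) $$ (a, b)" .
qed (simp_all add: lowmat_def)

lemma lowmat_unitri: "lower_unitri r (lowmat i s)"
  by (auto simp: lower_unitri_def lowmat_def)

lemma lowmat_GL: "lowmat i s \<in> GL r"
  by (rule lower_unitri_GL[OF lowmat_unitri])

lemma lowmat_inverse: "Suc i < r \<Longrightarrow> lowmat i s * lowmat i (- s) = 1\<^sub>m r"
  by (simp add: lowmat_mult) (auto simp: lowmat_def)

end

context hw_rep begin

lemma emb_zero: "emb (0\<^sub>v l) = (\<lambda>I. 0)"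
proof -
  have "0 \<cdot>\<^sub>v 0\<^sub>v l = (0\<^sub>v l :: 'k vec)" by (intro eq_vecI) auto
  then show ?thesis using emb_smult[of "0\<^sub>v l" 0] by simp
qed

lemma demb_zero: "demb (0\<^sub>v l) = (\<lambda>I. 0)"
proof -
  have "0 \<cdot>\<^sub>v 0\<^sub>v l = (0\<^sub>v l :: 'k vec)" by (intro eq_vecI) auto
  then show ?thesis using demb_smult[of "0\<^sub>v l" 0] by simp
qed

lemma emb_act:
  assumes g: "g \<in> GL r" and x: "x \<in> carrier_vec l"
  shows "emb (\<rho> g *\<^sub>v x) = tmul B g (emb x)"
  using x
proof (induction rule: orbit_induct)
  case zero
  have "\<rho> g *\<^sub>v 0\<^sub>v l = 0\<^sub>v l" using rho_carrier[OF g] by (intro eq_vecI) (auto simp: scalar_prod_def)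
  then show ?case by (simp add: emb_zero tmul_zero)
next
  case (step x h c)
  have "\<rho> g *\<^sub>v (c \<cdot>\<^sub>v (\<rho> h *\<^sub>v v) + x) = c \<cdot>\<^sub>v (\<rho> (g * h) *\<^sub>v v) + \<rho> g *\<^sub>v x"
    using step g v by (simp add: act_add act_smult act_mult)
  moreover have "emb (\<rho> (g * h) *\<^sub>v v) = tmul B g (emb (\<rho> h *\<^sub>v v))"
    using emb_orbit[OF GL_mult[OF g step(2)]] emb_orbit[OF step(2)]
      tmul_mult[OF fin GL_carrier[OF g] GL_carrier[OF step(2)]] by simp
  ultimately show ?case
    using step g v GL_mult[OF g step(2)] by (simp add: emb_add emb_smult tmul_add tmul_scale)
qed

lemma dual_orbit_induct [consumes 1, case_names zero step]:
  assumes x: "x \<in> carrier_vec l" and "P (0\<^sub>v l)"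
    and st: "\<And>x g c. x \<in> carrier_vec l \<Longrightarrow> g \<in> GL r \<Longrightarrow> P x \<Longrightarrow> P (c \<cdot>\<^sub>v (transpose_mat (\<rho> g) *\<^sub>v \<omega>) + x)"
  shows "P x"
proof -
  let ?R = "(\<lambda>g. transpose_mat (\<rho> g) *\<^sub>v \<omega>) ` GL r"
  have R: "?R \<subseteq> carrier_vec l"
    using rho_carrier \<omega>_carrier by (auto intro!: mult_mat_vec_carrier[of _ l l])
  have "x \<in> vspan l ?R" using x by (simp add: dual_orbit_span)
  then show ?thesis
  proof induction
    case (step x q c)
    then obtain g where "g \<in> GL r" "q = transpose_mat (\<rho> g) *\<^sub>v \<omega>" by auto
    then show ?case using st[OF vspan_carrier[OF R step(1)]] step by simp
  qed (rule assms(2))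
qed

lemma dual_act_carrier: "g \<in> GL r \<Longrightarrow> x \<in> carrier_vec l \<Longrightarrow> transpose_mat (\<rho> g) *\<^sub>v x \<in> carrier_vec l"
  using rho_carrier[of g] by (intro mult_mat_vec_carrier[of _ l l]) auto

lemma demb_act:
  assumes g: "g \<in> GL r" and x: "x \<in> carrier_vec l"
  shows "demb (transpose_mat (\<rho> g) *\<^sub>v x) = tmul B (transpose_mat g) (demb x)"
  using x
proof (induction rule: dual_orbit_induct)
  case zero
  have "transpose_mat (\<rho> g) *\<^sub>v 0\<^sub>v l = 0\<^sub>v l" using rho_carrier[OF g] by (intro eq_vecI) (auto simp: scalar_prod_def)
  then show ?case by (simp add: demb_zero tmul_zero)
next
  case (step x h c)
  note gc = rho_carrier[OF g] and hc = rho_carrier[OF step(2)]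
  have t: "transpose_mat (\<rho> (h * g)) = transpose_mat (\<rho> g) * transpose_mat (\<rho> h)"
    using rho_mult[OF step(2) g] transpose_mult[OF hc gc] by simp
  have "transpose_mat (\<rho> g) *\<^sub>v (c \<cdot>\<^sub>v (transpose_mat (\<rho> h) *\<^sub>v \<omega>) + x)
     = c \<cdot>\<^sub>v (transpose_mat (\<rho> (h * g)) *\<^sub>v \<omega>) + transpose_mat (\<rho> g) *\<^sub>v x"
    unfolding t using gc hc step(1) \<omega>_carrier dual_act_carrier[OF step(2) \<omega>_carrier]
    by (simp add: mult_add_distrib_mat_vec[of _ l l] mult_mat_vec[of _ l l] assoc_mult_mat_vec[of _ l l _ l])
  moreover have "demb (transpose_mat (\<rho> (h * g)) *\<^sub>v \<omega>) = tmul B (transpose_mat g) (demb (transpose_mat (\<rho> h) *\<^sub>v \<omega>))"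
    using demb_orbit[OF GL_mult[OF step(2) g]] demb_orbit[OF step(2)]
      transpose_mult[OF GL_carrier[OF step(2)] GL_carrier[OF g]]
      tmul_mult[OF fin, of "transpose_mat g" r r "transpose_mat h" r] GL_carrier[OF g] GL_carrier[OF step(2)] by simp
  ultimately show ?case
    using step g dual_act_carrier[OF GL_mult[OF step(2) g] \<omega>_carrier] dual_act_carrier[OF step(2) \<omega>_carrier]
      dual_act_carrier[OF g]
    by (simp add: demb_add demb_smult tmul_add tmul_scale)
qed

lemma emb_expand:
  assumes "x \<in> carrier_vec l"
  shows "emb x I = (\<Sum>q<l. emb (unit_vec l q) I * x $ q)"
proof -
  have "emb x I = vec l (\<lambda>i. emb (unit_vec l i) I) \<bullet> x"
    by (rule linear_functional_vec[of l "\<lambda>x. emb x I"]) (use assms in \<open>simp_all add: emb_add emb_smult\<close>)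
  then show ?thesis using assms by (simp add: scalar_prod_def atLeast0LessThan)
qed

lemma demb_expand:
  assumes "x \<in> carrier_vec l"
  shows "demb x I = (\<Sum>q<l. demb (unit_vec l q) I * x $ q)"
proof -
  have "demb x I = vec l (\<lambda>i. demb (unit_vec l i) I) \<bullet> x"
    by (rule linear_functional_vec[of l "\<lambda>x. demb x I"]) (use assms in \<open>simp_all add: demb_add demb_smult\<close>)
  then show ?thesis using assms by (simp add: scalar_prod_def atLeast0LessThan)
qed

text \<open>The dual module is spanned by the translates of \<open>\<omega>\<close>, and for the
  translate by g the coefficient is \<open>\<Delta> (g * lowmat i s)\<close>, whose degree is
  bounded by the number of free boxes.\<close>

lemma lowmat_coefficient:
  assumes i: "Suc i < r" and x: "x \<in> carrier_vec l"
  shows "\<exists>P. degree P \<le> card (free_boxes i) \<and> (\<forall>s. x \<bullet> (\<rho> (lowmat i s) *\<^sub>v v) = poly P s)"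
  using x
proof (induction rule: dual_orbit_induct)
  case zero
  have "0\<^sub>v l \<bullet> (\<rho> (lowmat i s) *\<^sub>v v) = 0" for s
    using act_carrier[OF lowmat_GL v(1)] by simp
  then show ?case by (intro exI[of _ 0]) simp
next
  case (step x g c)
  obtain P where P: "degree P \<le> card (free_boxes i)" "\<And>s. \<Delta> (g * lowmat i s) = poly P s"
    using \<Delta>_lowmat[OF i GL_carrier[OF step(2)]] by blast
  obtain Q where Q: "degree Q \<le> card (free_boxes i)" "\<And>s. x \<bullet> (\<rho> (lowmat i s) *\<^sub>v v) = poly Q s"
    using step(3) by blast
  have "(c \<cdot>\<^sub>v (transpose_mat (\<rho> g) *\<^sub>v \<omega>) + x) \<bullet> (\<rho> (lowmat i s) *\<^sub>v v) = poly ([:c:] * P + Q) s" for s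
  proof -
    note y = act_carrier[OF lowmat_GL[of i s] v(1)]
    have "(transpose_mat (\<rho> g) *\<^sub>v \<omega>) \<bullet> (\<rho> (lowmat i s) *\<^sub>v v) = \<Delta> (g * lowmat i s)"
      using transpose_vec_mult_scalar[OF rho_carrier[OF step(2)] y \<omega>_carrier]
        act_mult[OF step(2) lowmat_GL v(1)] \<omega>_act[OF GL_mult[OF step(2) lowmat_GL]] by simp
    then show ?thesis
      using y step(1) dual_act_carrier[OF step(2) \<omega>_carrier] P(2) Q(2)
      by (simp add: add_scalar_prod_distrib[of _ l])
  qed
  moreover have "degree ([:c:] * P + Q) \<le> card (free_boxes i)"
    using P(1) Q(1) by (intro degree_add_le) (auto intro: order.trans[OF Polynomial.degree_smult_le])
  ultimately show ?case by blast
qed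

end

section \<open>Tensors on a disjoint union of boxes\<close>

definition tpair :: "nat \<Rightarrow> nat set \<Rightarrow> ((nat \<Rightarrow> nat) \<Rightarrow> 'k :: field) \<Rightarrow> ((nat \<Rightarrow> nat) \<Rightarrow> 'k) \<Rightarrow> 'k" where
  "tpair n B y z = (\<Sum>K\<in>idx n B. y K * z K)"

text \<open>The tensor product of two tensors, as a tensor on the union of their box sets.\<close>

definition tjoin :: "nat set \<Rightarrow> nat set \<Rightarrow> ((nat \<Rightarrow> nat) \<Rightarrow> 'k :: field) \<Rightarrow> ((nat \<Rightarrow> nat) \<Rightarrow> 'k) \<Rightarrow> (nat \<Rightarrow> nat) \<Rightarrow> 'k" where
  "tjoin B C y z K = y (restrict K B) * z (restrict K C)"

lemma restrict_idx: "K \<in> idx n B \<Longrightarrow> C \<subseteq> B \<Longrightarrow> restrict K C \<in> idx n C"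
  by (auto simp: idx_def)

lemma sum_idx_Un:
  assumes "B \<inter> C = {}"
  shows "(\<Sum>K\<in>idx n (B \<union> C). f (restrict K B) (restrict K C)) = (\<Sum>I\<in>idx n B. \<Sum>J\<in>idx n C. f I J)"
proof -
  have "(\<Sum>K\<in>idx n (B \<union> C). f (restrict K B) (restrict K C)) = (\<Sum>x\<in>idx n B \<times> idx n C. f (fst x) (snd x))"
  proof (rule sum.reindex_bij_witness[of _ "\<lambda>x k. if k \<in> B then fst x k else snd x k" "\<lambda>K. (restrict K B, restrict K C)"])
    fix K assume K: "K \<in> idx n (B \<union> C)"
    show "(\<lambda>k. if k \<in> B then fst (restrict K B, restrict K C) k else snd (restrict K B, restrict K C) k) = K"
      using K by (auto simp: idx_def PiE_iff extensional_def fun_eq_iff)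
    show "(restrict K B, restrict K C) \<in> idx n B \<times> idx n C" using K by (auto intro: restrict_idx)
    show "f (fst (restrict K B, restrict K C)) (snd (restrict K B, restrict K C)) = f (restrict K B) (restrict K C)" by simp
  next
    fix x assume x: "x \<in> idx n B \<times> idx n C"
    have "restrict (\<lambda>k. if k \<in> B then fst x k else snd x k) B = fst x"
      using x by (auto simp: idx_def PiE_iff extensional_def fun_eq_iff)
    moreover have "restrict (\<lambda>k. if k \<in> B then fst x k else snd x k) C = snd x"
      using x assms by (auto simp: idx_def PiE_iff extensional_def fun_eq_iff)
    ultimately show "(restrict (\<lambda>k. if k \<in> B then fst x k else snd x k) B, restrict (\<lambda>k. if k \<in> B then fst x k else snd x k) C) = x"
      by simp
    show "(\<lambda>k. if k \<in> B then fst x k else snd x k) \<in> idx n (B \<union> C)"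
      using x by (auto simp: idx_def PiE_iff extensional_def)
  qed
  then show ?thesis by (simp add: sum.cartesian_product case_prod_beta)
qed

lemma tmul_tjoin:
  assumes fin: "finite B" "finite C" and BC: "B \<inter> C = {}" and I: "I \<in> idx (dim_row A) (B \<union> C)"
  shows "tmul (B \<union> C) A (tjoin B C y z) I = tjoin B C (tmul B A y) (tmul C A z) I"
proof -
  have r: "restrict I B \<in> idx (dim_row A) B" "restrict I C \<in> idx (dim_row A) C"
    using I by (auto intro: restrict_idx)
  have "tmul (B \<union> C) A (tjoin B C y z) I
     = (\<Sum>K\<in>idx (dim_col A) (B \<union> C). ((\<Prod>k\<in>B. A $$ (I k, restrict K B k)) * y (restrict K B)) *
          ((\<Prod>k\<in>C. A $$ (I k, restrict K C k)) * z (restrict K C)))"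
  proof -
    have "(\<Prod>k\<in>B \<union> C. A $$ (I k, K k)) = (\<Prod>k\<in>B. A $$ (I k, restrict K B k)) * (\<Prod>k\<in>C. A $$ (I k, restrict K C k))" for K
      using prod.union_disjoint[OF fin BC] by simp
    then show ?thesis using I by (simp add: tmul_def tjoin_def mult_ac)
  qed
  also have "\<dots> = (\<Sum>J\<in>idx (dim_col A) B. \<Sum>J'\<in>idx (dim_col A) C. ((\<Prod>k\<in>B. A $$ (I k, J k)) * y J) * ((\<Prod>k\<in>C. A $$ (I k, J' k)) * z J'))"
    by (rule sum_idx_Un[OF BC])
  also have "\<dots> = tjoin B C (tmul B A y) (tmul C A z) I"
    using r by (simp add: tjoin_def tmul_def sum_product)
  finally show ?thesis .
qed

lemma tpair_cong: "(\<And>K. K \<in> idx n B \<Longrightarrow> y K = y' K) \<Longrightarrow> (\<And>K. K \<in> idx n B \<Longrightarrow> z K = z' K) \<Longrightarrow> tpair n B y z = tpair n B y' z'"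
  unfolding tpair_def by (rule sum.cong) auto

lemma fib_perms_mono:
  assumes "B \<subseteq> C" "\<sigma> \<in> fib_perms B f"
  shows "\<sigma> \<in> fib_perms C f"
proof -
  have p: "\<sigma> permutes B" using assms(2) by (rule fib_perms_permutes)
  have "f (\<sigma> k) = f k" if "k \<in> C" for k
    using assms(2) permutes_not_in[OF p, of k] by (cases "k \<in> B") (auto simp: fib_perms_def)
  then show ?thesis using permutes_subset[OF p assms(1)] by (simp add: fib_perms_def)
qed

section \<open>Equivariant matrix functions\<close>

text \<open>A bundle homomorphism read in frames. The transformation law between the frames
  \<open>A\<close> and \<open>g * A\<close> is stated as an equality of products, which avoids the
  inverse of \<open>\<rho> g\<close>.\<close>

definition equivariant :: "nat \<Rightarrow> nat \<Rightarrow> nat \<Rightarrow> nat \<Rightarrow> ('k :: field mat \<Rightarrow> 'k mat) \<Rightarrow> ('k mat \<Rightarrow> 'k mat) \<Rightarrow> ('k mat \<Rightarrow> 'k mat) \<Rightarrow> bool" where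
  "equivariant r n l m \<rho> \<sigma> F \<longleftrightarrow> (\<forall>A\<in>surj_mats r n. F A \<in> carrier_mat m l) \<and>
     (\<forall>i<m. \<forall>j<l. regular_on r n (surj_mats r n) (\<lambda>A. F A $$ (i, j))) \<and>
     (\<forall>A\<in>surj_mats r n. \<forall>g\<in>GL r. F (g * A) * \<rho> g = \<sigma> g * F A)"

lemma surj_mats_carrier: "A \<in> surj_mats r n \<Longrightarrow> A \<in> carrier_mat r n"
  by (simp add: surj_mats_def)

lemma surj_mats_GL:
  fixes A :: "'k :: field mat"
  assumes A: "A \<in> surj_mats r n" and g: "g \<in> GL r"
  shows "g * A \<in> surj_mats r n"
proof -
  obtain C where C: "C \<in> carrier_mat n r" "A * C = 1\<^sub>m r" using surj_mats_right_inverse[OF A] .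
  note Ac = surj_mats_carrier[OF A] and gc = GL_carrier[OF g]
  have "g * A * C = g" using Ac gc C by (simp add: assoc_mult_mat[of g r r A n C r])
  then show ?thesis using surj_matsI[of "g * A" r n C] Ac gc C(1) g by simp
qed

lemma mat_eqI_scalar:
  fixes P Q :: "'k :: field mat"
  assumes P: "P \<in> carrier_mat m l" and Q: "Q \<in> carrier_mat m l"
    and eq: "\<And>x y. x \<in> carrier_vec l \<Longrightarrow> y \<in> carrier_vec m \<Longrightarrow> y \<bullet> (P *\<^sub>v x) = y \<bullet> (Q *\<^sub>v x)"
  shows "P = Q"
proof (rule eq_matI)
  fix i j assume "i < dim_row Q" "j < dim_col Q"
  then have ij: "i < m" "j < l" using Q by auto
  have "unit_vec m i \<bullet> (R *\<^sub>v unit_vec l j) = R $$ (i, j)" if "R \<in> carrier_mat m l" for R :: "'k mat"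
    using that ij scalar_prod_left_unit[of "R *\<^sub>v unit_vec l j" m i] by simp
  then show "P $$ (i, j) = Q $$ (i, j)" using eq[of "unit_vec l j" "unit_vec m i"] P Q by simp
qed (use P Q in auto)

text \<open>The three diagrams live in one numbering, with that of \<open>mu\<close> the disjoint
  union of the other two. The last assumption lists the two situations that parts bounded by n - r
  permit: for n = r the diagram of \<open>mu\<close> is empty.\<close>

locale hom_setup = S: skew_shape r Bs rw cl lam mu + L: hw_rep r Bl rw cl l \<rho> v + M: hw_rep r Bm rw cl m \<sigma> w
  for r :: nat and Bs Bl Bm :: "nat set" and rw :: "nat \<Rightarrow> nat" and cl lam mu :: "nat \<Rightarrow> int" and l m :: nat
    and \<rho> \<sigma> :: "'k :: {alg_closed_field, field_char_0} mat \<Rightarrow> 'k mat" and v w :: "'k vec" +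
  fixes n :: nat
  assumes Bm: "Bm = Bl \<union> Bs" and disj: "Bl \<inter> Bs = {}"
    and shape_l: "(\<lambda>k. (rw k, cl k)) ` Bl = {(i, c). i < r \<and> 0 < c \<and> c \<le> lam i}"
    and rn: "r < n \<or> n = r \<and> Bm = {}"
begin

text \<open>The module of highest weight \<open>mu\<close> is paired with the tensor product of the module of highest weight
  \<open>lam\<close> and the image of \<open>t\<close> under \<open>A\<close>, inside the tensors on the boxes of \<open>mu\<close>.\<close>

definition homtens :: "((nat \<Rightarrow> nat) \<Rightarrow> 'k) \<Rightarrow> 'k mat \<Rightarrow> 'k mat" where
  "homtens t A = mat m l (\<lambda>(p, q). tpair r Bm (M.demb (unit_vec m p)) (tjoin Bl Bs (L.emb (unit_vec l q)) (tmul Bs A t)))"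

lemma homtens_carrier [simp]: "homtens t A \<in> carrier_mat m l"
  by (simp add: homtens_def)

lemma homtens_scalar:
  assumes x: "x \<in> carrier_vec l" and y: "y \<in> carrier_vec m"
  shows "y \<bullet> (homtens t A *\<^sub>v x) = tpair r Bm (M.demb y) (tjoin Bl Bs (L.emb x) (tmul Bs A t))"
proof -
  let ?z = "tmul Bs A t"
  have "y \<bullet> (homtens t A *\<^sub>v x) = (\<Sum>p<m. y $ p * (\<Sum>q<l. tpair r Bm (M.demb (unit_vec m p)) (tjoin Bl Bs (L.emb (unit_vec l q)) ?z) * x $ q))"
    using x y by (simp add: homtens_def scalar_prod_def atLeast0LessThan)
  also have "\<dots> = (\<Sum>p<m. \<Sum>q<l. \<Sum>K\<in>idx r Bm. (M.demb (unit_vec m p) K * y $ p) * ((L.emb (unit_vec l q) (restrict K Bl) * x $ q) * ?z (restrict K Bs)))"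
    by (simp add: tpair_def tjoin_def sum_distrib_left sum_distrib_right mult_ac)
  also have "\<dots> = (\<Sum>p<m. \<Sum>K\<in>idx r Bm. \<Sum>q<l. (M.demb (unit_vec m p) K * y $ p) * ((L.emb (unit_vec l q) (restrict K Bl) * x $ q) * ?z (restrict K Bs)))"
    by (intro sum.cong refl) (rule sum.swap)
  also have "\<dots> = (\<Sum>K\<in>idx r Bm. \<Sum>p<m. \<Sum>q<l. (M.demb (unit_vec m p) K * y $ p) * ((L.emb (unit_vec l q) (restrict K Bl) * x $ q) * ?z (restrict K Bs)))"
    by (rule sum.swap)
  also have "\<dots> = (\<Sum>K\<in>idx r Bm. M.demb y K * (L.emb x (restrict K Bl) * ?z (restrict K Bs)))"
    unfolding M.demb_expand[OF y] L.emb_expand[OF x] sum_product sum_distrib_right[of _ _ "?z _"] ..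
  finally show ?thesis by (simp add: tpair_def tjoin_def)
qed

text \<open>Both embeddings are equivariant and \<open>g\<close> acts on a joined tensor factor by
  factor; moved across the pairing it becomes its transpose, which is the action on the dual of the
  target.\<close>

lemma homtens_equivariant:
  assumes A: "A \<in> carrier_mat r n" and g: "g \<in> GL r"
  shows "homtens t (g * A) * \<rho> g = \<sigma> g * homtens t A"
proof (rule mat_eqI_scalar)
  note gc = GL_carrier[OF g] and lc = L.rho_carrier[OF g] and mc = M.rho_carrier[OF g]
  show "homtens t (g * A) * \<rho> g \<in> carrier_mat m l" "\<sigma> g * homtens t A \<in> carrier_mat m l"
    using mult_carrier_mat[OF homtens_carrier lc] mult_carrier_mat[OF mc homtens_carrier] by simp_all
  fix x y :: "'k vec" assume x: "x \<in> carrier_vec l" and y: "y \<in> carrier_vec m"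
  let ?z = "tmul Bs A t"
  have "y \<bullet> ((homtens t (g * A) * \<rho> g) *\<^sub>v x) = y \<bullet> (homtens t (g * A) *\<^sub>v (\<rho> g *\<^sub>v x))"
    using assoc_mult_mat_vec[OF homtens_carrier lc x] by simp
  also have "\<dots> = tpair r Bm (M.demb y) (tjoin Bl Bs (tmul Bl g (L.emb x)) (tmul Bs g ?z))"
    using x y g by (simp add: homtens_scalar L.emb_act tmul_mult[OF S.fin gc A])
  also have "\<dots> = tpair r Bm (M.demb y) (tmul Bm g (tjoin Bl Bs (L.emb x) ?z))"
  proof (rule tpair_cong[OF refl])
    fix K assume "K \<in> idx r Bm"
    then have K: "K \<in> idx (dim_row g) (Bl \<union> Bs)" using gc by (simp add: Bm)
    show "tjoin Bl Bs (tmul Bl g (L.emb x)) (tmul Bs g ?z) K = tmul Bm g (tjoin Bl Bs (L.emb x) ?z) K"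
      unfolding Bm by (rule tmul_tjoin[OF L.fin S.fin disj K, symmetric])
  qed
  also have "\<dots> = tpair r Bm (tmul Bm (transpose_mat g) (M.demb y)) (tjoin Bl Bs (L.emb x) ?z)"
    unfolding tpair_def by (rule tmul_adjoint[OF gc])
  also have "\<dots> = (transpose_mat (\<sigma> g) *\<^sub>v y) \<bullet> (homtens t A *\<^sub>v x)"
    using x y g M.dual_act_carrier[OF g y] by (simp add: homtens_scalar M.demb_act)
  also have "\<dots> = y \<bullet> (\<sigma> g *\<^sub>v (homtens t A *\<^sub>v x))"
    by (rule transpose_vec_mult_scalar[OF mc _ y]) (use x in \<open>auto intro: mult_mat_vec_carrier[of _ m l]\<close>)
  also have "\<dots> = y \<bullet> ((\<sigma> g * homtens t A) *\<^sub>v x)"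
    using assoc_mult_mat_vec[OF mc homtens_carrier x] by simp
  finally show "y \<bullet> ((homtens t (g * A) * \<rho> g) *\<^sub>v x) = y \<bullet> ((\<sigma> g * homtens t A) *\<^sub>v x)" .
qed

lemma homtens_regular:
  assumes "p < m" "q < l"
  shows "regular_on r n (surj_mats r n) (\<lambda>A. homtens t A $$ (p, q))"
proof (rule regular_on_cong)
  let ?f = "\<lambda>A. \<Sum>K\<in>idx r Bm. M.demb (unit_vec m p) K * (L.emb (unit_vec l q) (restrict K Bl) *
      (\<Sum>J\<in>idx n Bs. (\<Prod>k\<in>Bs. A $$ (restrict K Bs k, J k)) * t J))"
  show "regular_on r n (surj_mats r n) ?f"
  proof (rule regular_on_poly[OF surj_mats_open])
    have "K k < r" if "K \<in> idx r Bm" "k \<in> Bs" for K k using that idx_less[of K r Bm k] by (simp add: Bm)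
    then show "?f \<in> poly_funs r n"
      using idx_less[of _ n Bs] by (intro poly_funs_sum poly_funs.mult poly_funs_prod poly_funs.coord poly_funs.const) auto
  qed
  fix A :: "'k mat" assume "A \<in> surj_mats r n"
  then have A: "A \<in> carrier_mat r n" by (rule surj_mats_carrier)
  have "restrict K Bs \<in> idx r Bs" if "K \<in> idx r Bm" for K using that by (auto simp: Bm intro: restrict_idx)
  then show "?f A = homtens t A $$ (p, q)"
    using A assms by (simp add: homtens_def tpair_def tjoin_def tmul_def)
qed

lemma equivariant_homtens: "equivariant r n l m \<rho> \<sigma> (homtens t)"
  unfolding equivariant_def
  by (intro conjI ballI allI impI homtens_carrier homtens_regular homtens_equivariant surj_mats_carrier)

lemma homtens_add:
  "homtens (\<lambda>I. s I + t I) A = homtens s A + homtens t A"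
  unfolding homtens_def tmul_add by (rule eq_matI) (simp_all add: tpair_def tjoin_def distrib_left sum.distrib)

lemma homtens_scale:
  "homtens (\<lambda>I. c * t I) A = c \<cdot>\<^sub>m homtens t A"
  unfolding homtens_def tmul_scale by (rule eq_matI) (simp_all add: tpair_def tjoin_def sum_distrib_left mult_ac)

text \<open>The column group of \<open>lam\<close> lies in that of \<open>mu\<close>, so the
  antisymmetrization hidden in \<open>y0\<close> is absorbed and only counts the smaller group. At
  the superstandard filling a permutation contributes only if it preserves the row of every box of
  \<open>lam\<close>; preserving columns as well, it fixes these boxes and is a column permutation
  of the skew boxes.\<close>

lemma csym_tjoin_y0:
  "csym Bm cl (tjoin Bl Bs L.y0 z) M.eB = of_nat (card (fib_perms Bl cl)) * (csym Bs cl z S.eB :: 'k)"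
proof -
  let ?G = "tjoin Bl Bs L.erow z"
  have y0: "tjoin Bl Bs L.y0 z K = (\<Sum>\<tau>\<in>fib_perms Bl cl. of_int (sign \<tau>) * ?G (K \<circ> \<tau>))" for K
  proof -
    have "restrict K Bl \<circ> \<tau> = restrict (K \<circ> \<tau>) Bl" "restrict (K \<circ> \<tau>) Bs = restrict K Bs" if t: "\<tau> \<in> fib_perms Bl cl" for \<tau>
    proof -
      note p = fib_perms_permutes[OF t]
      show "restrict K Bl \<circ> \<tau> = restrict (K \<circ> \<tau>) Bl"
        using permutes_in_image[OF p] by (auto simp: fun_eq_iff restrict_def)
      have "\<tau> k = k" if "k \<in> Bs" for k using permutes_not_in[OF p, of k] that disj by auto
      then show "restrict (K \<circ> \<tau>) Bs = restrict K Bs" by (auto simp: fun_eq_iff restrict_def)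
    qed
    then show ?thesis
      unfolding tjoin_def L.y0_def fsym_def sum_distrib_right by (intro sum.cong refl) (simp add: mult.assoc)
  qed
  have "csym Bm cl (tjoin Bl Bs L.y0 z) M.eB = (\<Sum>\<tau>\<in>fib_perms Bl cl. \<Sum>\<pi>\<in>fib_perms Bm cl. of_int (sign \<pi>) * of_int (sign \<tau>) * ?G (M.eB \<circ> (\<pi> \<circ> \<tau>)))"
    unfolding fsym_def y0 sum_distrib_left by (subst sum.swap) (simp add: mult.assoc comp_assoc)
  also have "\<dots> = (\<Sum>\<tau>\<in>fib_perms Bl cl. csym Bm cl ?G M.eB)"
  proof (rule sum.cong[OF refl])
    fix \<tau> assume "\<tau> \<in> fib_perms Bl cl"
    then have t: "\<tau> \<in> fib_perms Bm cl" by (rule fib_perms_mono[rotated]) (simp add: Bm)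
    note tp = fib_perms_permutes[OF t]
    show "(\<Sum>\<pi>\<in>fib_perms Bm cl. of_int (sign \<pi>) * of_int (sign \<tau>) * ?G (M.eB \<circ> (\<pi> \<circ> \<tau>))) = csym Bm cl ?G M.eB"
      unfolding fsym_def
    proof (rule sum.reindex_bij_witness[of _ "\<lambda>\<pi>. \<pi> \<circ> pinv \<tau>" "\<lambda>\<pi>. \<pi> \<circ> \<tau>"])
      fix \<pi> assume s: "\<pi> \<in> fib_perms Bm cl"
      show "(\<pi> \<circ> \<tau>) \<circ> pinv \<tau> = \<pi>" "(\<pi> \<circ> pinv \<tau>) \<circ> \<tau> = \<pi>"
        using permutes_inv_o[OF tp] by (simp_all add: comp_assoc)
      show "\<pi> \<circ> \<tau> \<in> fib_perms Bm cl" "\<pi> \<circ> pinv \<tau> \<in> fib_perms Bm cl"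
        using fib_perms_comp[OF s t] fib_perms_comp[OF s fib_perms_inv[OF t]] by simp_all
      have "sign (\<pi> \<circ> \<tau>) = sign \<pi> * sign \<tau>"
        by (rule sign_compose) (use fib_perms_permutation[OF M.fin] s t in auto)
      then show "of_int (sign (\<pi> \<circ> \<tau>)) * ?G (M.eB \<circ> (\<pi> \<circ> \<tau>)) = of_int (sign \<pi>) * of_int (sign \<tau>) * ?G (M.eB \<circ> (\<pi> \<circ> \<tau>))"
        by simp
    qed
  qed
  also have "csym Bm cl ?G M.eB = csym Bs cl z S.eB"
    unfolding fsym_def
  proof (rule sum.mono_neutral_cong_right[OF finite_fib_perms[OF M.fin]])
    show "fib_perms Bs cl \<subseteq> fib_perms Bm cl" using fib_perms_mono[of Bs Bm] by (auto simp: Bm)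

    show "\<forall>\<pi>\<in>fib_perms Bm cl - fib_perms Bs cl. of_int (sign \<pi>) * ?G (M.eB \<circ> \<pi>) = 0"
    proof
      fix \<pi> assume s: "\<pi> \<in> fib_perms Bm cl - fib_perms Bs cl"
      then have s1: "\<pi> \<in> fib_perms Bm cl" and s2: "\<pi> \<notin> fib_perms Bs cl" by auto
      note p = fib_perms_permutes[OF s1]
      have "restrict (M.eB \<circ> \<pi>) Bl \<noteq> L.eB"
      proof
        assume e: "restrict (M.eB \<circ> \<pi>) Bl = L.eB"
        have f: "\<pi> k = k" if k: "k \<in> Bl" for k
        proof -
          have km: "k \<in> Bm" "\<pi> k \<in> Bm" using k permutes_in_image[OF p] by (auto simp: Bm)
          have "rw (\<pi> k) = rw k" using fun_cong[OF e, of k] k km by (simp add: M.eB_def L.eB_def)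
          moreover have "cl (\<pi> k) = cl k" using s1 km by (simp add: fib_perms_def)
          ultimately show ?thesis using M.box_inj[OF km(2,1)] by simp
        qed
        have "\<pi> permutes Bs"
          by (rule permutes_superset[OF p]) (use f in \<open>auto simp: Bm\<close>)
        then have "\<pi> \<in> fib_perms Bs cl" using s1 by (auto simp: fib_perms_def Bm)
        then show False using s2 by simp
      qed
      then show "of_int (sign \<pi>) * ?G (M.eB \<circ> \<pi>) = 0" by (simp add: tjoin_def L.erow_def)
    qed
    fix \<pi> assume s: "\<pi> \<in> fib_perms Bs cl"
    note p = fib_perms_permutes[OF s]
    have e: "M.eB k = rw k" if "k \<in> Bl \<or> k \<in> Bs" for k using that by (simp add: M.eB_def) (simp add: Bm)
    have f: "\<pi> k = k" if "k \<in> Bl" for k using permutes_not_in[OF p, of k] that disj by auto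
    have "restrict (M.eB \<circ> \<pi>) Bl = L.eB"
      by (rule ext) (simp add: e f L.eB_def)
    moreover have "restrict (M.eB \<circ> \<pi>) Bs = S.eB \<circ> \<pi>"
      by (rule ext) (simp add: e S.eB_def permutes_in_image[OF p])
    ultimately show "of_int (sign \<pi>) * ?G (M.eB \<circ> \<pi>) = of_int (sign \<pi>) * z (S.eB \<circ> \<pi>)"
      by (simp add: tjoin_def L.erow_def)
  qed
  finally show ?thesis by simp
qed

text \<open>At \<open>v\<close> and \<open>\<omega>\<close> the embeddings take the value
  \<open>y0\<close>. The antisymmetrizer in the left \<open>y0\<close> moves to the joined tensor,
  pairing with \<open>erow\<close> evaluates at \<open>eB\<close>, and the boxes of
  \<open>lam\<close> drop out up to the order of their column group.\<close>

lemma homtens_corner: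
  assumes A: "A \<in> carrier_mat r n"
  shows "M.\<omega> \<bullet> (homtens t A *\<^sub>v v) = of_nat (card (fib_perms Bl cl)) * pfun Bs rw n (csym Bs cl t) A"
proof -
  let ?z = "tjoin Bl Bs L.y0 (tmul Bs A t)"
  have "M.\<omega> \<bullet> (homtens t A *\<^sub>v v) = tpair r Bm M.y0 ?z"
    by (simp add: homtens_scalar L.v(1) M.\<omega>_carrier L.emb_v M.demb_\<omega>)
  also have "\<dots> = (\<Sum>K\<in>idx r Bm. M.erow K * csym Bm cl ?z K)"
    unfolding tpair_def M.y0_def by (rule fsym_adjoint[OF M.fin perm_char_sign, symmetric])
  also have "\<dots> = csym Bm cl ?z M.eB"
    using M.eB_idx M.fin by (simp add: M.erow_def if_distrib[of "\<lambda>x. x * _"] cong: if_cong)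
  also have "\<dots> = of_nat (card (fib_perms Bl cl)) * csym Bs cl (tmul Bs A t) S.eB"
    by (rule csym_tjoin_y0)
  also have "csym Bs cl (tmul Bs A t) S.eB = pfun Bs rw n (csym Bs cl t) A"
    using S.pfun_tmul[OF A] by (simp add: fsym_tmul[OF S.fin])
  finally show ?thesis .
qed

end

section \<open>The corner of an equivariant matrix function\<close>

lemma surj_mats_dense:
  fixes f :: "'k :: field_char_0 mat \<Rightarrow> 'k"
  assumes f: "f \<in> poly_funs r n" and rn: "r \<le> n" and 0: "\<And>A. A \<in> surj_mats r n \<Longrightarrow> f A = 0"
    and A: "A \<in> carrier_mat r n"
  shows "f A = 0"
proof -
  let ?C = "mat n r (\<lambda>(i, j). if i = j then 1 else 0) :: 'k mat" and ?A = "mat r n (\<lambda>(i, j). if i = j then 1 else 0) :: 'k mat"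
  have AC: "?A * ?C = 1\<^sub>m r"
  proof (rule eq_matI)
    fix i j assume "i < dim_row (1\<^sub>m r :: 'k mat)" "j < dim_col (1\<^sub>m r :: 'k mat)"
    then have ij: "i < r" "j < r" by auto
    then have "(?A * ?C) $$ (i, j) = (\<Sum>k<n. if k = i then (if k = j then 1 else 0) else 0)"
      using rn by (simp add: scalar_prod_def atLeast0LessThan if_distrib[of "\<lambda>x. x * _"] cong: if_cong)
    then show "(?A * ?C) $$ (i, j) = (1\<^sub>m r :: 'k mat) $$ (i, j)" using ij rn by simp
  qed simp_all
  show ?thesis
  proof (rule poly_funs_dense[OF f cdet_poly_funs[of r n ?C] _ _ _ A, of ?A])
    show "cdet r n ?C ?A \<noteq> 0" by (subst cdet_eq) (simp_all add: AC)
    show "f B = 0" if B: "B \<in> carrier_mat r n" and nz: "cdet r n ?C B \<noteq> 0" for B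
    proof (rule 0, rule surj_matsI[OF B])
      show "B * ?C \<in> GL r" using nz B cdet_eq[OF B, of ?C] by (simp add: GL_iff)
    qed simp
  qed simp
qed

lemma surj_mats_identity:
  fixes f g :: "'k :: field_char_0 mat \<Rightarrow> 'k"
  assumes "f \<in> poly_funs r n" "g \<in> poly_funs r n" "r \<le> n"
    and "\<And>A. A \<in> surj_mats r n \<Longrightarrow> f A = g A" "A \<in> carrier_mat r n"
  shows "f A = g A"
  using surj_mats_dense[OF poly_funs_diff[OF assms(1,2)] assms(3) _ assms(5)] assms(4) by simp

lemma rowscale_poly_funs: "f \<in> poly_funs r n \<Longrightarrow> (\<lambda>A. f (rowscale r n i c A)) \<in> poly_funs r n"
proof (rule poly_funs_compose[where p = r and q = n])
  fix a b assume "a < r" "b < n"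
  then show "(\<lambda>A. rowscale r n i c A $$ (a, b)) \<in> poly_funs r n"
    by (cases "a = i") (auto simp: rowscale_def intro: poly_funs_scale poly_funs.coord)
qed

lemma rowadd_poly_funs: "Suc i < r \<Longrightarrow> f \<in> poly_funs r n \<Longrightarrow> (\<lambda>A. f (rowadd r n i c A)) \<in> poly_funs r n"
proof (rule poly_funs_compose[where p = r and q = n])
  fix a b assume "a < r" "b < n" "Suc i < r"
  then show "(\<lambda>A. rowadd r n i c A $$ (a, b)) \<in> poly_funs r n"
    by (cases "a = Suc i") (auto simp: rowadd_def intro!: poly_funs.add poly_funs_scale poly_funs.coord)
qed

definition rowscale_mat :: "nat \<Rightarrow> nat \<Rightarrow> 'k :: field \<Rightarrow> 'k mat" where
  "rowscale_mat r i c = mat r r (\<lambda>(a, b). if a = b then if a = i then c else 1 else 0)"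

lemma rowscale_eq:
  assumes A: "A \<in> carrier_mat r n"
  shows "rowscale r n i c A = rowscale_mat r i c * A"
proof (rule eq_matI)
  fix a b assume "a < dim_row (rowscale_mat r i c * A)" "b < dim_col (rowscale_mat r i c * A)"
  then have a: "a < r" and b: "b < n" using A by (auto simp: rowscale_mat_def)
  have "(rowscale_mat r i c * A) $$ (a, b) = (\<Sum>k<r. rowscale_mat r i c $$ (a, k) * A $$ (k, b))"
    using a b A by (simp add: rowscale_mat_def scalar_prod_def atLeast0LessThan)
  also have "\<dots> = (\<Sum>k<r. if k = a then rowscale r n i c A $$ (a, b) else 0)"
    by (intro sum.cong refl) (use a b in \<open>auto simp: rowscale_mat_def rowscale_def\<close>)
  finally show "rowscale r n i c A $$ (a, b) = (rowscale_mat r i c * A) $$ (a, b)" using a by simp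
qed (use A in \<open>auto simp: rowscale_def rowscale_mat_def\<close>)

lemma rowscale_mat_upper: "upper_triangular (rowscale_mat r i c)"
  by (simp add: upper_triangular_def rowscale_mat_def)

lemma rowscale_mat_GL:
  assumes "c \<noteq> 0"
  shows "rowscale_mat r i c \<in> GL r"
proof -
  have "det (rowscale_mat r i c) = (\<Prod>a<r. if a = i then c else 1)"
    by (subst det_upper_triangular[OF rowscale_mat_upper])
       (auto simp: rowscale_mat_def prod_list_diag_prod atLeast0LessThan intro!: prod.cong)
  also have "\<dots> \<noteq> 0" using assms by simp
  finally show ?thesis by (simp add: GL_iff rowscale_mat_def)
qed

context straight begin

lemma wt_rowscale:
  "wt (rowscale_mat r i c) = c ^ card {k \<in> B. rw k = i}"
proof -
  have "wt (rowscale_mat r i c) = (\<Prod>k\<in>B. if rw k = i then c else 1)"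
    unfolding wt_def by (intro prod.cong refl) (simp add: rowscale_mat_def rw_less)
  then show ?thesis using fin by (simp add: prod.If_cases Int_def)
qed

end

context hom_setup begin

lemma card_free_boxes: "Suc i < r \<Longrightarrow> card (L.free_boxes i) \<le> S.gap i"
proof -
  assume i: "Suc i < r"
  have "cl ` L.free_boxes i \<subseteq> {lam (Suc i)<..lam i}"
  proof
    fix c assume "c \<in> cl ` L.free_boxes i"
    then obtain k where k: "k \<in> Bl" "rw k = i" "c = cl k" "\<And>k'. k' \<in> Bl \<Longrightarrow> rw k' = Suc i \<Longrightarrow> cl k' \<noteq> cl k"
      by (auto simp: L.free_boxes_def)
    have "(rw k, cl k) \<in> (\<lambda>k. (rw k, cl k)) ` Bl" using k(1) by (rule imageI)
    then have c: "0 < c" "c \<le> lam i" unfolding shape_l using k by auto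
    have "\<not> c \<le> lam (Suc i)"
    proof
      assume "c \<le> lam (Suc i)"
      then have "(Suc i, c) \<in> (\<lambda>k. (rw k, cl k)) ` Bl" unfolding shape_l using i c by auto
      then obtain k' where k': "k' \<in> Bl" "rw k' = Suc i" "cl k' = c" by auto
      show False using k(4)[OF k'(1,2)] k'(3) k(3) by simp
    qed
    then show "c \<in> {lam (Suc i)<..lam i}" using c by simp
  qed
  moreover have "inj_on cl (L.free_boxes i)" by (rule inj_onI) (use L.box_inj in \<open>auto simp: L.free_boxes_def\<close>)
  ultimately have "card (L.free_boxes i) \<le> card {lam (Suc i)<..lam i}" by (intro card_inj_on_le) auto
  then show ?thesis by (simp add: S.gap_def)
qed

lemma r_le_n: "r \<le> n"
  using rn by auto

context
  fixes F :: "'k mat \<Rightarrow> 'k mat"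
  assumes F: "equivariant r n l m \<rho> \<sigma> F"
begin

lemma F_carrier: "A \<in> surj_mats r n \<Longrightarrow> F A \<in> carrier_mat m l"
  and F_regular: "i < m \<Longrightarrow> j < l \<Longrightarrow> regular_on r n (surj_mats r n) (\<lambda>A. F A $$ (i, j))"
  and F_mult: "A \<in> surj_mats r n \<Longrightarrow> g \<in> GL r \<Longrightarrow> F (g * A) * \<rho> g = \<sigma> g * F A"
  using F by (auto simp: equivariant_def)

lemma F_act:
  assumes A: "A \<in> surj_mats r n" and g: "g \<in> GL r" and x: "x \<in> carrier_vec l"
  shows "F (g * A) *\<^sub>v (\<rho> g *\<^sub>v x) = \<sigma> g *\<^sub>v (F A *\<^sub>v x)"
  using F_mult[OF A g] assoc_mult_mat_vec[OF F_carrier[OF surj_mats_GL[OF A g]] L.rho_carrier[OF g] x]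
    assoc_mult_mat_vec[OF M.rho_carrier[OF g] F_carrier[OF A] x] by simp

lemma F_vec: "A \<in> surj_mats r n \<Longrightarrow> x \<in> carrier_vec l \<Longrightarrow> F A *\<^sub>v x \<in> carrier_vec m"
  using F_carrier by (intro mult_mat_vec_carrier[of _ m l]) auto

definition corner :: "'k mat \<Rightarrow> 'k" where "corner A = M.\<omega> \<bullet> (F A *\<^sub>v v)"

lemma corner_lower:
  assumes A: "A \<in> surj_mats r n" and g: "g \<in> GL r" and low: "\<And>i j. i < j \<Longrightarrow> j < r \<Longrightarrow> g $$ (i, j) = 0"
  shows "M.\<omega> \<bullet> (F (g * A) *\<^sub>v (\<rho> g *\<^sub>v v)) = M.wt g * corner A"
  unfolding F_act[OF A g L.v(1)] corner_def by (rule M.\<omega>_lower[OF g low F_vec[OF A L.v(1)]])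

text \<open>In the dual of the module of highest weight \<open>mu\<close> the functional \<open>\<omega>\<close> is semi-invariant under the lower
  triangular group, while the orbit of \<open>v\<close> under that group spans: hence \<open>\<omega> \<otimes> v\<close> is cyclic.\<close>

lemma corner_zero_imp:
  assumes 0: "\<And>A. A \<in> surj_mats r n \<Longrightarrow> corner A = 0" and A: "A \<in> surj_mats r n"
  shows "F A = 0\<^sub>m m l"
proof -
  have 1: "M.\<omega> \<bullet> (F A *\<^sub>v x) = 0" if A: "A \<in> surj_mats r n" and x: "x \<in> carrier_vec l" for A x
  proof -
    let ?\<xi> = "transpose_mat (F A) *\<^sub>v M.\<omega>"
    have xi: "?\<xi> \<in> carrier_vec l" using F_carrier[OF A] M.\<omega>_carrier by (intro mult_mat_vec_carrier[of _ l m]) auto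
    have dual: "?\<xi> \<bullet> y = M.\<omega> \<bullet> (F A *\<^sub>v y)" if "y \<in> carrier_vec l" for y
      by (rule transpose_vec_mult_scalar[OF F_carrier[OF A] that M.\<omega>_carrier])
    have "?\<xi> = 0\<^sub>v l"
    proof (rule L.big_cell_annihilator[OF xi])
      fix g :: "'k mat" assume g: "g \<in> GL r" "big_cell r g \<noteq> 0"
      obtain N U where NU: "lower_unitri r N" "U \<in> GL r" "upper_triangular U" "g = N * U"
        using big_cell_decomp[OF GL_carrier[OF g(1)] g(2)] .
      note NG = lower_unitri_GL[OF NU(1)]
      \<comment> \<open>Semi-invariance is applied at the frame \<open>N' * A\<close>, so that
        translating it by \<open>N\<close> returns to \<open>A\<close> with \<open>N\<close> now
        acting on \<open>v\<close>.\<close>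
      obtain N' where N': "N' \<in> GL r" "N * N' = 1\<^sub>m r" using GL_inverse[OF NG] by metis
      have A': "N' * A \<in> surj_mats r n" by (rule surj_mats_GL[OF A N'(1)])
      have NA: "N * (N' * A) = A"
        using assoc_mult_mat[OF GL_carrier[OF NG] GL_carrier[OF N'(1)] surj_mats_carrier[OF A]] N'(2) surj_mats_carrier[OF A] by simp
      have "\<rho> g *\<^sub>v v = L.wt U \<cdot>\<^sub>v (\<rho> N *\<^sub>v v)"
        using NU NG L.v(1) L.hw[OF NU(2,3)] by (simp add: L.act_mult L.act_smult)
      moreover have "M.\<omega> \<bullet> (F A *\<^sub>v (\<rho> N *\<^sub>v v)) = 0"
        using corner_lower[OF A' NG] NU(1) 0[OF A'] unfolding NA by (simp add: lower_unitri_def)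
      ultimately show "?\<xi> \<bullet> (\<rho> g *\<^sub>v v) = 0"
        using dual[of "\<rho> N *\<^sub>v v"] L.act_carrier[OF NG L.v(1)] xi by simp
    qed
    then show ?thesis using dual[OF x] x by simp
  qed
  have "F A *\<^sub>v x = 0\<^sub>v m" if x: "x \<in> carrier_vec l" for x
  proof (rule M.\<omega>_separates[OF F_vec[OF A x]])
    fix g :: "'k mat" assume g: "g \<in> GL r"
    show "M.\<omega> \<bullet> (\<sigma> g *\<^sub>v (F A *\<^sub>v x)) = 0"
      using 1[OF surj_mats_GL[OF A g] L.act_carrier[OF g x]] F_act[OF A g x] by simp
  qed
  moreover have "0\<^sub>m m l *\<^sub>v x = (0\<^sub>v m :: 'k vec)" if "x \<in> carrier_vec l" for x
    using that by (intro eq_vecI) auto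
  ultimately show ?thesis
    by (intro mat_eqI_scalar[OF F_carrier[OF A]]) simp_all
qed

text \<open>For r < n this is the extension theorem for regular functions on surjective matrices.
  For r = n both diagrams are empty and \<open>\<Delta>\<close> is 1, so \<open>v\<close> and
  \<open>\<omega>\<close> are invariant; the surjective matrices form a single orbit of GL, on which
  the corner is constant.\<close>

lemma corner_poly: "\<exists>p\<in>poly_funs r n. \<forall>A\<in>surj_mats r n. corner A = p A"
proof (cases "r < n")
  case True
  have "regular_on r n (surj_mats r n) corner"
  proof (rule regular_on_cong)
    show "regular_on r n (surj_mats r n) (\<lambda>A. \<Sum>i<m. M.\<omega> $ i * (\<Sum>j<l. F A $$ (i, j) * v $ j))"
      by (intro regular_on_sum regular_on_mult regular_on_const surj_mats_open F_regular) auto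
    fix A :: "'k mat" assume A: "A \<in> surj_mats r n"
    show "(\<Sum>i<m. M.\<omega> $ i * (\<Sum>j<l. F A $$ (i, j) * v $ j)) = corner A"
      using F_carrier[OF A] L.v(1) by (simp add: corner_def scalar_prod_def atLeast0LessThan)
  qed
  then show ?thesis by (rule regular_on_surj_mats_poly[OF True])
next
  case False
  then have n: "n = r" and Bm0: "Bm = {}" using rn by auto
  have Bl0: "Bl = {}" using Bm0 Bm by simp
  have pf: "B = {} \<Longrightarrow> pfun B rw r y g = pfun B rw r y h" for B y and g h :: "'k mat" by (simp add: pfun_def)
  have Dl: "L.\<Delta> g = 1" for g :: "'k mat"
    using pf[OF Bl0, of L.y0 g "1\<^sub>m r"] L.\<Delta>_one[where 'a = 'k] by (simp only: L.\<Delta>_def)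
  have Dm: "M.\<Delta> g = 1" for g :: "'k mat"
    using pf[OF Bm0, of M.y0 g "1\<^sub>m r"] M.\<Delta>_one[where 'a = 'k] by (simp only: M.\<Delta>_def)
  have rv: "\<rho> g *\<^sub>v v = v" if g: "g \<in> GL r" for g
  proof -
    have "\<rho> g *\<^sub>v v - v = 0\<^sub>v l"
    proof (rule L.\<omega>_separates)
      fix h :: "'k mat" assume h: "h \<in> GL r"
      have "\<rho> h *\<^sub>v (\<rho> g *\<^sub>v v - v) = \<rho> (h * g) *\<^sub>v v - \<rho> h *\<^sub>v v"
        using L.act_mult[OF h g L.v(1)] mult_minus_distrib_mat_vec[OF L.rho_carrier[OF h] L.act_carrier[OF g L.v(1)] L.v(1)] by simp
      then show "L.\<omega> \<bullet> (\<rho> h *\<^sub>v (\<rho> g *\<^sub>v v - v)) = 0"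
        using scalar_prod_minus_distrib[OF L.\<omega>_carrier L.act_carrier[OF GL_mult[OF h g] L.v(1)] L.act_carrier[OF h L.v(1)]]
          L.\<omega>_act[OF GL_mult[OF h g]] L.\<omega>_act[OF h] Dl by simp
    qed (use g L.v(1) in auto)
    note d = this and dims = carrier_vecD[OF L.v(1)] carrier_vecD[OF L.act_carrier[OF g L.v(1)]]
    show ?thesis
    proof (rule eq_vecI)
      fix i assume "i < dim_vec v"
      then show "(\<rho> g *\<^sub>v v) $ i = v $ i"
        using arg_cong[OF d, of "\<lambda>x. x $ i"] dims by (simp del: index_mult_mat_vec)
    qed (use dims in \<open>simp only:\<close>)
  qed
  have wv: "M.\<omega> \<bullet> (\<sigma> g *\<^sub>v x) = M.\<omega> \<bullet> x" if g: "g \<in> GL r" and x: "x \<in> carrier_vec m" for g x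
    using x
  proof (induction rule: M.orbit_induct)
    case zero
    have "\<sigma> g *\<^sub>v 0\<^sub>v m = 0\<^sub>v m" using M.rho_carrier[OF g] by (intro eq_vecI) (auto simp: scalar_prod_def)
    then show ?case by simp
  next
    case (step x h c)
    have "M.\<omega> \<bullet> (\<sigma> g *\<^sub>v (\<sigma> h *\<^sub>v w)) = M.\<omega> \<bullet> (\<sigma> h *\<^sub>v w)"
      using M.act_mult[OF g step(2) M.v(1)] M.\<omega>_act[OF GL_mult[OF g step(2)]] M.\<omega>_act[OF step(2)] Dm by simp
    then show ?case
      using step g M.v(1) M.\<omega>_carrier by (simp add: M.act_add M.act_smult scalar_prod_add_distrib[of _ m])
  qed
  have "corner A = M.\<omega> \<bullet> (F (1\<^sub>m r) *\<^sub>v v)" if A: "A \<in> surj_mats r n" for A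
  proof -
    obtain C where "C \<in> carrier_mat n r" "A * C = 1\<^sub>m r" using surj_mats_right_inverse[OF A] .
    then have g: "A \<in> GL r" using GL_I[of A r C] surj_mats_carrier[OF A] n by simp
    have one: "(1\<^sub>m r :: 'k mat) \<in> surj_mats r n" using surj_matsI[of "1\<^sub>m r :: 'k mat" r n "1\<^sub>m r"] n by simp
    have "F A *\<^sub>v v = \<sigma> A *\<^sub>v (F (1\<^sub>m r) *\<^sub>v v)"
      using F_act[OF one g L.v(1)] rv[OF g] surj_mats_carrier[OF A] n by simp
    then show ?thesis using wv[OF g F_vec[OF one L.v(1)]] by (simp add: corner_def)
  qed
  then show ?thesis by (intro bexI[of _ "\<lambda>A. M.\<omega> \<bullet> (F (1\<^sub>m r) *\<^sub>v v)"] poly_funs.const) auto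
qed

text \<open>Both hypotheses of \<open>skew_spanning\<close> come from the two semi-invariances.
  Diagonal matrices act on \<open>v\<close> and \<open>\<omega>\<close> by their weights, whose
  quotient is the degree \<open>len\<close> of each row. Lowering matrices fix
  \<open>\<omega>\<close>, so the dependence on \<open>s\<close> is that of a matrix coefficient of
  \<open>v\<close>, of degree at most the number of free boxes of \<open>lam\<close>. Density
  extends both facts from surjective to all matrices.\<close>

lemma corner_spanned: "\<exists>t. \<forall>A\<in>surj_mats r n. corner A = pfun Bs rw n (csym Bs cl t) A"
proof -
  obtain p where p: "p \<in> poly_funs r n" "\<And>A. A \<in> surj_mats r n \<Longrightarrow> corner A = p A"
    using corner_poly by blast
  have "\<exists>t. \<forall>A. p A = pfun Bs rw n (csym Bs cl t) A"
  proof (rule S.skew_spanning[OF p(1)])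
    fix A :: "'k mat" and i assume A: "A \<in> carrier_mat r n" and i: "i < r"
    show "p (rowscale r n i 2 A) = 2 ^ S.len i * p A"
    proof (rule surj_mats_identity[OF rowscale_poly_funs[OF p(1)] poly_funs_scale[OF p(1)] r_le_n _ A])
      fix A :: "'k mat" assume A: "A \<in> surj_mats r n"
      let ?D = "rowscale_mat r i 2 :: 'k mat"
      have D: "?D \<in> GL r" by (rule rowscale_mat_GL) simp
      have DA: "rowscale r n i 2 A = ?D * A" by (rule rowscale_eq[OF surj_mats_carrier[OF A]])
      have "L.wt ?D * corner (?D * A) = M.\<omega> \<bullet> (F (?D * A) *\<^sub>v (\<rho> ?D *\<^sub>v v))"
        using L.hw[OF D rowscale_mat_upper] F_carrier[OF surj_mats_GL[OF A D]] L.v(1) F_vec[OF surj_mats_GL[OF A D] L.v(1)] M.\<omega>_carrier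
        by (simp add: corner_def mult_mat_vec[of _ m l])
      also have "\<dots> = M.wt ?D * corner A"
        by (rule corner_lower[OF A D]) (simp add: rowscale_mat_def)
      also have "M.wt ?D = L.wt ?D * 2 ^ S.len i"
      proof -
        have "{k \<in> Bm. rw k = i} = {k \<in> Bl. rw k = i} \<union> {k \<in> Bs. rw k = i}" by (auto simp: Bm)
        moreover have "card ({k \<in> Bl. rw k = i} \<union> {k \<in> Bs. rw k = i}) = card {k \<in> Bl. rw k = i} + card {k \<in> Bs. rw k = i}"
          by (rule card_Un_disjoint) (use L.fin S.fin disj in auto)
        ultimately show ?thesis using S.card_row[OF i] by (simp add: L.wt_rowscale M.wt_rowscale power_add)
      qed
      finally have "L.wt ?D * corner (?D * A) = L.wt ?D * (2 ^ S.len i * corner A)" by simp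
      moreover have "L.wt ?D \<noteq> 0" by (simp add: L.wt_rowscale)
      ultimately show "p (rowscale r n i 2 A) = 2 ^ S.len i * p A"
        using p(2)[OF A] p(2)[OF surj_mats_GL[OF A D]] DA by simp
    qed
  next
    fix A :: "'k mat" and i assume A: "A \<in> carrier_mat r n" and i: "Suc i < r"
    \<comment> \<open>For fixed \<open>A\<close> a degree bound is not a polynomial identity in
      \<open>A\<close>, so density does not apply to it directly. Interpolation at
      \<open>gap i + 1\<close> fixed nodes turns it into one.\<close>
    let ?S = "of_nat ` {..S.gap i} :: 'k set"
    have cS: "card ?S = Suc (S.gap i)" by (subst card_image) (auto intro: inj_onI)
    have eq: "p (rowadd r n i s A) = (\<Sum>s'\<in>?S. lagrange ?S s' s * p (rowadd r n i s' A))" for s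
    proof (rule surj_mats_identity[OF _ _ r_le_n _ A])
      show "(\<lambda>A. p (rowadd r n i s A)) \<in> poly_funs r n" by (rule rowadd_poly_funs[OF i p(1)])
      show "(\<lambda>A. \<Sum>s'\<in>?S. lagrange ?S s' s * p (rowadd r n i s' A)) \<in> poly_funs r n"
        by (intro poly_funs_sum poly_funs_scale rowadd_poly_funs[OF i p(1)])
      fix A :: "'k mat" assume A: "A \<in> surj_mats r n"
      let ?\<xi> = "transpose_mat (F A) *\<^sub>v M.\<omega>"
      have xi: "?\<xi> \<in> carrier_vec l" using F_carrier[OF A] M.\<omega>_carrier by (intro mult_mat_vec_carrier[of _ l m]) auto
      obtain P where P: "degree P \<le> card (L.free_boxes i)" "\<And>s. ?\<xi> \<bullet> (\<rho> (L.lowmat i s) *\<^sub>v v) = poly P s"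
        using L.lowmat_coefficient[OF i xi] by blast
      have val: "p (rowadd r n i s A) = poly (pcompose P [:0, -1:]) s" for s
      proof -
        \<comment> \<open>\<open>v\<close> is written as the image under \<open>?L\<close> of its
          translate by the inverse \<open>?L'\<close>; equivariance then lets \<open>?L\<close>
          disappear into \<open>\<omega>\<close>, and the coefficient polynomial is evaluated at
          -s.\<close>
        let ?L = "L.lowmat i s" and ?L' = "L.lowmat i (- s)"
        have "\<rho> ?L *\<^sub>v (\<rho> ?L' *\<^sub>v v) = \<rho> (?L * ?L') *\<^sub>v v"
          by (rule L.act_mult[OF L.lowmat_GL L.lowmat_GL L.v(1), symmetric])
        also have "\<dots> = v" by (simp only: L.lowmat_inverse[OF i] L.act_one[OF L.v(1)])
        finally have "corner (?L * A) = M.\<omega> \<bullet> (\<sigma> ?L *\<^sub>v (F A *\<^sub>v (\<rho> ?L' *\<^sub>v v)))"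
          using F_act[OF A L.lowmat_GL L.act_carrier[OF L.lowmat_GL L.v(1)], of i s i "- s"] by (simp add: corner_def)
        also have "\<dots> = M.wt ?L * (M.\<omega> \<bullet> (F A *\<^sub>v (\<rho> ?L' *\<^sub>v v)))"
          by (rule M.\<omega>_lower[OF L.lowmat_GL _ F_vec[OF A L.act_carrier[OF L.lowmat_GL L.v(1)]]]) (auto simp: L.lowmat_def)
        also have "M.wt ?L = 1" by (rule M.wt_lower_unitri[OF L.lowmat_unitri])
        also have "M.\<omega> \<bullet> (F A *\<^sub>v (\<rho> ?L' *\<^sub>v v)) = ?\<xi> \<bullet> (\<rho> ?L' *\<^sub>v v)"
          by (rule transpose_vec_mult_scalar[OF F_carrier[OF A] L.act_carrier[OF L.lowmat_GL L.v(1)] M.\<omega>_carrier, symmetric])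
        finally show ?thesis
          using p(2)[OF surj_mats_GL[OF A L.lowmat_GL], of i s] P(2)
          by (simp add: L.lowmat_rowadd[OF i surj_mats_carrier[OF A]] poly_pcompose)
      qed
      have "degree (pcompose P [:0, -1:]) < card ?S"
        using degree_pcompose_le[of P "[:0, -1:]"] P(1) card_free_boxes[OF i] cS by simp
      then show "p (rowadd r n i s A) = (\<Sum>s'\<in>?S. lagrange ?S s' s * p (rowadd r n i s' A))"
        unfolding val using lagrange_interpolation[of ?S "pcompose P [:0, -1:]" s] by (simp add: mult.commute)
    qed
    have fS: "finite ?S" by simp
    have "\<exists>Q. degree Q \<le> card ?S - 1 \<and> (\<forall>x. poly Q x = (\<Sum>s\<in>?S. p (rowadd r n i s A) * lagrange ?S s x))"
      by (rule lagrange_combination[OF fS])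
    then show "\<exists>P. degree P \<le> S.gap i \<and> (\<forall>s. p (rowadd r n i s A) = poly P s)"
    proof (elim exE conjE)
      fix Q assume Q: "degree Q \<le> card ?S - 1" "\<forall>x. poly Q x = (\<Sum>s\<in>?S. p (rowadd r n i s A) * lagrange ?S s x)"
      have "p (rowadd r n i s A) = poly Q s" for s
        using eq[of s] Q(2) by (simp only: mult.commute)
      moreover have "degree Q \<le> S.gap i" using Q(1) cS by simp
      ultimately show ?thesis by blast
    qed
  qed
  then show ?thesis
  proof (rule exE)
    fix t assume t: "\<forall>A. p A = pfun Bs rw n (csym Bs cl t) A"
    show ?thesis
    proof (intro exI ballI)
      fix A :: "'k mat" assume "A \<in> surj_mats r n"
      then show "corner A = pfun Bs rw n (csym Bs cl t) A" using p(2) t by simp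
    qed
  qed
qed

end

lemma equivariant_diff:
  assumes F: "equivariant r n l m \<rho> \<sigma> F" and G: "equivariant r n l m \<rho> \<sigma> G"
  shows "equivariant r n l m \<rho> \<sigma> (\<lambda>A. F A - G A)"
  unfolding equivariant_def
proof (intro conjI ballI allI impI)
  note c = F_carrier[OF F] F_carrier[OF G]
  show "F A - G A \<in> carrier_mat m l" if "A \<in> surj_mats r n" for A
    by (rule minus_carrier_mat[OF c(2)[OF that]])
  show "regular_on r n (surj_mats r n) (\<lambda>A. (F A - G A) $$ (i, j))" if "i < m" "j < l" for i j
  proof (rule regular_on_cong)
    show "regular_on r n (surj_mats r n) (\<lambda>A. F A $$ (i, j) + (- 1) * G A $$ (i, j))"
      by (intro regular_on_add regular_on_mult regular_on_const surj_mats_open F_regular[OF F] F_regular[OF G] that)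
    show "F A $$ (i, j) + (- 1) * G A $$ (i, j) = (F A - G A) $$ (i, j)" if A: "A \<in> surj_mats r n" for A
      using carrier_matD[OF c(2)[OF A]] \<open>i < m\<close> \<open>j < l\<close> by simp
  qed
  show "(F (g * A) - G (g * A)) * \<rho> g = \<sigma> g * (F A - G A)" if A: "A \<in> surj_mats r n" and g: "g \<in> GL r" for A g
    using minus_mult_distrib_mat[OF c(1)[OF surj_mats_GL[OF A g]] c(2)[OF surj_mats_GL[OF A g]] L.rho_carrier[OF g]]
      mult_minus_distrib_mat[OF M.rho_carrier[OF g] c(1)[OF A] c(2)[OF A]] F_mult[OF F A g] F_mult[OF G A g] by simp
qed

lemma corner_homtens_symmetrized:
  assumes A: "A \<in> surj_mats r n"
  shows "corner (homtens (csym Bs cl (rsym Bs rw z))) A =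
    of_nat (card (fib_perms Bl cl)) * (of_nat (card (fib_perms Bs cl)) * pfun Bs rw n (csym Bs cl (rsym Bs rw z)) A)"
proof -
  have "csym Bs cl (csym Bs cl (rsym Bs rw z)) = (\<lambda>I. of_nat (card (fib_perms Bs cl)) * csym Bs cl (rsym Bs rw z) I)"
    by (rule ext) (rule fsym_idem[OF S.fin perm_char_sign])
  then have "pfun Bs rw n (csym Bs cl (csym Bs cl (rsym Bs rw z))) A = of_nat (card (fib_perms Bs cl)) * pfun Bs rw n (csym Bs cl (rsym Bs rw z)) A"
    by (simp add: pfun_def sum_distrib_left mult_ac)
  then show ?thesis
    unfolding corner_def[OF equivariant_homtens] homtens_corner[OF surj_mats_carrier[OF A]] by simp
qed

lemma fib_card_nonzero: "of_nat (card (fib_perms Bl cl)) \<noteq> (0 :: 'k)" "of_nat (card (fib_perms Bs cl)) \<noteq> (0 :: 'k)"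
  "of_nat (card (fib_perms Bs rw)) \<noteq> (0 :: 'k)"
  using card_fib_perms[OF L.fin, of cl] card_fib_perms[OF S.fin, of cl] card_fib_perms[OF S.fin, of rw] by simp_all

text \<open>A vanishing corner gives a zero polynomial, first on surjective matrices and then on all
  by density. Hence the row symmetrization of the tensor vanishes, and with it the tensor, by the
  kernel statement for the symmetrizers.\<close>

lemma homtens_injective:
  assumes 0: "\<And>A. A \<in> surj_mats r n \<Longrightarrow> homtens (csym Bs cl (rsym Bs rw z)) A = 0\<^sub>m m l" and I: "I \<in> idx n Bs"
  shows "csym Bs cl (rsym Bs rw z) I = 0"
proof -
  let ?y = "csym Bs cl (rsym Bs rw z)"
  have "pfun Bs rw n ?y A = 0" if A: "A \<in> surj_mats r n" for A
  proof -
    have "0\<^sub>m m l *\<^sub>v v = (0\<^sub>v m :: 'k vec)" using L.v(1) by (intro eq_vecI) auto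
    then have "corner (homtens ?y) A = 0"
      using M.\<omega>_carrier unfolding corner_def[OF equivariant_homtens] 0[OF A] by simp
    then show ?thesis using fib_card_nonzero unfolding corner_homtens_symmetrized[OF A] by simp
  qed
  note surj0 = this
  have poly: "pfun Bs rw n ?y \<in> poly_funs r n" by (rule pfun_poly_funs[OF S.fin S.rw_less])
  have "pfun Bs rw n ?y A = 0" if "A \<in> carrier_mat r n" for A
    using poly r_le_n surj0 that by (rule surj_mats_dense)
  then have "rsym Bs rw ?y J = 0" if J: "J \<in> idx n Bs" for J
    using pfun_zero_imp_rsym_zero[where rw = rw and r = r and n = n and y = ?y, OF S.fin S.rw_less _ J] by simp
  then show ?thesis by (rule symmetrizer_kernel[OF S.fin _ I])
qed

text \<open>The polynomial of \<open>csym t\<close> depends only on its row symmetrization, and the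
  image statement for the symmetrizers provides a tensor \<open>csym\<close> of
  \<open>rsym z\<close> with the same one. The resulting function has the corner of
  \<open>F\<close>, and an equivariant function with zero corner is zero.\<close>

lemma homtens_surjective:
  assumes F: "equivariant r n l m \<rho> \<sigma> F"
  shows "\<exists>z. \<forall>A\<in>surj_mats r n. F A = homtens (csym Bs cl (rsym Bs rw z)) A"
proof -
  obtain t where t: "\<forall>A\<in>surj_mats r n. corner F A = pfun Bs rw n (csym Bs cl t) A"
    using corner_spanned[OF F] by (elim exE) (rule that)
  obtain z where z: "\<forall>I\<in>idx n Bs. rsym Bs rw (csym Bs cl t) I = rsym Bs rw (csym Bs cl (rsym Bs rw z)) I"
    using symmetrizer_image[OF S.fin, of n rw cl t] by (elim exE) (rule that)
  \<comment> \<open>The factor by which the corner of \<open>homtens\<close> exceeds the polynomial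
    of a tensor that is already antisymmetrized: one column group order from \<open>lam\<close>, one
    from repeating the antisymmetrizer.\<close>
  define N :: 'k where "N = of_nat (card (fib_perms Bl cl)) * of_nat (card (fib_perms Bs cl))"
  have N: "N \<noteq> 0" unfolding N_def using fib_card_nonzero by simp
  let ?y = "csym Bs cl (rsym Bs rw z)" and ?z = "\<lambda>I. 1 / N * z I"
  have "rsym Bs rw ?z = (\<lambda>I. 1 / N * rsym Bs rw z I)" by (rule ext) (rule fsym_scale)
  then have zy: "csym Bs cl (rsym Bs rw ?z) = (\<lambda>I. 1 / N * ?y I)"
    by (simp only:) (rule ext, rule fsym_scale)
  have pf: "pfun Bs rw n (csym Bs cl t) A = pfun Bs rw n ?y A" for A
  proof -
    have "pfun Bs rw n (rsym Bs rw (csym Bs cl t)) A = pfun Bs rw n (rsym Bs rw ?y) A"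
      unfolding pfun_def by (rule sum.cong) (use z in auto)
    then show ?thesis unfolding pfun_rsym[OF S.fin] using fib_card_nonzero by simp
  qed
  let ?G = "homtens (csym Bs cl (rsym Bs rw ?z))"
  have cG: "corner ?G A = corner F A" if A: "A \<in> surj_mats r n" for A
  proof -
    have "corner ?G A = N * pfun Bs rw n (csym Bs cl (rsym Bs rw ?z)) A"
      unfolding corner_homtens_symmetrized[OF A] N_def by (simp only: mult.assoc)
    also have "\<dots> = pfun Bs rw n ?y A"
      unfolding zy using N by (simp add: pfun_def sum_distrib_left)
    finally show ?thesis using t A pf by simp
  qed
  have D: "equivariant r n l m \<rho> \<sigma> (\<lambda>A. F A - ?G A)" by (rule equivariant_diff[OF F equivariant_homtens])
  have "F A = ?G A" if A: "A \<in> surj_mats r n" for A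
  proof -
    have "F A - ?G A = 0\<^sub>m m l"
    proof (rule corner_zero_imp[OF D _ A])
      fix A :: "'k mat" assume A: "A \<in> surj_mats r n"
      have "(F A - ?G A) *\<^sub>v v = F A *\<^sub>v v - ?G A *\<^sub>v v"
        by (rule minus_mult_distrib_mat_vec[OF F_carrier[OF F A] homtens_carrier L.v(1)])
      then show "corner (\<lambda>A. F A - ?G A) A = 0"
        using cG[OF A] scalar_prod_minus_distrib[OF M.\<omega>_carrier F_vec[OF F A L.v(1)] F_vec[OF equivariant_homtens A L.v(1)]]
        unfolding corner_def[OF D] corner_def[OF F] corner_def[OF equivariant_homtens] by simp
    qed
    then show ?thesis using F_carrier[OF F A] homtens_carrier[of "csym Bs cl (rsym Bs rw ?z)" A]
      by (intro eq_matI) (auto dest: arg_cong[where f = "\<lambda>M. M $$ _"] simp: mat_eq_iff)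
  qed
  then show ?thesis by blast
qed

end

section \<open>Homomorphisms of associated bundles\<close>

lemma frames_eq: "frames n r U = {A \<in> surj_mats r n. mat_kernel A \<in> U}"
  by (auto simp: frames_def surj_mats_def)

lemma kernel_GL:
  assumes A: "A \<in> carrier_mat r n" and g: "(g :: 'k :: field mat) \<in> GL r"
  shows "mat_kernel (g * A) = mat_kernel A"
proof -
  obtain h where "h \<in> GL r" "h * g = 1\<^sub>m r" using GL_inverse[OF g] by metis
  then show ?thesis using mat_kernel_mult_eq[OF A GL_carrier[OF g], of h] GL_carrier by blast
qed

text \<open>With \<open>C\<close> a right inverse of \<open>A\<close>, every x - C A x lies in the
  common kernel, so A' = (A' C) A; the element sought is A' C, inverted by A times a right inverse
  of A'.\<close>

lemma same_kernel:
  assumes A: "(A :: 'k :: field mat) \<in> surj_mats r n" and A': "A' \<in> surj_mats r n" and eq: "mat_kernel A = mat_kernel A'"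
  obtains g where "g \<in> GL r" "A' = g * A"
proof -
  note Ac = surj_mats_carrier[OF A] and A'c = surj_mats_carrier[OF A']
  obtain C where C: "C \<in> carrier_mat n r" "A * C = 1\<^sub>m r" using surj_mats_right_inverse[OF A] .
  obtain C' where C': "C' \<in> carrier_mat n r" "A' * C' = 1\<^sub>m r" using surj_mats_right_inverse[OF A'] .
  have eqA: "A' = A' * C * A"
  proof (rule mat_eqI_scalar[OF A'c])
    show "A' * C * A \<in> carrier_mat r n" using A'c C Ac by simp
    fix x y :: "'k vec" assume x: "x \<in> carrier_vec n"
    have Ax: "A *\<^sub>v x \<in> carrier_vec r" using Ac x by simp
    then have CAx: "C *\<^sub>v (A *\<^sub>v x) \<in> carrier_vec n" using C by simp
    have "A *\<^sub>v (x - C *\<^sub>v (A *\<^sub>v x)) = A *\<^sub>v x - A *\<^sub>v (C *\<^sub>v (A *\<^sub>v x))"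
      by (rule mult_minus_distrib_mat_vec[OF Ac x CAx])
    also have "A *\<^sub>v (C *\<^sub>v (A *\<^sub>v x)) = A *\<^sub>v x"
      using assoc_mult_mat_vec[OF Ac C(1) Ax] C(2) Ax by simp
    finally have "x - C *\<^sub>v (A *\<^sub>v x) \<in> mat_kernel A"
      using Ac Ax x CAx by (intro mat_kernelI[OF Ac]) auto
    then have "A' *\<^sub>v (x - C *\<^sub>v (A *\<^sub>v x)) = 0\<^sub>v r"
      unfolding eq by (rule mat_kernelD(2)[OF A'c])
    then have d: "A' *\<^sub>v x - A' *\<^sub>v (C *\<^sub>v (A *\<^sub>v x)) = 0\<^sub>v r"
      using mult_minus_distrib_mat_vec[OF A'c x CAx] by simp
    have "A' *\<^sub>v x = A' *\<^sub>v (C *\<^sub>v (A *\<^sub>v x))"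
    proof (rule eq_vecI)
      fix i assume "i < dim_vec (A' *\<^sub>v (C *\<^sub>v (A *\<^sub>v x)))"
      then show "(A' *\<^sub>v x) $ i = (A' *\<^sub>v (C *\<^sub>v (A *\<^sub>v x))) $ i"
        using arg_cong[OF d, of "\<lambda>z. z $ i"] A'c by (simp del: index_mult_mat_vec)
    qed simp
    also have "\<dots> = (A' * C * A) *\<^sub>v x"
      using assoc_mult_mat_vec[OF A'c C(1) Ax] assoc_mult_mat_vec[OF _ Ac x, of "A' * C" r] A'c C(1) by simp
    finally show "y \<bullet> (A' *\<^sub>v x) = y \<bullet> ((A' * C * A) *\<^sub>v x)" by simp
  qed
  show ?thesis
  proof (rule that[OF _ eqA])
    have "(A' * C) * (A * C') = A' * C * A * C'"
      by (rule assoc_mult_mat[symmetric]) (use A'c C C' Ac in auto)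
    also have "\<dots> = 1\<^sub>m r" using eqA C'(2) by simp
    finally show "A' * C \<in> GL r" by (rule GL_I[rotated 2]) (use A'c C C' Ac in auto)
  qed
qed

lemma kernel_Gr:
  assumes A: "(A :: 'k :: field mat) \<in> surj_mats r n"
  shows "mat_kernel A \<in> Gr n r"
proof -
  note Ac = surj_mats_carrier[OF A]
  interpret N: vec_space "TYPE('k)" n .
  interpret R: vec_space "TYPE('k)" r .
  let ?T = "\<lambda>v. A *\<^sub>v v"
  have lm: "linear_map class_ring (module_vec TYPE('k) n) (module_vec TYPE('k) r) ?T"
    unfolding linear_map_def mod_hom_def mod_hom_axioms_def
  proof (intro conjI)
    show "?T \<in> LinearCombinations.module_hom class_ring (module_vec TYPE('k) n) (module_vec TYPE('k) r)"
      unfolding LinearCombinations.module_hom_def using Ac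
      by (auto simp: module_vec_simps mult_add_distrib_mat_vec[of _ r n] mult_mat_vec[of _ r n])
  qed (rule vec_vs vec_module)+
  have ker: "mod_hom.ker (module_vec TYPE('k) n) (module_vec TYPE('k) r) ?T = mat_kernel A"
    unfolding mod_hom.ker_def[OF linear_map.axioms(3)[OF lm]] using Ac by (auto simp: module_vec_simps mat_kernel_def)
  have im: "mod_hom.im (module_vec TYPE('k) n) ?T = carrier_vec r"
    unfolding mod_hom.im_def[OF linear_map.axioms(3)[OF lm]] using A by (simp add: module_vec_simps surj_mats_def)
  have "vectorspace.dim class_ring ((module_vec TYPE('k) r)\<lparr>carrier := carrier_vec r\<rparr>)
      + vectorspace.dim class_ring ((module_vec TYPE('k) n)\<lparr>carrier := mat_kernel A\<rparr>) = n"
    using linear_map.rank_nullity_main(1)[OF lm N.fin_dim] unfolding ker im N.dim_is_n .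
  moreover have "(module_vec TYPE('k) r)\<lparr>carrier := carrier_vec r\<rparr> = module_vec TYPE('k) r"
    by (simp add: module_vec_def)
  ultimately have "vectorspace.dim class_ring ((module_vec TYPE('k) n)\<lparr>carrier := mat_kernel A\<rparr>) + r = n"
    using R.dim_is_n by simp
  moreover have "subspace class_ring (mat_kernel A) (module_vec TYPE('k) n)"
    using linear_map.kerT_is_subspace[OF lm] unfolding ker .
  ultimately show ?thesis by (simp add: Gr_def)
qed

text \<open>The quotients in which the images of the columns of \<open>C\<close> form a basis.
  Coordinate matrices \<open>C\<close> give the standard affine charts; general ones allow a chart
  centred at any given frame.\<close>

definition chart :: "nat \<Rightarrow> nat \<Rightarrow> 'k :: field mat \<Rightarrow> 'k vec set set" where
  "chart r n C = mat_kernel ` {A \<in> surj_mats r n. cdet r n C A \<noteq> 0}"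

lemma cdet_GL:
  assumes "A \<in> carrier_mat r n" "(C :: 'k :: field mat) \<in> carrier_mat n r"
  shows "cdet r n C A \<noteq> 0 \<longleftrightarrow> A * C \<in> GL r"
  using assms by (simp add: cdet_eq GL_iff)

lemma frames_chart:
  assumes C: "(C :: 'k :: field mat) \<in> carrier_mat n r"
  shows "frames n r (chart r n C) = {A \<in> surj_mats r n. cdet r n C A \<noteq> 0}"
proof -
  have "cdet r n C A' \<noteq> 0"
    if A: "A \<in> surj_mats r n" "cdet r n C A \<noteq> 0" and A': "A' \<in> surj_mats r n" and eq: "mat_kernel A' = mat_kernel A" for A A'
  proof -
    obtain g where g: "g \<in> GL r" "A' = g * A" using same_kernel[OF A(1) A' eq[symmetric]] .
    have AC: "A * C \<in> GL r" using A cdet_GL[OF surj_mats_carrier[OF A(1)] C] by simp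
    have "A' * C = g * (A * C)"
      unfolding g(2) by (rule assoc_mult_mat[OF GL_carrier[OF g(1)] surj_mats_carrier[OF A(1)] C])
    then show ?thesis using cdet_GL[OF surj_mats_carrier[OF A'] C] GL_mult[OF g(1) AC] by simp
  qed
  then show ?thesis unfolding frames_eq chart_def by blast
qed

lemma gr_open_chart:
  assumes C: "(C :: 'k :: field mat) \<in> carrier_mat n r"
  shows "gr_open n r (chart r n C)"
proof -
  have "{A \<in> surj_mats r n. cdet r n C A \<noteq> 0} = surj_mats r n \<inter> {A \<in> carrier_mat r n. cdet r n C A \<noteq> 0}"
    using surj_mats_carrier by auto
  then have "zariski_open r n (frames n r (chart r n C))"
    unfolding frames_chart[OF C] using zariski_open_Int[OF surj_mats_open zariski_open_basic[OF cdet_poly_funs]] by simp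
  then show ?thesis unfolding gr_open_def chart_def using kernel_Gr by auto
qed

lemma gr_open_Int:
  assumes "gr_open n r U" "gr_open n r V"
  shows "gr_open n r (U \<inter> V)"
proof -
  have "frames n r (U \<inter> V) = frames n r U \<inter> frames n r V" by (auto simp: frames_def)
  then show ?thesis using assms zariski_open_Int unfolding gr_open_def by fastforce
qed

lemma frames_mono: "U \<subseteq> V \<Longrightarrow> frames n r U \<subseteq> frames n r V"
  by (auto simp: frames_def)

lemma frames_surj: "A \<in> frames n r U \<Longrightarrow> A \<in> surj_mats r n"
  by (simp add: frames_eq)

lemma frames_GL:
  assumes A: "A \<in> frames n r U" and g: "(g :: 'k :: field mat) \<in> GL r"
  shows "g * A \<in> frames n r U"
  using A surj_mats_GL[OF frames_surj[OF A] g] kernel_GL[OF surj_mats_carrier[OF frames_surj[OF A]] g]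
  by (simp add: frames_eq)

lemma gr_open_frames: "gr_open n r U \<Longrightarrow> zariski_open r n (frames n r U)"
  by (simp add: gr_open_def)

section \<open>Sections of associated bundles and their expansion over a chart\<close>

lemma assoc_bundle_restrict:
  assumes s: "s \<in> carrier (assoc_bundle n r m \<rho> U)" and V: "gr_open n r V" "V \<subseteq> U"
  shows "restrict s (frames n r V) \<in> carrier (assoc_bundle n r m \<rho> V)"
proof -
  have sub: "frames n r V \<subseteq> frames n r U" using V(2) by (rule frames_mono)
  have "regular_on r n (frames n r V) (\<lambda>A. restrict s (frames n r V) A $ i)" if "i < m" for i
  proof (rule regular_on_cong)
    show "regular_on r n (frames n r V) (\<lambda>A. s A $ i)"
      by (rule regular_on_subset[OF _ gr_open_frames[OF V(1)] sub]) (use s that in \<open>simp add: assoc_bundle_def\<close>)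
  qed simp
  moreover have "restrict s (frames n r V) (g * A) = \<rho> g *\<^sub>v restrict s (frames n r V) A"
    if A: "A \<in> frames n r V" and g: "g \<in> GL r" for A g
  proof -
    have "g * A \<in> frames n r V" using A g by (rule frames_GL)
    moreover have "A \<in> frames n r U" using A sub by blast
    ultimately show ?thesis using s A g by (simp add: assoc_bundle_def)
  qed
  ultimately show ?thesis using s sub by (auto simp: assoc_bundle_def)
qed

lemma assoc_bundle_add:
  assumes U: "gr_open n r U" and s: "s \<in> carrier (assoc_bundle n r m \<rho> U)" and t: "t \<in> carrier (assoc_bundle n r m \<rho> U)"
    and lin: "\<And>g x y. g \<in> GL r \<Longrightarrow> x \<in> carrier_vec m \<Longrightarrow> y \<in> carrier_vec m \<Longrightarrow> \<rho> g *\<^sub>v (x + y) = \<rho> g *\<^sub>v x + \<rho> g *\<^sub>v y"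
  shows "s \<oplus>\<^bsub>assoc_bundle n r m \<rho> U\<^esub> t \<in> carrier (assoc_bundle n r m \<rho> U)"
proof -
  let ?u = "\<lambda>A\<in>frames n r U. s A + t A"
  have c: "s A \<in> carrier_vec m" "t A \<in> carrier_vec m" if "A \<in> frames n r U" for A
    using s t that by (simp_all add: assoc_bundle_def)
  have "regular_on r n (frames n r U) (\<lambda>A. ?u A $ i)" if "i < m" for i
  proof (rule regular_on_cong)
    show "regular_on r n (frames n r U) (\<lambda>A. s A $ i + t A $ i)"
      using s t that by (intro regular_on_add) (simp_all add: assoc_bundle_def)
    show "s A $ i + t A $ i = ?u A $ i" if "A \<in> frames n r U" for A
      using c[OF that] that \<open>i < m\<close> by simp
  qed
  moreover have "?u (g * A) = \<rho> g *\<^sub>v ?u A" if A: "A \<in> frames n r U" and g: "g \<in> GL r" for A g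
    using lin[OF g c[OF A]] s t A g frames_GL[OF A g] by (simp add: assoc_bundle_def)
  ultimately show ?thesis using c by (simp add: assoc_bundle_def)
qed

lemma assoc_bundle_smult:
  assumes U: "gr_open n r U" and f: "f \<in> carrier (gr_O n r U)" and s: "s \<in> carrier (assoc_bundle n r m \<rho> U)"
    and lin: "\<And>g c x. g \<in> GL r \<Longrightarrow> x \<in> carrier_vec m \<Longrightarrow> \<rho> g *\<^sub>v (c \<cdot>\<^sub>v x) = c \<cdot>\<^sub>v (\<rho> g *\<^sub>v x)"
  shows "f \<odot>\<^bsub>assoc_bundle n r m \<rho> U\<^esub> s \<in> carrier (assoc_bundle n r m \<rho> U)"
proof -
  let ?u = "\<lambda>A\<in>frames n r U. f (mat_kernel A) \<cdot>\<^sub>v s A"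
  have c: "s A \<in> carrier_vec m" if "A \<in> frames n r U" for A
    using s that by (simp add: assoc_bundle_def)
  have "regular_on r n (frames n r U) (\<lambda>A. ?u A $ i)" if "i < m" for i
  proof (rule regular_on_cong)
    show "regular_on r n (frames n r U) (\<lambda>A. f (mat_kernel A) * s A $ i)"
      using s f that by (intro regular_on_mult) (simp_all add: assoc_bundle_def gr_O_def)
    show "f (mat_kernel A) * s A $ i = ?u A $ i" if "A \<in> frames n r U" for A
      using c[OF that] that \<open>i < m\<close> by simp
  qed
  moreover have "?u (g * A) = \<rho> g *\<^sub>v ?u A" if A: "A \<in> frames n r U" and g: "g \<in> GL r" for A g
    using lin[OF g c[OF A]] s A g frames_GL[OF A g] kernel_GL[OF surj_mats_carrier[OF frames_surj[OF A]] g]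
    by (simp add: assoc_bundle_def)
  ultimately show ?thesis using c by (simp add: assoc_bundle_def)
qed

context rat_rep begin

lemma zero_section:
  assumes U: "gr_open n r U"
  shows "\<zero>\<^bsub>assoc_bundle n r l \<rho> U\<^esub> \<in> carrier (assoc_bundle n r l \<rho> U)"
proof -
  have "regular_on r n (frames n r U) (\<lambda>A. (\<lambda>A\<in>frames n r U. 0\<^sub>v l) A $ i)" if "i < l" for i
    by (rule regular_on_cong[OF regular_on_const[OF gr_open_frames[OF U], of 0]]) (use that in simp)
  moreover have "\<rho> g *\<^sub>v 0\<^sub>v l = 0\<^sub>v l" if "g \<in> GL r" for g
    using carrier_matD[OF rho_carrier[OF that]] by (intro eq_vecI) (auto simp: scalar_prod_def)
  then have "(\<lambda>A\<in>frames n r U. 0\<^sub>v l) (g * A) = \<rho> g *\<^sub>v (\<lambda>A\<in>frames n r U. 0\<^sub>v l) A" if "A \<in> frames n r U" "g \<in> GL r" for A g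
    using that frames_GL[OF that] by simp
  ultimately show ?thesis by (simp add: assoc_bundle_def)
qed

text \<open>The local frame of the associated bundle over the chart: section \<open>j\<close> takes
  the value of basis vector \<open>j\<close> at every frame \<open>A\<close> with
  \<open>A * C\<close> equal to the identity.\<close>

definition esec :: "nat \<Rightarrow> 'k mat \<Rightarrow> nat \<Rightarrow> 'k mat \<Rightarrow> 'k vec" where
  "esec n C j = (\<lambda>A\<in>frames n r (chart r n C). \<rho> (A * C) *\<^sub>v unit_vec l j)"

lemma chart_GL:
  assumes C: "C \<in> carrier_mat n r" and A: "A \<in> frames n r (chart r n C)"
  shows "A * C \<in> (GL r :: 'k mat set)"
  using A cdet_GL[OF surj_mats_carrier[OF frames_surj[OF A]] C] unfolding frames_chart[OF C] by simp

lemma chart_rho_regular: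
  assumes C: "C \<in> carrier_mat n r" and V: "gr_open n r V" "V \<subseteq> chart r n C" and ij: "i < l" "j < l"
  shows "regular_on r n (frames n r V) (\<lambda>A. \<rho> (A * C) $$ (i, j))"
proof (rule regular_on_cong)
  let ?\<Phi> = "\<lambda>A. mat r r (\<lambda>(i, j). \<Sum>k<n. A $$ (i, k) * C $$ (k, j))"
  have \<Phi>: "?\<Phi> A = A * C" if "A \<in> frames n r V" for A
    using surj_mats_carrier[OF frames_surj[OF that]] C
    by (intro eq_matI) (simp_all add: scalar_prod_def atLeast0LessThan)
  show "regular_on r n (frames n r V) (\<lambda>A. \<rho> (?\<Phi> A) $$ (i, j))"
  proof (rule regular_on_compose[OF rho_regular[OF ij] gr_open_frames[OF V(1)]])
    show "?\<Phi> A \<in> GL r" if "A \<in> frames n r V" for A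
      using chart_GL[OF C, of A] \<Phi>[OF that] frames_mono[OF V(2)] that by auto
    show "(\<lambda>A. ?\<Phi> A $$ (i, j)) \<in> poly_funs r n" if "i < r" "j < r" for i j
    proof -
      have "(\<lambda>A. \<Sum>k<n. A $$ (i, k) * C $$ (k, j)) \<in> poly_funs r n"
        using that by (intro poly_funs_sum poly_funs.mult poly_funs.coord poly_funs.const) auto
      then show ?thesis using that by simp
    qed
    show "GL r \<subseteq> (carrier_mat r r :: 'k mat set)" using GL_carrier by blast
  qed
  show "\<rho> (?\<Phi> A) $$ (i, j) = \<rho> (A * C) $$ (i, j)" if "A \<in> frames n r V" for A
    using \<Phi>[OF that] by simp
qed

lemma rho_unit: "g \<in> GL r \<Longrightarrow> i < l \<Longrightarrow> j < l \<Longrightarrow> (\<rho> g *\<^sub>v unit_vec l j) $ i = \<rho> g $$ (i, j)"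
  using carrier_matD[OF rho_carrier[of g]] by simp

lemma esec_section:
  assumes C: "C \<in> carrier_mat n r" and j: "j < l"
  shows "esec n C j \<in> carrier (assoc_bundle n r l \<rho> (chart r n C))"
proof -
  let ?U = "chart r n C"
  have "regular_on r n (frames n r ?U) (\<lambda>A. esec n C j A $ i)" if i: "i < l" for i
  proof (rule regular_on_cong[OF chart_rho_regular[OF C gr_open_chart[OF C] order_refl i j]])
    fix A :: "'k mat" assume A: "A \<in> frames n r ?U"
    then show "\<rho> (A * C) $$ (i, j) = esec n C j A $ i"
      using rho_unit[OF chart_GL[OF C A] i j] by (simp add: esec_def del: index_mult_mat_vec)
  qed
  moreover have "esec n C j (g * A) = \<rho> g *\<^sub>v esec n C j A" if A: "A \<in> frames n r ?U" and g: "g \<in> GL r" for A g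
  proof -
    have "g * A * C = g * (A * C)"
      by (rule assoc_mult_mat[OF GL_carrier[OF g] surj_mats_carrier[OF frames_surj[OF A]] C])
    then show ?thesis
      using A frames_GL[OF A g] act_mult[OF g chart_GL[OF C A], of "unit_vec l j"] by (simp add: esec_def)
  qed
  ultimately show ?thesis
    using chart_GL[OF C] act_carrier[OF _ unit_vec_carrier] by (simp add: assoc_bundle_def esec_def)
qed

end

lemma assoc_bundle_value:
  assumes "A \<in> frames n r U"
  shows "(s \<oplus>\<^bsub>assoc_bundle n r m \<rho> U\<^esub> t) A = s A + t A"
    and "(f \<odot>\<^bsub>assoc_bundle n r m \<rho> U\<^esub> s) A = f (mat_kernel A) \<cdot>\<^sub>v s A"
    and "\<zero>\<^bsub>assoc_bundle n r m \<rho> U\<^esub> A = 0\<^sub>v m"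
  using assms by (simp_all add: assoc_bundle_def)

context rat_rep begin

lemma rho_injective:
  assumes g: "g \<in> GL r" and x: "x \<in> carrier_vec l" and y: "y \<in> carrier_vec l" and eq: "\<rho> g *\<^sub>v x = \<rho> g *\<^sub>v y"
  shows "x = y"
proof -
  obtain h where h: "h \<in> GL r" "h * g = 1\<^sub>m r" using GL_inverse[OF g] by metis
  have "z = \<rho> h *\<^sub>v (\<rho> g *\<^sub>v z)" if "z \<in> carrier_vec l" for z
    using act_mult[OF h(1) g that] act_one[OF that] h(2) by simp
  then show ?thesis using x y eq by metis
qed

definition coords :: "'k mat \<Rightarrow> ('k mat \<Rightarrow> 'k vec) \<Rightarrow> 'k mat \<Rightarrow> 'k vec" where
  "coords C s B = (SOME x. x \<in> carrier_vec l \<and> \<rho> (B * C) *\<^sub>v x = s B)"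

context
  fixes n :: nat and C :: "'k mat" and V :: "'k vec set set" and s :: "'k mat \<Rightarrow> 'k vec"
  assumes C: "C \<in> carrier_mat n r" and V: "gr_open n r V" "V \<subseteq> chart r n C"
    and s: "s \<in> carrier (assoc_bundle n r l \<rho> V)"
begin

lemma V_GL: "B \<in> frames n r V \<Longrightarrow> B * C \<in> GL r"
  using chart_GL[OF C] frames_mono[OF V(2)] by blast

lemma s_carrier: "B \<in> frames n r V \<Longrightarrow> s B \<in> carrier_vec l"
  and s_regular: "i < l \<Longrightarrow> regular_on r n (frames n r V) (\<lambda>B. s B $ i)"
  and s_equivariant: "B \<in> frames n r V \<Longrightarrow> g \<in> GL r \<Longrightarrow> s (g * B) = \<rho> g *\<^sub>v s B"
  using s by (simp_all add: assoc_bundle_def)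

lemma coords:
  assumes B: "B \<in> frames n r V"
  shows "coords C s B \<in> carrier_vec l \<and> \<rho> (B * C) *\<^sub>v coords C s B = s B"
  unfolding coords_def
proof (rule someI_ex)
  obtain h where h: "h \<in> GL r" "B * C * h = 1\<^sub>m r" using GL_inverse[OF V_GL[OF B]] by metis
  have "\<rho> (B * C) *\<^sub>v (\<rho> h *\<^sub>v s B) = s B"
    using act_mult[OF V_GL[OF B] h(1) s_carrier[OF B]] act_one[OF s_carrier[OF B]] h(2) by simp
  then show "\<exists>x. x \<in> carrier_vec l \<and> \<rho> (B * C) *\<^sub>v x = s B"
    using act_carrier[OF h(1) s_carrier[OF B]] by blast
qed

lemma coords_GL:
  assumes B: "B \<in> frames n r V" and g: "g \<in> GL r"
  shows "coords C s (g * B) = coords C s B"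
proof (rule rho_injective[OF V_GL[OF frames_GL[OF B g]]])
  have e: "g * B * C = g * (B * C)"
    by (rule assoc_mult_mat[OF GL_carrier[OF g] surj_mats_carrier[OF frames_surj[OF B]] C])
  have "\<rho> (g * B * C) *\<^sub>v coords C s (g * B) = \<rho> g *\<^sub>v s B"
    using coords[OF frames_GL[OF B g]] s_equivariant[OF B g] by simp
  also have "\<dots> = \<rho> (g * B * C) *\<^sub>v coords C s B"
    unfolding e using act_mult[OF g V_GL[OF B]] coords[OF B] by simp
  finally show "\<rho> (g * B * C) *\<^sub>v coords C s (g * B) = \<rho> (g * B * C) *\<^sub>v coords C s B" .
qed (use coords[OF B] coords[OF frames_GL[OF B g]] in auto)

lemma coords_kernel:
  assumes "B \<in> frames n r V" "B' \<in> frames n r V" "mat_kernel B = mat_kernel B'"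
  shows "coords C s B' = coords C s B"
  using same_kernel[OF frames_surj[OF assms(1)] frames_surj[OF assms(2)] assms(3)] coords_GL[OF assms(1)] by metis

text \<open>The coordinates in the local frame agree at all frames over the same point, so they
  descend to functions on the Grassmannian, and any frame over the point may be chosen.\<close>

definition cfun :: "nat \<Rightarrow> 'k vec set \<Rightarrow> 'k" where
  "cfun j = (\<lambda>K\<in>V. coords C s (SOME B. B \<in> frames n r V \<and> mat_kernel B = K) $ j)"

lemma cfun_eq:
  assumes B: "B \<in> frames n r V"
  shows "cfun j (mat_kernel B) = coords C s B $ j"
proof -
  let ?B = "SOME B'. B' \<in> frames n r V \<and> mat_kernel B' = mat_kernel B"
  have "?B \<in> frames n r V \<and> mat_kernel ?B = mat_kernel B" by (rule someI[of _ B]) (use B in simp)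
  then have "coords C s ?B = coords C s B" using coords_kernel[OF B] by auto
  then show ?thesis using B by (simp add: cfun_def frames_eq)
qed

lemma cfun_regular:
  assumes j: "j < l"
  shows "cfun j \<in> carrier (gr_O n r V)"
proof -
  have "regular_on r n (frames n r V) (\<lambda>B. coords C s B $ j)"
  proof (rule regular_on_solution[OF gr_open_frames[OF V(1)], where M = "\<lambda>B. \<rho> (B * C)" and m = l])
    fix B assume B: "B \<in> frames n r V"
    show "\<rho> (B * C) \<in> carrier_mat l l" by (rule rho_carrier[OF V_GL[OF B]])
    show "det (\<rho> (B * C)) \<noteq> 0" using rho_GL[OF V_GL[OF B]] by (simp add: GL_iff)
    show "coords C s B \<in> carrier_vec l" using coords[OF B] by simp
  next
    show "regular_on r n (frames n r V) (\<lambda>B. \<rho> (B * C) $$ (i, k))" if "i < l" "k < l" for i k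
      by (rule chart_rho_regular[OF C V that])
    show "regular_on r n (frames n r V) (\<lambda>B. (\<rho> (B * C) *\<^sub>v coords C s B) $ i)" if "i < l" for i
      by (rule regular_on_cong[OF s_regular[OF that]]) (use coords in simp)
  qed (rule j)
  then have "regular_on r n (frames n r V) (\<lambda>B. cfun j (mat_kernel B))"
    by (rule regular_on_cong) (simp add: cfun_eq)
  then show ?thesis by (simp add: gr_O_def cfun_def)
qed

text \<open>The expansion of \<open>s\<close> in the local frame is built by the operations of the
  module of sections, one term at a time, so that a homomorphism can be applied term by
  term.\<close>

primrec partial :: "nat \<Rightarrow> 'k mat \<Rightarrow> 'k vec" where
  "partial 0 = \<zero>\<^bsub>assoc_bundle n r l \<rho> V\<^esub>"
| "partial (Suc k) = partial k \<oplus>\<^bsub>assoc_bundle n r l \<rho> V\<^esub> (cfun k \<odot>\<^bsub>assoc_bundle n r l \<rho> V\<^esub> restrict (esec n C k) (frames n r V))"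

lemma esec_restrict: "k < l \<Longrightarrow> restrict (esec n C k) (frames n r V) \<in> carrier (assoc_bundle n r l \<rho> V)"
  by (rule assoc_bundle_restrict[OF esec_section[OF C] V])

lemma term_section: "k < l \<Longrightarrow> cfun k \<odot>\<^bsub>assoc_bundle n r l \<rho> V\<^esub> restrict (esec n C k) (frames n r V) \<in> carrier (assoc_bundle n r l \<rho> V)"
  by (rule assoc_bundle_smult[OF V(1) cfun_regular esec_restrict]) (simp_all add: act_smult)

lemma partial_section: "k \<le> l \<Longrightarrow> partial k \<in> carrier (assoc_bundle n r l \<rho> V)"
proof (induction k)
  case 0
  show ?case by (simp add: zero_section[OF V(1)])
next
  case (Suc k)
  show ?case unfolding partial.simps
    by (rule assoc_bundle_add[OF V(1) _ term_section]) (use Suc in \<open>simp_all add: act_add\<close>)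
qed

lemma partial_value:
  assumes B: "B \<in> frames n r V" and i: "i < l"
  shows "k \<le> l \<Longrightarrow> partial k B \<in> carrier_vec l \<and> partial k B $ i = (\<Sum>j<k. coords C s B $ j * \<rho> (B * C) $$ (i, j))"
proof (induction k)
  case 0
  then show ?case using B i by (simp add: assoc_bundle_def)
next
  case (Suc k)
  have e: "restrict (esec n C k) (frames n r V) B = \<rho> (B * C) *\<^sub>v unit_vec l k"
    using B frames_mono[OF V(2)] by (auto simp: esec_def)
  have c: "\<rho> (B * C) *\<^sub>v unit_vec l k \<in> carrier_vec l" by (rule act_carrier[OF V_GL[OF B] unit_vec_carrier])
  have "partial (Suc k) B = partial k B + coords C s B $ k \<cdot>\<^sub>v (\<rho> (B * C) *\<^sub>v unit_vec l k)"
    using B e cfun_eq[OF B, of k] by (simp add: assoc_bundle_value)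
  moreover have "partial k B \<in> carrier_vec l" "partial k B $ i = (\<Sum>j<k. coords C s B $ j * \<rho> (B * C) $$ (i, j))"
    using Suc by simp_all
  moreover have "(\<rho> (B * C) *\<^sub>v unit_vec l k) $ i = \<rho> (B * C) $$ (i, k)"
    using rho_unit[OF V_GL[OF B] i] Suc.prems by simp
  ultimately show ?case
    using c i carrier_vecD[OF c] by (simp del: index_mult_mat_vec dim_mult_mat_vec)
qed

lemma section_expansion: "partial l = s"
proof
  fix B
  show "partial l B = s B"
  proof (cases "B \<in> frames n r V")
    case True
    have "partial l B $ i = s B $ i" if i: "i < l" for i
    proof -
      have "s B $ i = (\<rho> (B * C) *\<^sub>v coords C s B) $ i" using coords[OF True] by simp
      also have "\<dots> = (\<Sum>j<l. coords C s B $ j * \<rho> (B * C) $$ (i, j))"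
        using i carrier_matD[OF rho_carrier[OF V_GL[OF True]]] conjunct1[OF coords[OF True]]
        by (simp add: scalar_prod_def atLeast0LessThan mult.commute)
      finally show ?thesis using partial_value[OF True i order_refl] by simp
    qed
    moreover have "partial l B \<in> carrier_vec l"
      using partial_section[OF order_refl] True by (simp add: assoc_bundle_def)
    ultimately show ?thesis using s_carrier[OF True] by (intro eq_vecI) auto
  next
    case False
    have "partial l \<in> extensional (frames n r V)" "s \<in> extensional (frames n r V)"
      using partial_section[OF order_refl] s by (simp_all add: assoc_bundle_def)
    then show ?thesis using False by (simp add: extensional_def)
  qed
qed

end

end

section \<open>Bundle homomorphisms as equivariant matrix functions\<close>

locale bundle_hom = L: rat_rep r l \<rho> + M: rat_rep r m \<sigma>
  for r l m :: nat and \<rho> \<sigma> :: "'k :: field mat \<Rightarrow> 'k mat" +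
  fixes n :: nat
begin

abbreviation "E \<equiv> assoc_bundle n r l \<rho>"
abbreviation "E' \<equiv> assoc_bundle n r m \<sigma>"

definition hom_of :: "('k mat \<Rightarrow> 'k mat) \<Rightarrow> 'k vec set set \<Rightarrow> ('k mat \<Rightarrow> 'k vec) \<Rightarrow> 'k mat \<Rightarrow> 'k vec" where
  "hom_of F = (\<lambda>U\<in>{U. gr_open n r U}. \<lambda>s\<in>carrier (E U). \<lambda>A\<in>frames n r U. F A *\<^sub>v s A)"

lemma hom_of_value:
  "gr_open n r U \<Longrightarrow> s \<in> carrier (E U) \<Longrightarrow> A \<in> frames n r U \<Longrightarrow> hom_of F U s A = F A *\<^sub>v s A"
  by (simp add: hom_of_def)

lemma hom_of_carrier:
  assumes F: "equivariant r n l m \<rho> \<sigma> F"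
  shows "hom_of F \<in> carrier (O_Hom n r E E')"
proof -
  have Fc: "F A \<in> carrier_mat m l" if "A \<in> surj_mats r n" for A using F that by (simp add: equivariant_def)
  have Fr: "regular_on r n (surj_mats r n) (\<lambda>A. F A $$ (i, j))" if "i < m" "j < l" for i j
    using F that by (simp add: equivariant_def)
  have sec: "hom_of F U s \<in> carrier (E' U)" if U: "gr_open n r U" and s: "s \<in> carrier (E U)" for U s
  proof -
    have sc: "s A \<in> carrier_vec l" if "A \<in> frames n r U" for A using s that by (simp add: assoc_bundle_def)
    have val: "hom_of F U s A = F A *\<^sub>v s A" if "A \<in> frames n r U" for A using hom_of_value[OF U s that] .
    have "regular_on r n (frames n r U) (\<lambda>A. hom_of F U s A $ i)" if i: "i < m" for i
    proof (rule regular_on_cong)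
      show "regular_on r n (frames n r U) (\<lambda>A. \<Sum>j<l. F A $$ (i, j) * s A $ j)"
      proof (intro regular_on_sum regular_on_mult gr_open_frames[OF U])
        fix j assume "j \<in> {..<l}"
        then have j: "j < l" by simp
        show "regular_on r n (frames n r U) (\<lambda>A. F A $$ (i, j))"
          by (rule regular_on_subset[OF Fr[OF i j] gr_open_frames[OF U]]) (use frames_surj in blast)
        show "regular_on r n (frames n r U) (\<lambda>A. s A $ j)" using s j by (simp add: assoc_bundle_def)
      qed
      fix A assume A: "A \<in> frames n r U"
      show "(\<Sum>j<l. F A $$ (i, j) * s A $ j) = hom_of F U s A $ i"
        using Fc[OF frames_surj[OF A]] sc[OF A] i by (simp add: val[OF A] scalar_prod_def atLeast0LessThan)
    qed
    moreover have "hom_of F U s A \<in> carrier_vec m" if A: "A \<in> frames n r U" for A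
      unfolding val[OF A] by (rule mult_mat_vec_carrier[OF Fc[OF frames_surj[OF A]] sc[OF A]])
    moreover have "hom_of F U s (g * A) = \<sigma> g *\<^sub>v hom_of F U s A" if A: "A \<in> frames n r U" and g: "g \<in> GL r" for A g
    proof -
      note A' = frames_surj[OF A] and gA = frames_GL[OF A g]
      have sg: "s (g * A) = \<rho> g *\<^sub>v s A" using s A g by (simp add: assoc_bundle_def)
      have "F (g * A) *\<^sub>v (\<rho> g *\<^sub>v s A) = (F (g * A) * \<rho> g) *\<^sub>v s A"
        by (rule assoc_mult_mat_vec[OF Fc[OF frames_surj[OF gA]] L.rho_carrier[OF g] sc[OF A], symmetric])
      also have "F (g * A) * \<rho> g = \<sigma> g * F A" using F A' g by (simp add: equivariant_def)
      also have "(\<sigma> g * F A) *\<^sub>v s A = \<sigma> g *\<^sub>v (F A *\<^sub>v s A)"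
        by (rule assoc_mult_mat_vec[OF M.rho_carrier[OF g] Fc[OF A'] sc[OF A]])
      finally show ?thesis unfolding val[OF A] val[OF gA] sg .
    qed
    moreover have "hom_of F U s \<in> extensional (frames n r U)" using U s by (simp add: hom_of_def)
    ultimately show ?thesis by (simp add: assoc_bundle_def)
  qed
  have hom: "hom_of F U \<in> LinearCombinations.module_hom (gr_O n r U) (E U) (E' U)" if U: "gr_open n r U" for U
    unfolding LinearCombinations.module_hom_def
  proof (intro CollectI conjI allI impI)
    show "hom_of F U \<in> carrier (E U) \<rightarrow> carrier (E' U)" using sec[OF U] by blast
    have sc: "s A \<in> carrier_vec l" if "s \<in> carrier (E U)" "A \<in> frames n r U" for s A using that by (simp add: assoc_bundle_def)
    fix s t assume st: "s \<in> carrier (E U) \<and> t \<in> carrier (E U)"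
    have a: "s \<oplus>\<^bsub>E U\<^esub> t \<in> carrier (E U)"
      by (rule assoc_bundle_add[OF U]) (use st in \<open>simp_all add: L.act_add\<close>)
    show "hom_of F U (s \<oplus>\<^bsub>E U\<^esub> t) = hom_of F U s \<oplus>\<^bsub>E' U\<^esub> hom_of F U t"
    proof
      fix A
      show "hom_of F U (s \<oplus>\<^bsub>E U\<^esub> t) A = (hom_of F U s \<oplus>\<^bsub>E' U\<^esub> hom_of F U t) A"
      proof (cases "A \<in> frames n r U")
        case True
        have "F A *\<^sub>v (s A + t A) = F A *\<^sub>v s A + F A *\<^sub>v t A"
          by (rule mult_add_distrib_mat_vec[OF Fc[OF frames_surj[OF True]]]) (use sc st True in auto)
        then show ?thesis using hom_of_value[OF U a True] hom_of_value[OF U _ True] st True by (simp add: assoc_bundle_def)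
      next
        case False
        then show ?thesis using U a by (simp add: hom_of_def) (simp add: assoc_bundle_def)
      qed
    qed
  next
    fix f s assume fs: "f \<in> carrier (gr_O n r U) \<and> s \<in> carrier (E U)"
    have sc: "s A \<in> carrier_vec l" if "A \<in> frames n r U" for A using that fs by (simp add: assoc_bundle_def)
    have a: "f \<odot>\<^bsub>E U\<^esub> s \<in> carrier (E U)"
      by (rule assoc_bundle_smult[OF U]) (use fs in \<open>simp_all add: L.act_smult\<close>)
    show "hom_of F U (f \<odot>\<^bsub>E U\<^esub> s) = f \<odot>\<^bsub>E' U\<^esub> hom_of F U s"
    proof
      fix A
      show "hom_of F U (f \<odot>\<^bsub>E U\<^esub> s) A = (f \<odot>\<^bsub>E' U\<^esub> hom_of F U s) A"
      proof (cases "A \<in> frames n r U")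
        case True
        have "F A *\<^sub>v (f (mat_kernel A) \<cdot>\<^sub>v s A) = f (mat_kernel A) \<cdot>\<^sub>v (F A *\<^sub>v s A)"
          by (rule mult_mat_vec[OF Fc[OF frames_surj[OF True]] sc[OF True]])
        then show ?thesis using hom_of_value[OF U a True] hom_of_value[OF U _ True] fs True by (simp add: assoc_bundle_def)
      next
        case False
        then show ?thesis using U a by (simp add: hom_of_def) (simp add: assoc_bundle_def)
      qed
    qed
  qed
  have res: "hom_of F U' (restrict s (frames n r U')) = restrict (hom_of F U s) (frames n r U')"
    if U: "gr_open n r U" and U': "gr_open n r U'" and sub: "U' \<subseteq> U" and s: "s \<in> carrier (E U)" for U U' s
  proof
    fix A
    show "hom_of F U' (restrict s (frames n r U')) A = restrict (hom_of F U s) (frames n r U') A"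
    proof (cases "A \<in> frames n r U'")
      case True
      then have "A \<in> frames n r U" using frames_mono[OF sub] by blast
      then show ?thesis
        using True hom_of_value[OF U' assoc_bundle_restrict[OF s U' sub] True] hom_of_value[OF U s] by simp
    next
      case False
      then show ?thesis using U' assoc_bundle_restrict[OF s U' sub] by (simp add: hom_of_def)
    qed
  qed
  have ext: "hom_of F \<in> extensional {U. gr_open n r U}" "gr_open n r U \<Longrightarrow> hom_of F U \<in> extensional (carrier (E U))" for U
    by (simp_all add: hom_of_def)
  show ?thesis
    unfolding O_Hom_def using ext hom res by simp
qed

context
  fixes \<phi> assumes \<phi>: "\<phi> \<in> carrier (O_Hom n r E E')"
begin

lemma phi_hom: "gr_open n r U \<Longrightarrow> \<phi> U \<in> LinearCombinations.module_hom (gr_O n r U) (E U) (E' U)"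
  and phi_ext: "gr_open n r U \<Longrightarrow> \<phi> U \<in> extensional (carrier (E U))" "\<phi> \<in> extensional {U. gr_open n r U}"
  and phi_restrict: "gr_open n r U \<Longrightarrow> gr_open n r U' \<Longrightarrow> U' \<subseteq> U \<Longrightarrow> s \<in> carrier (E U) \<Longrightarrow>
     \<phi> U' (restrict s (frames n r U')) = restrict (\<phi> U s) (frames n r U')"
  using \<phi> by (simp_all add: O_Hom_def)

lemma phi_section: "gr_open n r U \<Longrightarrow> s \<in> carrier (E U) \<Longrightarrow> \<phi> U s \<in> carrier (E' U)"
  using LinearCombinations.module_hom_closed[OF phi_hom] by (rule funcset_mem)

lemma phi_carrier: "gr_open n r U \<Longrightarrow> s \<in> carrier (E U) \<Longrightarrow> A \<in> frames n r U \<Longrightarrow> \<phi> U s A \<in> carrier_vec m"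
  using phi_section[of U s] by (simp add: assoc_bundle_def)

definition rinv :: "'k mat \<Rightarrow> 'k mat" where
  "rinv A = (SOME C. C \<in> carrier_mat n r \<and> A * C = 1\<^sub>m r)"

lemma rinv: "A \<in> surj_mats r n \<Longrightarrow> rinv A \<in> carrier_mat n r \<and> A * rinv A = 1\<^sub>m r"
  unfolding rinv_def by (rule someI_ex) (metis surj_mats_right_inverse)

text \<open>In the chart centred at \<open>A\<close>, with \<open>A * C\<close> the identity, the
  local frame takes the standard basis as its values at \<open>A\<close>. The images of the frame
  sections, evaluated at \<open>A\<close>, are therefore the columns of the matrix sought.\<close>

definition mat_of :: "'k mat \<Rightarrow> 'k mat" where
  "mat_of A = mat m l (\<lambda>(i, j). \<phi> (chart r n (rinv A)) (L.esec n (rinv A) j) A $ i)"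

lemma phi_partial:
  assumes C: "C \<in> carrier_mat n r" and V: "gr_open n r V" "V \<subseteq> chart r n C"
    and s: "s \<in> carrier (E V)" and A: "A \<in> frames n r V" and i: "i < m"
  shows "k \<le> l \<Longrightarrow> \<phi> V (L.partial n C V s k) A $ i = (\<Sum>j<k. L.coords C s A $ j * \<phi> (chart r n C) (L.esec n C j) A $ i)"
proof (induction k)
  case 0
  let ?z = "\<zero>\<^bsub>E V\<^esub>"
  have z: "?z \<in> carrier (E V)" by (rule L.zero_section[OF V(1)])
  have "?z \<oplus>\<^bsub>E V\<^esub> ?z = ?z" by (simp add: assoc_bundle_def fun_eq_iff)
  then have "\<phi> V ?z = \<phi> V ?z \<oplus>\<^bsub>E' V\<^esub> \<phi> V ?z"
    using LinearCombinations.module_hom_add[OF phi_hom[OF V(1)] z z] by simp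
  then have "\<phi> V ?z A = \<phi> V ?z A + \<phi> V ?z A"
    using assoc_bundle_value(1)[OF A, where s = "\<phi> V ?z" and t = "\<phi> V ?z" and m = m and \<rho> = \<sigma>] by simp
  from arg_cong[OF this, of "\<lambda>x. x $ i"] have "\<phi> V ?z A $ i = \<phi> V ?z A $ i + \<phi> V ?z A $ i"
    using carrier_vecD[OF phi_carrier[OF V(1) z A]] i by simp
  then have "\<phi> V ?z A $ i = 0" by (rule iffD1[OF add_cancel_right_right])
  then show ?case unfolding L.partial.simps[OF C V s] by simp
next
  case (Suc k)
  then have k: "k < l" "k \<le> l" by simp_all
  note p = L.partial_section[OF C V s k(2)] and e = L.esec_restrict[OF C V s k(1)] and t = L.term_section[OF C V s k(1)]
    and c = L.cfun_regular[OF C V s k(1)]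
  let ?e = "restrict (L.esec n C k) (frames n r V)" and ?f = "L.cfun n C V s k"
  have "\<phi> V (L.partial n C V s (Suc k)) = \<phi> V (L.partial n C V s k) \<oplus>\<^bsub>E' V\<^esub> (?f \<odot>\<^bsub>E' V\<^esub> \<phi> V ?e)"
    unfolding L.partial.simps[OF C V s]
    using LinearCombinations.module_hom_add[OF phi_hom[OF V(1)] p t] LinearCombinations.module_hom_smult[OF phi_hom[OF V(1)] c e] by simp
  moreover have "\<phi> V ?e A = \<phi> (chart r n C) (L.esec n C k) A"
    using phi_restrict[OF gr_open_chart[OF C] V L.esec_section[OF C k(1)]] A by simp
  ultimately have "\<phi> V (L.partial n C V s (Suc k)) A = \<phi> V (L.partial n C V s k) A + L.coords C s A $ k \<cdot>\<^sub>v \<phi> (chart r n C) (L.esec n C k) A"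
    using L.cfun_eq[OF C V s A, of k] by (simp add: assoc_bundle_value[OF A])
  moreover have "\<phi> (chart r n C) (L.esec n C k) A \<in> carrier_vec m"
    by (rule phi_carrier[OF gr_open_chart[OF C] L.esec_section[OF C k(1)]]) (use A frames_mono[OF V(2)] in blast)
  ultimately show ?case using Suc.IH[OF k(2)] i phi_carrier[OF V(1) p A] by simp
qed

text \<open>Compatibility with restriction allows passing to the chart centred at \<open>A\<close>,
  where the section is expanded in the local frame and linearity over the structure sheaf applies.
  At \<open>A\<close> itself the coordinates of the section are the entries of
  \<open>s A\<close>.\<close>

lemma phi_value:
  assumes U: "gr_open n r U" and s: "s \<in> carrier (E U)" and A: "A \<in> frames n r U"
  shows "\<phi> U s A = mat_of A *\<^sub>v s A"
proof (rule eq_vecI)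
  note As = frames_surj[OF A]
  let ?C = "rinv A"
  have C: "?C \<in> carrier_mat n r" and AC: "A * ?C = 1\<^sub>m r" using rinv[OF As] by simp_all
  let ?V = "U \<inter> chart r n ?C"
  have V: "gr_open n r ?V" "?V \<subseteq> chart r n ?C" "?V \<subseteq> U" using gr_open_Int[OF U gr_open_chart[OF C]] by auto
  have "cdet r n ?C A \<noteq> 0" using cdet_GL[OF surj_mats_carrier[OF As] C] AC by simp
  then have AV: "A \<in> frames n r ?V" using A As frames_chart[OF C] by (auto simp: frames_eq)
  let ?s = "restrict s (frames n r ?V)"
  note s' = assoc_bundle_restrict[OF s V(1,3)]
  have sA: "s A \<in> carrier_vec l" using s A by (simp add: assoc_bundle_def)
  have co: "L.coords ?C ?s A = s A"
    using L.coords[OF C V(1,2) s' AV] L.act_one[OF conjunct1[OF L.coords[OF C V(1,2) s' AV]]] AV unfolding AC by simp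
  show "dim_vec (\<phi> U s A) = dim_vec (mat_of A *\<^sub>v s A)"
    using phi_carrier[OF U s A] by (simp add: mat_of_def)
  fix i assume "i < dim_vec (mat_of A *\<^sub>v s A)"
  then have i: "i < m" by (simp add: mat_of_def)
  have "\<phi> U s A $ i = \<phi> ?V ?s A $ i" using phi_restrict[OF U V(1,3) s] AV by simp
  also have "\<dots> = (\<Sum>j<l. s A $ j * \<phi> (chart r n ?C) (L.esec n ?C j) A $ i)"
    using phi_partial[OF C V(1,2) s' AV i order_refl] unfolding L.section_expansion[OF C V(1,2) s'] co .
  finally show "\<phi> U s A $ i = (mat_of A *\<^sub>v s A) $ i"
    using i sA by (simp add: mat_of_def scalar_prod_def atLeast0LessThan mult.commute)
qed

lemma mat_of_carrier: "mat_of A \<in> carrier_mat m l"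
  by (simp add: mat_of_def)

text \<open>The transformation law is read off by evaluating one section at both frames. Regularity
  is not visible in the definition, since the chart varies with the frame. In a fixed chart the
  product of \<open>mat_of A\<close> with \<open>\<rho> (A * C)\<close> has regular entries, namely
  those of the images of the local frame, and Cramer's rule recovers the rows of
  \<open>mat_of A\<close>.\<close>

lemma mat_of_equivariant: "equivariant r n l m \<rho> \<sigma> mat_of"
  unfolding equivariant_def
proof (intro conjI ballI allI impI)
  fix A g :: "'k mat" assume A: "A \<in> surj_mats r n" and g: "g \<in> GL r"
  let ?C = "rinv A"
  have C: "?C \<in> carrier_mat n r" and AC: "A * ?C = 1\<^sub>m r" using rinv[OF A] by simp_all
  let ?U = "chart r n ?C"
  note U = gr_open_chart[OF C]
  have "cdet r n ?C A \<noteq> 0" using cdet_GL[OF surj_mats_carrier[OF A] C] AC by simp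
  then have AU: "A \<in> frames n r ?U" using A frames_chart[OF C] by simp
  note gA = frames_GL[OF AU g]
  have e: "L.esec n ?C j A = unit_vec l j" "L.esec n ?C j (g * A) = \<rho> g *\<^sub>v unit_vec l j" for j
  proof -
    have "g * A * ?C = g" using assoc_mult_mat[OF GL_carrier[OF g] surj_mats_carrier[OF A] C] AC GL_carrier[OF g] by simp
    then show "L.esec n ?C j (g * A) = \<rho> g *\<^sub>v unit_vec l j" using gA by (simp add: L.esec_def)
    show "L.esec n ?C j A = unit_vec l j" using AU AC L.act_one[OF unit_vec_carrier] by (simp add: L.esec_def)
  qed
  have col: "mat_of (g * A) *\<^sub>v (\<rho> g *\<^sub>v unit_vec l j) = \<sigma> g *\<^sub>v (mat_of A *\<^sub>v unit_vec l j)" if j: "j < l" for j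
  proof -
    note s = L.esec_section[OF C j]
    have "\<phi> ?U (L.esec n ?C j) (g * A) = \<sigma> g *\<^sub>v \<phi> ?U (L.esec n ?C j) A"
      using phi_section[OF U s] AU g by (simp add: assoc_bundle_def)
    then show ?thesis unfolding phi_value[OF U s AU] phi_value[OF U s gA] e .
  qed
  have P: "mat_of (g * A) * \<rho> g \<in> carrier_mat m l" and Q: "\<sigma> g * mat_of A \<in> carrier_mat m l"
    using mult_carrier_mat[OF mat_of_carrier L.rho_carrier[OF g]] mult_carrier_mat[OF M.rho_carrier[OF g] mat_of_carrier] by simp_all
  show "mat_of (g * A) * \<rho> g = \<sigma> g * mat_of A"
  proof (rule eq_matI)
    fix i j assume "i < dim_row (\<sigma> g * mat_of A)" "j < dim_col (\<sigma> g * mat_of A)"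
    then have i: "i < m" and j: "j < l" using carrier_matD[OF Q] by simp_all
    have ent: "(X *\<^sub>v unit_vec l j) $ i = X $$ (i, j)" if "X \<in> carrier_mat m l" for X :: "'k mat"
      using carrier_matD[OF that] i j by simp
    have "(mat_of (g * A) * \<rho> g) *\<^sub>v unit_vec l j = (\<sigma> g * mat_of A) *\<^sub>v unit_vec l j"
      using col[OF j] assoc_mult_mat_vec[OF mat_of_carrier L.rho_carrier[OF g] unit_vec_carrier]
        assoc_mult_mat_vec[OF M.rho_carrier[OF g] mat_of_carrier unit_vec_carrier] by simp
    then show "(mat_of (g * A) * \<rho> g) $$ (i, j) = (\<sigma> g * mat_of A) $$ (i, j)"
      unfolding ent[OF P, symmetric] ent[OF Q, symmetric] by (rule arg_cong)
  qed (use carrier_matD[OF P] carrier_matD[OF Q] in simp_all)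
next
  fix i j assume i: "i < m" and j: "j < l"
  show "regular_on r n (surj_mats r n) (\<lambda>A. mat_of A $$ (i, j))"
  proof (rule regular_on_local)
    fix A0 :: "'k mat" assume A0: "A0 \<in> surj_mats r n"
    let ?C = "rinv A0"
    have C: "?C \<in> carrier_mat n r" and AC: "A0 * ?C = 1\<^sub>m r" using rinv[OF A0] by simp_all
    let ?U = "chart r n ?C" let ?W = "frames n r ?U"
    note U = gr_open_chart[OF C]
    have "cdet r n ?C A0 \<noteq> 0" using cdet_GL[OF surj_mats_carrier[OF A0] C] AC by simp
    then have AU: "A0 \<in> ?W" using A0 frames_chart[OF C] by simp
    have "regular_on r n ?W (\<lambda>A. row (mat_of A) i $ j)"
    proof (rule regular_on_solution[OF gr_open_frames[OF U], where M = "\<lambda>A. transpose_mat (\<rho> (A * ?C))" and m = l])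
      fix A assume A: "A \<in> ?W"
      note g = L.chart_GL[OF C A]
      show "transpose_mat (\<rho> (A * ?C)) \<in> carrier_mat l l" using L.rho_carrier[OF g] by (simp only: transpose_carrier_mat)
      show "det (transpose_mat (\<rho> (A * ?C))) \<noteq> 0"
        using L.rho_GL[OF g] L.rho_carrier[OF g] by (simp add: GL_iff det_transpose[of _ l])
      show "row (mat_of A) i \<in> carrier_vec l" by (rule row_carrier_vec[OF i mat_of_carrier])
    next
      fix a b assume ab: "a < l" "b < l"
      show "regular_on r n ?W (\<lambda>A. transpose_mat (\<rho> (A * ?C)) $$ (a, b))"
      proof (rule regular_on_cong[OF L.chart_rho_regular[OF C U order_refl ab(2,1)]])
        fix A assume "A \<in> ?W"
        then show "\<rho> (A * ?C) $$ (b, a) = transpose_mat (\<rho> (A * ?C)) $$ (a, b)"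
          using carrier_matD[OF L.rho_carrier[OF L.chart_GL[OF C]]] ab by simp
      qed
    next
      fix a assume a: "a < l"
      note s = L.esec_section[OF C a]
      show "regular_on r n ?W (\<lambda>A. (transpose_mat (\<rho> (A * ?C)) *\<^sub>v row (mat_of A) i) $ a)"
      proof (rule regular_on_cong)
        show "regular_on r n ?W (\<lambda>A. \<phi> ?U (L.esec n ?C a) A $ i)"
          using phi_section[OF U s] i by (simp add: assoc_bundle_def)
        fix A assume A: "A \<in> ?W"
        note c = carrier_matD[OF L.rho_carrier[OF L.chart_GL[OF C A]]] and d = carrier_matD[OF mat_of_carrier[of A]]
        have "L.esec n ?C a A = \<rho> (A * ?C) *\<^sub>v unit_vec l a" using A by (simp add: L.esec_def)
        also have "\<dots> = col (\<rho> (A * ?C)) a" using c a by (intro eq_vecI) simp_all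
        finally have ea: "L.esec n ?C a A = col (\<rho> (A * ?C)) a" .
        have "\<phi> ?U (L.esec n ?C a) A $ i = (mat_of A *\<^sub>v col (\<rho> (A * ?C)) a) $ i"
          unfolding phi_value[OF U s A] ea ..
        also have "\<dots> = row (mat_of A) i \<bullet> col (\<rho> (A * ?C)) a"
          by (rule index_mult_mat_vec) (simp only: d i)
        also have "\<dots> = col (\<rho> (A * ?C)) a \<bullet> row (mat_of A) i"
          by (rule comm_scalar_prod[OF row_carrier_vec[OF i mat_of_carrier] col_carrier_vec[OF a L.rho_carrier[OF L.chart_GL[OF C A]]]])
        also have "\<dots> = (transpose_mat (\<rho> (A * ?C)) *\<^sub>v row (mat_of A) i) $ a"
          using a c by simp
        finally show "\<phi> ?U (L.esec n ?C a) A $ i = (transpose_mat (\<rho> (A * ?C)) *\<^sub>v row (mat_of A) i) $ a" .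
      qed
    qed (rule j)
    then have "regular_on r n ?W (\<lambda>A. mat_of A $$ (i, j))"
      by (rule regular_on_cong) (use i j carrier_matD[OF mat_of_carrier] in simp)
    then show "\<exists>V. A0 \<in> V \<and> V \<subseteq> surj_mats r n \<and> regular_on r n V (\<lambda>A. mat_of A $$ (i, j))"
      by (intro exI[of _ ?W] conjI AU subsetI) (rule frames_surj)
  qed
qed (rule mat_of_carrier)

lemma hom_of_mat_of: "hom_of mat_of = \<phi>"
proof (rule extensionalityI[of _ "{U. gr_open n r U}"])
  show "hom_of mat_of \<in> extensional {U. gr_open n r U}" by (simp add: hom_of_def)
  show "\<phi> \<in> extensional {U. gr_open n r U}" by (rule phi_ext(2))
  fix U :: "'k vec set set" assume "U \<in> {U. gr_open n r U}"
  then have U: "gr_open n r U" by simp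
  show "hom_of mat_of U = \<phi> U"
  proof (rule extensionalityI[of _ "carrier (E U)"])
    show "hom_of mat_of U \<in> extensional (carrier (E U))" using U by (simp add: hom_of_def)
    show "\<phi> U \<in> extensional (carrier (E U))" by (rule phi_ext(1)[OF U])
    fix s assume s: "s \<in> carrier (E U)"
    show "hom_of mat_of U s = \<phi> U s"
    proof (rule extensionalityI[of _ "frames n r U"])
      show "hom_of mat_of U s \<in> extensional (frames n r U)" using U s by (simp add: hom_of_def)
      show "\<phi> U s \<in> extensional (frames n r U)" using phi_section[OF U s] by (simp add: assoc_bundle_def)
      show "hom_of mat_of U s A = \<phi> U s A" if "A \<in> frames n r U" for A
        using hom_of_value[OF U s that] phi_value[OF U s that] by simp
    qed
  qed
qed

end

lemma hom_of_surjective: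
  assumes "\<phi> \<in> carrier (O_Hom n r E E')"
  shows "\<exists>F. equivariant r n l m \<rho> \<sigma> F \<and> \<phi> = hom_of F"
  using mat_of_equivariant[OF assms] hom_of_mat_of[OF assms] by metis

lemma hom_of_injective:
  assumes eq: "hom_of F = hom_of G" and A: "A \<in> surj_mats r n" and F: "F A \<in> carrier_mat m l" and G: "G A \<in> carrier_mat m l"
  shows "F A = G A"
proof (rule eq_matI)
  obtain C where C: "C \<in> carrier_mat n r" and AC: "A * C = 1\<^sub>m r" using surj_mats_right_inverse[OF A] .
  let ?U = "chart r n C"
  note U = gr_open_chart[OF C]
  have "cdet r n C A \<noteq> 0" using cdet_GL[OF surj_mats_carrier[OF A] C] AC by simp
  then have AU: "A \<in> frames n r ?U" using A frames_chart[OF C] by simp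
  fix i j assume "i < dim_row (G A)" "j < dim_col (G A)"
  then have i: "i < m" and j: "j < l" using G by auto
  have e: "L.esec n C j A = unit_vec l j" using AU AC L.act_one[OF unit_vec_carrier] by (simp add: L.esec_def)
  have "F A *\<^sub>v unit_vec l j = G A *\<^sub>v unit_vec l j"
    using hom_of_value[OF U L.esec_section[OF C j] AU, of F] hom_of_value[OF U L.esec_section[OF C j] AU, of G] unfolding eq e by simp
  note eqv = this
  have ent: "(X *\<^sub>v unit_vec l j) $ i = X $$ (i, j)" if "X \<in> carrier_mat m l" for X :: "'k mat"
    using carrier_matD[OF that] i j by simp
  show "F A $$ (i, j) = G A $$ (i, j)" unfolding ent[OF F, symmetric] ent[OF G, symmetric] eqv ..
qed (use F G in auto)

end

section \<open>The isomorphism\<close>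

lemma vectorspaceI:
  fixes V :: "('k :: field, 'a) module"
  assumes closed: "\<And>x y. x \<in> carrier V \<Longrightarrow> y \<in> carrier V \<Longrightarrow> x \<oplus>\<^bsub>V\<^esub> y \<in> carrier V"
    and zero: "\<zero>\<^bsub>V\<^esub> \<in> carrier V"
    and smult: "\<And>c x. x \<in> carrier V \<Longrightarrow> c \<odot>\<^bsub>V\<^esub> x \<in> carrier V"
    and assoc: "\<And>x y z. x \<in> carrier V \<Longrightarrow> y \<in> carrier V \<Longrightarrow> z \<in> carrier V \<Longrightarrow> (x \<oplus>\<^bsub>V\<^esub> y) \<oplus>\<^bsub>V\<^esub> z = x \<oplus>\<^bsub>V\<^esub> (y \<oplus>\<^bsub>V\<^esub> z)"
    and comm: "\<And>x y. x \<in> carrier V \<Longrightarrow> y \<in> carrier V \<Longrightarrow> x \<oplus>\<^bsub>V\<^esub> y = y \<oplus>\<^bsub>V\<^esub> x"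
    and l_zero: "\<And>x. x \<in> carrier V \<Longrightarrow> \<zero>\<^bsub>V\<^esub> \<oplus>\<^bsub>V\<^esub> x = x"
    and l_inv: "\<And>x. x \<in> carrier V \<Longrightarrow> (- 1) \<odot>\<^bsub>V\<^esub> x \<oplus>\<^bsub>V\<^esub> x = \<zero>\<^bsub>V\<^esub>"
    and distr: "\<And>a b x. x \<in> carrier V \<Longrightarrow> (a + b) \<odot>\<^bsub>V\<^esub> x = a \<odot>\<^bsub>V\<^esub> x \<oplus>\<^bsub>V\<^esub> b \<odot>\<^bsub>V\<^esub> x"
    and distr': "\<And>a x y. x \<in> carrier V \<Longrightarrow> y \<in> carrier V \<Longrightarrow> a \<odot>\<^bsub>V\<^esub> (x \<oplus>\<^bsub>V\<^esub> y) = a \<odot>\<^bsub>V\<^esub> x \<oplus>\<^bsub>V\<^esub> a \<odot>\<^bsub>V\<^esub> y"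
    and assoc': "\<And>a b x. x \<in> carrier V \<Longrightarrow> (a * b) \<odot>\<^bsub>V\<^esub> x = a \<odot>\<^bsub>V\<^esub> (b \<odot>\<^bsub>V\<^esub> x)"
    and one: "\<And>x. x \<in> carrier V \<Longrightarrow> 1 \<odot>\<^bsub>V\<^esub> x = x"
  shows "vectorspace class_ring V"
proof -
  have "abelian_group V"
  proof (rule abelian_groupI)
    show "\<exists>y\<in>carrier V. y \<oplus>\<^bsub>V\<^esub> x = \<zero>\<^bsub>V\<^esub>" if "x \<in> carrier V" for x
      using l_inv[OF that] smult[OF that] by (rule bexI)
  qed (fact closed zero assoc comm l_zero)+
  moreover have f: "field (class_ring :: 'k ring)" using class_field by (simp add: class_field_def)
  ultimately have "Module.module class_ring V"
    unfolding Module.module_def module_axioms_def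
    using fieldE(1)[OF f] smult distr distr' assoc' one by (simp add: class_ring_simps)
  then show ?thesis unfolding vectorspace_def using f by simp
qed

text \<open>\<open>W\<close> inherits the vector space axioms from \<open>V\<close> along
  \<open>h\<close>, which spares their verification for sheaf homomorphisms; the isomorphism is the
  inverse of \<open>h\<close>.\<close>

lemma vs_isomorphic_transport:
  fixes V :: "('k :: field, 'a) module" and W :: "('k, 'b) module"
  assumes V: "vectorspace class_ring V" and bij: "bij_betw h (carrier V) (carrier W)"
    and add: "\<And>x y. x \<in> carrier V \<Longrightarrow> y \<in> carrier V \<Longrightarrow> h (x \<oplus>\<^bsub>V\<^esub> y) = h x \<oplus>\<^bsub>W\<^esub> h y"
    and smult: "\<And>c x. x \<in> carrier V \<Longrightarrow> h (c \<odot>\<^bsub>V\<^esub> x) = c \<odot>\<^bsub>W\<^esub> h x"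
    and zero: "h \<zero>\<^bsub>V\<^esub> = \<zero>\<^bsub>W\<^esub>"
  shows "vs_isomorphic W V"
proof -
  interpret V: vectorspace class_ring V by (rule V)
  have hc: "h x \<in> carrier W" if "x \<in> carrier V" for x using bij that by (auto simp: bij_betw_def)
  have sur: "\<exists>x\<in>carrier V. y = h x" if "y \<in> carrier W" for y using bij that by (auto simp: bij_betw_def)
  have sc: "c \<odot>\<^bsub>V\<^esub> x \<in> carrier V" if "x \<in> carrier V" for c x using V.smult_closed[of c x] that by (simp add: class_ring_simps)
  have W: "vectorspace class_ring W"
  proof (rule vectorspaceI)
    fix x y z assume x: "x \<in> carrier W" and y: "y \<in> carrier W" and z: "z \<in> carrier W"
    obtain a b c where a: "a \<in> carrier V" "x = h a" and b: "b \<in> carrier V" "y = h b" and c: "c \<in> carrier V" "z = h c"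
      using sur[OF x] sur[OF y] sur[OF z] by (elim bexE) (rule that)
    show "(x \<oplus>\<^bsub>W\<^esub> y) \<oplus>\<^bsub>W\<^esub> z = x \<oplus>\<^bsub>W\<^esub> (y \<oplus>\<^bsub>W\<^esub> z)"
      using a b c V.a_assoc[OF a(1) b(1) c(1)] by (simp add: add[symmetric])
  next
    fix x y assume x: "x \<in> carrier W" and y: "y \<in> carrier W"
    obtain a b where a: "a \<in> carrier V" "x = h a" and b: "b \<in> carrier V" "y = h b" using sur[OF x] sur[OF y] by (elim bexE) (rule that)
    show "x \<oplus>\<^bsub>W\<^esub> y \<in> carrier W" using a b hc by (simp add: add[symmetric])
    show "x \<oplus>\<^bsub>W\<^esub> y = y \<oplus>\<^bsub>W\<^esub> x" using a b V.a_comm[OF a(1) b(1)] by (simp add: add[symmetric])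
    show "e \<odot>\<^bsub>W\<^esub> (x \<oplus>\<^bsub>W\<^esub> y) = e \<odot>\<^bsub>W\<^esub> x \<oplus>\<^bsub>W\<^esub> e \<odot>\<^bsub>W\<^esub> y" for e
      using a b V.smult_r_distr[OF _ a(1) b(1), of e] sc by (simp add: add[symmetric] smult[symmetric] class_ring_simps)
  next
    fix x assume x: "x \<in> carrier W"
    obtain a where a: "a \<in> carrier V" "x = h a" using sur[OF x] by (elim bexE) (rule that)
    show "\<zero>\<^bsub>W\<^esub> \<oplus>\<^bsub>W\<^esub> x = x" using a add[of "\<zero>\<^bsub>V\<^esub>" a] zero by simp
    show "e \<odot>\<^bsub>W\<^esub> x \<in> carrier W" for e using a sc hc by (simp add: smult[symmetric])
    show "(e + f) \<odot>\<^bsub>W\<^esub> x = e \<odot>\<^bsub>W\<^esub> x \<oplus>\<^bsub>W\<^esub> f \<odot>\<^bsub>W\<^esub> x" for e f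
      using a V.smult_l_distr[OF _ _ a(1), of e f] sc by (simp add: add[symmetric] smult[symmetric] class_ring_simps)
    show "(e * f) \<odot>\<^bsub>W\<^esub> x = e \<odot>\<^bsub>W\<^esub> (f \<odot>\<^bsub>W\<^esub> x)" for e f
      using a V.smult_assoc1[OF _ _ a(1), of e f] sc by (simp add: smult[symmetric] class_ring_simps)
    show "1 \<odot>\<^bsub>W\<^esub> x = x" using a V.smult_one[OF a(1)] by (simp add: smult[symmetric] class_ring_simps)
    have "(- 1) \<odot>\<^bsub>V\<^esub> a \<oplus>\<^bsub>V\<^esub> 1 \<odot>\<^bsub>V\<^esub> a = 0 \<odot>\<^bsub>V\<^esub> a"
      using V.smult_l_distr[OF _ _ a(1), of "- 1" 1] by (simp add: class_ring_simps)
    moreover have "0 \<odot>\<^bsub>V\<^esub> a = \<zero>\<^bsub>V\<^esub>" using V.smult_l_null[OF a(1)] by (simp add: class_ring_simps)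
    moreover have "1 \<odot>\<^bsub>V\<^esub> a = a" using V.smult_one[OF a(1)] by (simp add: class_ring_simps)
    ultimately have "(- 1) \<odot>\<^bsub>V\<^esub> a \<oplus>\<^bsub>V\<^esub> a = \<zero>\<^bsub>V\<^esub>" by simp
    then show "(- 1) \<odot>\<^bsub>W\<^esub> x \<oplus>\<^bsub>W\<^esub> x = \<zero>\<^bsub>W\<^esub>"
      using a sc zero by (simp add: add[symmetric] smult[symmetric])
  next
    show "\<zero>\<^bsub>W\<^esub> \<in> carrier W" using hc[of "\<zero>\<^bsub>V\<^esub>"] zero by simp
  qed
  define f where "f = the_inv_into (carrier V) h"
  have fh: "f (h x) = x" if "x \<in> carrier V" for x
    using bij that unfolding f_def bij_betw_def by (intro the_inv_into_f_f) auto
  have bf: "bij_betw f (carrier W) (carrier V)" unfolding f_def by (rule bij_betw_the_inv_into[OF bij])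
  have "f \<in> LinearCombinations.module_hom class_ring W V"
    unfolding LinearCombinations.module_hom_def
  proof (intro CollectI conjI allI impI)
    show "f \<in> carrier W \<rightarrow> carrier V" using bf by (auto simp: bij_betw_def)
    fix x y assume "x \<in> carrier W \<and> y \<in> carrier W"
    then have x: "x \<in> carrier W" and y: "y \<in> carrier W" by simp_all
    obtain a b where "a \<in> carrier V" "x = h a" "b \<in> carrier V" "y = h b" using sur[OF x] sur[OF y] by (elim bexE) (rule that)
    then show "f (x \<oplus>\<^bsub>W\<^esub> y) = f x \<oplus>\<^bsub>V\<^esub> f y" by (simp add: add[symmetric] fh)
  next
    fix c :: 'k and x assume "c \<in> carrier class_ring \<and> x \<in> carrier W"
    then have x: "x \<in> carrier W" by simp
    obtain a where "a \<in> carrier V" "x = h a" using sur[OF x] by (elim bexE) (rule that)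
    then show "f (c \<odot>\<^bsub>W\<^esub> x) = c \<odot>\<^bsub>V\<^esub> f x" by (simp add: smult[symmetric] fh sc)
  qed
  then have "linear_map class_ring W V f"
    using V W unfolding linear_map_def mod_hom_def mod_hom_axioms_def vectorspace_def by simp
  then show ?thesis unfolding vs_isomorphic_def using bf by blast
qed

context bundle_hom begin

lemma E'_ops:
  "s \<oplus>\<^bsub>E' U\<^esub> t = (\<lambda>A\<in>frames n r U. s A + t A)" "f \<odot>\<^bsub>E' U\<^esub> s = (\<lambda>A\<in>frames n r U. f (mat_kernel A) \<cdot>\<^sub>v s A)"
  "\<zero>\<^bsub>E' U\<^esub> = (\<lambda>A\<in>frames n r U. 0\<^sub>v m)"
  by (simp_all add: assoc_bundle_def)

lemma O_Hom_ops:
  "\<phi> \<oplus>\<^bsub>O_Hom n r E E'\<^esub> \<psi> = (\<lambda>U\<in>{U. gr_open n r U}. \<lambda>s\<in>carrier (E U). \<phi> U s \<oplus>\<^bsub>E' U\<^esub> \<psi> U s)"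
  "c \<odot>\<^bsub>O_Hom n r E E'\<^esub> \<phi> = (\<lambda>U\<in>{U. gr_open n r U}. \<lambda>s\<in>carrier (E U). (\<lambda>K\<in>U. c) \<odot>\<^bsub>E' U\<^esub> \<phi> U s)"
  "\<zero>\<^bsub>O_Hom n r E E'\<^esub> = (\<lambda>U\<in>{U. gr_open n r U}. \<lambda>s\<in>carrier (E U). \<zero>\<^bsub>E' U\<^esub>)"
  by (simp_all add: O_Hom_def)

lemma section_carrier: "s \<in> carrier (E U) \<Longrightarrow> A \<in> frames n r U \<Longrightarrow> s A \<in> carrier_vec l"
  by (simp add: assoc_bundle_def)

lemma hom_of_add:
  assumes "\<And>A. A \<in> surj_mats r n \<Longrightarrow> F A \<in> carrier_mat m l" "\<And>A. A \<in> surj_mats r n \<Longrightarrow> G A \<in> carrier_mat m l"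
  shows "hom_of (\<lambda>A. F A + G A) = hom_of F \<oplus>\<^bsub>O_Hom n r E E'\<^esub> hom_of G"
proof -
  have "(F A + G A) *\<^sub>v s A = F A *\<^sub>v s A + G A *\<^sub>v s A" if "s \<in> carrier (E U)" "A \<in> frames n r U" for s U A
    by (rule add_mult_distrib_mat_vec[OF assms(1)[OF frames_surj[OF that(2)]] assms(2)[OF frames_surj[OF that(2)]] section_carrier[OF that]])
  then show ?thesis unfolding O_Hom_ops E'_ops hom_of_def by (intro restrict_ext) (auto intro!: restrict_ext)
qed

lemma hom_of_smult:
  assumes "\<And>A. A \<in> surj_mats r n \<Longrightarrow> F A \<in> carrier_mat m l"
  shows "hom_of (\<lambda>A. c \<cdot>\<^sub>m F A) = c \<odot>\<^bsub>O_Hom n r E E'\<^esub> hom_of F"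
proof -
  have "(c \<cdot>\<^sub>m F A) *\<^sub>v s A = (\<lambda>K\<in>U. c) (mat_kernel A) \<cdot>\<^sub>v (F A *\<^sub>v s A)" if "s \<in> carrier (E U)" "A \<in> frames n r U" for s U A
  proof -
    have "(c \<cdot>\<^sub>m F A) *\<^sub>v s A = c \<cdot>\<^sub>v (F A *\<^sub>v s A)"
      using carrier_matD[OF assms[OF frames_surj[OF that(2)]]] carrier_vecD[OF section_carrier[OF that]]
      by (intro eq_vecI) (simp_all add: scalar_prod_def sum_distrib_left mult.assoc)
    moreover have "mat_kernel A \<in> U" using that(2) by (simp add: frames_eq)
    ultimately show ?thesis by simp
  qed
  then show ?thesis unfolding O_Hom_ops E'_ops hom_of_def by (intro restrict_ext) (auto intro!: restrict_ext)
qed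

lemma hom_of_zero:
  assumes "\<And>A. A \<in> surj_mats r n \<Longrightarrow> F A = 0\<^sub>m m l"
  shows "hom_of F = \<zero>\<^bsub>O_Hom n r E E'\<^esub>"
proof -
  have "F A *\<^sub>v s A = 0\<^sub>v m" if "s \<in> carrier (E U)" "A \<in> frames n r U" for s U A
    unfolding assms[OF frames_surj[OF that(2)]] using section_carrier[OF that] by (intro eq_vecI) auto
  then show ?thesis unfolding O_Hom_ops E'_ops hom_of_def by (intro restrict_ext) (auto intro!: restrict_ext)
qed

lemma hom_of_cong:
  assumes "\<And>A. A \<in> surj_mats r n \<Longrightarrow> F A = G A"
  shows "hom_of F = hom_of G"
  unfolding hom_of_def by (intro restrict_ext) (simp add: assms frames_surj)

end

context hom_setup begin

sublocale bundle_hom r l m \<rho> \<sigma> n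
  by unfold_locales

text \<open>The carrier of the skew Schur power in the notation of boxes.\<close>

definition sym_tensors :: "((nat \<Rightarrow> nat) \<Rightarrow> 'k) set" where
  "sym_tensors = (\<lambda>z. csym Bs cl (rsym Bs rw z)) ` {z. \<forall>I. I \<notin> idx n Bs \<longrightarrow> z I = 0}"

lemma sym_tensorsE:
  assumes "t \<in> sym_tensors"
  obtains z where "\<And>I. I \<notin> idx n Bs \<Longrightarrow> z I = 0" "t = csym Bs cl (rsym Bs rw z)"
proof -
  from assms obtain z where "z \<in> {z. \<forall>I. I \<notin> idx n Bs \<longrightarrow> z I = 0}" "t = csym Bs cl (rsym Bs rw z)"
    unfolding sym_tensors_def by (rule imageE)
  then show ?thesis by (intro that[of z]) simp_all
qed

lemma sym_tensorsI:
  assumes "\<And>I. I \<notin> idx n Bs \<Longrightarrow> z I = 0" "t = csym Bs cl (rsym Bs rw z)"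
  shows "t \<in> sym_tensors"
  unfolding sym_tensors_def using assms by (intro image_eqI[of _ _ z]) simp_all

lemma sym_tensors_outside: "t \<in> sym_tensors \<Longrightarrow> I \<notin> idx n Bs \<Longrightarrow> t I = 0"
  by (auto simp: sym_tensors_def fsym_def idx_comp_iff[OF fib_perms_permutes])

lemma sym_tensors_linear:
  "(\<lambda>I. 0) \<in> sym_tensors"
  "s \<in> sym_tensors \<Longrightarrow> t \<in> sym_tensors \<Longrightarrow> (\<lambda>I. s I + t I) \<in> sym_tensors"
  "t \<in> sym_tensors \<Longrightarrow> (\<lambda>I. c * t I) \<in> sym_tensors"
proof -
  show "(\<lambda>I. 0) \<in> sym_tensors"
  proof (rule sym_tensorsI[of "\<lambda>I. 0"])
    have "rsym Bs rw (\<lambda>I. 0) = (\<lambda>I. 0 :: 'k)" by (rule ext) (rule fsym_zero)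
    then show "(\<lambda>I. 0) = csym Bs cl (rsym Bs rw (\<lambda>I. 0 :: 'k))" by (simp only:) (rule ext, rule fsym_zero[symmetric])
  qed simp
  show "(\<lambda>I. s I + t I) \<in> sym_tensors" if s: "s \<in> sym_tensors" and t: "t \<in> sym_tensors"
  proof -
    obtain y where y: "\<And>I. I \<notin> idx n Bs \<Longrightarrow> y I = 0" "s = csym Bs cl (rsym Bs rw y)" by (rule sym_tensorsE[OF s]) (rule that)
    obtain z where z: "\<And>I. I \<notin> idx n Bs \<Longrightarrow> z I = 0" "t = csym Bs cl (rsym Bs rw z)" by (rule sym_tensorsE[OF t]) (rule that)
    show ?thesis
    proof (rule sym_tensorsI[of "\<lambda>I. y I + z I"])
      have "rsym Bs rw (\<lambda>I. y I + z I) = (\<lambda>I. rsym Bs rw y I + rsym Bs rw z I)" by (rule ext) (rule fsym_add)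
      then show "(\<lambda>I. s I + t I) = csym Bs cl (rsym Bs rw (\<lambda>I. y I + z I))"
        unfolding y(2) z(2) by (simp only:) (rule ext, rule fsym_add[symmetric])
    qed (use y z in simp)
  qed
  show "(\<lambda>I. c * t I) \<in> sym_tensors" if t: "t \<in> sym_tensors"
  proof -
    obtain z where z: "\<And>I. I \<notin> idx n Bs \<Longrightarrow> z I = 0" "t = csym Bs cl (rsym Bs rw z)" by (rule sym_tensorsE[OF t]) (rule that)
    show ?thesis
    proof (rule sym_tensorsI[of "\<lambda>I. c * z I"])
      have "rsym Bs rw (\<lambda>I. c * z I) = (\<lambda>I. c * rsym Bs rw z I)" by (rule ext) (rule fsym_scale)
      then show "(\<lambda>I. c * t I) = csym Bs cl (rsym Bs rw (\<lambda>I. c * z I))"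
        unfolding z(2) by (simp only:) (rule ext, rule fsym_scale[symmetric])
    qed (use z in simp)
  qed
qed

lemma hom_bij: "bij_betw (\<lambda>t. hom_of (homtens t)) sym_tensors (carrier (O_Hom n r E E'))"
proof (rule bij_betwI')
  fix s t assume s: "s \<in> sym_tensors" and t: "t \<in> sym_tensors"
  show "(hom_of (homtens s) = hom_of (homtens t)) = (s = t)"
  proof
    assume eq: "hom_of (homtens s) = hom_of (homtens t)"
    let ?u = "\<lambda>I. s I + (- 1) * t I"
    have "?u \<in> sym_tensors" by (rule sym_tensors_linear(2)[OF s sym_tensors_linear(3)[OF t]])
    then obtain z where z: "?u = csym Bs cl (rsym Bs rw z)" by (rule sym_tensorsE)
    have "homtens ?u A = 0\<^sub>m m l" if A: "A \<in> surj_mats r n" for A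
    proof -
      have "homtens s A = homtens t A" by (rule hom_of_injective[OF eq A homtens_carrier homtens_carrier])
      then show ?thesis
        unfolding homtens_add homtens_scale using carrier_matD[OF homtens_carrier[of t A]] by (intro eq_matI) simp_all
    qed
    then have u0: "?u I = 0" if "I \<in> idx n Bs" for I
      using fun_cong[OF z, of I] homtens_injective[of z I] that unfolding z by simp
    show "s = t"
    proof (intro ext)
      fix I
      show "s I = t I"
      proof (cases "I \<in> idx n Bs")
        case True
        then show ?thesis using u0 by simp
      next
        case False
        then show ?thesis using sym_tensors_outside[OF s] sym_tensors_outside[OF t] by simp
      qed
    qed
  qed simp
next
  fix t
  show "hom_of (homtens t) \<in> carrier (O_Hom n r E E')" by (rule hom_of_carrier[OF equivariant_homtens])
next
  fix \<phi> assume "\<phi> \<in> carrier (O_Hom n r E E')"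
  then obtain F where F: "equivariant r n l m \<rho> \<sigma> F" "\<phi> = hom_of F" using hom_of_surjective by blast
  obtain z where z: "\<forall>A\<in>surj_mats r n. F A = homtens (csym Bs cl (rsym Bs rw z)) A" using homtens_surjective[OF F(1)] by (elim exE) (rule that)
  \<comment> \<open>Members of the skew Schur power come from tensors supported on multi-indices.
    Cutting \<open>z\<close> down to them leaves \<open>homtens\<close> unchanged, because it reads
    the tensor only there.\<close>
  let ?z = "\<lambda>I. if I \<in> idx n Bs then z I else 0"
  have c: "csym Bs cl (rsym Bs rw z) I = csym Bs cl (rsym Bs rw ?z) I" if I: "I \<in> idx n Bs" for I
  proof (rule fsym_cong[OF _ I])
    show "rsym Bs rw z J = rsym Bs rw ?z J" if J: "J \<in> idx n Bs" for J
      by (rule fsym_cong[OF _ J]) simp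
  qed
  have "F A = homtens (csym Bs cl (rsym Bs rw ?z)) A" if A: "A \<in> surj_mats r n" for A
  proof -
    have "tmul Bs A (csym Bs cl (rsym Bs rw z)) = tmul Bs A (csym Bs cl (rsym Bs rw ?z))"
      by (rule tmul_cong) (use c surj_mats_carrier[OF A] in auto)
    then show ?thesis using z A unfolding homtens_def by simp
  qed
  then have "\<phi> = hom_of (homtens (csym Bs cl (rsym Bs rw ?z)))" unfolding F(2) by (rule hom_of_cong)
  moreover have "csym Bs cl (rsym Bs rw ?z) \<in> sym_tensors" by (rule sym_tensorsI[of ?z]) simp_all
  ultimately show "\<exists>t\<in>sym_tensors. \<phi> = hom_of (homtens t)" by blast
qed

theorem isomorphic:
  fixes V :: "('k, (nat \<Rightarrow> nat) \<Rightarrow> 'k) module"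
  assumes carr: "carrier V = sym_tensors" and add: "\<And>s t. s \<oplus>\<^bsub>V\<^esub> t = (\<lambda>I. s I + t I)"
    and smult: "\<And>c t. c \<odot>\<^bsub>V\<^esub> t = (\<lambda>I. c * t I)" and zero: "\<zero>\<^bsub>V\<^esub> = (\<lambda>I. 0)"
  shows "vs_isomorphic (O_Hom n r E E') V"
proof (rule vs_isomorphic_transport[where h = "\<lambda>t. hom_of (homtens t)"])
  show "vectorspace class_ring V"
    by (rule vectorspaceI) (simp_all add: carr add smult zero sym_tensors_linear fun_eq_iff algebra_simps)
  show "bij_betw (\<lambda>t. hom_of (homtens t)) (carrier V) (carrier (O_Hom n r E E'))"
    unfolding carr by (rule hom_bij)
  show "hom_of (homtens (s \<oplus>\<^bsub>V\<^esub> t)) = hom_of (homtens s) \<oplus>\<^bsub>O_Hom n r E E'\<^esub> hom_of (homtens t)" for s t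
  proof -
    have "homtens (\<lambda>I. s I + t I) = (\<lambda>A. homtens s A + homtens t A)" by (rule ext) (rule homtens_add)
    then show ?thesis unfolding add by (simp only:) (rule hom_of_add, rule homtens_carrier, rule homtens_carrier)
  qed
  show "hom_of (homtens (c \<odot>\<^bsub>V\<^esub> t)) = c \<odot>\<^bsub>O_Hom n r E E'\<^esub> hom_of (homtens t)" for c t
  proof -
    have "homtens (\<lambda>I. c * t I) = (\<lambda>A. c \<cdot>\<^sub>m homtens t A)" by (rule ext) (rule homtens_scale)
    then show ?thesis unfolding smult by (simp only:) (rule hom_of_smult, rule homtens_carrier)
  qed
  show "hom_of (homtens \<zero>\<^bsub>V\<^esub>) = \<zero>\<^bsub>O_Hom n r E E'\<^esub>"
  proof (rule hom_of_zero)
    fix A :: "'k mat"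
    have "homtens (\<lambda>I. 0) A = 0\<^sub>m m l" unfolding homtens_def tmul_zero
      by (intro eq_matI) (simp_all add: tpair_def tjoin_def)
    then show "homtens \<zero>\<^bsub>V\<^esub> A = 0\<^sub>m m l" unfolding zero .
  qed
qed

end

section \<open>The diagrams of the two weights and the final identification\<close>

lemma distinct_concat_map:
  assumes "distinct xs" "\<And>x. x \<in> set xs \<Longrightarrow> distinct (f x)"
    and "\<And>x y. x \<in> set xs \<Longrightarrow> y \<in> set xs \<Longrightarrow> x \<noteq> y \<Longrightarrow> set (f x) \<inter> set (f y) = {}"
  shows "distinct (concat (map f xs))"
  using assms
proof (induction xs)
  case (Cons x xs)
  have "set (f x) \<inter> set (f y) = {}" if "y \<in> set xs" for y
    using Cons.prems(3)[of x y] Cons.prems(1) that by auto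
  then have "set (f x) \<inter> set (concat (map f xs)) = {}" by auto
  moreover have "distinct (concat (map f xs))" by (rule Cons.IH) (use Cons.prems in auto)
  ultimately show ?case using Cons.prems by simp
qed simp

lemma set_skew_boxes: "set (skew_boxes la mm) = {(i, c). i < length mm \<and> la ! i < c \<and> c \<le> mm ! i}"
  by (auto simp: skew_boxes_def)

lemma distinct_skew_boxes: "distinct (skew_boxes la mm)"
  unfolding skew_boxes_def by (rule distinct_concat_map) (auto simp: distinct_map inj_on_def)

lemma Young_antitone: "la \<in> Young a r \<Longrightarrow> i \<le> j \<Longrightarrow> j < r \<Longrightarrow> la ! j \<le> la ! i"
  unfolding Young_def by (cases "i = j") (auto simp: sorted_wrt_iff_nth_less)

lemma Young_nonneg: "la \<in> Young a r \<Longrightarrow> i < r \<Longrightarrow> 0 \<le> la ! i"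
  and Young_le: "la \<in> Young a r \<Longrightarrow> i < r \<Longrightarrow> la ! i \<le> int a"
  and Young_length: "la \<in> Young a r \<Longrightarrow> length la = r"
  by (auto simp: Young_def)

text \<open>Row \<open>i\<close> of the diagram has \<open>la ! i\<close> boxes, so the product of
  diagonal entries over the boxes is the character of the highest weight. The row lengths are
  obtained by viewing the diagram as a skew shape over the empty one.\<close>

lemma hw_rep_Young:
  fixes \<rho> :: "'k :: field_char_0 mat \<Rightarrow> 'k mat"
  assumes la: "la \<in> Young a r" and fin: "finite B" and inj: "inj_on (\<lambda>k. (rw k, cl k)) B"
    and shape: "(\<lambda>k. (rw k, cl k)) ` B = {(i, c). i < r \<and> 0 < c \<and> c \<le> la ! i}"
    and irr: "irreducible_of_highest_weight r l \<rho> la"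
  shows "\<exists>v. hw_rep r B rw cl l \<rho> v"
proof -
  have mem: "rw k < r \<and> 0 < cl k \<and> cl k \<le> la ! rw k" if "k \<in> B" for k
  proof -
    have "(rw k, cl k) \<in> (\<lambda>k. (rw k, cl k)) ` B" using that by (rule imageI)
    then show ?thesis unfolding shape by simp
  qed
  have ex: "\<exists>k\<in>B. rw k = i \<and> cl k = c" if "i < r" "0 < c" "c \<le> la ! i" for i c
  proof -
    have "(i, c) \<in> (\<lambda>k. (rw k, cl k)) ` B" unfolding shape using that by simp
    then show ?thesis by auto
  qed
  interpret straight r B rw cl
  proof
    show "k = k'" if "k \<in> B" "k' \<in> B" "rw k = rw k'" "cl k = cl k'" for k k'
      using inj that by (auto dest: inj_onD)
    show "\<exists>k'\<in>B. rw k' = i \<and> cl k' = cl k" if k: "k \<in> B" "i < rw k" for k i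
    proof (rule ex)
      show "cl k \<le> la ! i" using mem[OF k(1)] Young_antitone[OF la, of i "rw k"] k(2) by simp
    qed (use mem[OF k(1)] k(2) in auto)
  qed (use fin mem in auto)
  interpret skew_shape r B rw cl "\<lambda>_. 0" "\<lambda>i. la ! i"
    by unfold_locales (use shape Young_antitone[OF la] Young_nonneg[OF la] in auto)
  have wt: "wt b = (\<Prod>i<r. (b $$ (i, i)) powi (la ! i))" for b :: "'k mat"
  proof -
    have "wt b = (\<Prod>i<r. \<Prod>k\<in>{k \<in> B. rw k = i}. b $$ (rw k, rw k))"
      unfolding wt_def by (rule prod.group[symmetric]) (use fin mem in auto)
    also have "\<dots> = (\<Prod>i<r. (b $$ (i, i)) powi (la ! i))"
      by (intro prod.cong refl) (use card_row Young_nonneg[OF la] in \<open>simp add: len_def power_int_def\<close>)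
    finally show ?thesis .
  qed
  from irr have irr': "irreducible_rep r l \<rho>" and "has_highest_weight r l \<rho> la"
    unfolding irreducible_of_highest_weight_def by simp_all
  then obtain v where v: "v \<in> carrier_vec l" "v \<noteq> 0\<^sub>v l"
    "\<forall>b\<in>GL r. upper_triangular b \<longrightarrow> \<rho> b *\<^sub>v v = (\<Prod>i<r. (b $$ (i, i)) powi (la ! i)) \<cdot>\<^sub>v v"
    unfolding has_highest_weight_def by auto
  have "hw_rep r B rw cl l \<rho> v"
  proof
    show "rational_rep r l \<rho>" using irr' by (simp add: irreducible_rep_def)
  qed (use irr' v wt in auto)
  then show ?thesis ..
qed

text \<open>The action on tensors inverts permutations whereas \<open>fsym\<close> does not;
  inversion permutes the row and the column group and preserves the sign.\<close>

lemma symmetrizers_eq: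
  assumes rw: "\<And>k. k < skew_size lam mu \<Longrightarrow> rw k = fst (skew_boxes lam mu ! k)"
    and cl: "\<And>k. k < skew_size lam mu \<Longrightarrow> cl k = snd (skew_boxes lam mu ! k)"
  shows "row_symmetrizer lam mu t = rsym {..<skew_size lam mu} rw t"
    and "col_antisymmetrizer lam mu t = csym {..<skew_size lam mu} cl t"
proof -
  let ?B = "{..<skew_size lam mu}"
  have m: "\<sigma> k < skew_size lam mu" if "\<sigma> permutes ?B" "k < skew_size lam mu" for \<sigma> k
    using permutes_in_image[OF that(1), of k] that(2) by simp
  have r: "row_perms lam mu = fib_perms ?B rw"
    unfolding row_perms_def fib_perms_def using m by (auto simp: rw)
  have c: "col_perms lam mu = fib_perms ?B cl"
    unfolding col_perms_def fib_perms_def using m by (auto simp: cl)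
  show "row_symmetrizer lam mu t = rsym ?B rw t"
  proof
    fix I
    show "row_symmetrizer lam mu t I = rsym ?B rw t I"
      using sum_fib_perms_inv[of "\<lambda>\<sigma>. t (I \<circ> \<sigma>)" ?B rw]
      by (simp add: row_symmetrizer_def tensor_act_def fsym_def r)
  qed
  show "col_antisymmetrizer lam mu t = csym ?B cl t"
  proof
    fix I
    have s: "sign (Hilbert_Choice.inv \<sigma>) = sign \<sigma>" if "\<sigma> \<in> fib_perms ?B cl" for \<sigma>
      by (rule sign_inverse[OF fib_perms_permutation[OF _ that]]) simp
    have "col_antisymmetrizer lam mu t I = (\<Sum>\<sigma>\<in>fib_perms ?B cl. of_int (sign (Hilbert_Choice.inv \<sigma>)) * t (I \<circ> Hilbert_Choice.inv \<sigma>))"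
      unfolding col_antisymmetrizer_def tensor_act_def c by (intro sum.cong refl) (simp add: s)
    also have "\<dots> = csym ?B cl t I"
      unfolding fsym_def by (rule sum_fib_perms_inv[of "\<lambda>\<sigma>. of_int (sign \<sigma>) * t (I \<circ> \<sigma>)"])
    finally show "col_antisymmetrizer lam mu t I = csym ?B cl t I" .
  qed
qed

theorem proposition2p8:
  fixes n r l m :: nat
    and lam mu :: "int list"
    and \<rho> \<sigma> :: "'k :: {alg_closed_field, field_char_0} mat \<Rightarrow> 'k mat"
  assumes "1 < r" and "r \<le> n"
    and "lam \<in> Young (n - r) r" and "mu \<in> Young (n - r) r" and "list_all2 (\<le>) lam mu"
    and "irreducible_of_highest_weight r l \<rho> lam"
    and "irreducible_of_highest_weight r m \<sigma> mu"
  shows "vs_isomorphic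
           (O_Hom n r (assoc_bundle n r l \<rho>) (assoc_bundle n r m \<sigma>))
           (skew_schur n lam mu)"
proof -
  note la = \<open>lam \<in> Young (n - r) r\<close> and mm = \<open>mu \<in> Young (n - r) r\<close>
  have le: "lam ! i \<le> mu ! i" if "i < r" for i
    using \<open>list_all2 (\<le>) lam mu\<close> that Young_length[OF la] by (simp add: list_all2_conv_all_nth)
  let ?d = "skew_size lam mu"
  let ?sb = "skew_boxes lam mu" and ?lb = "skew_boxes (replicate r 0) lam"
  \<comment> \<open>The boxes of \<open>mu/lam\<close> come first, so that their numbers agree with
    the numbering in the skew Schur power; the boxes of \<open>lam\<close> follow and complete the
    diagram of \<open>mu\<close>.\<close>
  let ?bx = "?sb @ ?lb"
  let ?N = "length ?bx"
  let ?rw = "\<lambda>k. fst (?bx ! k)" and ?cl = "\<lambda>k. snd (?bx ! k)"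
  let ?Bs = "{..<?d}" and ?Bl = "{?d..<?N}" and ?Bm = "{..<?N}"
  have d: "length ?sb = ?d" by (rule length_skew_boxes[OF \<open>list_all2 (\<le>) lam mu\<close>])
  have Bm: "?Bm = ?Bl \<union> ?Bs" using d by auto
  have sets: "set ?sb = {(i, c). i < r \<and> lam ! i < c \<and> c \<le> mu ! i}" "set ?lb = {(i, c). i < r \<and> 0 < c \<and> c \<le> lam ! i}"
    unfolding set_skew_boxes Young_length[OF la] Young_length[OF mm] by auto
  have im: "(\<lambda>k. (?rw k, ?cl k)) ` ?Bs = set ?sb" "(\<lambda>k. (?rw k, ?cl k)) ` ?Bl = set ?lb"
  proof -
    have "(\<lambda>k. ?bx ! k) ` ?Bs = (\<lambda>k. ?sb ! k) ` ?Bs" by (rule image_cong) (simp_all add: nth_append d)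
    also have "\<dots> = set ?sb" by (auto simp: set_conv_nth d)
    finally show "(\<lambda>k. (?rw k, ?cl k)) ` ?Bs = set ?sb" by simp
    have "?Bl = (\<lambda>k. k + ?d) ` {..<length ?lb}"
    proof (intro subset_antisym subsetI)
      fix k assume "k \<in> ?Bl"
      then show "k \<in> (\<lambda>k. k + ?d) ` {..<length ?lb}" using d by (intro image_eqI[of _ _ "k - ?d"]) auto
    qed (use d in auto)
    then have "(\<lambda>k. ?bx ! k) ` ?Bl = (\<lambda>k. ?bx ! k) ` (\<lambda>k. k + ?d) ` {..<length ?lb}" by (rule arg_cong)
    also have "\<dots> = (\<lambda>k. ?lb ! k) ` {..<length ?lb}"
      unfolding image_image by (rule image_cong) (simp_all add: nth_append d)
    also have "\<dots> = set ?lb" by (auto simp: set_conv_nth)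
    finally show "(\<lambda>k. (?rw k, ?cl k)) ` ?Bl = set ?lb" by simp
  qed
  have "set ?sb \<inter> set ?lb = {}" unfolding sets by auto
  then have dist: "distinct ?bx" by (simp add: distinct_skew_boxes)
  have inj: "inj_on (\<lambda>k. (?rw k, ?cl k)) ?Bm"
  proof (rule inj_onI)
    fix k k' assume k: "k \<in> ?Bm" "k' \<in> ?Bm" "(?rw k, ?cl k) = (?rw k', ?cl k')"
    then have "?bx ! k = ?bx ! k'" by (simp only: prod_eq_iff fst_conv snd_conv)
    then show "k = k'" using k(1,2) nth_eq_iff_index_eq[OF dist] by blast
  qed
  have imm: "(\<lambda>k. (?rw k, ?cl k)) ` ?Bm = {(i, c). i < r \<and> 0 < c \<and> c \<le> mu ! i}"
  proof -
    have "{(i, c). i < r \<and> 0 < c \<and> c \<le> lam ! i} \<union> {(i, c). i < r \<and> lam ! i < c \<and> c \<le> mu ! i}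
       = {(i, c). i < r \<and> 0 < c \<and> c \<le> mu ! i}" (is "?X \<union> ?Y = ?Z")
    proof (intro subset_antisym subsetI)
      fix x assume x: "x \<in> ?X \<union> ?Y"
      obtain i c where ic: "x = (i, c)" by (cases x)
      have i: "i < r" using x ic by auto
      show "x \<in> ?Z" using x ic le[OF i] Young_nonneg[OF la i] by auto
    qed auto
    then show ?thesis unfolding Bm image_Un im sets .
  qed
  obtain v where L: "hw_rep r ?Bl ?rw ?cl l \<rho> v"
  proof -
    have "?Bl \<subseteq> ?Bm" by auto
    then have "\<exists>v. hw_rep r ?Bl ?rw ?cl l \<rho> v"
      using hw_rep_Young[OF la _ inj_on_subset[OF inj] im(2)[unfolded sets(2)] \<open>irreducible_of_highest_weight r l \<rho> lam\<close>] by blast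
    then show ?thesis using that by (rule exE)
  qed
  obtain w where M: "hw_rep r ?Bm ?rw ?cl m \<sigma> w"
    using hw_rep_Young[OF mm _ inj imm \<open>irreducible_of_highest_weight r m \<sigma> mu\<close>] by blast
  interpret L: hw_rep r ?Bl ?rw ?cl l \<rho> v by (rule L)
  interpret M: hw_rep r ?Bm ?rw ?cl m \<sigma> w by (rule M)
  interpret S: skew_shape r ?Bs ?rw ?cl "\<lambda>i. lam ! i" "\<lambda>i. mu ! i"
  proof
    show "k = k'" if "k \<in> ?Bs" "k' \<in> ?Bs" "?rw k = ?rw k'" "?cl k = ?cl k'" for k k'
      by (rule M.box_inj) (use that Bm in auto)
    show "?rw k < r" if "k \<in> ?Bs" for k by (rule M.rw_less) (use that Bm in auto)
    show "(\<lambda>k. (?rw k, ?cl k)) ` ?Bs = {(i, c). i < r \<and> lam ! i < c \<and> c \<le> mu ! i}" unfolding im sets ..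
  qed (use le Young_antitone[OF la] Young_antitone[OF mm] in simp_all)
  interpret hom_setup r ?Bs ?Bl ?Bm ?rw ?cl "\<lambda>i. lam ! i" "\<lambda>i. mu ! i" l m \<rho> \<sigma> v w n
  proof
    show "?Bm = ?Bl \<union> ?Bs" by (rule Bm)
    show "(\<lambda>k. (?rw k, ?cl k)) ` ?Bl = {(i, c). i < r \<and> 0 < c \<and> c \<le> lam ! i}" unfolding im sets ..
    show "r < n \<or> n = r \<and> ?Bm = {}"
    proof (cases "r < n")
      \<comment> \<open>With n = r the parts of \<open>mu\<close> are bounded by 0, so its diagram
        has no boxes.\<close>
      case False
      then have "n = r" using \<open>r \<le> n\<close> by simp
      then have "mu ! i \<le> 0" if "i < r" for i using Young_le[OF mm that] by simp
      then have "(\<lambda>k. (?rw k, ?cl k)) ` ?Bm = {}" unfolding imm by force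
      then show ?thesis using \<open>n = r\<close> by blast
    qed simp
  qed auto
  have sym: "row_symmetrizer lam mu t = rsym ?Bs ?rw t" "col_antisymmetrizer lam mu t = csym ?Bs ?cl t" for t :: "(nat \<Rightarrow> nat) \<Rightarrow> 'k"
    using symmetrizers_eq[of lam mu ?rw ?cl] by (simp_all add: nth_append d)
  show ?thesis
  proof (rule isomorphic)
    show "carrier (skew_schur n lam mu) = sym_tensors"
      unfolding skew_schur_def sym_tensors_def tensor_power_def multi_indices_def idx_def
      by (simp add: sym image_image comp_def)
  qed (simp_all add: skew_schur_def tensor_power_def)
qed

end
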